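(* Let $N$ be a manifold. There is a one-to-one correspondence between Cartan algebroids over $N$ up to gauge equivalence and Cartan pairs over $N$ up to isomorphism, given by the two constructions described in the context: $(\mathcal{C},\sigma)\mapsto(\mathcal{C}\oplus\sigma,\sigma)$ (depending on a choice of $(t,\nabla)$) and $(A,\sigma)\mapsto(A/\sigma,\sigma)$ (depending on a choice of splitting $\xi$).
   Context: All manifolds and maps are smooth. An almost Lie algebroid over $N$ is a vector bundle $A\to N$ with a vector bundle map $\rho:A\to TN$ (anchor) and a bilinear antisymmetric bracket on $\Gamma(A)$ with $[\alpha,f\beta]=f[\alpha,\beta]+L_{\rho(\alpha)}(f)\beta$ and $\rho([\alpha,\beta])=[\rho(\alpha),\rho(\beta)]$ for all $\alpha,\beta\in\Gamma(A)$, $f\in C^\infty(N)$; it is transitive if $\rho$ is surjective. **Cartan algebroids.** An almost Cartan algebroid over $N$ is a pair $(\mathcal{C},\sigma)$ with $\mathcal{C}$ a transitive almost Lie algebroid over $N$ and $\sigma\subset\mathrm{Hom}(\mathcal{C},\mathcal{C})$ a vector subbundle with $\rho\circ T=0$ for all $T\in\sigma$. It is a Cartan algebroid if (1) $\sigma$ is closed under the commutator bracket; (2) there is a vector bundle map $t:\Lambda^2\mathcal{C}\to\sigma$, $(\alpha,\beta)\mapsto t_{\alpha,\beta}$, with $[[\alpha,\beta],\gamma]+[[\beta,\gamma],\alpha]+[[\gamma,\alpha],\beta]=t_{\alpha,\beta}(\gamma)+t_{\beta,\gamma}(\alpha)+t_{\gamma,\alpha}(\beta)$ for all $\alpha,\beta,\gamma\in\Gamma(\mathcal{C})$;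 (3) there is a $\mathcal{C}$-connection $\nabla:\Gamma(\mathcal{C})\times\Gamma(\sigma)\to\Gamma(\sigma)$ (i.e. a bilinear map with $\nabla_{f\alpha}T=f\nabla_\alpha T$, $\nabla_\alpha(fT)=f\nabla_\alpha T+L_{\rho(\alpha)}(f)T$) with $T([\alpha,\beta])-[T(\alpha),\beta]-[\alpha,T(\beta)]=\nabla_\beta(T)(\alpha)-\nabla_\alpha(T)(\beta)$ for all $\alpha,\beta\in\Gamma(\mathcal{C})$, $T\in\Gamma(\sigma)$. Two almost Cartan algebroids $(\mathcal{C},\sigma)$, $(\mathcal{C}',\sigma')$ over $N$ are isomorphic if there is a vector bundle isomorphism $\psi:\mathcal{C}\to\mathcal{C}'$ preserving brackets, with $\rho'\circ\psi=\rho$ and $\{\psi\circ T\circ\psi^{-1}:T\in\sigma\}=\sigma'$. Given a vector bundle map $\eta:\mathcal{C}\to\sigma$, $\mathcal{C}^\eta$ is $\mathcal{C}$ with the same anchor and the bracket $[\alpha,\beta]^\eta=[\alpha,\beta]+\eta(\alpha)(\beta)-\eta(\beta)(\alpha)$. $(\mathcal{C},\sigma)$ and $(\mathcal{C}',\sigma')$ are gauge equivalent if $(\mathcal{C}',\sigma')$ is isomorphic to $(\mathcal{C}^\eta,\sigma)$ for some such $\eta$. **Cartan pairs.** A Cartan pair over $N$ is a pair $(A,\sigma)$ of a transitive almost Lie algebroid $A$ over $N$ and a vector subbundle $\sigma\subset\ker\rho\subset A$ with $[\Gamma(\sigma),\Gamma(\sigma)]\subset\Gamma(\sigma)$ and such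 that the Jacobiator $[[\alpha,\beta],\gamma]+[[\beta,\gamma],\alpha]+[[\gamma,\alpha],\beta]$ lies in $\Gamma(\sigma)$ for all $\alpha,\beta,\gamma\in\Gamma(A)$. With $\mathrm{pr}:A\to A/\sigma$ the projection, it induces the vector bundle map $\iota:\sigma\to\mathrm{Hom}(A/\sigma,A/\sigma)$, $\iota(T)(\mathrm{pr}(\alpha))=\mathrm{pr}([T,\alpha])$; the Cartan pair is called standard if $\iota$ is injective. Two Cartan pairs $(A,\sigma),(A',\sigma')$ over $N$ are isomorphic if there is a vector bundle isomorphism $\psi:A\to A'$ with $\psi(\sigma)=\sigma'$, $\rho'\circ\psi=\rho$ and $\psi([\alpha,\beta])\equiv[\psi(\alpha),\psi(\beta)]\pmod{\sigma'}$ for all $\alpha,\beta\in\Gamma(A)$. **From Cartan algebroids to Cartan pairs.** Given a Cartan algebroid $(\mathcal{C},\sigma)$ and a choice of $t,\nabla$ as in (2),(3), put $A=\mathcal{C}\oplus\sigma$ with anchor $\rho(\alpha,S)=\rho(\alpha)$ and bracket $[(\alpha,S),(\beta,T)]=([\alpha,\beta]+S(\beta)-T(\alpha),\ -t_{\alpha,\beta}+\nabla_\alpha T-\nabla_\beta S+[S,T])$; the associated Cartan pair is $(\mathcal{C}\oplus\sigma,\sigma)$, and it is standard. **From Cartan pairs to Cartan algebroids.** This construction is described for a standard Cartan pair $(A,\sigma)$. Given a vector bundle splitting $\xi:A/\sigma\to A$ of $\mathrm{pr}$, equip $A/\sigma$ with the bracket $[\alpha,\beta]=\mathrm{pr}([\xi(\alpha),\xi(\beta)])$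 and the anchor $\rho(\alpha)=\rho(\xi(\alpha))$, and view $\sigma$ as a subbundle of $\mathrm{Hom}(A/\sigma,A/\sigma)$ via $\iota$, which is injective; the associated Cartan algebroid is $(A/\sigma,\sigma)$.
   Formalization: "Cartan pairs" is read as standard Cartan pairs (ι injective): for arbitrary ones the claim fails, e.g. over a point A = σ = R with zero bracket is isomorphic to no (C⊕σ,σ), since those are all standard. N is taken nonempty. *)

theory Defs
  imports "HOL-Analysis.Analysis"
begin

section \<open>Smooth functions on open subsets of Euclidean space\<close>

text \<open>
  The model space is the library's \<^const>\<open>Euclidean_space\<close> n, i.e. the sequences
  x :: nat => real with x i = 0 for i >= n; this includes n = 0. On open subsets of it a real
  function is smooth iff all its iterated partial derivatives exist and are continuous.
\<close>

definition partial :: "nat \<Rightarrow> ((nat \<Rightarrow> real) \<Rightarrow> real) \<Rightarrow> (nat \<Rightarrow> real) \<Rightarrow> real" where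
  "partial i f x = deriv (\<lambda>s. f (x(i := s))) (x i)"

primrec Ck_on :: "nat \<Rightarrow> nat \<Rightarrow> (nat \<Rightarrow> real) set \<Rightarrow> ((nat \<Rightarrow> real) \<Rightarrow> real) \<Rightarrow> bool" where
  "Ck_on n 0 V f \<longleftrightarrow> continuous_on V f"
| "Ck_on n (Suc k) V f \<longleftrightarrow> continuous_on V f \<and>
     (\<forall>i<n. (\<forall>x\<in>V. (\<lambda>s. f (x(i := s))) differentiable (at (x i))) \<and> Ck_on n k V (partial i f))"

definition smooth_on :: "nat \<Rightarrow> (nat \<Rightarrow> real) set \<Rightarrow> ((nat \<Rightarrow> real) \<Rightarrow> real) \<Rightarrow> bool" where
  "smooth_on n V f \<longleftrightarrow> (\<forall>k. Ck_on n k V f)"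

section \<open>Manifolds\<close>

text \<open>
  The underlying space of a manifold is a Hausdorff second countable type, via the classes
  \<^class>\<open>t2_space\<close> and \<^class>\<open>second_countable_topology\<close>; the record adds
  the dimension and an atlas.
\<close>

record 'm manifold =
  mdim :: nat
  charts :: "('m set \<times> ('m \<Rightarrow> nat \<Rightarrow> real)) set"

definition smooth_fun ::
  "'m::topological_space manifold \<Rightarrow> 'm set \<Rightarrow> ('m \<Rightarrow> real) \<Rightarrow> bool" where
  "smooth_fun M W f \<longleftrightarrow>
     (\<forall>(U, \<phi>) \<in> charts M. smooth_on (mdim M) (\<phi> ` (U \<inter> W)) (\<lambda>x. f (inv_into U \<phi> x)))"

definition smooth_manifold :: "'m::{t2_space, second_countable_topology} manifold \<Rightarrow> bool" where
  "smooth_manifold M \<longleftrightarrow>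
     (\<Union>(U, \<phi>) \<in> charts M. U) = UNIV \<and>
     (\<forall>(U, \<phi>) \<in> charts M. open U \<and> openin (Euclidean_space (mdim M)) (\<phi> ` U) \<and>
        homeomorphism U (\<phi> ` U) \<phi> (inv_into U \<phi>)) \<and>
     (\<forall>(U, \<phi>) \<in> charts M. \<forall>(V, \<psi>) \<in> charts M. \<forall>i < mdim M.
        smooth_on (mdim M) (\<phi> ` (U \<inter> V)) (\<lambda>x. \<psi> (inv_into U \<phi> x) i))"

definition Cinf :: "'m::topological_space manifold \<Rightarrow> ('m \<Rightarrow> real) set" where
  "Cinf M = {f. smooth_fun M UNIV f}"

text \<open>
  Tangent vectors at p are the derivations at p of the algebra of smooth functions. They are made
  total functions by the value 0 on non-smooth arguments, so that equality of tangent vectors is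
  equality of functions and the zero vector is the zero function.
\<close>

definition tangent_space ::
  "'m::topological_space manifold \<Rightarrow> 'm \<Rightarrow> (('m \<Rightarrow> real) \<Rightarrow> real) set" where
  "tangent_space M p = {v.
     (\<forall>f\<in>Cinf M. \<forall>g\<in>Cinf M. v (\<lambda>q. f q + g q) = v f + v g) \<and>
     (\<forall>c. \<forall>f\<in>Cinf M. v (\<lambda>q. c * f q) = c * v f) \<and>
     (\<forall>f\<in>Cinf M. \<forall>g\<in>Cinf M. v (\<lambda>q. f q * g q) = f p * v g + g p * v f) \<and>
     (\<forall>f. f \<notin> Cinf M \<longrightarrow> v f = 0)}"

section \<open>Vector bundles\<close>

text \<open>
  A bundle consists of its fibres with their vector space operations and an atlas of local
  trivialisations (U, k, \<open>\<Phi>\<close>): for p in U, \<open>\<Phi> p\<close> maps the fibre over p to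
  \<^const>\<open>Euclidean_space\<close> k. The smooth structure of the total space is the one determined by
  this atlas. The rank k may depend on the trivialisation, so that it is locally constant.
\<close>

record ('m, 'e) vbundle =
  fib :: "'m \<Rightarrow> 'e set"
  vzero :: "'m \<Rightarrow> 'e"
  vadd :: "'m \<Rightarrow> 'e \<Rightarrow> 'e \<Rightarrow> 'e"
  vscale :: "'m \<Rightarrow> real \<Rightarrow> 'e \<Rightarrow> 'e"
  trivs :: "('m set \<times> nat \<times> ('m \<Rightarrow> 'e \<Rightarrow> nat \<Rightarrow> real)) set"

definition vminus :: "('m, 'e, 'z) vbundle_scheme \<Rightarrow> 'm \<Rightarrow> 'e \<Rightarrow> 'e \<Rightarrow> 'e" where
  "vminus E p u v = vadd E p u (vscale E p (-1) v)"

definition local_triv :: "('m::topological_space, 'e, 'z) vbundle_scheme \<Rightarrow>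
    'm set \<Rightarrow> nat \<Rightarrow> ('m \<Rightarrow> 'e \<Rightarrow> nat \<Rightarrow> real) \<Rightarrow> bool" where
  "local_triv E U k \<Phi> \<longleftrightarrow> open U \<and> (\<forall>p\<in>U.
     bij_betw (\<Phi> p) (fib E p) (topspace (Euclidean_space k)) \<and>
     (\<forall>u\<in>fib E p. \<forall>v\<in>fib E p. \<Phi> p (vadd E p u v) = (\<lambda>i. \<Phi> p u i + \<Phi> p v i)) \<and>
     (\<forall>c. \<forall>u\<in>fib E p. \<Phi> p (vscale E p c u) = (\<lambda>i. c * \<Phi> p u i)))"

text \<open>The j-th section of the local frame belonging to a trivialisation.\<close>

definition frame :: "('m, 'e, 'z) vbundle_scheme \<Rightarrow> ('m \<Rightarrow> 'e \<Rightarrow> nat \<Rightarrow> real) \<Rightarrow> nat \<Rightarrow> 'm \<Rightarrow> 'e" where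
  "frame E \<Phi> j p = inv_into (fib E p) (\<Phi> p) (\<lambda>i. if i = j then 1 else 0)"

definition smooth_transition :: "'m::topological_space manifold \<Rightarrow> ('m, 'e, 'z) vbundle_scheme \<Rightarrow>
    'm set \<Rightarrow> nat \<Rightarrow> ('m \<Rightarrow> 'e \<Rightarrow> nat \<Rightarrow> real) \<Rightarrow>
    'm set \<Rightarrow> nat \<Rightarrow> ('m \<Rightarrow> 'e \<Rightarrow> nat \<Rightarrow> real) \<Rightarrow> bool" where
  "smooth_transition M E U k \<Phi> V l \<Psi> \<longleftrightarrow>
     (\<forall>j<k. \<forall>i<l. smooth_fun M (U \<inter> V) (\<lambda>p. \<Psi> p (frame E \<Phi> j p) i))"

text \<open>
  The vector space axioms of the fibres need not be listed: they follow from the existence of a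
  bijection to a Euclidean space which respects the operations.
\<close>

definition vector_bundle ::
  "'m::topological_space manifold \<Rightarrow> ('m, 'e, 'z) vbundle_scheme \<Rightarrow> bool" where
  "vector_bundle M E \<longleftrightarrow>
     (\<forall>p. vzero E p \<in> fib E p \<and>
        (\<forall>v\<in>fib E p. vadd E p (vzero E p) v = v) \<and>
        (\<forall>u\<in>fib E p. \<forall>v\<in>fib E p. vadd E p u v \<in> fib E p) \<and>
        (\<forall>c. \<forall>v\<in>fib E p. vscale E p c v \<in> fib E p)) \<and>
     (\<Union>(U, k, \<Phi>) \<in> trivs E. U) = UNIV \<and>
     (\<forall>(U, k, \<Phi>) \<in> trivs E. local_triv E U k \<Phi>) \<and>
     (\<forall>(U, k, \<Phi>) \<in> trivs E. \<forall>(V, l, \<Psi>) \<in> trivs E. smooth_transition M E U k \<Phi> V l \<Psi>)"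

text \<open>All local trivialisations compatible with the atlas.\<close>

definition smooth_triv :: "'m::topological_space manifold \<Rightarrow> ('m, 'e, 'z) vbundle_scheme \<Rightarrow>
    'm set \<Rightarrow> nat \<Rightarrow> ('m \<Rightarrow> 'e \<Rightarrow> nat \<Rightarrow> real) \<Rightarrow> bool" where
  "smooth_triv M E U k \<Phi> \<longleftrightarrow> local_triv E U k \<Phi> \<and>
     (\<forall>(V, l, \<Psi>) \<in> trivs E.
        smooth_transition M E U k \<Phi> V l \<Psi> \<and> smooth_transition M E V l \<Psi> U k \<Phi>)"

definition sections ::
  "'m::topological_space manifold \<Rightarrow> ('m, 'e, 'z) vbundle_scheme \<Rightarrow> ('m \<Rightarrow> 'e) set" where
  "sections M E = {s. (\<forall>p. s p \<in> fib E p) \<and>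
     (\<forall>(U, k, \<Phi>) \<in> trivs E. \<forall>i<k. smooth_fun M U (\<lambda>p. \<Phi> p (s p) i))}"

definition sadd :: "('m, 'e, 'z) vbundle_scheme \<Rightarrow> ('m \<Rightarrow> 'e) \<Rightarrow> ('m \<Rightarrow> 'e) \<Rightarrow> 'm \<Rightarrow> 'e" where
  "sadd E s s' = (\<lambda>p. vadd E p (s p) (s' p))"

definition sminus :: "('m, 'e, 'z) vbundle_scheme \<Rightarrow> ('m \<Rightarrow> 'e) \<Rightarrow> ('m \<Rightarrow> 'e) \<Rightarrow> 'm \<Rightarrow> 'e" where
  "sminus E s s' = (\<lambda>p. vminus E p (s p) (s' p))"

definition sscale :: "('m, 'e, 'z) vbundle_scheme \<Rightarrow> ('m \<Rightarrow> real) \<Rightarrow> ('m \<Rightarrow> 'e) \<Rightarrow> 'm \<Rightarrow> 'e" where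
  "sscale E f s = (\<lambda>p. vscale E p (f p) (s p))"

text \<open>A pointwise operation applied to a section.\<close>

definition sapp :: "('m \<Rightarrow> 'e \<Rightarrow> 'f) \<Rightarrow> ('m \<Rightarrow> 'e) \<Rightarrow> 'm \<Rightarrow> 'f" where
  "sapp h s = (\<lambda>p. h p (s p))"

definition linear_on :: "('m, 'e, 'y) vbundle_scheme \<Rightarrow> ('m, 'f, 'z) vbundle_scheme \<Rightarrow>
    'm \<Rightarrow> ('e \<Rightarrow> 'f) \<Rightarrow> bool" where
  "linear_on E F p h \<longleftrightarrow>
     (\<forall>u\<in>fib E p. h u \<in> fib F p) \<and>
     (\<forall>u\<in>fib E p. \<forall>v\<in>fib E p. h (vadd E p u v) = vadd F p (h u) (h v)) \<and>
     (\<forall>c. \<forall>u\<in>fib E p. h (vscale E p c u) = vscale F p c (h u))"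

text \<open>
  Vector bundle maps over the identity: fibrewise linear maps whose matrix entries in the
  trivialisations are smooth.
\<close>

definition bundle_map :: "'m::topological_space manifold \<Rightarrow> ('m, 'e, 'y) vbundle_scheme \<Rightarrow>
    ('m, 'f, 'z) vbundle_scheme \<Rightarrow> ('m \<Rightarrow> 'e \<Rightarrow> 'f) \<Rightarrow> bool" where
  "bundle_map M E F h \<longleftrightarrow> (\<forall>p. linear_on E F p (h p)) \<and>
     (\<forall>(U, k, \<Phi>) \<in> trivs E. \<forall>(V, l, \<Psi>) \<in> trivs F. \<forall>j<k. \<forall>i<l.
        smooth_fun M (U \<inter> V) (\<lambda>p. \<Psi> p (h p (frame E \<Phi> j p)) i))"

definition bundle_iso :: "'m::topological_space manifold \<Rightarrow> ('m, 'e, 'y) vbundle_scheme \<Rightarrow>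
    ('m, 'f, 'z) vbundle_scheme \<Rightarrow> ('m \<Rightarrow> 'e \<Rightarrow> 'f) \<Rightarrow> bool" where
  "bundle_iso M E F h \<longleftrightarrow> bundle_map M E F h \<and>
     (\<forall>p. bij_betw (h p) (fib E p) (fib F p)) \<and>
     bundle_map M F E (\<lambda>p. inv_into (fib E p) (h p))"

text \<open>
  Vector bundle maps from the second exterior power of E to F, given as families of alternating
  bilinear maps.
\<close>

definition alternating_bundle_map :: "'m::topological_space manifold \<Rightarrow>
    ('m, 'e, 'y) vbundle_scheme \<Rightarrow> ('m, 'f, 'z) vbundle_scheme \<Rightarrow>
    ('m \<Rightarrow> 'e \<Rightarrow> 'e \<Rightarrow> 'f) \<Rightarrow> bool" where
  "alternating_bundle_map M E F t \<longleftrightarrow>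
     (\<forall>p. \<forall>u\<in>fib E p. linear_on E F p (t p u)) \<and>
     (\<forall>p. \<forall>u\<in>fib E p. \<forall>v\<in>fib E p. t p v u = vscale F p (-1) (t p u v)) \<and>
     (\<forall>(U, k, \<Phi>) \<in> trivs E. \<forall>(V, l, \<Psi>) \<in> trivs F. \<forall>j<k. \<forall>j'<k. \<forall>i<l.
        smooth_fun M (U \<inter> V) (\<lambda>p. \<Psi> p (t p (frame E \<Phi> j p) (frame E \<Phi> j' p)) i))"

text \<open>
  A vector subbundle is a family of subsets S p of the fibres such that around every point there is
  a trivialisation of E over some U taking S over U to U times the span of the first r basis
  vectors. These adapted trivialisations make S itself, and the quotient of E by S, a bundle.
\<close>

definition adapted_triv :: "'m::topological_space manifold \<Rightarrow> ('m, 'e, 'z) vbundle_scheme \<Rightarrow>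
    ('m \<Rightarrow> 'e set) \<Rightarrow> 'm set \<Rightarrow> nat \<Rightarrow> nat \<Rightarrow> ('m \<Rightarrow> 'e \<Rightarrow> nat \<Rightarrow> real) \<Rightarrow> bool" where
  "adapted_triv M E S U k r \<Phi> \<longleftrightarrow> smooth_triv M E U k \<Phi> \<and> r \<le> k \<and>
     (\<forall>p\<in>U. S p = {v \<in> fib E p. \<forall>i\<ge>r. \<Phi> p v i = 0})"

definition subbundle :: "'m::topological_space manifold \<Rightarrow> ('m, 'e, 'z) vbundle_scheme \<Rightarrow>
    ('m \<Rightarrow> 'e set) \<Rightarrow> bool" where
  "subbundle M E S \<longleftrightarrow> (\<forall>p. \<exists>U k r \<Phi>. p \<in> U \<and> adapted_triv M E S U k r \<Phi>)"

definition sub_bundle :: "'m::topological_space manifold \<Rightarrow> ('m, 'e, 'z) vbundle_scheme \<Rightarrow>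
    ('m \<Rightarrow> 'e set) \<Rightarrow> ('m, 'e) vbundle" where
  "sub_bundle M E S = \<lparr>fib = S, vzero = vzero E, vadd = vadd E, vscale = vscale E,
     trivs = {(U, r, \<Phi>). \<exists>k. adapted_triv M E S U k r \<Phi>}\<rparr>"

definition pr :: "('m, 'e, 'z) vbundle_scheme \<Rightarrow> ('m \<Rightarrow> 'e set) \<Rightarrow> 'm \<Rightarrow> 'e \<Rightarrow> 'e set" where
  "pr E S p v = vadd E p v ` S p"

definition quot_bundle :: "'m::topological_space manifold \<Rightarrow> ('m, 'e, 'z) vbundle_scheme \<Rightarrow>
    ('m \<Rightarrow> 'e set) \<Rightarrow> ('m, 'e set) vbundle" where
  "quot_bundle M E S = \<lparr>
     fib = (\<lambda>p. pr E S p ` fib E p),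
     vzero = (\<lambda>p. pr E S p (vzero E p)),
     vadd = (\<lambda>p a b. pr E S p (vadd E p (SOME u. u \<in> a) (SOME v. v \<in> b))),
     vscale = (\<lambda>p c a. pr E S p (vscale E p c (SOME u. u \<in> a))),
     trivs = {(U, k - r, \<lambda>p a i. \<Phi> p (SOME u. u \<in> a) (r + i)) | U k r \<Phi>.
                adapted_triv M E S U k r \<Phi>}\<rparr>"

definition sum_bundle :: "('m, 'e, 'y) vbundle_scheme \<Rightarrow> ('m, 'f, 'z) vbundle_scheme \<Rightarrow>
    ('m, 'e \<times> 'f) vbundle" where
  "sum_bundle E F = \<lparr>
     fib = (\<lambda>p. fib E p \<times> fib F p),
     vzero = (\<lambda>p. (vzero E p, vzero F p)),
     vadd = (\<lambda>p (u, w) (u', w'). (vadd E p u u', vadd F p w w')),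
     vscale = (\<lambda>p c (u, w). (vscale E p c u, vscale F p c w)),
     trivs = {(U \<inter> V, k + l, \<lambda>p (u, w) i. if i < k then \<Phi> p u i else \<Psi> p w (i - k)) |
                U k \<Phi> V l \<Psi>. (U, k, \<Phi>) \<in> trivs E \<and> (V, l, \<Psi>) \<in> trivs F}\<rparr>"

text \<open>
  The bundle Hom(E, E). Endomorphisms of a fibre are extensional functions, so that they are equal
  iff they agree on the fibre; coordinate number a * k + b of an endomorphism is its matrix entry
  (a, b).
\<close>

definition hom_bundle :: "('m, 'e, 'z) vbundle_scheme \<Rightarrow> ('m, 'e \<Rightarrow> 'e) vbundle" where
  "hom_bundle E = \<lparr>
     fib = (\<lambda>p. {T \<in> extensional (fib E p). linear_on E E p T}),
     vzero = (\<lambda>p. \<lambda>v\<in>fib E p. vzero E p),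
     vadd = (\<lambda>p S T. \<lambda>v\<in>fib E p. vadd E p (S v) (T v)),
     vscale = (\<lambda>p c T. \<lambda>v\<in>fib E p. vscale E p c (T v)),
     trivs = {(U, k * k, \<lambda>p T m.
                if m < k * k then \<Phi> p (T (frame E \<Phi> (m mod k) p)) (m div k) else 0) |
                U k \<Phi>. (U, k, \<Phi>) \<in> trivs E}\<rparr>"

definition commutator ::
  "('m, 'e, 'z) vbundle_scheme \<Rightarrow> 'm \<Rightarrow> ('e \<Rightarrow> 'e) \<Rightarrow> ('e \<Rightarrow> 'e) \<Rightarrow> 'e \<Rightarrow> 'e" where
  "commutator E p S T = (\<lambda>v\<in>fib E p. vminus E p (S (T v)) (T (S v)))"

section \<open>Almost Lie algebroids\<close>

text \<open>The bracket is only meaningful on smooth global sections.\<close>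

record ('m, 'e) algebroid = "('m, 'e) vbundle" +
  anchor :: "'m \<Rightarrow> 'e \<Rightarrow> ('m \<Rightarrow> real) \<Rightarrow> real"
  brk :: "('m \<Rightarrow> 'e) \<Rightarrow> ('m \<Rightarrow> 'e) \<Rightarrow> 'm \<Rightarrow> 'e"

text \<open>
  Vector bundle maps from E to the tangent bundle: fibrewise linear, and taking local frames to
  smooth vector fields, where a vector field is smooth iff it takes smooth functions to smooth
  functions.
\<close>

definition anchor_map :: "'m::topological_space manifold \<Rightarrow> ('m, 'e, 'z) vbundle_scheme \<Rightarrow>
    ('m \<Rightarrow> 'e \<Rightarrow> ('m \<Rightarrow> real) \<Rightarrow> real) \<Rightarrow> bool" where
  "anchor_map M E \<rho> \<longleftrightarrow>
     (\<forall>p. \<forall>u\<in>fib E p. \<rho> p u \<in> tangent_space M p) \<and>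
     (\<forall>p. \<forall>u\<in>fib E p. \<forall>v\<in>fib E p. \<rho> p (vadd E p u v) = (\<lambda>f. \<rho> p u f + \<rho> p v f)) \<and>
     (\<forall>p c. \<forall>u\<in>fib E p. \<rho> p (vscale E p c u) = (\<lambda>f. c * \<rho> p u f)) \<and>
     (\<forall>(U, k, \<Phi>) \<in> trivs E. \<forall>j<k. \<forall>f\<in>Cinf M. smooth_fun M U (\<lambda>p. \<rho> p (frame E \<Phi> j p) f))"

text \<open>The Lie derivative of f along the vector field \<open>\<rho>(\<alpha>)\<close>.\<close>

definition Lie :: "('m, 'e) algebroid \<Rightarrow> ('m \<Rightarrow> 'e) \<Rightarrow> ('m \<Rightarrow> real) \<Rightarrow> 'm \<Rightarrow> real" where
  "Lie A \<alpha> f = (\<lambda>p. anchor A p (\<alpha> p) f)"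

definition bilinear_sections :: "'m::topological_space manifold \<Rightarrow> ('m, 'e, 'x) vbundle_scheme \<Rightarrow>
    ('m, 'f, 'y) vbundle_scheme \<Rightarrow> ('m, 'g, 'z) vbundle_scheme \<Rightarrow>
    (('m \<Rightarrow> 'e) \<Rightarrow> ('m \<Rightarrow> 'f) \<Rightarrow> 'm \<Rightarrow> 'g) \<Rightarrow> bool" where
  "bilinear_sections M E F G B \<longleftrightarrow>
     (\<forall>a\<in>sections M E. \<forall>b\<in>sections M F. B a b \<in> sections M G) \<and>
     (\<forall>a\<in>sections M E. \<forall>a'\<in>sections M E. \<forall>b\<in>sections M F.
        B (sadd E a a') b = sadd G (B a b) (B a' b)) \<and>
     (\<forall>a\<in>sections M E. \<forall>b\<in>sections M F. \<forall>b'\<in>sections M F.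
        B a (sadd F b b') = sadd G (B a b) (B a b')) \<and>
     (\<forall>c. \<forall>a\<in>sections M E. \<forall>b\<in>sections M F.
        B (sscale E (\<lambda>_. c) a) b = sscale G (\<lambda>_. c) (B a b) \<and>
        B a (sscale F (\<lambda>_. c) b) = sscale G (\<lambda>_. c) (B a b))"

definition almost_Lie_algebroid ::
  "'m::topological_space manifold \<Rightarrow> ('m, 'e) algebroid \<Rightarrow> bool" where
  "almost_Lie_algebroid M A \<longleftrightarrow>
     vector_bundle M A \<and> anchor_map M A (anchor A) \<and> bilinear_sections M A A A (brk A) \<and>
     (\<forall>\<alpha>\<in>sections M A. \<forall>\<beta>\<in>sections M A.
        brk A \<alpha> \<beta> = sscale A (\<lambda>_. -1) (brk A \<beta> \<alpha>) \<and>
        (\<forall>f\<in>Cinf M. brk A \<alpha> (sscale A f \<beta>) =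
           sadd A (sscale A f (brk A \<alpha> \<beta>)) (sscale A (Lie A \<alpha> f) \<beta>)) \<and>
        (\<forall>f\<in>Cinf M. Lie A (brk A \<alpha> \<beta>) f =
           (\<lambda>p. Lie A \<alpha> (Lie A \<beta> f) p - Lie A \<beta> (Lie A \<alpha> f) p)))"

definition transitive_algebroid ::
  "'m::topological_space manifold \<Rightarrow> ('m, 'e) algebroid \<Rightarrow> bool" where
  "transitive_algebroid M A \<longleftrightarrow> (\<forall>p. anchor A p ` fib A p = tangent_space M p)"

definition jacobiator ::
  "('m, 'e) algebroid \<Rightarrow> ('m \<Rightarrow> 'e) \<Rightarrow> ('m \<Rightarrow> 'e) \<Rightarrow> ('m \<Rightarrow> 'e) \<Rightarrow> 'm \<Rightarrow> 'e" where
  "jacobiator A \<alpha> \<beta> \<gamma> =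
     sadd A (sadd A (brk A (brk A \<alpha> \<beta>) \<gamma>) (brk A (brk A \<beta> \<gamma>) \<alpha>)) (brk A (brk A \<gamma> \<alpha>) \<beta>)"

section \<open>Cartan algebroids\<close>

definition almost_Cartan_algebroid :: "'m::topological_space manifold \<Rightarrow> ('m, 'e) algebroid \<Rightarrow>
    ('m \<Rightarrow> ('e \<Rightarrow> 'e) set) \<Rightarrow> bool" where
  "almost_Cartan_algebroid M C \<sigma> \<longleftrightarrow>
     almost_Lie_algebroid M C \<and> transitive_algebroid M C \<and> subbundle M (hom_bundle C) \<sigma> \<and>
     (\<forall>p. \<forall>T\<in>\<sigma> p. \<forall>v\<in>fib C p. anchor C p (T v) = (\<lambda>_. 0))"

abbreviation sigma_bundle :: "'m::topological_space manifold \<Rightarrow> ('m, 'e) algebroid \<Rightarrow>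
    ('m \<Rightarrow> ('e \<Rightarrow> 'e) set) \<Rightarrow> ('m, 'e \<Rightarrow> 'e) vbundle" where
  "sigma_bundle M C \<sigma> \<equiv> sub_bundle M (hom_bundle C) \<sigma>"

definition Cartan_torsion :: "'m::topological_space manifold \<Rightarrow> ('m, 'e) algebroid \<Rightarrow>
    ('m \<Rightarrow> ('e \<Rightarrow> 'e) set) \<Rightarrow> ('m \<Rightarrow> 'e \<Rightarrow> 'e \<Rightarrow> 'e \<Rightarrow> 'e) \<Rightarrow> bool" where
  "Cartan_torsion M C \<sigma> t \<longleftrightarrow>
     alternating_bundle_map M C (sigma_bundle M C \<sigma>) t \<and>
     (\<forall>\<alpha>\<in>sections M C. \<forall>\<beta>\<in>sections M C. \<forall>\<gamma>\<in>sections M C.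
        jacobiator C \<alpha> \<beta> \<gamma> =
          (\<lambda>p. vadd C p (vadd C p (t p (\<alpha> p) (\<beta> p) (\<gamma> p)) (t p (\<beta> p) (\<gamma> p) (\<alpha> p)))
                 (t p (\<gamma> p) (\<alpha> p) (\<beta> p))))"

definition Cartan_connection :: "'m::topological_space manifold \<Rightarrow> ('m, 'e) algebroid \<Rightarrow>
    ('m \<Rightarrow> ('e \<Rightarrow> 'e) set) \<Rightarrow> (('m \<Rightarrow> 'e) \<Rightarrow> ('m \<Rightarrow> 'e \<Rightarrow> 'e) \<Rightarrow> 'm \<Rightarrow> 'e \<Rightarrow> 'e) \<Rightarrow> bool" where
  "Cartan_connection M C \<sigma> D \<longleftrightarrow>
     bilinear_sections M C (sigma_bundle M C \<sigma>) (sigma_bundle M C \<sigma>) D \<and>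
     (\<forall>\<alpha>\<in>sections M C. \<forall>T\<in>sections M (sigma_bundle M C \<sigma>). \<forall>f\<in>Cinf M.
        D (sscale C f \<alpha>) T = sscale (sigma_bundle M C \<sigma>) f (D \<alpha> T) \<and>
        D \<alpha> (sscale (sigma_bundle M C \<sigma>) f T) =
          sadd (sigma_bundle M C \<sigma>) (sscale (sigma_bundle M C \<sigma>) f (D \<alpha> T))
            (sscale (sigma_bundle M C \<sigma>) (Lie C \<alpha> f) T)) \<and>
     (\<forall>\<alpha>\<in>sections M C. \<forall>\<beta>\<in>sections M C. \<forall>T\<in>sections M (sigma_bundle M C \<sigma>).
        sminus C (sminus C (sapp T (brk C \<alpha> \<beta>)) (brk C (sapp T \<alpha>) \<beta>)) (brk C \<alpha> (sapp T \<beta>)) =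
        sminus C (sapp (D \<beta> T) \<alpha>) (sapp (D \<alpha> T) \<beta>))"

definition Cartan_algebroid :: "'m::topological_space manifold \<Rightarrow> ('m, 'e) algebroid \<Rightarrow>
    ('m \<Rightarrow> ('e \<Rightarrow> 'e) set) \<Rightarrow> bool" where
  "Cartan_algebroid M C \<sigma> \<longleftrightarrow>
     almost_Cartan_algebroid M C \<sigma> \<and>
     (\<forall>p. \<forall>S\<in>\<sigma> p. \<forall>T\<in>\<sigma> p. commutator C p S T \<in> \<sigma> p) \<and>
     (\<exists>t. Cartan_torsion M C \<sigma> t) \<and>
     (\<exists>D. Cartan_connection M C \<sigma> D)"

definition Cartan_algebroid_iso :: "'m::topological_space manifold \<Rightarrow>
    ('m, 'e) algebroid \<Rightarrow> ('m \<Rightarrow> ('e \<Rightarrow> 'e) set) \<Rightarrow>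
    ('m, 'f) algebroid \<Rightarrow> ('m \<Rightarrow> ('f \<Rightarrow> 'f) set) \<Rightarrow> bool" where
  "Cartan_algebroid_iso M C \<sigma> C' \<sigma>' \<longleftrightarrow> (\<exists>\<psi>. bundle_iso M C C' \<psi> \<and>
     (\<forall>\<alpha>\<in>sections M C. \<forall>\<beta>\<in>sections M C.
        sapp \<psi> (brk C \<alpha> \<beta>) = brk C' (sapp \<psi> \<alpha>) (sapp \<psi> \<beta>)) \<and>
     (\<forall>p. \<forall>v\<in>fib C p. anchor C' p (\<psi> p v) = anchor C p v) \<and>
     (\<forall>p. (\<lambda>T. \<lambda>v\<in>fib C' p. \<psi> p (T (inv_into (fib C p) (\<psi> p) v))) ` \<sigma> p = \<sigma>' p))"

definition twist ::
  "('m, 'e) algebroid \<Rightarrow> ('m \<Rightarrow> 'e \<Rightarrow> 'e \<Rightarrow> 'e) \<Rightarrow> ('m, 'e) algebroid" where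
  "twist C \<eta> = C\<lparr>brk := \<lambda>\<alpha> \<beta> p.
     vminus C p (vadd C p (brk C \<alpha> \<beta> p) (\<eta> p (\<alpha> p) (\<beta> p))) (\<eta> p (\<beta> p) (\<alpha> p))\<rparr>"

definition gauge_equivalent :: "'m::topological_space manifold \<Rightarrow>
    ('m, 'e) algebroid \<Rightarrow> ('m \<Rightarrow> ('e \<Rightarrow> 'e) set) \<Rightarrow>
    ('m, 'f) algebroid \<Rightarrow> ('m \<Rightarrow> ('f \<Rightarrow> 'f) set) \<Rightarrow> bool" where
  "gauge_equivalent M C \<sigma> C' \<sigma>' \<longleftrightarrow>
     (\<exists>\<eta>. bundle_map M C (sigma_bundle M C \<sigma>) \<eta> \<and>
          Cartan_algebroid_iso M C' \<sigma>' (twist C \<eta>) \<sigma>)"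

section \<open>Cartan pairs\<close>

definition Cartan_pair :: "'m::topological_space manifold \<Rightarrow> ('m, 'e) algebroid \<Rightarrow>
    ('m \<Rightarrow> 'e set) \<Rightarrow> bool" where
  "Cartan_pair M A \<sigma> \<longleftrightarrow>
     almost_Lie_algebroid M A \<and> transitive_algebroid M A \<and> subbundle M A \<sigma> \<and>
     (\<forall>p. \<forall>v\<in>\<sigma> p. anchor A p v = (\<lambda>_. 0)) \<and>
     (\<forall>S\<in>sections M (sub_bundle M A \<sigma>). \<forall>T\<in>sections M (sub_bundle M A \<sigma>).
        brk A S T \<in> sections M (sub_bundle M A \<sigma>)) \<and>
     (\<forall>\<alpha>\<in>sections M A. \<forall>\<beta>\<in>sections M A. \<forall>\<gamma>\<in>sections M A.
        jacobiator A \<alpha> \<beta> \<gamma> \<in> sections M (sub_bundle M A \<sigma>))"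

text \<open>
  The map \<open>\<iota>(T)(pr(\<alpha>)) = pr([T, \<alpha>])\<close> is given on sections but depends only on the values at p,
  which is what the description operator expresses.
\<close>

definition iota :: "'m::topological_space manifold \<Rightarrow> ('m, 'e) algebroid \<Rightarrow>
    ('m \<Rightarrow> 'e set) \<Rightarrow> 'm \<Rightarrow> 'e \<Rightarrow> 'e set \<Rightarrow> 'e set" where
  "iota M A \<sigma> p u = (\<lambda>a \<in> fib (quot_bundle M A \<sigma>) p.
     THE b. \<exists>T\<in>sections M (sub_bundle M A \<sigma>). \<exists>\<alpha>\<in>sections M A.
       T p = u \<and> pr A \<sigma> p (\<alpha> p) = a \<and> b = pr A \<sigma> p (brk A T \<alpha> p))"

definition standard_Cartan_pair :: "'m::topological_space manifold \<Rightarrow> ('m, 'e) algebroid \<Rightarrow>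
    ('m \<Rightarrow> 'e set) \<Rightarrow> bool" where
  "standard_Cartan_pair M A \<sigma> \<longleftrightarrow>
     Cartan_pair M A \<sigma> \<and> (\<forall>p. inj_on (iota M A \<sigma> p) (\<sigma> p))"

definition Cartan_pair_iso :: "'m::topological_space manifold \<Rightarrow>
    ('m, 'e) algebroid \<Rightarrow> ('m \<Rightarrow> 'e set) \<Rightarrow> ('m, 'f) algebroid \<Rightarrow> ('m \<Rightarrow> 'f set) \<Rightarrow> bool" where
  "Cartan_pair_iso M A \<sigma> A' \<sigma>' \<longleftrightarrow> (\<exists>\<psi>. bundle_iso M A A' \<psi> \<and>
     (\<forall>p. \<psi> p ` \<sigma> p = \<sigma>' p) \<and>
     (\<forall>p. \<forall>v\<in>fib A p. anchor A' p (\<psi> p v) = anchor A p v) \<and>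
     (\<forall>\<alpha>\<in>sections M A. \<forall>\<beta>\<in>sections M A. \<forall>p.
        vminus A' p (\<psi> p (brk A \<alpha> \<beta> p)) (brk A' (sapp \<psi> \<alpha>) (sapp \<psi> \<beta>) p) \<in> \<sigma>' p))"

section \<open>The two constructions\<close>

definition pair_of :: "'m::topological_space manifold \<Rightarrow> ('m, 'e) algebroid \<Rightarrow>
    ('m \<Rightarrow> ('e \<Rightarrow> 'e) set) \<Rightarrow> ('m \<Rightarrow> 'e \<Rightarrow> 'e \<Rightarrow> 'e \<Rightarrow> 'e) \<Rightarrow>
    (('m \<Rightarrow> 'e) \<Rightarrow> ('m \<Rightarrow> 'e \<Rightarrow> 'e) \<Rightarrow> 'm \<Rightarrow> 'e \<Rightarrow> 'e) \<Rightarrow>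
    ('m, 'e \<times> ('e \<Rightarrow> 'e)) algebroid" where
  "pair_of M C \<sigma> t D =
     (let H = hom_bundle C in
      vbundle.extend (sum_bundle C (sigma_bundle M C \<sigma>))
        (algebroid.fields
          (\<lambda>p (v, S). anchor C p v)
          (\<lambda>a b p.
             let \<alpha> = fst \<circ> a; S = snd \<circ> a; \<beta> = fst \<circ> b; T = snd \<circ> b in
             (vminus C p (vadd C p (brk C \<alpha> \<beta> p) (S p (\<beta> p))) (T p (\<alpha> p)),
              vadd H p
                (vminus H p (vadd H p (vscale H p (-1) (t p (\<alpha> p) (\<beta> p))) (D \<alpha> T p)) (D \<beta> S p))
                (commutator C p (S p) (T p))))))"

text \<open>The copy of \<open>\<sigma>\<close> in the direct sum.\<close>

definition pair_sub :: "('m, 'e) algebroid \<Rightarrow> ('m \<Rightarrow> ('e \<Rightarrow> 'e) set) \<Rightarrow>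
    'm \<Rightarrow> ('e \<times> ('e \<Rightarrow> 'e)) set" where
  "pair_sub C \<sigma> p = {vzero C p} \<times> \<sigma> p"

definition splitting :: "'m::topological_space manifold \<Rightarrow> ('m, 'e) algebroid \<Rightarrow>
    ('m \<Rightarrow> 'e set) \<Rightarrow> ('m \<Rightarrow> 'e set \<Rightarrow> 'e) \<Rightarrow> bool" where
  "splitting M A \<sigma> \<xi> \<longleftrightarrow> bundle_map M (quot_bundle M A \<sigma>) A \<xi> \<and>
     (\<forall>p. \<forall>a\<in>fib (quot_bundle M A \<sigma>) p. pr A \<sigma> p (\<xi> p a) = a)"

definition algebroid_of :: "'m::topological_space manifold \<Rightarrow> ('m, 'e) algebroid \<Rightarrow>
    ('m \<Rightarrow> 'e set) \<Rightarrow> ('m \<Rightarrow> 'e set \<Rightarrow> 'e) \<Rightarrow> ('m, 'e set) algebroid" where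
  "algebroid_of M A \<sigma> \<xi> =
     vbundle.extend (quot_bundle M A \<sigma>)
       (algebroid.fields
         (\<lambda>p a. anchor A p (\<xi> p a))
         (\<lambda>\<alpha> \<beta>. sapp (pr A \<sigma>) (brk A (sapp \<xi> \<alpha>) (sapp \<xi> \<beta>))))"

definition algebroid_sub :: "'m::topological_space manifold \<Rightarrow> ('m, 'e) algebroid \<Rightarrow>
    ('m \<Rightarrow> 'e set) \<Rightarrow> 'm \<Rightarrow> ('e set \<Rightarrow> 'e set) set" where
  "algebroid_sub M A \<sigma> p = iota M A \<sigma> p ` \<sigma> p"

end

theory Submission imports Defs begin

text \<open>
  A splitting identifies \<open>A\<close> with \<open>A/\<sigma> \<oplus> \<sigma>\<close>, and modulo \<open>\<sigma>\<close> the bracket of \<open>A\<close> is then given by the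
  bracket of \<open>A/\<sigma>\<close> and the action \<open>\<iota>\<close> of \<open>\<sigma>\<close>; the remaining components are exactly the freedom
  in \<open>t\<close> and \<open>\<nabla>\<close>. Conversely \<open>t\<close> and \<open>\<nabla>\<close> on \<open>A/\<sigma>\<close> are read off from the \<open>\<sigma>\<close>-components of
  \<open>[\<xi>(\<alpha>), \<xi>(\<beta>)]\<close> and \<open>[\<xi>(\<alpha>), T]\<close>, and the identities (2) and (3) are the projection to \<open>A/\<sigma>\<close>
  of the fact that the Jacobiator lies in \<open>\<sigma>\<close>. An isomorphism of pairs
  \<open>C \<oplus> \<sigma> \<rightarrow> C' \<oplus> \<sigma>'\<close> is block triangular: its diagonal part is an isomorphism of bundles \<open>C \<rightarrow> C'\<close>, its
  off-diagonal part is a bundle map \<open>\<eta>\<close> with values in \<open>\<sigma>'\<close>, and compatibility with the brackets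
  modulo \<open>\<sigma>'\<close> says that the diagonal part preserves the bracket twisted by \<open>\<eta>\<close>. This turns gauge
  equivalence into isomorphism of pairs.
\<close>


section \<open>Smooth functions\<close>

text \<open>All clauses of the theorem come from two facts: Cartan algebroids are gauge equivalent
  iff their pairs are isomorphic, whatever \<open>t\<close> and \<nabla> were used, and a standard
  pair is isomorphic to the pair of its algebroid, whatever splitting was used. The rest is formal;
  the composite from algebroids to pairs and back is never computed, and gauge equivalence inherits
  reflexivity, symmetry and transitivity from isomorphism of pairs. Independence of the choices is
  cheap because brackets are compared modulo \<sigma>, where \<open>t\<close> and \<nabla> do not
  appear. The obstacle is that brackets and connections act on global sections, while \<iota>,
  \<open>t\<close> and \<eta> are fibrewise. Passing between the two takes sections through a given
  vector, extensions of local sections and the locality of function-linear operators, hence bump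
  functions; splittings must be glued too. Moreover \<iota>(\<sigma>) and the copy of \<sigma> in C
  \<oplus> \<sigma> have to be recognised as subbundles. Smoothness itself is developed from
  iterated partial derivatives.\<close>

lemma openin_Euclidean_space_eventually:
  assumes "openin (Euclidean_space n) V" "x \<in> V" "i < n"
  shows "\<forall>\<^sub>F s in nhds (x i). x(i := s) \<in> V"
proof -
  obtain T where T: "open T" "V = T \<inter> {x. \<forall>i\<ge>n. x i = 0}"
    using assms(1) by (auto simp: Euclidean_space_def openin_subtopology euclidean_product_topology)
  have "continuous_on UNIV (\<lambda>s. x(i := s))"
  proof (rule continuous_on_coordinatewise_then_product)
    show "continuous_on UNIV (\<lambda>s. (x(i := s)) j)" for j
      by (cases "j = i") (simp_all add: continuous_intros)
  qed
  then have "open ((\<lambda>s. x(i := s)) -` T)"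
    using T(1) by (simp add: open_vimage)
  moreover have "x i \<in> (\<lambda>s. x(i := s)) -` T"
    using assms T by auto
  ultimately have "\<forall>\<^sub>F s in nhds (x i). s \<in> (\<lambda>s. x(i := s)) -` T"
    using eventually_nhds_in_open by blast
  then show ?thesis
    by eventually_elim (use assms T in auto)
qed

text \<open>\<open>partial i f\<close> agrees with the candidate derivative \<open>F i\<close> on
  \<open>V\<close> only, so a congruence rule for order \<open>k\<close> is needed. It enters as the
  premise \<open>cong\<close> because \<open>Ck_on_cong\<close> is itself proved with this rule and
  has only its induction hypothesis to offer.\<close>

lemma Ck_on_SucI:
  assumes "continuous_on V f"
    and d: "\<And>i x. i < n \<Longrightarrow> x \<in> V \<Longrightarrow> ((\<lambda>s. f (x(i := s))) has_real_derivative F i x) (at (x i))"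
    and F: "\<And>i. i < n \<Longrightarrow> Ck_on n k V (F i)"
    and cong: "\<And>f g. Ck_on n k V f \<Longrightarrow> (\<And>x. x \<in> V \<Longrightarrow> f x = g x) \<Longrightarrow> Ck_on n k V g"
  shows "Ck_on n (Suc k) V f"
  unfolding Ck_on.simps
proof (intro conjI allI impI ballI assms(1))
  fix i assume i: "i < n"
  show "(\<lambda>s. f (x(i := s))) differentiable at (x i)" if "x \<in> V" for x
    using d[OF i that] real_differentiable_def by blast
  show "Ck_on n k V (partial i f)"
  proof (rule cong[OF F[OF i]])
    show "F i x = partial i f x" if "x \<in> V" for x
      unfolding partial_def using DERIV_imp_deriv[OF d[OF i that]] by (rule sym)
  qed
qed

lemma Ck_on_SucD:
  assumes "Ck_on n (Suc k) V f" "i < n" "x \<in> V"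
  shows "((\<lambda>s. f (x(i := s))) has_real_derivative partial i f x) (at (x i))"
  using assms unfolding partial_def by (simp add: DERIV_deriv_iff_real_differentiable)

lemma Ck_on_continuous: "Ck_on n k V f \<Longrightarrow> continuous_on V f"
  by (cases k) auto

lemma Ck_on_Suc_partial: "Ck_on n (Suc k) V f \<Longrightarrow> i < n \<Longrightarrow> Ck_on n k V (partial i f)"
  by simp

text \<open>A small change of a coordinate below \<open>n\<close> keeps a point of a relatively open
  \<open>V\<close> inside \<open>V\<close>, so partial derivatives at points of \<open>V\<close> do
  not see the values outside it.\<close>

lemma Ck_on_cong:
  assumes V: "openin (Euclidean_space n) V"
  shows "Ck_on n k V f \<Longrightarrow> (\<And>x. x \<in> V \<Longrightarrow> f x = g x) \<Longrightarrow> Ck_on n k V g"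
proof (induction k arbitrary: f g)
  case 0
  then show ?case by (simp cong: continuous_on_cong)
next
  case (Suc k)
  show ?case
  proof (rule Ck_on_SucI)
    show "continuous_on V g"
      using Suc.prems by (simp cong: continuous_on_cong)
    show "((\<lambda>s. g (x(i := s))) has_real_derivative partial i f x) (at (x i))" if i: "i < n" and x: "x \<in> V" for i x
    proof (rule DERIV_cong_ev[THEN iffD1, OF refl _ refl Ck_on_SucD[OF Suc.prems(1) i x]])
      show "\<forall>\<^sub>F s in nhds (x i). f (x(i := s)) = g (x(i := s))"
        using openin_Euclidean_space_eventually[OF V x i]
        by eventually_elim (rule Suc.prems(2))
    qed
  qed (rule Ck_on_Suc_partial[OF Suc.prems(1)], assumption, rule Suc.IH)
qed

lemma Ck_on_pred: "Ck_on n (Suc k) V f \<Longrightarrow> Ck_on n k V f"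
  by (induction k arbitrary: f) auto

lemma Ck_on_subset: "Ck_on n k V f \<Longrightarrow> W \<subseteq> V \<Longrightarrow> Ck_on n k W f"
  by (induction k arbitrary: f) (auto intro: continuous_on_subset)

lemma continuous_on_local:
  fixes f :: "'a::t2_space \<Rightarrow> 'b::topological_space"
  assumes "\<And>x. x \<in> V \<Longrightarrow> \<exists>T. open T \<and> x \<in> T \<and> continuous_on (V \<inter> T) f"
  shows "continuous_on V f"
  unfolding continuous_on_eq_continuous_within
proof
  fix x assume x: "x \<in> V"
  then obtain T where T: "open T" "x \<in> T" "continuous_on (V \<inter> T) f" using assms by blast
  then have "continuous (at x within V \<inter> T) f"
    using x by (simp add: continuous_on_eq_continuous_within)
  then show "continuous (at x within V) f"
    using at_within_nhd[OF T(2,1), of "V \<inter> T" V] by simp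
qed

text \<open>Partial derivatives are those of the total function \<open>f\<close>, so at a given
  point they are the same for \<open>V\<close> and for \<open>V \<inter> T\<close>; only continuity
  has to be localised.\<close>

lemma Ck_on_local:
  "(\<And>x. x \<in> V \<Longrightarrow> \<exists>T. open T \<and> x \<in> T \<and> Ck_on n k (V \<inter> T) f) \<Longrightarrow> Ck_on n k V f"
proof (induction k arbitrary: f)
  case 0
  then show ?case using continuous_on_local[of V f] by simp
next
  case (Suc k)
  have "continuous_on V f"
  proof (rule continuous_on_local)
    fix x assume "x \<in> V"
    then obtain T where T: "open T" "x \<in> T" "Ck_on n (Suc k) (V \<inter> T) f" using Suc.prems by blast
    show "\<exists>T. open T \<and> x \<in> T \<and> continuous_on (V \<inter> T) f"
      using T(1,2) Ck_on_continuous[OF T(3)] by blast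
  qed
  moreover have "Ck_on n k V (partial i f)" if "i < n" for i
  proof (rule Suc.IH)
    fix x assume "x \<in> V"
    then obtain T where "open T" "x \<in> T" "Ck_on n (Suc k) (V \<inter> T) f" using Suc.prems by blast
    then show "\<exists>T. open T \<and> x \<in> T \<and> Ck_on n k (V \<inter> T) (partial i f)"
      using that unfolding Ck_on.simps by blast
  qed
  moreover have "(\<lambda>s. f (x(i := s))) differentiable at (x i)" if i: "i < n" and x: "x \<in> V" for i x
  proof -
    obtain T where T: "x \<in> T" "Ck_on n (Suc k) (V \<inter> T) f" using Suc.prems[OF x] by blast
    show ?thesis using Ck_on_SucD[OF T(2) i, of x] T(1) x real_differentiable_def by blast
  qed
  ultimately show ?case by simp
qed

lemma Ck_on_const:
  assumes "openin (Euclidean_space n) V" shows "Ck_on n k V (\<lambda>_. c)"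
proof (induction k arbitrary: c)
  case (Suc k)
  show ?case
    by (rule Ck_on_SucI[where F = "\<lambda>_ _. 0"]) (simp_all add: Suc Ck_on_cong[OF assms])
qed simp

lemma Ck_on_add:
  assumes V: "openin (Euclidean_space n) V"
  shows "Ck_on n k V f \<Longrightarrow> Ck_on n k V g \<Longrightarrow> Ck_on n k V (\<lambda>x. f x + g x)"
proof (induction k arbitrary: f g)
  case 0 then show ?case by (simp add: continuous_on_add)
next
  case (Suc k)
  show ?case
  proof (rule Ck_on_SucI[where F = "\<lambda>i x. partial i f x + partial i g x"])
    show "continuous_on V (\<lambda>x. f x + g x)"
      by (intro continuous_on_add Ck_on_continuous[OF Suc.prems(1)] Ck_on_continuous[OF Suc.prems(2)])
    fix i assume i: "i < n"
    show "((\<lambda>s. f (x(i := s)) + g (x(i := s))) has_real_derivative partial i f x + partial i g x) (at (x i))"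
      if "x \<in> V" for x
      by (rule DERIV_add[OF Ck_on_SucD[OF Suc.prems(1) i that] Ck_on_SucD[OF Suc.prems(2) i that]])
    show "Ck_on n k V (\<lambda>x. partial i f x + partial i g x)"
      by (intro Suc.IH Ck_on_Suc_partial[OF Suc.prems(1) i] Ck_on_Suc_partial[OF Suc.prems(2) i])
  qed (rule Ck_on_cong[OF V])
qed

lemma Ck_on_mult:
  assumes V: "openin (Euclidean_space n) V"
  shows "Ck_on n k V f \<Longrightarrow> Ck_on n k V g \<Longrightarrow> Ck_on n k V (\<lambda>x. f x * g x)"
proof (induction k arbitrary: f g)
  case 0 then show ?case by (simp add: continuous_on_mult)
next
  case (Suc k)
  show ?case
  proof (rule Ck_on_SucI[where F = "\<lambda>i x. partial i f x * g x + partial i g x * f x"])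
    show "continuous_on V (\<lambda>x. f x * g x)"
      by (intro continuous_on_mult Ck_on_continuous[OF Suc.prems(1)] Ck_on_continuous[OF Suc.prems(2)])
    fix i assume i: "i < n"
    show "Ck_on n k V (\<lambda>x. partial i f x * g x + partial i g x * f x)"
      by (intro Ck_on_add[OF V] Suc.IH Ck_on_Suc_partial[OF Suc.prems(1) i] Ck_on_Suc_partial[OF Suc.prems(2) i]
          Ck_on_pred[OF Suc.prems(1)] Ck_on_pred[OF Suc.prems(2)])
    show "((\<lambda>s. f (x(i := s)) * g (x(i := s))) has_real_derivative
        partial i f x * g x + partial i g x * f x) (at (x i))" if "x \<in> V" for x
      by (rule DERIV_cong[OF DERIV_mult[OF Ck_on_SucD[OF Suc.prems(1) i that] Ck_on_SucD[OF Suc.prems(2) i that]]]) simp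
  qed (rule Ck_on_cong[OF V])
qed

text \<open>The outer function is given by the sequence \<open>H\<close> of its successive
  derivatives. The induction runs over all \<open>m\<close> at once since differentiation replaces
  \<open>H m\<close> by \<open>H (Suc m)\<close>.\<close>

lemma Ck_on_compose:
  fixes H :: "nat \<Rightarrow> real \<Rightarrow> real"
  assumes V: "openin (Euclidean_space n) V" and H: "\<And>m x. (H m has_real_derivative H (Suc m) x) (at x)"
  shows "Ck_on n k V f \<Longrightarrow> Ck_on n k V (\<lambda>x. H m (f x))"
proof (induction k arbitrary: f m)
  case 0
  have "continuous_on UNIV (H m)"
    by (intro continuous_at_imp_continuous_on ballI DERIV_isCont[OF H])
  then show ?case using 0 continuous_on_compose2[of UNIV "H m" V f] by simp
next
  case (Suc k)
  show ?case
  proof (rule Ck_on_SucI[where F = "\<lambda>i x. H (Suc m) (f x) * partial i f x"])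
    have "continuous_on UNIV (H m)"
      by (intro continuous_at_imp_continuous_on ballI DERIV_isCont[OF H])
    then show "continuous_on V (\<lambda>x. H m (f x))"
      by (rule continuous_on_compose2[OF _ Ck_on_continuous[OF Suc.prems]]) simp
    fix i assume i: "i < n"
    show "Ck_on n k V (\<lambda>x. H (Suc m) (f x) * partial i f x)"
      by (intro Ck_on_mult[OF V] Suc.IH Ck_on_Suc_partial[OF Suc.prems i] Ck_on_pred[OF Suc.prems])
    show "((\<lambda>s. H m (f (x(i := s)))) has_real_derivative
      H (Suc m) (f x) * partial i f x) (at (x i))" if "x \<in> V" for x
      by (rule DERIV_chain2[OF _ Ck_on_SucD[OF Suc.prems i that]]) (simp add: H)
  qed (rule Ck_on_cong[OF V])
qed

lemma Ck_on_inverse: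
  assumes V: "openin (Euclidean_space n) V" and nz: "\<And>x. x \<in> V \<Longrightarrow> f x \<noteq> 0"
  shows "Ck_on n k V f \<Longrightarrow> Ck_on n k V (\<lambda>x. inverse (f x))"
proof (induction k)
  case 0 then show ?case using nz by (simp add: continuous_on_inverse)
next
  case (Suc k)
  show ?case
  \<comment> \<open>The derivative is written as a product of \<open>inverse f\<close> and
    \<open>partial i f\<close> without squares or quotients, so that the induction hypothesis and
    \<open>Ck_on_mult\<close> cover it.\<close>
  proof (rule Ck_on_SucI[where F = "\<lambda>i x. (-1) * (inverse (f x) * (partial i f x * inverse (f x)))"])
    show "continuous_on V (\<lambda>x. inverse (f x))"
      using nz Ck_on_continuous[OF Suc.prems] by (simp add: continuous_on_inverse)
    fix i assume i: "i < n"
    show "Ck_on n k V (\<lambda>x. (-1) * (inverse (f x) * (partial i f x * inverse (f x))))"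
      by (intro Ck_on_mult[OF V] Ck_on_const[OF V] Suc.IH Ck_on_Suc_partial[OF Suc.prems i] Ck_on_pred[OF Suc.prems])
    show "((\<lambda>s. inverse (f (x(i := s)))) has_real_derivative
        (-1) * (inverse (f x) * (partial i f x * inverse (f x)))) (at (x i))" if "x \<in> V" for x
      by (rule DERIV_cong[OF DERIV_inverse'[OF Ck_on_SucD[OF Suc.prems i that]]]) (use nz[OF that] in simp_all)
  qed (rule Ck_on_cong[OF V])
qed

subsection \<open>A flat function\<close>

text \<open>The polynomial factor makes this family of functions closed under differentiation.\<close>

definition flat :: "real poly \<Rightarrow> real \<Rightarrow> real" where
  "flat P x = (if x > 0 then poly P (inverse x) * exp (- inverse x) else 0)"

text \<open>With y = 1/x the claim is that exp(-y) beats every polynomial in y as y tends to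
  infinity.\<close>

lemma flat_tendsto: "((\<lambda>x. poly P (inverse x) * exp (- inverse x)) \<longlongrightarrow> 0) (at_right (0::real))"
proof -
  have pw: "((\<lambda>y. y ^ m * exp (- y)) \<longlongrightarrow> 0) (at_top :: real filter)" for m
    using tendsto_power_div_exp_0[of m] by (simp add: exp_minus divide_inverse)
  have "((\<lambda>y. poly P y * exp (- y)) \<longlongrightarrow> 0) at_top"
  proof -
    have "((\<lambda>y. \<Sum>i\<le>degree P. coeff P i * (y ^ i * exp (- y))) \<longlongrightarrow> (\<Sum>i\<le>degree P. coeff P i * 0)) (at_top :: real filter)"
      by (intro tendsto_sum tendsto_mult tendsto_const pw)
    moreover have "poly P y * exp (- y) = (\<Sum>i\<le>degree P. coeff P i * (y ^ i * exp (- y)))" for y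
      by (simp add: poly_altdef sum_distrib_right mult.assoc)
    ultimately show ?thesis by simp
  qed
  then show ?thesis
    by (rule filterlim_compose[OF _ filterlim_inverse_at_top_right])
qed

text \<open>For x > 0 and y = 1/x the chain rule gives y^2 (P(y) - P'(y)) exp(-y), whence the
  polynomial in the statement. At 0 the difference quotient from the right has the same shape with
  \<open>P\<close> multiplied by the variable, so it tends to 0 by
  \<open>flat_tendsto\<close>.\<close>

lemma flat_deriv:
  "(flat P has_real_derivative flat ([:0, 0, 1:] * (P - pderiv P)) x) (at x)"
proof -
  consider "x > 0" | "x < 0" | "x = 0" by linarith
  then show ?thesis
  proof cases
    case 1
    have "((\<lambda>x. poly P (inverse x) * exp (- inverse x)) has_real_derivative
        flat ([:0, 0, 1:] * (P - pderiv P)) x) (at x)"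
      using 1 by (auto intro!: derivative_eq_intros DERIV_chain2[OF poly_DERIV]
          simp: flat_def field_simps power2_eq_square)
    moreover have "\<forall>\<^sub>F y in nhds x. poly P (inverse y) * exp (- inverse y) = flat P y"
      using eventually_nhds_in_open[OF open_greaterThan, of x 0] 1
      by (auto simp: flat_def elim: eventually_mono)
    ultimately show ?thesis using DERIV_cong_ev[OF refl _ refl, of "\<lambda>y. poly P (inverse y) * exp (- inverse y)"] by simp
  next
    case 2
    have "\<forall>\<^sub>F y in nhds x. 0 = flat P y"
      using eventually_nhds_in_open[OF open_lessThan, of x 0] 2
      by (auto simp: flat_def elim: eventually_mono)
    then have "((\<lambda>x. 0) has_real_derivative 0) (at x) \<longleftrightarrow> (flat P has_real_derivative 0) (at x)"
      by (rule DERIV_cong_ev[OF refl _ refl])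
    then show ?thesis using 2 by (simp add: flat_def)
  next
    case 3
    have "((\<lambda>h. flat P h / h) \<longlongrightarrow> 0) (at 0)"
    proof (rule filterlim_split_at)
      have "\<forall>\<^sub>F h in at_left 0. 0 = flat P h / h"
        by (simp add: eventually_at_filter flat_def)
      then show "((\<lambda>h. flat P h / h) \<longlongrightarrow> 0) (at_left 0)"
        by (rule Lim_transform_eventually[OF tendsto_const])
      have "\<forall>\<^sub>F h in at_right 0. poly (P * [:0,1:]) (inverse h) * exp (- inverse h) = flat P h / h"
        by (rule eventually_mono[OF eventually_at_right_less]) (simp add: flat_def field_simps)
      then show "((\<lambda>h. flat P h / h) \<longlongrightarrow> 0) (at_right 0)"
        by (rule Lim_transform_eventually[OF flat_tendsto])
    qed
    then show ?thesis using 3 by (simp add: DERIV_def flat_def)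
  qed
qed

text \<open>Its iterates on \<open>P\<close> enumerate the derivatives of \<open>flat P\<close>, the
  sequence \<open>H\<close> that \<open>Ck_on_compose\<close> asks for.\<close>

definition flat_step :: "real poly \<Rightarrow> real poly" where
  "flat_step P = [:0, 0, 1:] * (P - pderiv P)"

subsection \<open>Smooth functions on manifolds\<close>

locale smooth_mfd =
  fixes M :: "'m::{t2_space, second_countable_topology} manifold"
  assumes mfd: "smooth_manifold M"
begin

lemma chart_open:
  assumes "(U, \<phi>) \<in> charts M" "open W"
  shows "openin (Euclidean_space (mdim M)) (\<phi> ` (U \<inter> W))"
proof -
  have U: "openin (Euclidean_space (mdim M)) (\<phi> ` U)" "homeomorphism U (\<phi> ` U) \<phi> (inv_into U \<phi>)"
    using mfd assms(1) unfolding smooth_manifold_def by auto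
  have "openin (top_of_set U) (U \<inter> W)" using assms(2) by (simp add: openin_open_Int)
  then have "openin (top_of_set (\<phi> ` U)) (\<phi> ` (U \<inter> W))"
    using U(2) by (meson homeomorphism_imp_open_map)
  then obtain T where T: "open T" "\<phi> ` (U \<inter> W) = \<phi> ` U \<inter> T" by (auto simp: openin_open)
  have "openin (Euclidean_space (mdim M)) (topspace (Euclidean_space (mdim M)) \<inter> T)"
    unfolding Euclidean_space_def openin_subtopology euclidean_product_topology using T(1) by auto
  then have "openin (Euclidean_space (mdim M)) (\<phi> ` U \<inter> (topspace (Euclidean_space (mdim M)) \<inter> T))"
    using U(1) by (rule openin_Int[rotated])
  moreover have "\<phi> ` U \<inter> (topspace (Euclidean_space (mdim M)) \<inter> T) = \<phi> ` (U \<inter> W)"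
    using T(2) openin_subset[OF U(1)] by auto
  ultimately show ?thesis by simp
qed

lemma chart_props:
  assumes "(U, \<phi>) \<in> charts M"
  shows "open U" "inj_on \<phi> U" "continuous_on U \<phi>" "continuous_on (\<phi> ` U) (inv_into U \<phi>)"
    "openin (Euclidean_space (mdim M)) (\<phi> ` U)"
proof -
  have *: "open U" "homeomorphism U (\<phi> ` U) \<phi> (inv_into U \<phi>)" "openin (Euclidean_space (mdim M)) (\<phi> ` U)"
    using mfd assms(1) unfolding smooth_manifold_def by auto
  then show "open U" "continuous_on U \<phi>" "continuous_on (\<phi> ` U) (inv_into U \<phi>)"
     "openin (Euclidean_space (mdim M)) (\<phi> ` U)"
    unfolding homeomorphism_def by auto
  show "inj_on \<phi> U" using *(2) unfolding homeomorphism_def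
    by (intro inj_on_inverseI[where g = "inv_into U \<phi>"]) simp
qed

lemma chart_ex: obtains U \<phi> where "(U, \<phi>) \<in> charts M" "p \<in> U"
proof -
  have "p \<in> (\<Union>(U, \<phi>) \<in> charts M. U)" using mfd unfolding smooth_manifold_def by auto
  then show thesis using that by auto
qed

lemma smooth_funI:
  assumes "\<And>U \<phi> k. (U, \<phi>) \<in> charts M \<Longrightarrow> Ck_on (mdim M) k (\<phi> ` (U \<inter> W)) (\<lambda>x. f (inv_into U \<phi> x))"
  shows "smooth_fun M W f"
  unfolding smooth_fun_def smooth_on_def using assms by (auto split: prod.splits)

lemma smooth_funD:
  assumes "smooth_fun M W f" "(U, \<phi>) \<in> charts M"
  shows "Ck_on (mdim M) k (\<phi> ` (U \<inter> W)) (\<lambda>x. f (inv_into U \<phi> x))"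
  using assms unfolding smooth_fun_def smooth_on_def by auto

lemma smooth_fun_cong:
  assumes "open W" "smooth_fun M W f" "\<And>p. p \<in> W \<Longrightarrow> f p = g p"
  shows "smooth_fun M W g"
  proof (rule smooth_funI)
  fix U \<phi> k assume c: "(U, \<phi>) \<in> charts M"
  have "Ck_on (mdim M) k (\<phi> ` (U \<inter> W)) (\<lambda>x. f (inv_into U \<phi> x))"
    by (rule smooth_funD[OF assms(2) c])
  then show "Ck_on (mdim M) k (\<phi> ` (U \<inter> W)) (\<lambda>x. g (inv_into U \<phi> x))"
    by (rule Ck_on_cong[OF chart_open[OF c assms(1)]])
      (use assms(3) chart_props(2)[OF c] in \<open>auto simp: inv_into_f_f\<close>)
qed

lemma smooth_fun_subset:
  "smooth_fun M W f \<Longrightarrow> W' \<subseteq> W \<Longrightarrow> smooth_fun M W' f"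
  by (intro smooth_funI) (rule Ck_on_subset[OF smooth_funD], auto)

lemma smooth_fun_const: "open W \<Longrightarrow> smooth_fun M W (\<lambda>_. c)"
  by (intro smooth_funI Ck_on_const chart_open)

lemma smooth_fun_add:
  "open W \<Longrightarrow> smooth_fun M W f \<Longrightarrow> smooth_fun M W g \<Longrightarrow> smooth_fun M W (\<lambda>p. f p + g p)"
  by (rule smooth_funI, rule Ck_on_add) (simp_all add: chart_open smooth_funD)

lemma smooth_fun_mult:
  "open W \<Longrightarrow> smooth_fun M W f \<Longrightarrow> smooth_fun M W g \<Longrightarrow> smooth_fun M W (\<lambda>p. f p * g p)"
  by (rule smooth_funI, rule Ck_on_mult) (simp_all add: chart_open smooth_funD)

lemma smooth_fun_diff:
  assumes "open W" "smooth_fun M W f" "smooth_fun M W g"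
  shows "smooth_fun M W (\<lambda>p. f p - g p)"
  using smooth_fun_add[OF assms(1,2) smooth_fun_mult[OF assms(1) smooth_fun_const[OF assms(1), of "-1"] assms(3)]]
  by simp

lemma smooth_fun_sum:
  assumes "open W" "\<And>j. j \<in> J \<Longrightarrow> smooth_fun M W (f j)"
  shows "smooth_fun M W (\<lambda>p. \<Sum>j\<in>J. f j p)"
  using assms(2) by (induction J rule: infinite_finite_induct) (simp_all add: smooth_fun_const smooth_fun_add assms(1))

lemma smooth_fun_prod:
  assumes "open W" "\<And>j. j \<in> J \<Longrightarrow> smooth_fun M W (f j)"
  shows "smooth_fun M W (\<lambda>p. \<Prod>j\<in>J. f j p)"
  using assms(2) by (induction J rule: infinite_finite_induct) (simp_all add: smooth_fun_const smooth_fun_mult assms(1))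

lemma smooth_fun_inverse:
  assumes "open W" "smooth_fun M W f" "\<And>p. p \<in> W \<Longrightarrow> f p \<noteq> 0"
  shows "smooth_fun M W (\<lambda>p. inverse (f p))"
  proof (rule smooth_funI)
  fix U \<phi> k assume c: "(U, \<phi>) \<in> charts M"
  have "Ck_on (mdim M) k (\<phi> ` (U \<inter> W)) (\<lambda>x. f (inv_into U \<phi> x))"
    by (rule smooth_funD[OF assms(2) c])
  then show "Ck_on (mdim M) k (\<phi> ` (U \<inter> W)) (\<lambda>x. inverse (f (inv_into U \<phi> x)))"
    by (rule Ck_on_inverse[OF chart_open[OF c assms(1)], rotated])
      (use assms(3) chart_props(2)[OF c] in \<open>auto simp: inv_into_f_f\<close>)
qed

lemma smooth_fun_divide:
  assumes "open W" "smooth_fun M W f" "smooth_fun M W g" "\<And>p. p \<in> W \<Longrightarrow> g p \<noteq> 0"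
  shows "smooth_fun M W (\<lambda>p. f p / g p)"
  using smooth_fun_mult[OF assms(1,2) smooth_fun_inverse[OF assms(1,3,4)]] by (simp add: divide_inverse)

lemma smooth_fun_flat:
  assumes "open W" "smooth_fun M W f"
  shows "smooth_fun M W (\<lambda>p. flat P (f p))"
proof -
  define H where "H m = flat ((flat_step ^^ m) P)" for m
  have H: "(H m has_real_derivative H (Suc m) x) (at x)" for m x
    unfolding H_def using flat_deriv by (simp add: flat_step_def)
  have "flat P = H 0" by (simp add: H_def)
  then show ?thesis
  proof (intro smooth_funI)
    fix U \<phi> k assume c: "(U, \<phi>) \<in> charts M"
    have "Ck_on (mdim M) k (\<phi> ` (U \<inter> W)) (\<lambda>x. f (inv_into U \<phi> x))"
      by (rule smooth_funD[OF assms(2) c])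
    then show "Ck_on (mdim M) k (\<phi> ` (U \<inter> W)) (\<lambda>x. flat P (f (inv_into U \<phi> x)))"
      unfolding \<open>flat P = H 0\<close> by (rule Ck_on_compose[where H = H, OF chart_open[OF c assms(1)] H])
  qed
qed

text \<open>The chart carries an open neighbourhood in the manifold to the trace of an open set
  \<open>T\<close> of sequences, and its injectivity turns membership in \<open>T\<close> back into
  membership in the neighbourhood. Then \<open>Ck_on_local\<close> applies.\<close>

lemma smooth_fun_local:
  assumes "\<And>p. p \<in> W \<Longrightarrow> \<exists>W'. open W' \<and> p \<in> W' \<and> smooth_fun M (W \<inter> W') f"
  shows "smooth_fun M W f"
  proof (rule smooth_funI)
  fix U \<phi> k assume c: "(U, \<phi>) \<in> charts M"
  show "Ck_on (mdim M) k (\<phi> ` (U \<inter> W)) (\<lambda>x. f (inv_into U \<phi> x))"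
  proof (rule Ck_on_local)
    fix x assume "x \<in> \<phi> ` (U \<inter> W)"
    then obtain p where p: "p \<in> U" "p \<in> W" "x = \<phi> p" by auto
    then obtain W' where W': "open W'" "p \<in> W'" "smooth_fun M (W \<inter> W') f" using assms by blast
    have "openin (Euclidean_space (mdim M)) (\<phi> ` (U \<inter> W'))" using chart_open[OF c W'(1)] .
    then obtain T where T: "open T" "\<phi> ` (U \<inter> W') = T \<inter> {x. \<forall>i\<ge>mdim M. x i = 0}"
      by (auto simp: Euclidean_space_def openin_subtopology euclidean_product_topology)
    have inE: "\<phi> ` U \<subseteq> {x. \<forall>i\<ge>mdim M. x i = 0}"
      using openin_subset[OF chart_props(5)[OF c]] by (simp add: topspace_Euclidean_space)
    have "\<phi> ` (U \<inter> W) \<inter> T \<subseteq> \<phi> ` (U \<inter> (W \<inter> W'))"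
    proof
      fix y assume "y \<in> \<phi> ` (U \<inter> W) \<inter> T"
      then obtain q where q: "q \<in> U" "q \<in> W" "y = \<phi> q" "y \<in> T" by auto
      then have "y \<in> \<phi> ` (U \<inter> W')" using inE T(2) by auto
      then have "q \<in> W'" using q chart_props(2)[OF c] by (auto dest: inj_onD)
      then show "y \<in> \<phi> ` (U \<inter> (W \<inter> W'))" using q by auto
    qed
    moreover have "Ck_on (mdim M) k (\<phi> ` (U \<inter> (W \<inter> W'))) (\<lambda>x. f (inv_into U \<phi> x))"
      by (rule smooth_funD[OF W'(3) c])
    ultimately have "Ck_on (mdim M) k (\<phi> ` (U \<inter> W) \<inter> T) (\<lambda>x. f (inv_into U \<phi> x))"
      by (rule Ck_on_subset[rotated])
    moreover have "x \<in> T" using p W' T(2) by auto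
    ultimately show "\<exists>T. open T \<and> x \<in> T \<and> Ck_on (mdim M) k (\<phi> ` (U \<inter> W) \<inter> T) (\<lambda>x. f (inv_into U \<phi> x))"
      using T(1) by blast
  qed
qed

text \<open>Needed to know that the sets on which a smooth function is nonzero, or exceeds a
  constant, are open.\<close>

lemma smooth_fun_continuous:
  assumes "open W" "smooth_fun M W f" shows "continuous_on W f"
  unfolding continuous_on_eq_continuous_at[OF assms(1)]
proof
  fix p assume p: "p \<in> W"
  obtain U \<phi> where c: "(U, \<phi>) \<in> charts M" "p \<in> U" by (rule chart_ex)
  have "Ck_on (mdim M) 0 (\<phi> ` (U \<inter> W)) (\<lambda>x. f (inv_into U \<phi> x))"
    by (rule smooth_funD[OF assms(2) c(1)])
  then have "continuous_on (\<phi> ` (U \<inter> W)) (\<lambda>x. f (inv_into U \<phi> x))" by simp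
  moreover have "continuous_on (U \<inter> W) \<phi>"
    by (rule continuous_on_subset[OF chart_props(3)[OF c(1)]]) simp
  ultimately have "continuous_on (U \<inter> W) (\<lambda>q. f (inv_into U \<phi> (\<phi> q)))"
    by (rule continuous_on_compose2) simp
  then have "continuous_on (U \<inter> W) f"
    by (rule continuous_on_eq) (simp add: inv_into_f_f[OF chart_props(2)[OF c(1)]])
  then show "continuous (at p) f"
    using continuous_on_eq_continuous_at[OF open_Int[OF chart_props(1)[OF c(1)] assms(1)]] c(2) p by auto
qed

lemma smooth_fun_chart:
  assumes "(U, \<phi>) \<in> charts M" "i < mdim M"
  shows "smooth_fun M U (\<lambda>q. \<phi> q i)"
proof (intro smooth_funI)
  fix V \<psi> k assume c: "(V, \<psi>) \<in> charts M"
  have "\<forall>(U, \<phi>) \<in> charts M. \<forall>(V, \<psi>) \<in> charts M. \<forall>i < mdim M.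
        smooth_on (mdim M) (\<phi> ` (U \<inter> V)) (\<lambda>x. \<psi> (inv_into U \<phi> x) i)"
    using mfd unfolding smooth_manifold_def by blast
  from bspec[OF this c] have "\<forall>(U, \<phi>) \<in> charts M. \<forall>i < mdim M.
        smooth_on (mdim M) (\<psi> ` (V \<inter> U)) (\<lambda>x. \<phi> (inv_into V \<psi> x) i)" by simp
  from bspec[OF this assms(1)] show "Ck_on (mdim M) k (\<psi> ` (V \<inter> U)) (\<lambda>x. \<phi> (inv_into V \<psi> x) i)"
    using assms(2) by (simp add: smooth_on_def)
qed

end


section \<open>Bump functions\<close>

lemma openin_Euclidean_space_box:
  assumes V: "openin (Euclidean_space n) V" "x \<in> V"
  obtains \<delta> where "\<delta> > 0" "\<forall>y. (\<forall>i<n. \<bar>y i - x i\<bar> \<le> \<delta>) \<and> (\<forall>i\<ge>n. y i = 0) \<longrightarrow> y \<in> V"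
proof -
  obtain T where T: "open T" "V = T \<inter> {x. \<forall>i\<ge>n. x i = 0}"
    using V(1) by (auto simp: Euclidean_space_def openin_subtopology euclidean_product_topology)
  have "openin (product_topology (\<lambda>i. euclidean) UNIV) T"
    using T(1) by (simp add: open_fun_def)
  from product_topology_open_contains_basis[OF this, of x] V(2) T(2)
  obtain X where X: "x \<in> (\<Pi>\<^sub>E i\<in>UNIV. X i)" "\<And>i. open (X i)" "(\<Pi>\<^sub>E i\<in>UNIV. X i) \<subseteq> T"
    by auto
  have "\<exists>e>0. \<forall>s. \<bar>s - x i\<bar> \<le> e \<longrightarrow> s \<in> X i" for i
  proof -
    have "x i \<in> X i" using X(1) by auto
    then obtain e where "e > 0" "cball (x i) e \<subseteq> X i" using X(2) open_contains_cball by blast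
    then show ?thesis by (intro exI[of _ e]) (auto simp: dist_real_def abs_minus_commute subset_iff)
  qed
  then obtain e where e: "\<And>i. e i > 0" "\<And>i s. \<bar>s - x i\<bar> \<le> e i \<Longrightarrow> s \<in> X i" by metis
  \<comment> \<open>Only the finitely many coordinates below \<open>n\<close> can vary; the others
    are fixed to 0. The extra 1 keeps the minimum defined when \<open>n = 0\<close>.\<close>
  define \<delta> where "\<delta> = Min (insert 1 (e ` {..<n}))"
  have pos: "\<delta> > 0" unfolding \<delta>_def using e(1) by (subst Min_gr_iff) auto
  have le: "\<delta> \<le> e i" if "i < n" for i unfolding \<delta>_def using that by (intro Min_le) auto
  show thesis
  proof (rule that[OF pos], intro allI impI)
    fix y assume "(\<forall>i<n. \<bar>y i - x i\<bar> \<le> \<delta>) \<and> (\<forall>i\<ge>n. y i = 0)"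
    then have y: "\<And>i. i < n \<Longrightarrow> \<bar>y i - x i\<bar> \<le> \<delta>" "\<And>i. i \<ge> n \<Longrightarrow> y i = 0" by auto
    have "y i \<in> X i" for i
    proof (cases "i < n")
      case True
      then show ?thesis using e(2)[of "y i" i] y(1)[of i] le[of i] by simp
    next
      case False
      then have "y i = x i" using y(2)[of i] V(2) T(2) by auto
      then show ?thesis using e(1)[of i] e(2)[of "y i" i] by simp
    qed
    then have "y \<in> T" using X(3) by auto
    then show "y \<in> V" using T(2) y(2) by auto
  qed
qed

text \<open>Tychonoff's theorem. Compactness in the space of all sequences makes the preimage of a
  box under a chart compact, hence closed in the Hausdorff manifold.\<close>

lemma compact_box_sequences:
  fixes K :: "nat \<Rightarrow> real set"
  assumes "\<And>i. compact (K i)" shows "compact (\<Pi>\<^sub>E i\<in>UNIV. K i)"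
proof -
  have "compactin (product_topology (\<lambda>i. euclidean) UNIV) (PiE UNIV K)"
    using assms by (simp add: compactin_PiE)
  then show ?thesis by (simp add: euclidean_product_topology)
qed

context smooth_mfd
begin

lemma CinfD: "f \<in> Cinf M \<Longrightarrow> open W \<Longrightarrow> smooth_fun M W f"
  unfolding Cinf_def using smooth_fun_subset[of UNIV f W] by simp

lemma CinfI: "smooth_fun M UNIV f \<Longrightarrow> f \<in> Cinf M"
  by (simp add: Cinf_def)

lemma Cinf_const: "(\<lambda>_. c) \<in> Cinf M"
  by (simp add: Cinf_def smooth_fun_const)
lemma Cinf_mult: "f \<in> Cinf M \<Longrightarrow> g \<in> Cinf M \<Longrightarrow> (\<lambda>p. f p * g p) \<in> Cinf M"
  by (simp add: Cinf_def smooth_fun_mult)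

text \<open>\<open>U\<close> and the complement of \<open>K\<close> form an open cover, and on the
  complement the function is 0.\<close>

lemma Cinf_extend_by_zero:
  assumes U: "open U" "smooth_fun M U f" and K: "closed K" "K \<subseteq> U" "\<And>p. p \<notin> K \<Longrightarrow> f p = 0"
  shows "f \<in> Cinf M"
proof (rule CinfI, rule smooth_fun_local)
  fix p :: 'm
  have K': "open (- K)" using K(1) by (simp add: open_Compl)
  have "smooth_fun M (- K) f"
    by (rule smooth_fun_cong[OF K' smooth_fun_const[OF K', of 0]]) (simp add: K(3))
  then show "\<exists>W'. open W' \<and> p \<in> W' \<and> smooth_fun M (UNIV \<inter> W') f"
    using U K K' by (cases "p \<in> K") auto
qed

text \<open>A product of one-dimensional flat bumps in chart coordinates is positive at
  \<open>p\<close> and vanishes outside a compact box. Composing it with a flat step gives a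
  function that equals 1 on the open set where the product exceeds half its value at
  \<open>p\<close>.\<close>

lemma bump_ex:
  assumes "open W" "p \<in> W"
  obtains ch V K where "ch \<in> Cinf M" "open V" "p \<in> V" "\<forall>q\<in>V. ch q = 1" "V \<subseteq> W"
    "closed K" "K \<subseteq> W" "\<forall>q. q \<notin> K \<longrightarrow> ch q = 0"
proof -
  obtain U \<phi> where c: "(U, \<phi>) \<in> charts M" "p \<in> U" by (rule chart_ex)
  let ?n = "mdim M"
  have opn: "openin (Euclidean_space ?n) (\<phi> ` (U \<inter> W))" by (rule chart_open[OF c(1) assms(1)])
  have "\<phi> p \<in> \<phi> ` (U \<inter> W)" using c(2) assms(2) by simp
  with opn obtain \<delta> where \<delta>: "\<delta> > 0"
    "\<forall>y. (\<forall>i<?n. \<bar>y i - \<phi> p i\<bar> \<le> \<delta>) \<and> (\<forall>i\<ge>?n. y i = 0) \<longrightarrow> y \<in> \<phi> ` (U \<inter> W)"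
    by (rule openin_Euclidean_space_box)
  have inE: "\<phi> q i = 0" if "q \<in> U" "i \<ge> ?n" for q i
    using openin_subset[OF chart_props(5)[OF c(1)]] that by (auto simp: topspace_Euclidean_space)
  define B where "B = (\<Pi>\<^sub>E i\<in>UNIV. if i < ?n then {\<phi> p i - \<delta>..\<phi> p i + \<delta>} else {0})"
  have BE: "y \<in> B \<longleftrightarrow> (\<forall>i<?n. \<bar>y i - \<phi> p i\<bar> \<le> \<delta>) \<and> (\<forall>i\<ge>?n. y i = 0)" for y
  proof -
    have "y \<in> B \<longleftrightarrow> (\<forall>i. y i \<in> (if i < ?n then {\<phi> p i - \<delta>..\<phi> p i + \<delta>} else {0}))"
      unfolding B_def by (simp add: PiE_UNIV_domain Pi_iff)
    moreover have "y i \<in> (if i < ?n then {\<phi> p i - \<delta>..\<phi> p i + \<delta>} else {0}) \<longleftrightarrow>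
        (i < ?n \<longrightarrow> \<bar>y i - \<phi> p i\<bar> \<le> \<delta>) \<and> (i \<ge> ?n \<longrightarrow> y i = 0)" for i
      by (cases "i < ?n") auto
    ultimately show ?thesis by meson
  qed
  have Bsub: "B \<subseteq> \<phi> ` (U \<inter> W)" using \<delta>(2) BE by blast
  have cB: "compact B" unfolding B_def by (rule compact_box_sequences) auto
  define K where "K = inv_into U \<phi> ` B"
  have "compact K" unfolding K_def
  proof (rule compact_continuous_image[OF _ cB])
    show "continuous_on B (inv_into U \<phi>)"
      by (rule continuous_on_subset[OF chart_props(4)[OF c(1)]]) (use Bsub in auto)
  qed
  then have clK: "closed K" by (rule compact_imp_closed)
  have inv: "inv_into U \<phi> (\<phi> q) = q" if "q \<in> U" for q
    using inv_into_f_f[OF chart_props(2)[OF c(1)] that] .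
  have KE: "q \<in> K \<longleftrightarrow> q \<in> U \<and> \<phi> q \<in> B" for q
  proof
    assume "q \<in> K"
    then obtain y where y: "y \<in> B" "q = inv_into U \<phi> y" by (auto simp: K_def)
    then obtain q' where "q' \<in> U" "y = \<phi> q'" using Bsub by auto
    then show "q \<in> U \<and> \<phi> q \<in> B" using y inv by simp
  next
    assume "q \<in> U \<and> \<phi> q \<in> B"
    then show "q \<in> K" unfolding K_def using inv[of q] by (metis imageI)
  qed
  have KW: "K \<subseteq> U \<inter> W"
  proof
    fix q assume "q \<in> K"
    then have q: "q \<in> U" "\<phi> q \<in> \<phi> ` (U \<inter> W)" using KE Bsub by auto
    then obtain q' where q': "q' \<in> U" "q' \<in> W" "\<phi> q = \<phi> q'" by auto
    then have "q = q'" using inj_onD[OF chart_props(2)[OF c(1)]] q(1) by blast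
    then show "q \<in> U \<inter> W" using q' by blast
  qed
  \<comment> \<open>Each factor vanishes once the coordinate is \<delta> or more away from that of
    \<open>p\<close>, so the product vanishes outside the box; inside the chart it is smooth because
    \<open>flat 1\<close> is.\<close>
  define b where "b q = (if q \<in> U then \<Prod>i<?n. flat 1 (\<delta>\<^sup>2 - (\<phi> q i - \<phi> p i)\<^sup>2) else 0)" for q
  have U: "open U" using chart_props(1)[OF c(1)] .
  have "smooth_fun M U (\<lambda>q. \<Prod>i<?n. flat 1 (\<delta>\<^sup>2 - (\<phi> q i - \<phi> p i)\<^sup>2))"
    unfolding power2_eq_square
    by (intro smooth_fun_prod smooth_fun_flat smooth_fun_diff smooth_fun_mult smooth_fun_const
        smooth_fun_chart[OF c(1)] U) auto
  then have bU: "smooth_fun M U b"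
    by (rule smooth_fun_cong[OF U]) (simp add: b_def)
  have b0: "b q = 0" if "q \<notin> K" for q
  proof (cases "q \<in> U")
    case True
    then obtain i where i: "i < ?n" "\<not> \<bar>\<phi> q i - \<phi> p i\<bar> \<le> \<delta>"
      using \<open>q \<notin> K\<close> KE BE inE by blast
    then have "\<delta> < \<bar>\<phi> q i - \<phi> p i\<bar>" by simp
    then have "\<delta>\<^sup>2 < \<bar>\<phi> q i - \<phi> p i\<bar>\<^sup>2" by (rule power_strict_mono) (use \<delta>(1) in auto)
    then have "\<delta>\<^sup>2 - (\<phi> q i - \<phi> p i)\<^sup>2 \<le> 0" by simp
    then have "flat 1 (\<delta>\<^sup>2 - (\<phi> q i - \<phi> p i)\<^sup>2) = 0" by (simp add: flat_def)
    then show ?thesis unfolding b_def using i(1) by (auto intro: prod_zero)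
  qed (simp add: b_def)
  have KU: "K \<subseteq> U" using KW by auto
  have bC: "b \<in> Cinf M"
    by (rule Cinf_extend_by_zero[OF U bU clK KU b0])
  have fpos: "flat 1 x > 0" if "x > 0" for x using that by (simp add: flat_def)
  have bp: "b p > 0" unfolding b_def using c(2) \<delta>(1) by (simp add: prod_pos fpos)
  define k where "k = b p / 2"
  have k: "k > 0" using bp by (simp add: k_def)
  \<comment> \<open>\<open>flat 1\<close> vanishes on nonpositive arguments, so \<open>ch\<close> is
    1 where \<open>b\<close> is at least \<open>k\<close>; where \<open>b\<close> is 0 the factor
    \<open>inverse (flat 1 k)\<close> normalises the difference to 0.\<close>
  define ch where "ch q = 1 - inverse (flat 1 k) * flat 1 (k - b q)" for q
  have "ch \<in> Cinf M" unfolding ch_def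
    by (intro CinfI smooth_fun_diff smooth_fun_mult smooth_fun_flat smooth_fun_const CinfD[OF bC] open_UNIV)
  moreover have "ch q = 0" if "q \<notin> K" for q
    unfolding ch_def using b0[OF that] fpos[OF k] by simp
  moreover have "ch q = 1" if "b q > k" for q
    unfolding ch_def using that by (simp add: flat_def)
  moreover have "open {q. b q > k}"
  proof -
    have "continuous_on UNIV b" by (rule smooth_fun_continuous[OF open_UNIV CinfD[OF bC open_UNIV]])
    then show ?thesis using open_Collect_less[OF continuous_on_const, of b k] by simp
  qed
  moreover have "p \<in> {q. b q > k}" using bp by (simp add: k_def)
  moreover have "{q. b q > k} \<subseteq> W"
  proof
    fix q assume "q \<in> {q. b q > k}"
    then have "q \<in> K" using b0[of q] k by (cases "q \<in> K") auto
    then show "q \<in> W" using KW by auto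
  qed
  moreover have "K \<subseteq> W" using KW by auto
  ultimately show thesis using that[of ch "{q. b q > k}" K, OF _ _ _ _ _ clK] by auto
qed

end


section \<open>Vector bundles\<close>

lemma local_trivD:
  assumes "local_triv E U k \<Phi>"
  shows "open U"
    and "p \<in> U \<Longrightarrow> bij_betw (\<Phi> p) (fib E p) (topspace (Euclidean_space k))"
    and "p \<in> U \<Longrightarrow> u \<in> fib E p \<Longrightarrow> v \<in> fib E p \<Longrightarrow> \<Phi> p (vadd E p u v) i = \<Phi> p u i + \<Phi> p v i"
    and "p \<in> U \<Longrightarrow> u \<in> fib E p \<Longrightarrow> \<Phi> p (vscale E p c u) i = c * \<Phi> p u i"
  using assms unfolding local_triv_def by auto

lemma local_trivI:
  assumes "open U"
    and "\<And>p. p \<in> U \<Longrightarrow> bij_betw (\<Phi> p) (fib E p) (topspace (Euclidean_space k))"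
    and "\<And>p u v i. p \<in> U \<Longrightarrow> u \<in> fib E p \<Longrightarrow> v \<in> fib E p \<Longrightarrow> \<Phi> p (vadd E p u v) i = \<Phi> p u i + \<Phi> p v i"
    and "\<And>p u c i. p \<in> U \<Longrightarrow> u \<in> fib E p \<Longrightarrow> \<Phi> p (vscale E p c u) i = c * \<Phi> p u i"
  shows "local_triv E U k \<Phi>"
  using assms unfolding local_triv_def by auto

lemma bij_betw_EuclideanI:
  assumes "\<And>u i. u \<in> A \<Longrightarrow> i \<ge> k \<Longrightarrow> f u i = 0"
    and "\<And>u v. u \<in> A \<Longrightarrow> v \<in> A \<Longrightarrow> (\<And>i. i < k \<Longrightarrow> f u i = f v i) \<Longrightarrow> u = v"
    and "\<And>x. (\<And>i. i \<ge> k \<Longrightarrow> x i = 0) \<Longrightarrow> \<exists>u\<in>A. \<forall>i<k. f u i = x i"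
  shows "bij_betw f A (topspace (Euclidean_space k))"
proof -
  have "inj_on f A" by (rule inj_onI) (metis assms(2))
  moreover have "f ` A = topspace (Euclidean_space k)"
  proof
    show "f ` A \<subseteq> topspace (Euclidean_space k)" using assms(1) by (auto simp: topspace_Euclidean_space)
    show "topspace (Euclidean_space k) \<subseteq> f ` A"
    proof
      fix x assume "x \<in> topspace (Euclidean_space k)"
      then have x: "x i = 0" if "i \<ge> k" for i using that by (simp add: topspace_Euclidean_space)
      then obtain u where u: "u \<in> A" "\<forall>i<k. f u i = x i" using assms(3) by blast
      have "f u = x"
      proof
        fix i show "f u i = x i" using u assms(1)[OF u(1), of i] x[of i] by (cases "i < k") auto
      qed
      then show "x \<in> f ` A" using u(1) by blast
    qed
  qed
  ultimately show ?thesis by (simp add: bij_betw_def)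
qed

lemma local_triv_ge:
  assumes "local_triv E U k \<Phi>" "p \<in> U" "u \<in> fib E p" "i \<ge> k"
  shows "\<Phi> p u i = 0"
proof -
  have "\<Phi> p u \<in> topspace (Euclidean_space k)"
    using bij_betwE[OF local_trivD(2)[OF assms(1,2)]] assms(3) by blast
  then show ?thesis using assms(4) by (simp add: topspace_Euclidean_space)
qed

lemma local_triv_inj:
  assumes "local_triv E U k \<Phi>" "p \<in> U" "u \<in> fib E p" "v \<in> fib E p" "\<And>i. i < k \<Longrightarrow> \<Phi> p u i = \<Phi> p v i"
  shows "u = v"
proof -
  have "\<Phi> p u = \<Phi> p v"
  proof
    fix i show "\<Phi> p u i = \<Phi> p v i"
      using assms(5)[of i] local_triv_ge[OF assms(1,2,3), of i] local_triv_ge[OF assms(1,2,4), of i]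
      by (cases "i < k") auto
  qed
  then show ?thesis
    using bij_betw_imp_inj_on[OF local_trivD(2)[OF assms(1,2)]] assms(3,4) by (meson inj_onD)
qed

definition vec_of :: "('m, 'e, 'z) vbundle_scheme \<Rightarrow> ('m \<Rightarrow> 'e \<Rightarrow> nat \<Rightarrow> real) \<Rightarrow> 'm \<Rightarrow> (nat \<Rightarrow> real) \<Rightarrow> 'e" where
  "vec_of E \<Phi> p x = inv_into (fib E p) (\<Phi> p) x"

lemma vec_of:
  assumes "local_triv E U k \<Phi>" "p \<in> U" "\<And>i. i \<ge> k \<Longrightarrow> x i = 0"
  shows "vec_of E \<Phi> p x \<in> fib E p" "\<Phi> p (vec_of E \<Phi> p x) i = x i"
proof -
  have "x \<in> \<Phi> p ` fib E p"
    using bij_betw_imp_surj_on[OF local_trivD(2)[OF assms(1,2)]] assms(3) by (simp add: topspace_Euclidean_space)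
  then show "vec_of E \<Phi> p x \<in> fib E p" "\<Phi> p (vec_of E \<Phi> p x) i = x i"
    unfolding vec_of_def by (simp_all add: inv_into_into f_inv_into_f)
qed

lemma frame_props:
  assumes "local_triv E U k \<Phi>" "p \<in> U" "j < k"
  shows "frame E \<Phi> j p \<in> fib E p" "\<Phi> p (frame E \<Phi> j p) i = (if i = j then 1 else 0)"
proof -
  have eq: "frame E \<Phi> j p = vec_of E \<Phi> p (\<lambda>i. if i = j then 1 else 0)"
    by (simp add: frame_def vec_of_def)
  show "frame E \<Phi> j p \<in> fib E p" "\<Phi> p (frame E \<Phi> j p) i = (if i = j then 1 else 0)"
    unfolding eq by (rule vec_of[OF assms(1,2)]; use assms(3) in auto)+
qed

lemma vector_bundleD:
  assumes "vector_bundle M E"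
  shows "vzero E p \<in> fib E p"
    and "v \<in> fib E p \<Longrightarrow> vadd E p (vzero E p) v = v"
    and "u \<in> fib E p \<Longrightarrow> v \<in> fib E p \<Longrightarrow> vadd E p u v \<in> fib E p"
    and "v \<in> fib E p \<Longrightarrow> vscale E p c v \<in> fib E p"
    and "(U, k, \<Phi>) \<in> trivs E \<Longrightarrow> local_triv E U k \<Phi>"
    and "(U, k, \<Phi>) \<in> trivs E \<Longrightarrow> (V, l, \<Psi>) \<in> trivs E \<Longrightarrow> smooth_transition M E U k \<Phi> V l \<Psi>"
    and "\<exists>U k \<Phi>. (U, k, \<Phi>) \<in> trivs E \<and> p \<in> U"
proof -
  show "(U, k, \<Phi>) \<in> trivs E \<Longrightarrow> (V, l, \<Psi>) \<in> trivs E \<Longrightarrow> smooth_transition M E U k \<Phi> V l \<Psi>"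
    "(U, k, \<Phi>) \<in> trivs E \<Longrightarrow> local_triv E U k \<Phi>"
    using assms unfolding vector_bundle_def by fast+
  have "p \<in> (\<Union>(U, k, \<Phi>) \<in> trivs E. U)" using assms unfolding vector_bundle_def by simp
  then show "\<exists>U k \<Phi>. (U, k, \<Phi>) \<in> trivs E \<and> p \<in> U" by auto
qed (use assms in \<open>simp_all add: vector_bundle_def\<close>)

lemma vector_bundleI:
  assumes "\<And>p. vzero E p \<in> fib E p"
    and "\<And>p v. v \<in> fib E p \<Longrightarrow> vadd E p (vzero E p) v = v"
    and "\<And>p u v. u \<in> fib E p \<Longrightarrow> v \<in> fib E p \<Longrightarrow> vadd E p u v \<in> fib E p"
    and "\<And>p v c. v \<in> fib E p \<Longrightarrow> vscale E p c v \<in> fib E p"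
    and "\<And>U k \<Phi>. (U, k, \<Phi>) \<in> trivs E \<Longrightarrow> local_triv E U k \<Phi>"
    and "\<And>U k \<Phi> V l \<Psi>. (U, k, \<Phi>) \<in> trivs E \<Longrightarrow> (V, l, \<Psi>) \<in> trivs E \<Longrightarrow> smooth_transition M E U k \<Phi> V l \<Psi>"
    and "\<And>p. \<exists>U k \<Phi>. (U, k, \<Phi>) \<in> trivs E \<and> p \<in> U"
  shows "vector_bundle M E"
  unfolding vector_bundle_def
proof (intro conjI allI ballI)
  show "(\<Union>(U, k, \<Phi>) \<in> trivs E. U) = UNIV"
  proof (intro equalityI subset_UNIV subsetI)
    fix p obtain U k \<Phi> where "(U, k, \<Phi>) \<in> trivs E" "p \<in> U" using assms(7) by blast
    then show "p \<in> (\<Union>(U, k, \<Phi>) \<in> trivs E. U)" by (intro UN_I[of "(U, k, \<Phi>)"]) auto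
  qed
  show "case x of (U, k, \<Phi>) \<Rightarrow> local_triv E U k \<Phi>" if "x \<in> trivs E" for x
    using that assms(5) by (cases x) auto
  show "case x of (U, k, \<Phi>) \<Rightarrow> \<forall>(V, l, \<Psi>)\<in>trivs E. smooth_transition M E U k \<Phi> V l \<Psi>" if "x \<in> trivs E" for x
    using that assms(6) by (cases x) auto
qed (use assms in simp_all)

text \<open>Coordinates at \<open>p\<close> in an arbitrarily chosen trivialisation, with no
  smoothness in \<open>p\<close>. By \<open>fib_eqI\<close> an equation in a fibre holds once it
  holds in these coordinates, which replaces the vector space axioms by real arithmetic.\<close>

definition crd :: "('m, 'e, 'z) vbundle_scheme \<Rightarrow> 'm \<Rightarrow> 'e \<Rightarrow> nat \<Rightarrow> real" where
  "crd E p = (SOME f. \<exists>U k \<Phi>. (U, k, \<Phi>) \<in> trivs E \<and> p \<in> U \<and> f = \<Phi> p)"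

lemma linear_onD:
  assumes "linear_on E F p h"
  shows "u \<in> fib E p \<Longrightarrow> h u \<in> fib F p"
    "u \<in> fib E p \<Longrightarrow> v \<in> fib E p \<Longrightarrow> h (vadd E p u v) = vadd F p (h u) (h v)"
    "u \<in> fib E p \<Longrightarrow> h (vscale E p c u) = vscale F p c (h u)"
  using assms unfolding linear_on_def by auto

lemma linear_onI:
  assumes "\<And>u. u \<in> fib E p \<Longrightarrow> h u \<in> fib F p"
    "\<And>u v. u \<in> fib E p \<Longrightarrow> v \<in> fib E p \<Longrightarrow> h (vadd E p u v) = vadd F p (h u) (h v)"
    "\<And>u c. u \<in> fib E p \<Longrightarrow> h (vscale E p c u) = vscale F p c (h u)"
  shows "linear_on E F p h"
  using assms unfolding linear_on_def by auto

section \<open>Linear algebra in the fibres\<close>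

context smooth_mfd
begin

lemma crd_ex:
  assumes "vector_bundle M E"
  obtains U k \<Phi> where "(U, k, \<Phi>) \<in> trivs E" "p \<in> U" "local_triv E U k \<Phi>" "crd E p = \<Phi> p"
proof -
  have "\<exists>f U k \<Phi>. (U, k, \<Phi>) \<in> trivs E \<and> p \<in> U \<and> f = \<Phi> p" using vector_bundleD(7)[OF assms] by metis
  from someI_ex[OF this] obtain U k \<Phi> where *: "(U, k, \<Phi>) \<in> trivs E" "p \<in> U" "crd E p = \<Phi> p"
    unfolding crd_def by blast
  show thesis by (rule that[OF *(1,2) vector_bundleD(5)[OF assms *(1)] *(3)])
qed

lemma fib_eqI:
  assumes E: "vector_bundle M E" and "u \<in> fib E p" "v \<in> fib E p" "\<And>i. crd E p u i = crd E p v i"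
  shows "u = v"
proof -
  obtain U k \<Phi> where t: "p \<in> U" "local_triv E U k \<Phi>" "crd E p = \<Phi> p"
    by (rule crd_ex[OF E])
  show ?thesis by (rule local_triv_inj[OF t(2,1) assms(2,3)]) (use assms(4) t(3) in simp)
qed

lemma crd_add:
  assumes E: "vector_bundle M E" and "u \<in> fib E p" "v \<in> fib E p"
  shows "crd E p (vadd E p u v) i = crd E p u i + crd E p v i"
proof -
  obtain U k \<Phi> where t: "p \<in> U" "local_triv E U k \<Phi>" "crd E p = \<Phi> p"
    by (rule crd_ex[OF E])
  show ?thesis unfolding t(3) by (rule local_trivD(3)[OF t(2,1) assms(2,3)])
qed

lemma crd_scale:
  assumes E: "vector_bundle M E" and "u \<in> fib E p"
  shows "crd E p (vscale E p c u) i = c * crd E p u i"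
proof -
  obtain U k \<Phi> where t: "p \<in> U" "local_triv E U k \<Phi>" "crd E p = \<Phi> p"
    by (rule crd_ex[OF E])
  show ?thesis unfolding t(3) by (rule local_trivD(4)[OF t(2,1) assms(2)])
qed

lemma crd_zero:
  assumes E: "vector_bundle M E" shows "crd E p (vzero E p) i = 0"
  using crd_add[OF E vector_bundleD(1)[OF E] vector_bundleD(1)[OF E], of p i]
    vector_bundleD(2)[OF E vector_bundleD(1)[OF E], of p] by simp

lemma vminus_in: "vector_bundle M E \<Longrightarrow> u \<in> fib E p \<Longrightarrow> v \<in> fib E p \<Longrightarrow> vminus E p u v \<in> fib E p"
  unfolding vminus_def by (intro vector_bundleD)

lemma crd_minus:
  assumes E: "vector_bundle M E" and "u \<in> fib E p" "v \<in> fib E p"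
  shows "crd E p (vminus E p u v) i = crd E p u i - crd E p v i"
  unfolding vminus_def by (simp add: crd_add crd_scale vector_bundleD(4)[OF E] assms)

text \<open>These two rule sets carry nearly every fibre identity: \<open>crds\<close> evaluates
  coordinates of sums, multiples and differences, \<open>fibs\<close> discharges the membership
  conditions.\<close>

lemmas crds = crd_add crd_scale crd_zero crd_minus
lemmas fibs = vector_bundleD(1,3,4)[where M = M] vminus_in

lemma vscale_one:
  assumes E: "vector_bundle M E" and u: "u \<in> fib E p" shows "vscale E p 1 u = u"
  by (rule fib_eqI[OF E, where p = p]) (simp_all add: fibs crds E u)
lemma vscale_zero:
  assumes E: "vector_bundle M E" and u: "u \<in> fib E p" shows "vscale E p 0 u = vzero E p"
  by (rule fib_eqI[OF E, where p = p]) (simp_all add: fibs crds E u)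
lemma vscale_vzero:
  assumes E: "vector_bundle M E" shows "vscale E p c (vzero E p) = vzero E p"
  by (rule fib_eqI[OF E, where p = p]) (simp_all add: fibs crds E)

lemma linear_on_zero:
  assumes "vector_bundle M E" "vector_bundle M F" "linear_on E F p h"
  shows "h (vzero E p) = vzero F p"
  using linear_onD(3)[OF assms(3), of "vzero E p" 0] linear_onD(1)[OF assms(3), of "vzero E p"]
  by (simp add: fibs assms(1,2) vscale_zero)

lemma linear_on_minus:
  assumes "vector_bundle M E" "linear_on E F p h" "u \<in> fib E p" "v \<in> fib E p"
  shows "h (vminus E p u v) = vminus F p (h u) (h v)"
  unfolding vminus_def using assms by (simp add: linear_onD fibs)

lemma triv_zero:
  assumes E: "vector_bundle M E" and t: "local_triv E U k \<Phi>" "p \<in> U"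
  shows "\<Phi> p (vzero E p) i = 0"
  using local_trivD(4)[OF t vector_bundleD(1)[OF E], of 0 i] by (simp add: vscale_vzero E)

lemma triv_minus:
  assumes E: "vector_bundle M E" and t: "local_triv E U k \<Phi>" "p \<in> U" and "u \<in> fib E p" "v \<in> fib E p"
  shows "\<Phi> p (vminus E p u v) i = \<Phi> p u i - \<Phi> p v i"
  unfolding vminus_def using assms by (simp add: local_trivD(3,4)[OF t] fibs)

text \<open>Induction on the number of leading coordinates that may be nonzero: subtracting the
  component along the last frame vector lowers it by one. A real-valued \<open>L\<close> covers both
  the matrix entries of a bundle map and an anchor applied to one function.\<close>

lemma triv_expand:
  fixes L :: "'e \<Rightarrow> real"
  assumes E: "vector_bundle M E" and t: "local_triv E U k \<Phi>" "p \<in> U"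
    and add: "\<And>u v. u \<in> fib E p \<Longrightarrow> v \<in> fib E p \<Longrightarrow> L (vadd E p u v) = L u + L v"
    and scale: "\<And>c u. u \<in> fib E p \<Longrightarrow> L (vscale E p c u) = c * L u"
    and v: "v \<in> fib E p"
  shows "L v = (\<Sum>j<k. \<Phi> p v j * L (frame E \<Phi> j p))"
proof -
  have "L v = (\<Sum>j<m. \<Phi> p v j * L (frame E \<Phi> j p))"
    if "m \<le> k" "v \<in> fib E p" "\<And>i. i \<ge> m \<Longrightarrow> \<Phi> p v i = 0" for m v
    using that
  proof (induction m arbitrary: v)
    case 0
    have "v = vzero E p"
      by (rule local_triv_inj[OF t]) (simp_all add: 0 fibs E triv_zero[OF E t])
    then have "vscale E p 0 v = v" by (simp add: vscale_vzero E)
    then show ?case using scale[OF 0(2), of 0] by simp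
  next
    case (Suc m)
    let ?e = "frame E \<Phi> m p" and ?c = "\<Phi> p v m"
    have m: "m < k" using Suc.prems by simp
    have e: "?e \<in> fib E p" "\<And>i. \<Phi> p ?e i = (if i = m then 1 else 0)"
      using frame_props[OF t m] by auto
    define w where "w = vminus E p v (vscale E p ?c ?e)"
    have w: "w \<in> fib E p" unfolding w_def by (simp add: fibs E Suc.prems e)
    have pw: "\<Phi> p w i = (if i = m then 0 else \<Phi> p v i)" for i
      unfolding w_def by (simp add: triv_minus[OF E t] local_trivD(4)[OF t] Suc.prems e fibs E)
    have "L w = (\<Sum>j<m. \<Phi> p w j * L (frame E \<Phi> j p))"
    proof (rule Suc.IH[OF _ w])
      show "\<Phi> p w i = 0" if "i \<ge> m" for i
        using Suc.prems(3)[of i] that pw[of i] by (cases "i = m") auto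
    qed (use m in simp)
    also have "\<dots> = (\<Sum>j<m. \<Phi> p v j * L (frame E \<Phi> j p))"
      by (rule sum.cong) (auto simp: pw)
    finally have "L w = (\<Sum>j<m. \<Phi> p v j * L (frame E \<Phi> j p))" .
    moreover have "L w = L v - ?c * L ?e"
      unfolding w_def vminus_def by (simp add: add scale fibs E Suc.prems e)
    ultimately show ?case by simp
  qed
  from this[of k v] v local_triv_ge[OF t v] show ?thesis by simp
qed

lemma triv_expand_map:
  assumes E: "vector_bundle M E" and t: "local_triv E U k \<Phi>" "p \<in> U"
    and s: "local_triv F V l \<Psi>" "p \<in> V" and h: "linear_on E F p h" and v: "v \<in> fib E p"
  shows "\<Psi> p (h v) i = (\<Sum>j<k. \<Phi> p v j * \<Psi> p (h (frame E \<Phi> j p)) i)"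
  by (rule triv_expand[OF E t _ _ v, where L = "\<lambda>v. \<Psi> p (h v) i"])
    (simp_all add: linear_onD[OF h] local_trivD(3,4)[OF s])

lemma linear_on_id: "linear_on E E p (\<lambda>u. u)"
  unfolding linear_on_def by simp

section \<open>Smooth local sections\<close>

definition lsmooth :: "('m, 'e, 'z) vbundle_scheme \<Rightarrow> 'm set \<Rightarrow> ('m \<Rightarrow> 'e) \<Rightarrow> bool" where
  "lsmooth E W s \<longleftrightarrow> (\<forall>p\<in>W. s p \<in> fib E p) \<and>
     (\<forall>(U, k, \<Phi>) \<in> trivs E. \<forall>i<k. smooth_fun M (U \<inter> W) (\<lambda>p. \<Phi> p (s p) i))"

lemma lsmoothI:
  assumes "\<And>p. p \<in> W \<Longrightarrow> s p \<in> fib E p"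
    "\<And>U k \<Phi> i. (U, k, \<Phi>) \<in> trivs E \<Longrightarrow> i < k \<Longrightarrow> smooth_fun M (U \<inter> W) (\<lambda>p. \<Phi> p (s p) i)"
  shows "lsmooth E W s"
  using assms unfolding lsmooth_def by (auto split: prod.splits)

lemma lsmoothD:
  assumes "lsmooth E W s"
  shows "p \<in> W \<Longrightarrow> s p \<in> fib E p"
    "(U, k, \<Phi>) \<in> trivs E \<Longrightarrow> i < k \<Longrightarrow> smooth_fun M (U \<inter> W) (\<lambda>p. \<Phi> p (s p) i)"
  using assms unfolding lsmooth_def by auto

lemma sections_iff: "s \<in> sections M E \<longleftrightarrow> lsmooth E UNIV s"
  unfolding sections_def lsmooth_def by simp

lemma sec_fib: "s \<in> sections M E \<Longrightarrow> s p \<in> fib E p"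
  unfolding sections_def by simp

lemma triv_smooth: "vector_bundle M E \<Longrightarrow> (U, k, \<Phi>) \<in> trivs E \<Longrightarrow> smooth_triv M E U k \<Phi>"
  unfolding smooth_triv_def using vector_bundleD(5,6) by fastforce

lemma smooth_trivD:
  assumes "smooth_triv M E U k \<Phi>"
  shows "local_triv E U k \<Phi>"
    "(V, l, \<Psi>) \<in> trivs E \<Longrightarrow> j < k \<Longrightarrow> i < l \<Longrightarrow> smooth_fun M (U \<inter> V) (\<lambda>p. \<Psi> p (frame E \<Phi> j p) i)"
    "(V, l, \<Psi>) \<in> trivs E \<Longrightarrow> j < l \<Longrightarrow> i < k \<Longrightarrow> smooth_fun M (V \<inter> U) (\<lambda>p. \<Phi> p (frame E \<Psi> j p) i)"
  using assms unfolding smooth_triv_def smooth_transition_def by fastforce+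

text \<open>Smoothness is defined through the atlas. Near each point the coordinates in another
  compatible trivialisation are combinations of atlas coordinates with smooth transition entries as
  coefficients.\<close>

lemma lsmooth_triv:
  assumes E: "vector_bundle M E" and t: "smooth_triv M E U k \<Phi>" and W: "open W" and s: "lsmooth E W s"
  shows "smooth_fun M (U \<inter> W) (\<lambda>p. \<Phi> p (s p) i)"
proof (rule smooth_fun_local)
  fix p assume p: "p \<in> U \<inter> W"
  note t' = smooth_trivD(1)[OF t]
  have U: "open U" by (rule local_trivD(1)[OF t'])
  obtain V l \<Psi> where V: "(V, l, \<Psi>) \<in> trivs E" "p \<in> V" using vector_bundleD(7)[OF E] by blast
  note V' = vector_bundleD(5)[OF E V(1)]
  have oV: "open V" by (rule local_trivD(1)[OF V'])
  have "smooth_fun M (U \<inter> W \<inter> V) (\<lambda>p. \<Phi> p (s p) i)"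
  proof (cases "i < k")
    case True
    have o: "open (U \<inter> W \<inter> V)" using U W oV by auto
    have "smooth_fun M (U \<inter> W \<inter> V) (\<lambda>p. \<Sum>j<l. \<Psi> p (s p) j * \<Phi> p (frame E \<Psi> j p) i)"
    proof (intro smooth_fun_sum smooth_fun_mult o)
      fix j assume "j \<in> {..<l}"
      then have j: "j < l" by simp
      show "smooth_fun M (U \<inter> W \<inter> V) (\<lambda>p. \<Psi> p (s p) j)"
        by (rule smooth_fun_subset[OF lsmoothD(2)[OF s V(1) j]]) auto
      show "smooth_fun M (U \<inter> W \<inter> V) (\<lambda>p. \<Phi> p (frame E \<Psi> j p) i)"
        by (rule smooth_fun_subset[OF smooth_trivD(3)[OF t V(1) j True]]) auto
    qed
    then show ?thesis
    proof (rule smooth_fun_cong[OF o])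
      fix q assume q: "q \<in> U \<inter> W \<inter> V"
      show "(\<Sum>j<l. \<Psi> q (s q) j * \<Phi> q (frame E \<Psi> j q) i) = \<Phi> q (s q) i"
        using triv_expand_map[OF E V' _ t' _ linear_on_id lsmoothD(1)[OF s], of q i] q by simp
    qed
  next
    case False
    have o: "open (U \<inter> W \<inter> V)" using U W oV by auto
    show ?thesis
      by (rule smooth_fun_cong[OF o smooth_fun_const[OF o, of 0]])
        (use local_triv_ge[OF t' _ lsmoothD(1)[OF s], of _ i] False in simp)
  qed
  then show "\<exists>W'. open W' \<and> p \<in> W' \<and> smooth_fun M (U \<inter> W \<inter> W') (\<lambda>p. \<Phi> p (s p) i)"
    using oV V(2) by blast
qed

text \<open>The converse passage: one compatible trivialisation over \<open>W\<close> decides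
  smoothness in all trivialisations of the atlas, so an adapted one can be chosen.\<close>

lemma lsmooth_trivI:
  assumes E: "vector_bundle M E" and t: "smooth_triv M E U k \<Phi>" and W: "open W" "W \<subseteq> U"
    and fib: "\<And>p. p \<in> W \<Longrightarrow> s p \<in> fib E p"
    and s: "\<And>i. i < k \<Longrightarrow> smooth_fun M W (\<lambda>p. \<Phi> p (s p) i)"
  shows "lsmooth E W s"
proof (rule lsmoothI[OF fib])
  fix V l \<Psi> i assume V: "(V, l, \<Psi>) \<in> trivs E" and i: "i < l"
  note V' = vector_bundleD(5)[OF E V]
  note t' = smooth_trivD(1)[OF t]
  have oV: "open V" by (rule local_trivD(1)[OF V'])
  have o: "open (V \<inter> W)" using W oV by auto
  have "smooth_fun M (V \<inter> W) (\<lambda>p. \<Sum>j<k. \<Phi> p (s p) j * \<Psi> p (frame E \<Phi> j p) i)"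
  proof (intro smooth_fun_sum smooth_fun_mult o)
    fix j assume "j \<in> {..<k}"
    then have j: "j < k" by simp
    show "smooth_fun M (V \<inter> W) (\<lambda>p. \<Phi> p (s p) j)"
      by (rule smooth_fun_subset[OF s[OF j]]) auto
    show "smooth_fun M (V \<inter> W) (\<lambda>p. \<Psi> p (frame E \<Phi> j p) i)"
      by (rule smooth_fun_subset[OF smooth_trivD(2)[OF t V j i]]) (use W in auto)
  qed
  then show "smooth_fun M (V \<inter> W) (\<lambda>p. \<Psi> p (s p) i)"
  proof (rule smooth_fun_cong[OF o])
    fix q assume q: "q \<in> V \<inter> W"
    show "(\<Sum>j<k. \<Phi> q (s q) j * \<Psi> q (frame E \<Phi> j q) i) = \<Psi> q (s q) i"
      using triv_expand_map[OF E t' _ V' _ linear_on_id fib, of q i] q W(2) by auto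
  qed
qed

lemma lsmooth_subset: "lsmooth E W s \<Longrightarrow> W' \<subseteq> W \<Longrightarrow> lsmooth E W' s"
  unfolding lsmooth_def by (fastforce intro: smooth_fun_subset)

lemma trivs_open: "vector_bundle M E \<Longrightarrow> (U, k, \<Phi>) \<in> trivs E \<Longrightarrow> open U"
  using local_trivD(1)[OF vector_bundleD(5)] .

lemma lsmooth_cong:
  assumes E: "vector_bundle M E" and W: "open W" and s: "lsmooth E W s" and eq: "\<And>p. p \<in> W \<Longrightarrow> s p = s' p"
  shows "lsmooth E W s'"
proof (rule lsmoothI)
  show "s' p \<in> fib E p" if "p \<in> W" for p using lsmoothD(1)[OF s that] eq[OF that] by simp
  fix U k \<Phi> i assume t: "(U, k, \<Phi>) \<in> trivs E" "i < k"
  have o: "open (U \<inter> W)" using trivs_open[OF E t(1)] W by auto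
  show "smooth_fun M (U \<inter> W) (\<lambda>p. \<Phi> p (s' p) i)"
    by (rule smooth_fun_cong[OF o lsmoothD(2)[OF s t]]) (simp add: eq)
qed

lemma lsmooth_local:
  assumes "\<And>p. p \<in> W \<Longrightarrow> \<exists>W'. open W' \<and> p \<in> W' \<and> lsmooth E (W \<inter> W') s"
  shows "lsmooth E W s"
proof (rule lsmoothI)
  show "s p \<in> fib E p" if p: "p \<in> W" for p
  proof -
    obtain W' where W': "p \<in> W'" "lsmooth E (W \<inter> W') s" using assms[OF p] by blast
    show ?thesis by (rule lsmoothD(1)[OF W'(2)]) (use p W' in simp)
  qed
  fix U k \<Phi> i assume t: "(U, k, \<Phi>) \<in> trivs E" "i < k"
  show "smooth_fun M (U \<inter> W) (\<lambda>p. \<Phi> p (s p) i)"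
  proof (rule smooth_fun_local)
    fix p assume p: "p \<in> U \<inter> W"
    obtain W' where W': "open W'" "p \<in> W'" "lsmooth E (W \<inter> W') s" using assms[of p] p by blast
    have "smooth_fun M (U \<inter> W \<inter> W') (\<lambda>p. \<Phi> p (s p) i)"
      using lsmoothD(2)[OF W'(3) t] by (simp add: Int_assoc)
    then show "\<exists>W'. open W' \<and> p \<in> W' \<and> smooth_fun M (U \<inter> W \<inter> W') (\<lambda>p. \<Phi> p (s p) i)"
      using W'(1,2) by blast
  qed
qed

lemma frame_lsmooth:
  assumes E: "vector_bundle M E" and t: "smooth_triv M E U k \<Phi>" "j < k"
  shows "lsmooth E U (frame E \<Phi> j)"
proof -
  note t' = smooth_trivD(1)[OF t(1)]
  have U: "open U" by (rule local_trivD(1)[OF t'])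
  show ?thesis
  proof (rule lsmooth_trivI[OF E t(1) U order_refl])
    show "frame E \<Phi> j p \<in> fib E p" if "p \<in> U" for p by (rule frame_props(1)[OF t' that t(2)])
    show "smooth_fun M U (\<lambda>p. \<Phi> p (frame E \<Phi> j p) i)" for i
      by (rule smooth_fun_cong[OF U smooth_fun_const[OF U]]) (simp add: frame_props(2)[OF t' _ t(2)])
  qed
qed

lemma lsmooth_add:
  assumes E: "vector_bundle M E" and W: "open W" and s: "lsmooth E W s" "lsmooth E W s'"
  shows "lsmooth E W (sadd E s s')"
proof (rule lsmoothI)
  show "sadd E s s' p \<in> fib E p" if "p \<in> W" for p
    unfolding sadd_def by (simp add: fibs E lsmoothD(1)[OF s(1) that] lsmoothD(1)[OF s(2) that])
  fix U k \<Phi> i assume t: "(U, k, \<Phi>) \<in> trivs E" "i < k"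
  have o: "open (U \<inter> W)" using trivs_open[OF E t(1)] W by auto
  show "smooth_fun M (U \<inter> W) (\<lambda>p. \<Phi> p (sadd E s s' p) i)"
    by (rule smooth_fun_cong[OF o smooth_fun_add[OF o lsmoothD(2)[OF s(1) t] lsmoothD(2)[OF s(2) t]]])
      (simp add: sadd_def local_trivD(3)[OF vector_bundleD(5)[OF E t(1)]] lsmoothD(1)[OF s(1)] lsmoothD(1)[OF s(2)])
qed

lemma lsmooth_scale:
  assumes E: "vector_bundle M E" and W: "open W" and s: "lsmooth E W s" "smooth_fun M W f"
  shows "lsmooth E W (sscale E f s)"
proof (rule lsmoothI)
  show "sscale E f s p \<in> fib E p" if "p \<in> W" for p
    unfolding sscale_def by (simp add: fibs E lsmoothD(1)[OF s(1) that])
  fix U k \<Phi> i assume t: "(U, k, \<Phi>) \<in> trivs E" "i < k"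
  have o: "open (U \<inter> W)" using trivs_open[OF E t(1)] W by auto
  have f: "smooth_fun M (U \<inter> W) f" by (rule smooth_fun_subset[OF s(2)]) simp
  show "smooth_fun M (U \<inter> W) (\<lambda>p. \<Phi> p (sscale E f s p) i)"
    by (rule smooth_fun_cong[OF o smooth_fun_mult[OF o f lsmoothD(2)[OF s(1) t]]])
      (simp add: sscale_def local_trivD(4)[OF vector_bundleD(5)[OF E t(1)]] lsmoothD(1)[OF s(1)])
qed

lemma lsmooth_zero:
  assumes E: "vector_bundle M E" and W: "open W"
  shows "lsmooth E W (vzero E)"
proof (rule lsmoothI)
  show "vzero E p \<in> fib E p" for p by (simp add: fibs E)
  fix U k \<Phi> i assume t: "(U, k, \<Phi>) \<in> trivs E" "i < k"
  have o: "open (U \<inter> W)" using trivs_open[OF E t(1)] W by auto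
  show "smooth_fun M (U \<inter> W) (\<lambda>p. \<Phi> p (vzero E p) i)"
    by (rule smooth_fun_cong[OF o smooth_fun_const[OF o, of 0]])
      (simp add: triv_zero[OF E vector_bundleD(5)[OF E t(1)]])
qed

lemma zero_sec: "vector_bundle M E \<Longrightarrow> vzero E \<in> sections M E"
  by (simp add: sections_iff lsmooth_zero)
lemma sadd_sec: "vector_bundle M E \<Longrightarrow> s \<in> sections M E \<Longrightarrow> s' \<in> sections M E \<Longrightarrow> sadd E s s' \<in> sections M E"
  by (simp add: sections_iff lsmooth_add)
lemma sscale_sec: "vector_bundle M E \<Longrightarrow> s \<in> sections M E \<Longrightarrow> f \<in> Cinf M \<Longrightarrow> sscale E f s \<in> sections M E"
  by (simp add: sections_iff lsmooth_scale Cinf_def)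
lemma sminus_eq: "sminus E s s' = sadd E s (sscale E (\<lambda>_. -1) s')"
  by (simp add: sminus_def sadd_def sscale_def vminus_def)
lemma sminus_sec: "vector_bundle M E \<Longrightarrow> s \<in> sections M E \<Longrightarrow> s' \<in> sections M E \<Longrightarrow> sminus E s s' \<in> sections M E"
  by (simp add: sminus_eq sadd_sec sscale_sec Cinf_const)

lemmas secs = zero_sec sadd_sec sscale_sec sminus_sec Cinf_const

lemma lsmooth_sec_subset: "s \<in> sections M E \<Longrightarrow> lsmooth E W s"
  unfolding sections_iff by (erule lsmooth_subset) simp

text \<open>Smoothness is checked on \<open>W\<close> and on the complement of \<open>K\<close>,
  where the section is zero.\<close>

lemma lsmooth_extend_by_zero:
  assumes E: "vector_bundle M E" and W: "open W" and s: "lsmooth E W s"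
    and ch: "ch \<in> Cinf M" "closed K" "K \<subseteq> W" "\<And>q. q \<notin> K \<Longrightarrow> ch q = 0"
  shows "(\<lambda>q. if q \<in> W then vscale E q (ch q) (s q) else vzero E q) \<in> sections M E"
  unfolding sections_iff
proof (rule lsmooth_local)
  let ?s = "\<lambda>q. if q \<in> W then vscale E q (ch q) (s q) else vzero E q"
  fix p :: 'm
  have K': "open (- K)" using ch(2) by (simp add: open_Compl)
  have 1: "lsmooth E W ?s"
    by (rule lsmooth_cong[OF E W lsmooth_scale[OF E W s CinfD[OF ch(1) W]]]) (simp add: sscale_def)
  have 2: "lsmooth E (- K) ?s"
    by (rule lsmooth_cong[OF E K' lsmooth_zero[OF E K']]) (simp add: ch(4) vscale_zero[OF E] lsmoothD(1)[OF s])
  show "\<exists>W'. open W' \<and> p \<in> W' \<and> lsmooth E (UNIV \<inter> W') ?s"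
    using 1 2 W K' ch(3) by (cases "p \<in> K") auto
qed

text \<open>Brackets, connections and \<open>module_map\<close> accept global sections only, so a
  local frame has to be replaced by global sections that agree with it near the given point.\<close>

lemma lsmooth_extend:
  assumes E: "vector_bundle M E" and W: "open W" and s: "lsmooth E W s" and p: "p \<in> W"
  obtains s' V where "s' \<in> sections M E" "open V" "p \<in> V" "V \<subseteq> W" "\<forall>q\<in>V. s' q = s q"
proof -
  obtain ch V K where b: "ch \<in> Cinf M" "open V" "p \<in> V" "\<forall>q\<in>V. ch q = 1" "V \<subseteq> W"
    "closed K" "K \<subseteq> W" "\<forall>q. q \<notin> K \<longrightarrow> ch q = 0" by (rule bump_ex[OF W p])
  show thesis
  proof (rule that[OF lsmooth_extend_by_zero[OF E W s b(1,6,7)] b(2,3,5)])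
    show "ch q = 0" if "q \<notin> K" for q using b(8) that by simp
    show "\<forall>q\<in>V. (if q \<in> W then vscale E q (ch q) (s q) else vzero E q) = s q"
    proof
    fix q assume "q \<in> V"
    then show "(if q \<in> W then vscale E q (ch q) (s q) else vzero E q) = s q"
      using b(4,5) vscale_one[OF E lsmoothD(1)[OF s]] by auto
    qed
  qed
qed

text \<open>In a trivialisation the section with constant coordinates is smooth, and a bump function
  extends it.\<close>

lemma section_through:
  assumes E: "vector_bundle M E" and u: "u \<in> fib E p"
  obtains s where "s \<in> sections M E" "s p = u"
proof -
  obtain U k \<Phi> where t: "(U, k, \<Phi>) \<in> trivs E" "p \<in> U" using vector_bundleD(7)[OF E] by blast
  note t' = vector_bundleD(5)[OF E t(1)]
  have U: "open U" by (rule trivs_open[OF E t(1)])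
  have ge: "\<And>i. i \<ge> k \<Longrightarrow> \<Phi> p u i = 0" by (rule local_triv_ge[OF t' t(2) u])
  have "lsmooth E U (\<lambda>q. vec_of E \<Phi> q (\<Phi> p u))"
  proof (rule lsmooth_trivI[OF E triv_smooth[OF E t(1)] U order_refl])
    show "vec_of E \<Phi> q (\<Phi> p u) \<in> fib E q" if "q \<in> U" for q by (rule vec_of(1)[OF t' that ge])
    show "smooth_fun M U (\<lambda>q. \<Phi> q (vec_of E \<Phi> q (\<Phi> p u)) i)" for i
      by (rule smooth_fun_cong[OF U smooth_fun_const[OF U]]) (simp add: vec_of(2)[OF t' _ ge])
  qed
  then obtain s V where s: "s \<in> sections M E" "p \<in> V" "\<And>q. q \<in> V \<Longrightarrow> s q = vec_of E \<Phi> q (\<Phi> p u)"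
    using lsmooth_extend[OF E U _ t(2)] by metis
  have "vec_of E \<Phi> p (\<Phi> p u) = u"
    by (rule local_triv_inj[OF t' t(2) vec_of(1)[OF t' t(2) ge] u]) (simp_all add: vec_of(2)[OF t' t(2) ge])
  then show thesis using that[OF s(1)] s(3)[OF s(2)] by simp
qed

section \<open>Smoothness of bundle maps tested on sections\<close>

lemma bundle_map_linear: "bundle_map M E F h \<Longrightarrow> linear_on E F p (h p)"
  unfolding bundle_map_def by blast

lemma bundle_map_lsmooth:
  assumes E: "vector_bundle M E" and F: "vector_bundle M F" and h: "bundle_map M E F h"
    and W: "open W" and s: "lsmooth E W s"
  shows "lsmooth F W (sapp h s)"
proof (rule lsmoothI)
  show "sapp h s p \<in> fib F p" if "p \<in> W" for p
    unfolding sapp_def by (rule linear_onD(1)[OF bundle_map_linear[OF h] lsmoothD(1)[OF s that]])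
  fix V l \<Psi> i assume V: "(V, l, \<Psi>) \<in> trivs F" and i: "i < l"
  note V' = vector_bundleD(5)[OF F V]
  show "smooth_fun M (V \<inter> W) (\<lambda>p. \<Psi> p (sapp h s p) i)"
  proof (rule smooth_fun_local)
    fix p assume p: "p \<in> V \<inter> W"
    obtain U k \<Phi> where t: "(U, k, \<Phi>) \<in> trivs E" "p \<in> U" using vector_bundleD(7)[OF E] by blast
    note t' = vector_bundleD(5)[OF E t(1)]
    have U: "open U" by (rule trivs_open[OF E t(1)])
    have o: "open (V \<inter> W \<inter> U)" using U W trivs_open[OF F V] by auto
    have "smooth_fun M (V \<inter> W \<inter> U) (\<lambda>p. \<Sum>j<k. \<Phi> p (s p) j * \<Psi> p (h p (frame E \<Phi> j p)) i)"
    proof (intro smooth_fun_sum smooth_fun_mult o)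
      fix j assume "j \<in> {..<k}"
      then have j: "j < k" by simp
      show "smooth_fun M (V \<inter> W \<inter> U) (\<lambda>p. \<Phi> p (s p) j)"
        by (rule smooth_fun_subset[OF lsmoothD(2)[OF s t(1) j]]) auto
      have "smooth_fun M (U \<inter> V) (\<lambda>p. \<Psi> p (h p (frame E \<Phi> j p)) i)"
        using h t(1) V i j unfolding bundle_map_def by fastforce
      then show "smooth_fun M (V \<inter> W \<inter> U) (\<lambda>p. \<Psi> p (h p (frame E \<Phi> j p)) i)"
        by (rule smooth_fun_subset) auto
    qed
    then have "smooth_fun M (V \<inter> W \<inter> U) (\<lambda>p. \<Psi> p (sapp h s p) i)"
    proof (rule smooth_fun_cong[OF o])
      fix q assume q: "q \<in> V \<inter> W \<inter> U"
      show "(\<Sum>j<k. \<Phi> q (s q) j * \<Psi> q (h q (frame E \<Phi> j q)) i) = \<Psi> q (sapp h s q) i"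
        using triv_expand_map[OF E t' _ V' _ bundle_map_linear[OF h] lsmoothD(1)[OF s], of q i] q
        by (simp add: sapp_def)
    qed
    then show "\<exists>W'. open W' \<and> p \<in> W' \<and> smooth_fun M (V \<inter> W \<inter> W') (\<lambda>p. \<Psi> p (sapp h s p) i)"
      using U t(2) by blast
  qed
qed

lemma bundle_map_sec:
  assumes "vector_bundle M E" "vector_bundle M F" "bundle_map M E F h" "s \<in> sections M E"
  shows "sapp h s \<in> sections M F"
  using bundle_map_lsmooth[OF assms(1-3) open_UNIV] assms(4) by (simp add: sections_iff)

text \<open>After shrinking the domain a frame section extends to a global section, so preserving
  global sections already makes the matrix entries smooth. Most later bundle maps are recognised in
  this way, without touching trivialisations.\<close>

lemma bundle_mapI:
  assumes E: "vector_bundle M E" and F: "vector_bundle M F" and lin: "\<And>p. linear_on E F p (h p)"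
    and sec: "\<And>s. s \<in> sections M E \<Longrightarrow> sapp h s \<in> sections M F"
  shows "bundle_map M E F h"
proof -
  have "smooth_fun M (U \<inter> V) (\<lambda>p. \<Psi> p (h p (frame E \<Phi> j p)) i)"
    if U: "(U, k, \<Phi>) \<in> trivs E" and V: "(V, l, \<Psi>) \<in> trivs F" and j: "j < k" and i: "i < l" for U k \<Phi> V l \<Psi> j i
  proof (rule smooth_fun_local)
    fix p assume p: "p \<in> U \<inter> V"
    have oU: "open U" by (rule trivs_open[OF E U])
    obtain s' W where s': "s' \<in> sections M E" "open W" "p \<in> W" "W \<subseteq> U" "\<And>q. q \<in> W \<Longrightarrow> s' q = frame E \<Phi> j q"
      using lsmooth_extend[OF E oU frame_lsmooth[OF E triv_smooth[OF E U] j], of p] p by (metis IntE)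
    have o: "open (U \<inter> V \<inter> W)" using oU trivs_open[OF F V] s'(2) by auto
    have "smooth_fun M (U \<inter> V \<inter> W) (\<lambda>p. \<Psi> p (sapp h s' p) i)"
      by (rule smooth_fun_subset[OF lsmoothD(2)[OF sec[OF s'(1), unfolded sections_iff] V i]]) auto
    then have "smooth_fun M (U \<inter> V \<inter> W) (\<lambda>p. \<Psi> p (h p (frame E \<Phi> j p)) i)"
      by (rule smooth_fun_cong[OF o]) (simp add: sapp_def s'(5))
    then show "\<exists>W'. open W' \<and> p \<in> W' \<and> smooth_fun M (U \<inter> V \<inter> W') (\<lambda>p. \<Psi> p (h p (frame E \<Phi> j p)) i)"
      using s'(2,3) by blast
  qed
  then show ?thesis unfolding bundle_map_def using lin by fast
qed

lemma bundle_map_cong: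
  assumes E: "vector_bundle M E" and F: "vector_bundle M F" and h: "bundle_map M E F h"
    and eq: "\<And>p u. u \<in> fib E p \<Longrightarrow> h p u = h' p u"
  shows "bundle_map M E F h'"
proof (rule bundle_mapI[OF E F])
  show "linear_on E F p (h' p)" for p
    by (rule linear_onI) (simp_all add: eq[symmetric] fibs E linear_onD[OF bundle_map_linear[OF h]])
  fix s assume s: "s \<in> sections M E"
  have "sapp h' s = sapp h s" unfolding sapp_def by (simp add: eq sec_fib[OF s])
  then show "sapp h' s \<in> sections M F" using bundle_map_sec[OF E F h s] by simp
qed

text \<open>The scalar version of the same test. It serves anchors, where \<open>L\<close> is the
  derivative of one fixed smooth function.\<close>

lemma smooth_functional_iff:
  fixes L :: "'m \<Rightarrow> 'e \<Rightarrow> real"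
  assumes E: "vector_bundle M E"
    and add: "\<And>p u v. u \<in> fib E p \<Longrightarrow> v \<in> fib E p \<Longrightarrow> L p (vadd E p u v) = L p u + L p v"
    and scale: "\<And>p c u. u \<in> fib E p \<Longrightarrow> L p (vscale E p c u) = c * L p u"
  shows "(\<forall>(U, k, \<Phi>) \<in> trivs E. \<forall>j<k. smooth_fun M U (\<lambda>p. L p (frame E \<Phi> j p))) \<longleftrightarrow>
    (\<forall>s\<in>sections M E. (\<lambda>p. L p (s p)) \<in> Cinf M)"
proof (intro iffI ballI)
  assume fr: "\<forall>(U, k, \<Phi>) \<in> trivs E. \<forall>j<k. smooth_fun M U (\<lambda>p. L p (frame E \<Phi> j p))"
  fix s assume s: "s \<in> sections M E"
  show "(\<lambda>p. L p (s p)) \<in> Cinf M"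
  proof (rule CinfI, rule smooth_fun_local)
    fix p :: 'm
    obtain U k \<Phi> where t: "(U, k, \<Phi>) \<in> trivs E" "p \<in> U" using vector_bundleD(7)[OF E] by blast
    have U: "open U" by (rule trivs_open[OF E t(1)])
    have "smooth_fun M U (\<lambda>p. \<Sum>j<k. \<Phi> p (s p) j * L p (frame E \<Phi> j p))"
    proof (intro smooth_fun_sum smooth_fun_mult U)
      fix j assume "j \<in> {..<k}"
      then have j: "j < k" by simp
      show "smooth_fun M U (\<lambda>p. \<Phi> p (s p) j)"
        using lsmoothD(2)[OF s[unfolded sections_iff] t(1) j] by simp
      show "smooth_fun M U (\<lambda>p. L p (frame E \<Phi> j p))" using bspec[OF fr t(1)] j by simp
    qed
    then have "smooth_fun M U (\<lambda>p. L p (s p))"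
      by (rule smooth_fun_cong[OF U])
        (rule triv_expand[OF E vector_bundleD(5)[OF E t(1)] _ add scale sec_fib[OF s], symmetric])
    then show "\<exists>W'. open W' \<and> p \<in> W' \<and> smooth_fun M (UNIV \<inter> W') (\<lambda>p. L p (s p))"
      using U t(2) by auto
  qed
next
  assume sec: "\<forall>s\<in>sections M E. (\<lambda>p. L p (s p)) \<in> Cinf M"
  fix x assume "x \<in> trivs E"
  then obtain U k \<Phi> where x: "x = (U, k, \<Phi>)" and t: "(U, k, \<Phi>) \<in> trivs E" by (cases x) auto
  have "smooth_fun M U (\<lambda>p. L p (frame E \<Phi> j p))" if j: "j < k" for j
  proof (rule smooth_fun_local)
    fix p assume p: "p \<in> U"
    have oU: "open U" by (rule trivs_open[OF E t])
    obtain s' W where s': "s' \<in> sections M E" "open W" "p \<in> W" "W \<subseteq> U" "\<And>q. q \<in> W \<Longrightarrow> s' q = frame E \<Phi> j q"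
      using lsmooth_extend[OF E oU frame_lsmooth[OF E triv_smooth[OF E t] j] p] by metis
    have o: "open (U \<inter> W)" using oU s'(2) by auto
    have "smooth_fun M (U \<inter> W) (\<lambda>p. L p (frame E \<Phi> j p))"
      by (rule smooth_fun_cong[OF o CinfD[OF bspec[OF sec s'(1)] o]]) (simp add: s'(5))
    then show "\<exists>W'. open W' \<and> p \<in> W' \<and> smooth_fun M (U \<inter> W') (\<lambda>p. L p (frame E \<Phi> j p))"
      using s'(2,3) by blast
  qed
  then show "case x of (U, k, \<Phi>) \<Rightarrow> \<forall>j<k. smooth_fun M U (\<lambda>p. L p (frame E \<Phi> j p))" by (simp add: x)
qed

end


subsection \<open>Tensoriality\<close>

text \<open>Sums are formed by recursion since the addition of sections belongs to the bundle
  \<open>E\<close>, not to the type of its fibres.\<close>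

primrec ssum :: "('m, 'e, 'z) vbundle_scheme \<Rightarrow> (nat \<Rightarrow> 'm \<Rightarrow> 'e) \<Rightarrow> nat \<Rightarrow> 'm \<Rightarrow> 'e" where
  "ssum E t 0 = vzero E"
| "ssum E t (Suc m) = sadd E (ssum E t m) (t m)"

context smooth_mfd
begin

definition module_map :: "('m, 'e, 'y) vbundle_scheme \<Rightarrow> ('m, 'f, 'z) vbundle_scheme \<Rightarrow>
    (('m \<Rightarrow> 'e) \<Rightarrow> 'm \<Rightarrow> 'f) \<Rightarrow> bool" where
  "module_map E F B \<longleftrightarrow> (\<forall>s\<in>sections M E. B s \<in> sections M F) \<and>
     (\<forall>s\<in>sections M E. \<forall>s'\<in>sections M E. B (sadd E s s') = sadd F (B s) (B s')) \<and>
     (\<forall>f\<in>Cinf M. \<forall>s\<in>sections M E. B (sscale E f s) = sscale F f (B s))"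

lemma module_mapD:
  assumes "module_map E F B"
  shows "s \<in> sections M E \<Longrightarrow> B s \<in> sections M F"
    "s \<in> sections M E \<Longrightarrow> s' \<in> sections M E \<Longrightarrow> B (sadd E s s') = sadd F (B s) (B s')"
    "f \<in> Cinf M \<Longrightarrow> s \<in> sections M E \<Longrightarrow> B (sscale E f s) = sscale F f (B s)"
  using assms unfolding module_map_def by auto

lemma module_mapI:
  assumes "\<And>s. s \<in> sections M E \<Longrightarrow> B s \<in> sections M F"
    "\<And>s s'. s \<in> sections M E \<Longrightarrow> s' \<in> sections M E \<Longrightarrow> B (sadd E s s') = sadd F (B s) (B s')"
    "\<And>f s. f \<in> Cinf M \<Longrightarrow> s \<in> sections M E \<Longrightarrow> B (sscale E f s) = sscale F f (B s)"
  shows "module_map E F B"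
  using assms unfolding module_map_def by auto

lemma ssum_fib:
  assumes E: "vector_bundle M E" and t: "\<And>j. t j p \<in> fib E p"
  shows "ssum E t m p \<in> fib E p"
  by (induction m) (simp_all add: fibs E sadd_def t)

lemma ssum_sec:
  assumes E: "vector_bundle M E" and t: "\<And>j. t j \<in> sections M E"
  shows "ssum E t m \<in> sections M E"
  by (induction m) (simp_all add: secs E t)

lemma crd_ssum:
  assumes E: "vector_bundle M E" and t: "\<And>j. t j p \<in> fib E p"
  shows "crd E p (ssum E t m p) i = (\<Sum>j<m. crd E p (t j p) i)"
  by (induction m) (simp_all add: fibs crds E sadd_def t ssum_fib)

lemma triv_ssum:
  assumes E: "vector_bundle M E" and t: "\<And>j. t j p \<in> fib E p" and tr: "local_triv E U k \<Phi>" "p \<in> U"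
  shows "\<Phi> p (ssum E t m p) i = (\<Sum>j<m. \<Phi> p (t j p) i)"
  by (induction m) (simp_all add: fibs triv_zero[OF E tr] local_trivD(3)[OF tr] E sadd_def t ssum_fib)

lemma module_map_zero:
  assumes E: "vector_bundle M E" and F: "vector_bundle M F" and B: "module_map E F B"
  shows "B (vzero E) = vzero F"
proof -
  have "sscale E (\<lambda>_. 0) (vzero E) = vzero E" unfolding sscale_def by (simp add: vscale_vzero E)
  then have "B (vzero E) = sscale F (\<lambda>_. 0) (B (vzero E))"
    using module_mapD(3)[OF B Cinf_const zero_sec[OF E]] by metis
  also have "\<dots> = vzero F"
    unfolding sscale_def by (simp add: vscale_zero F sec_fib[OF module_mapD(1)[OF B zero_sec[OF E]]])
  finally show ?thesis .
qed

lemma module_map_ssum: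
  assumes E: "vector_bundle M E" and F: "vector_bundle M F" and B: "module_map E F B" and t: "\<And>j. t j \<in> sections M E"
  shows "B (ssum E t m) = ssum F (\<lambda>j. B (t j)) m"
  by (induction m) (simp_all add: module_map_zero[OF E F B] module_mapD(2)[OF B] t ssum_sec E)

text \<open>Near \<open>p\<close> the section is a combination of frame sections; cutting both the coefficients and the
  frame off by a bump function makes this an identity of global objects.\<close>

lemma module_map_vanishes:
  assumes E: "vector_bundle M E" and F: "vector_bundle M F" and B: "module_map E F B"
    and s: "s \<in> sections M E" and sp: "s p = vzero E p"
  shows "B s p = vzero F p"
proof -
  obtain U k \<Phi> where t: "(U, k, \<Phi>) \<in> trivs E" "p \<in> U" using vector_bundleD(7)[OF E] by blast
  note t' = vector_bundleD(5)[OF E t(1)]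
  have U: "open U" by (rule trivs_open[OF E t(1)])
  obtain ch V K where b: "ch \<in> Cinf M" "open V" "p \<in> V" "\<forall>q\<in>V. ch q = 1" "V \<subseteq> U"
    "closed K" "K \<subseteq> U" "\<forall>q. q \<notin> K \<longrightarrow> ch q = 0" by (rule bump_ex[OF U t(2)])
  have off: "ch q = 0" if "q \<notin> U" for q using b(7,8) that by auto
  define a where "a j q = (if q \<in> U then ch q * \<Phi> q (s q) j else 0)" for j q
  define e where "e j = (if j < k then (\<lambda>q. if q \<in> U then vscale E q (ch q) (frame E \<Phi> j q) else vzero E q) else vzero E)" for j
  have e: "e j \<in> sections M E" for j
    using lsmooth_extend_by_zero[OF E U frame_lsmooth[OF E triv_smooth[OF E t(1)]] b(1,6,7)] b(8)
    by (auto simp: e_def zero_sec[OF E])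
  have a: "a j \<in> Cinf M" for j
  proof (rule Cinf_extend_by_zero[OF U _ b(6,7)])
    have "smooth_fun M U (\<lambda>q. ch q * \<Phi> q (s q) j)"
      using lsmooth_triv[OF E triv_smooth[OF E t(1)] open_UNIV, of s j] s
      by (intro smooth_fun_mult U CinfD[OF b(1)]) (simp add: sections_iff)
    then show "smooth_fun M U (a j)" by (rule smooth_fun_cong[OF U]) (simp add: a_def)
    show "a j q = 0" if "q \<notin> K" for q using b(8) that by (simp add: a_def)
  qed
  define t where "t j = sscale E (a j) (e j)" for j
  have tsec: "t j \<in> sections M E" for j unfolding t_def by (intro sscale_sec[OF E e a])
  have sq: "sscale E (\<lambda>q. ch q * ch q) s = ssum E t k"
  proof
    fix q
    have tf: "t j q \<in> fib E q" for j by (rule sec_fib[OF tsec])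
    show "sscale E (\<lambda>q. ch q * ch q) s q = ssum E t k q"
    proof (cases "q \<in> U")
      case True
      have fr: "frame E \<Phi> j q \<in> fib E q" "\<Phi> q (frame E \<Phi> j q) i = (if i = j then 1 else 0)" if "j < k" for j i
        using frame_props[OF t' True that] by auto
      show ?thesis
      proof (rule local_triv_inj[OF t' True])
        fix i assume i: "i < k"
        have "\<Phi> q (ssum E t k q) i = (\<Sum>j<k. \<Phi> q (t j q) i)"
          by (rule triv_ssum[where t = t, OF E tf t' True])
        also have "\<dots> = (\<Sum>j<k. if j = i then ch q * ch q * \<Phi> q (s q) i else 0)"
        proof (rule sum.cong[OF refl])
          fix j assume "j \<in> {..<k}"
          then have j: "j < k" by simp
          show "\<Phi> q (t j q) i = (if j = i then ch q * ch q * \<Phi> q (s q) i else 0)"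
            using True j by (simp add: t_def sscale_def e_def a_def local_trivD(4)[OF t' True] fibs E fr)
        qed
        also have "\<dots> = ch q * ch q * \<Phi> q (s q) i" using i by simp
        also have "\<dots> = \<Phi> q (sscale E (\<lambda>q. ch q * ch q) s q) i"
          by (simp add: sscale_def local_trivD(4)[OF t' True] sec_fib[OF s])
        finally show "\<Phi> q (sscale E (\<lambda>q. ch q * ch q) s q) i = \<Phi> q (ssum E t k q) i" by simp
      qed (simp_all add: sscale_def fibs E sec_fib[OF s] ssum_fib[where t = t, OF E tf])
    next
      case False
      have "t j q = vzero E q" for j
        using False by (simp add: t_def sscale_def e_def vscale_vzero[OF E])
      then have "crd E q (ssum E t k q) i = 0" for i
        using crd_ssum[where t = t, OF E tf] by (simp add: crds E)
      then have "ssum E t k q = vzero E q"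
        by (intro fib_eqI[OF E ssum_fib[where t = t, OF E tf]]) (simp_all add: fibs crds E)
      then show ?thesis using off[OF False] by (simp add: sscale_def vscale_zero[OF E sec_fib[OF s]])
    qed
  qed
  have Bs: "B s p \<in> fib F p" by (rule sec_fib[OF module_mapD(1)[OF B s]])
  have chp: "ch p = 1" using b(3,4) by simp
  have "B s p = sscale F (\<lambda>q. ch q * ch q) (B s) p"
    by (simp add: sscale_def chp vscale_one[OF F Bs])
  also have "\<dots> = B (sscale E (\<lambda>q. ch q * ch q) s) p"
    by (simp add: module_mapD(3)[OF B Cinf_mult[OF b(1) b(1)] s])
  also have "\<dots> = ssum F (\<lambda>j. B (t j)) k p"
    unfolding sq by (simp add: module_map_ssum[where t = t, OF E F B tsec])
  also have "\<dots> = vzero F p"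
  proof -
    \<comment> \<open>The hypothesis on \<open>s\<close> enters here: the coefficient
      \<open>a j\<close> carries a coordinate of \<open>s\<close>, so it vanishes at
      \<open>p\<close> and kills the whole term.\<close>
    have Bt: "B (t j) p = vzero F p" for j
    proof -
      have "a j p = 0" using t(2) chp by (simp add: a_def sp triv_zero[OF E t' t(2)])
      moreover have "B (t j) = sscale F (a j) (B (e j))" unfolding t_def by (rule module_mapD(3)[OF B a e])
      ultimately show ?thesis by (simp add: sscale_def vscale_zero[OF F sec_fib[OF module_mapD(1)[OF B e]]])
    qed
    show ?thesis
      by (rule fib_eqI[OF F, where p = p]) (simp_all add: ssum_fib crd_ssum F Bt fibs crds)
  qed
  finally show ?thesis .
qed

lemma module_map_local:
  assumes E: "vector_bundle M E" and F: "vector_bundle M F" and B: "module_map E F B"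
    and s: "s \<in> sections M E" "s' \<in> sections M E" and sp: "s p = s' p"
  shows "B s p = B s' p"
proof -
  let ?d = "sadd E s (sscale E (\<lambda>_. -1) s')"
  have m: "sscale E (\<lambda>_. -1) s' \<in> sections M E" by (intro secs E s)
  have d: "?d \<in> sections M E" by (intro secs E s)
  have "?d p = vzero E p"
    by (rule fib_eqI[OF E, where p = p]) (simp_all add: sadd_def sscale_def sp fibs crds E sec_fib[OF s(2)])
  then have "B ?d p = vzero F p" by (rule module_map_vanishes[OF E F B d])
  moreover have "B ?d p = vminus F p (B s p) (B s' p)"
    unfolding module_mapD(2)[OF B s(1) m] module_mapD(3)[OF B Cinf_const s(2)]
    by (simp add: sadd_def sscale_def vminus_def)
  ultimately have z: "vminus F p (B s p) (B s' p) = vzero F p" by simp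
  have f: "B s p \<in> fib F p" "B s' p \<in> fib F p" by (rule sec_fib[OF module_mapD(1)[OF B]], rule s)+
  show ?thesis
    by (rule fib_eqI[OF F f]) (use crd_minus[OF F f] z crd_zero[OF F] in \<open>metis eq_iff_diff_eq_0\<close>)
qed

text \<open>Wherever this choice is used the result depends on the value at \<open>p\<close> only,
  by \<open>module_map_local\<close>.\<close>

definition sec_thr :: "('m, 'e, 'z) vbundle_scheme \<Rightarrow> 'm \<Rightarrow> 'e \<Rightarrow> 'm \<Rightarrow> 'e" where
  "sec_thr E p u = (SOME s. s \<in> sections M E \<and> s p = u)"

lemma sec_thr:
  assumes E: "vector_bundle M E" and u: "u \<in> fib E p"
  shows "sec_thr E p u \<in> sections M E" "sec_thr E p u p = u"
proof -
  have "\<exists>s. s \<in> sections M E \<and> s p = u" by (rule section_through[OF E u]) blast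
  from someI_ex[OF this] show "sec_thr E p u \<in> sections M E" "sec_thr E p u p = u" unfolding sec_thr_def by auto
qed

lemma module_map_linear_on:
  assumes E: "vector_bundle M E" and F: "vector_bundle M F" and B: "module_map E F B"
  shows "linear_on E F p (\<lambda>u. B (sec_thr E p u) p)"
proof (rule linear_onI)
  fix u assume u: "u \<in> fib E p"
  note su = sec_thr[OF E u]
  show "B (sec_thr E p u) p \<in> fib F p" by (rule sec_fib[OF module_mapD(1)[OF B su(1)]])
  show "B (sec_thr E p (vscale E p c u)) p = vscale F p c (B (sec_thr E p u) p)" for c
  proof -
    have cu: "vscale E p c u \<in> fib E p" by (simp add: fibs E u)
    have "B (sec_thr E p (vscale E p c u)) p = B (sscale E (\<lambda>_. c) (sec_thr E p u)) p"
      by (rule module_map_local[OF E F B sec_thr(1)[OF E cu] sscale_sec[OF E su(1) Cinf_const]])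
        (simp add: su sscale_def sec_thr(2)[OF E cu])
    then show ?thesis unfolding module_mapD(3)[OF B Cinf_const su(1)] by (simp add: sscale_def)
  qed
  fix v assume v: "v \<in> fib E p"
  note sv = sec_thr[OF E v]
  have uv: "vadd E p u v \<in> fib E p" by (simp add: fibs E u v)
  have "B (sec_thr E p (vadd E p u v)) p = B (sadd E (sec_thr E p u) (sec_thr E p v)) p"
    by (rule module_map_local[OF E F B sec_thr(1)[OF E uv] sadd_sec[OF E su(1) sv(1)]])
      (simp add: su sv sadd_def sec_thr(2)[OF E uv])
  then show "B (sec_thr E p (vadd E p u v)) p = vadd F p (B (sec_thr E p u) p) (B (sec_thr E p v) p)"
    unfolding module_mapD(2)[OF B su(1) sv(1)] by (simp add: sadd_def)
qed

text \<open>With one argument frozen \<open>module_map_local\<close> applies to the other, so an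
  operation on sections that is function-linear in both arguments descends to a bilinear map of
  fibres. This later handles \<iota> and the curvature of a splitting.\<close>

lemma bilinear_tensor:
  assumes E: "vector_bundle M E" and F: "vector_bundle M F" and G: "vector_bundle M G"
    and B1: "\<And>t. t \<in> sections M F \<Longrightarrow> module_map E G (\<lambda>s. B s t)"
    and B2: "\<And>s. s \<in> sections M E \<Longrightarrow> module_map F G (B s)"
  defines "b \<equiv> \<lambda>p u v. B (sec_thr E p u) (sec_thr F p v) p"
  shows "s \<in> sections M E \<Longrightarrow> t \<in> sections M F \<Longrightarrow> b p (s p) (t p) = B s t p"
    "u \<in> fib E p \<Longrightarrow> linear_on F G p (b p u)"
    "v \<in> fib F p \<Longrightarrow> linear_on E G p (\<lambda>u. b p u v)"
proof -
  assume s: "s \<in> sections M E" and t: "t \<in> sections M F"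
  note s' = sec_thr[OF E sec_fib[OF s, of p]] and t' = sec_thr[OF F sec_fib[OF t, of p]]
  have "b p (s p) (t p) = B s (sec_thr F p (t p)) p"
    unfolding b_def by (rule module_map_local[OF E G B1[OF t'(1)] s'(1) s s'(2)])
  also have "\<dots> = B s t p" by (rule module_map_local[OF F G B2[OF s] t'(1) t t'(2)])
  finally show "b p (s p) (t p) = B s t p" .
next
  assume u: "u \<in> fib E p"
  show "linear_on F G p (b p u)" unfolding b_def
    by (rule module_map_linear_on[OF F G B2[OF sec_thr(1)[OF E u]]])
next
  assume v: "v \<in> fib F p"
  show "linear_on E G p (\<lambda>u. b p u v)" unfolding b_def
    by (rule module_map_linear_on[OF E G B1[OF sec_thr(1)[OF F v]]])
qed

subsection \<open>Subbundles\<close>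

lemma adapted_trivD:
  assumes "adapted_triv M E S U k r \<Phi>"
  shows "smooth_triv M E U k \<Phi>" "r \<le> k" "local_triv E U k \<Phi>" "open U"
    "p \<in> U \<Longrightarrow> v \<in> S p \<longleftrightarrow> v \<in> fib E p \<and> (\<forall>i\<ge>r. \<Phi> p v i = 0)"
proof -
  show 1: "smooth_triv M E U k \<Phi>" "r \<le> k" "p \<in> U \<Longrightarrow> v \<in> S p \<longleftrightarrow> v \<in> fib E p \<and> (\<forall>i\<ge>r. \<Phi> p v i = 0)"
    using assms unfolding adapted_triv_def by auto
  show "local_triv E U k \<Phi>" by (rule smooth_trivD(1)[OF 1(1)])
  then show "open U" by (rule local_trivD(1))
qed

lemma subbundleE:
  assumes "subbundle M E S"
  obtains U k r \<Phi> where "p \<in> U" "adapted_triv M E S U k r \<Phi>"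
  using assms[unfolded subbundle_def, rule_format, of p] by auto

lemma sub_fib:
  assumes S: "subbundle M E S" and v: "v \<in> S p" shows "v \<in> fib E p"
proof -
  obtain U k r \<Phi> where p: "p \<in> U" and a: "adapted_triv M E S U k r \<Phi>" by (rule subbundleE[OF S])
  show ?thesis using adapted_trivD(5)[OF a p] v by simp
qed

lemma sub_zero:
  assumes E: "vector_bundle M E" and S: "subbundle M E S" shows "vzero E p \<in> S p"
proof -
  obtain U k r \<Phi> where p: "p \<in> U" and a: "adapted_triv M E S U k r \<Phi>" by (rule subbundleE[OF S])
  show ?thesis using adapted_trivD(5)[OF a p] triv_zero[OF E adapted_trivD(3)[OF a] p] by (simp add: fibs E)
qed

lemma sub_add:
  assumes E: "vector_bundle M E" and S: "subbundle M E S" and u: "u \<in> S p" and v: "v \<in> S p"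
  shows "vadd E p u v \<in> S p"
proof -
  obtain U k r \<Phi> where p: "p \<in> U" and a: "adapted_triv M E S U k r \<Phi>" by (rule subbundleE[OF S])
  show ?thesis using adapted_trivD(5)[OF a p] u v
    by (simp add: fibs E local_trivD(3)[OF adapted_trivD(3)[OF a] p])
qed

lemma sub_scale:
  assumes E: "vector_bundle M E" and S: "subbundle M E S" and u: "u \<in> S p"
  shows "vscale E p c u \<in> S p"
proof -
  obtain U k r \<Phi> where p: "p \<in> U" and a: "adapted_triv M E S U k r \<Phi>" by (rule subbundleE[OF S])
  show ?thesis using adapted_trivD(5)[OF a p] u
    by (simp add: fibs E local_trivD(4)[OF adapted_trivD(3)[OF a] p])
qed

lemma sub_minus:
  assumes E: "vector_bundle M E" and S: "subbundle M E S" and u: "u \<in> S p" and v: "v \<in> S p"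
  shows "vminus E p u v \<in> S p"
  unfolding vminus_def by (intro sub_add[OF E S] sub_scale[OF E S] u v)

lemmas subs = sub_zero sub_add sub_scale sub_minus

lemma sub_bundle_simps [simp]:
  "fib (sub_bundle M E S) = S" "vzero (sub_bundle M E S) = vzero E" "vadd (sub_bundle M E S) = vadd E"
  "vscale (sub_bundle M E S) = vscale E" "vminus (sub_bundle M E S) = vminus E"
  "sadd (sub_bundle M E S) = sadd E" "sscale (sub_bundle M E S) = sscale E"
  by (simp_all add: sub_bundle_def vminus_def sadd_def sscale_def fun_eq_iff)

lemma sub_bundle_trivs: "(U, r, \<Phi>) \<in> trivs (sub_bundle M E S) \<longleftrightarrow> (\<exists>k. adapted_triv M E S U k r \<Phi>)"
  by (simp add: sub_bundle_def)

lemma frame_eqI: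
  assumes "local_triv E U k \<Phi>" "p \<in> U" "j < k" "u \<in> fib E p" "\<And>i. i < k \<Longrightarrow> \<Phi> p u i = (if i = j then 1 else 0)"
  shows "frame E \<Phi> j p = u"
  by (rule local_triv_inj[OF assms(1,2) frame_props(1)[OF assms(1-3)] assms(4)])
    (simp add: frame_props(2)[OF assms(1-3)] assms(5))

lemma sub_local_triv:
  assumes E: "vector_bundle M E" and S: "subbundle M E S" and a: "adapted_triv M E S U k r \<Phi>"
  shows "local_triv (sub_bundle M E S) U r \<Phi>"
proof (rule local_trivI)
  note aD = adapted_trivD[OF a]
  show "open U" by (rule aD(4))
  fix p assume p: "p \<in> U"
  show "bij_betw (\<Phi> p) (fib (sub_bundle M E S) p) (topspace (Euclidean_space r))"
  proof (rule bij_betw_EuclideanI)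
    show "\<Phi> p u i = 0" if "u \<in> fib (sub_bundle M E S) p" "r \<le> i" for u i
      using that aD(5)[OF p] by simp
    show "u = v" if "u \<in> fib (sub_bundle M E S) p" "v \<in> fib (sub_bundle M E S) p" "\<And>i. i < r \<Longrightarrow> \<Phi> p u i = \<Phi> p v i" for u v
    proof (rule local_triv_inj[OF aD(3) p])
      show "\<Phi> p u i = \<Phi> p v i" for i
        using that aD(5)[OF p] by (cases "i < r") auto
    qed (use that sub_fib[OF S] in auto)
    fix x :: "nat \<Rightarrow> real" assume x: "\<And>i. r \<le> i \<Longrightarrow> x i = 0"
    have ge: "x i = 0" if "k \<le> i" for i using x[of i] that aD(2) by simp
    show "\<exists>u\<in>fib (sub_bundle M E S) p. \<forall>i<r. \<Phi> p u i = x i"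
      by (rule bexI[of _ "vec_of E \<Phi> p x"]) (use x vec_of[OF aD(3) p ge] aD(5)[OF p] in auto)
  qed
  show "\<Phi> p (vadd (sub_bundle M E S) p u v) i = \<Phi> p u i + \<Phi> p v i"
    if "u \<in> fib (sub_bundle M E S) p" "v \<in> fib (sub_bundle M E S) p" for u v i
    using that sub_fib[OF S] local_trivD(3)[OF aD(3) p] by simp
  show "\<Phi> p (vscale (sub_bundle M E S) p c u) i = c * \<Phi> p u i"
    if "u \<in> fib (sub_bundle M E S) p" for u c i
    using that sub_fib[OF S] local_trivD(4)[OF aD(3) p] by simp
qed

lemma sub_vector_bundle:
  assumes E: "vector_bundle M E" and S: "subbundle M E S"
  shows "vector_bundle M (sub_bundle M E S)"
proof (rule vector_bundleI)
  show "\<And>p v. v \<in> fib (sub_bundle M E S) p \<Longrightarrow> vadd (sub_bundle M E S) p (vzero (sub_bundle M E S) p) v = v"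
    using vector_bundleD(2)[OF E sub_fib[OF S]] by simp
  show "local_triv (sub_bundle M E S) U k \<Phi>" if "(U, k, \<Phi>) \<in> trivs (sub_bundle M E S)" for U k \<Phi>
    using that sub_local_triv[OF E S] by (auto simp: sub_bundle_trivs)
  show "\<exists>U k \<Phi>. (U, k, \<Phi>) \<in> trivs (sub_bundle M E S) \<and> p \<in> U" for p
    by (rule subbundleE[OF S, of p]) (auto simp: sub_bundle_trivs)
  fix U r \<Phi> V l \<Psi>
  assume "(U, r, \<Phi>) \<in> trivs (sub_bundle M E S)" "(V, l, \<Psi>) \<in> trivs (sub_bundle M E S)"
  then obtain k k' where a: "adapted_triv M E S U k r \<Phi>" and a': "adapted_triv M E S V k' l \<Psi>"
    by (auto simp: sub_bundle_trivs)
  note aD = adapted_trivD[OF a] and aD' = adapted_trivD[OF a']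
  show "smooth_transition M (sub_bundle M E S) U r \<Phi> V l \<Psi>"
    unfolding smooth_transition_def
  proof (intro allI impI)
    fix j i assume j: "j < r" and i: "i < l"
    have jk: "j < k" using j aD(2) by simp
    have o: "open (V \<inter> U)" using aD(4) aD'(4) by auto
    have "smooth_fun M (V \<inter> U) (\<lambda>p. \<Psi> p (frame E \<Phi> j p) i)"
      by (rule lsmooth_triv[OF E aD'(1) aD(4) frame_lsmooth[OF E aD(1) jk]])
    then have "smooth_fun M (V \<inter> U) (\<lambda>p. \<Psi> p (frame (sub_bundle M E S) \<Phi> j p) i)"
    proof (rule smooth_fun_cong[OF o])
      fix p assume "p \<in> V \<inter> U"
      then have p: "p \<in> U" by simp
      have "frame (sub_bundle M E S) \<Phi> j p = frame E \<Phi> j p"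
        by (rule frame_eqI[OF sub_local_triv[OF E S a] p j])
          (use frame_props[OF aD(3) p jk] aD(5)[OF p] j in auto)
      then show "\<Psi> p (frame E \<Phi> j p) i = \<Psi> p (frame (sub_bundle M E S) \<Phi> j p) i" by simp
    qed
    then show "smooth_fun M (U \<inter> V) (\<lambda>p. \<Psi> p (frame (sub_bundle M E S) \<Phi> j p) i)" by (simp add: Int_commute)
  qed
qed (simp_all add: subs[OF E S])

text \<open>On \<open>S\<close> the adapted coordinates from \<open>r\<close> on vanish identically,
  so smoothness of the first \<open>r\<close> is smoothness of all. From here on a section of the
  subbundle is handled as a section of \<open>E\<close> with values in \<open>S\<close>.\<close>

lemma sub_sections:
  assumes E: "vector_bundle M E" and S: "subbundle M E S"
  shows "s \<in> sections M (sub_bundle M E S) \<longleftrightarrow> s \<in> sections M E \<and> (\<forall>p. s p \<in> S p)"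
proof
  assume s: "s \<in> sections M (sub_bundle M E S)"
  have sS: "s p \<in> S p" for p using sec_fib[OF s] by simp
  have "lsmooth E UNIV s"
  proof (rule lsmooth_local)
    fix p :: 'm
    obtain U k r \<Phi> where p: "p \<in> U" and a: "adapted_triv M E S U k r \<Phi>" by (rule subbundleE[OF S])
    note aD = adapted_trivD[OF a]
    have t: "(U, r, \<Phi>) \<in> trivs (sub_bundle M E S)" using a by (auto simp: sub_bundle_trivs)
    have "lsmooth E U s"
    proof (rule lsmooth_trivI[OF E aD(1,4) order_refl sub_fib[OF S sS]])
      fix i
      show "smooth_fun M U (\<lambda>p. \<Phi> p (s p) i)"
      proof (cases "i < r")
        case True
        then show ?thesis using lsmoothD(2)[OF s[unfolded sections_iff] t] by simp
      next
        case False
        show ?thesis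
          by (rule smooth_fun_cong[OF aD(4) smooth_fun_const[OF aD(4), of 0]])
            (use False aD(5) sS in \<open>auto simp: not_less\<close>)
      qed
    qed
    then show "\<exists>W'. open W' \<and> p \<in> W' \<and> lsmooth E (UNIV \<inter> W') s" using aD(4) p by auto
  qed
  then show "s \<in> sections M E \<and> (\<forall>p. s p \<in> S p)" using sS by (simp add: sections_iff)
next
  assume s: "s \<in> sections M E \<and> (\<forall>p. s p \<in> S p)"
  then have s': "lsmooth E UNIV s" by (simp add: sections_iff)
  show "s \<in> sections M (sub_bundle M E S)"
    unfolding sections_iff
  proof (rule lsmoothI)
    show "s p \<in> fib (sub_bundle M E S) p" for p using s by simp
    fix U r \<Phi> i assume "(U, r, \<Phi>) \<in> trivs (sub_bundle M E S)"
    then obtain k where a: "adapted_triv M E S U k r \<Phi>" by (auto simp: sub_bundle_trivs)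
    show "smooth_fun M (U \<inter> UNIV) (\<lambda>p. \<Phi> p (s p) i)"
      by (rule lsmooth_triv[OF E adapted_trivD(1)[OF a] open_UNIV s'])
  qed
qed

subsection \<open>Quotient bundles\<close>

definition rep :: "'a set \<Rightarrow> 'a" where "rep a = (SOME u. u \<in> a)"

lemma pr_eqI:
  assumes E: "vector_bundle M E" and S: "subbundle M E S" and u: "u \<in> fib E p" and v: "v \<in> fib E p"
    and d: "vminus E p u v \<in> S p"
  shows "pr E S p u = pr E S p v"
proof -
  have "pr E S p u' \<subseteq> pr E S p v'" if u': "u' \<in> fib E p" and v': "v' \<in> fib E p" and d: "vminus E p u' v' \<in> S p" for u' v'
  proof
    fix x assume "x \<in> pr E S p u'"
    then obtain w where w: "w \<in> S p" "x = vadd E p u' w" by (auto simp: pr_def)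
    have wf: "w \<in> fib E p" by (rule sub_fib[OF S w(1)])
    have "x = vadd E p v' (vadd E p (vminus E p u' v') w)"
      unfolding w(2) by (rule fib_eqI[OF E, where p = p]) (simp_all add: fibs crds E u' v' wf)
    then show "x \<in> pr E S p v'" unfolding pr_def using sub_add[OF E S d w(1)] by blast
  qed
  moreover have "vminus E p v u = vscale E p (-1) (vminus E p u v)"
    by (rule fib_eqI[OF E, where p = p]) (simp_all add: fibs crds E u v)
  ultimately show ?thesis using u v d sub_scale[OF E S d, of "-1"] by (intro equalityI) simp_all
qed

lemma pr_self:
  assumes E: "vector_bundle M E" and S: "subbundle M E S" and u: "u \<in> fib E p"
  shows "u \<in> pr E S p u"
proof -
  have "u = vadd E p u (vzero E p)"
    by (rule fib_eqI[OF E, where p = p]) (simp_all add: fibs crds E u)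
  then show ?thesis unfolding pr_def using sub_zero[OF E S] by blast
qed

lemma in_pr:
  assumes E: "vector_bundle M E" and S: "subbundle M E S" and v: "v \<in> fib E p" and u: "u \<in> pr E S p v"
  shows "u \<in> fib E p" "vminus E p u v \<in> S p"
proof -
  obtain w where w: "w \<in> S p" "u = vadd E p v w" using u by (auto simp: pr_def)
  have wf: "w \<in> fib E p" by (rule sub_fib[OF S w(1)])
  show "u \<in> fib E p" unfolding w(2) by (simp add: fibs E v wf)
  have "vminus E p u v = w" unfolding w(2)
    by (rule fib_eqI[OF E, where p = p]) (simp_all add: fibs crds E v wf)
  then show "vminus E p u v \<in> S p" using w(1) by simp
qed

lemma pr_eqD:
  assumes E: "vector_bundle M E" and S: "subbundle M E S" and u: "u \<in> fib E p" and v: "v \<in> fib E p"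
    and e: "pr E S p u = pr E S p v"
  shows "vminus E p u v \<in> S p"
  using in_pr(2)[OF E S v, of u] pr_self[OF E S u] e by simp

lemma rep_pr:
  assumes E: "vector_bundle M E" and S: "subbundle M E S" and v: "v \<in> fib E p"
  shows "rep (pr E S p v) \<in> fib E p" "vminus E p (rep (pr E S p v)) v \<in> S p" "pr E S p (rep (pr E S p v)) = pr E S p v"
proof -
  have "\<exists>u. u \<in> pr E S p v" using pr_self[OF E S v] by blast
  then have r: "rep (pr E S p v) \<in> pr E S p v" unfolding rep_def by (rule someI_ex)
  show 1: "rep (pr E S p v) \<in> fib E p" "vminus E p (rep (pr E S p v)) v \<in> S p" using in_pr[OF E S v r] .
  show "pr E S p (rep (pr E S p v)) = pr E S p v" by (rule pr_eqI[OF E S 1(1) v 1(2)])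
qed

lemma quot_fib: "a \<in> fib (quot_bundle M E S) p \<longleftrightarrow> (\<exists>v\<in>fib E p. a = pr E S p v)"
  by (auto simp: quot_bundle_def)

lemma pr_fib: "v \<in> fib E p \<Longrightarrow> pr E S p v \<in> fib (quot_bundle M E S) p"
  by (auto simp: quot_fib)

lemma quot_zero: "vzero (quot_bundle M E S) p = pr E S p (vzero E p)"
  by (simp add: quot_bundle_def)

lemma quot_add:
  assumes E: "vector_bundle M E" and S: "subbundle M E S" and u: "u \<in> fib E p" and v: "v \<in> fib E p"
  shows "vadd (quot_bundle M E S) p (pr E S p u) (pr E S p v) = pr E S p (vadd E p u v)"
proof -
  note u' = rep_pr[OF E S u] and v' = rep_pr[OF E S v]
  have "vminus E p (vadd E p (rep (pr E S p u)) (rep (pr E S p v))) (vadd E p u v) =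
      vadd E p (vminus E p (rep (pr E S p u)) u) (vminus E p (rep (pr E S p v)) v)"
    by (rule fib_eqI[OF E, where p = p]) (simp_all add: fibs crds E u v u'(1) v'(1))
  then have "pr E S p (vadd E p (rep (pr E S p u)) (rep (pr E S p v))) = pr E S p (vadd E p u v)"
    by (intro pr_eqI[OF E S]) (simp_all add: fibs E u v u'(1) v'(1) sub_add[OF E S u'(2) v'(2)])
  then show ?thesis by (simp add: quot_bundle_def rep_def)
qed

lemma quot_scale:
  assumes E: "vector_bundle M E" and S: "subbundle M E S" and u: "u \<in> fib E p"
  shows "vscale (quot_bundle M E S) p c (pr E S p u) = pr E S p (vscale E p c u)"
proof -
  note u' = rep_pr[OF E S u]
  have "vminus E p (vscale E p c (rep (pr E S p u))) (vscale E p c u) = vscale E p c (vminus E p (rep (pr E S p u)) u)"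
    by (rule fib_eqI[OF E, where p = p]) (simp_all add: fibs crds E u u'(1) right_diff_distrib)
  then have "pr E S p (vscale E p c (rep (pr E S p u))) = pr E S p (vscale E p c u)"
    by (intro pr_eqI[OF E S]) (simp_all add: fibs E u u'(1) sub_scale[OF E S u'(2)])
  then show ?thesis by (simp add: quot_bundle_def rep_def)
qed

definition qtriv :: "nat \<Rightarrow> ('m \<Rightarrow> 'e \<Rightarrow> nat \<Rightarrow> real) \<Rightarrow> 'm \<Rightarrow> 'e set \<Rightarrow> nat \<Rightarrow> real" where
  "qtriv r \<Phi> = (\<lambda>p a i. \<Phi> p (rep a) (r + i))"

lemma quot_trivs: "(U, m, \<Theta>) \<in> trivs (quot_bundle M E S) \<longleftrightarrow>
    (\<exists>k r \<Phi>. adapted_triv M E S U k r \<Phi> \<and> m = k - r \<and> \<Theta> = qtriv r \<Phi>)"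
  by (auto simp: quot_bundle_def qtriv_def rep_def)

text \<open>The chosen representative differs from \<open>v\<close> by an element of
  \<open>S\<close>, whose coordinates from \<open>r\<close> on vanish.\<close>

lemma qtriv_pr:
  assumes E: "vector_bundle M E" and S: "subbundle M E S" and a: "adapted_triv M E S U k r \<Phi>"
    and p: "p \<in> U" and v: "v \<in> fib E p"
  shows "qtriv r \<Phi> p (pr E S p v) i = \<Phi> p v (r + i)"
proof -
  note aD = adapted_trivD[OF a] and v' = rep_pr[OF E S v]
  have "\<Phi> p (vminus E p (rep (pr E S p v)) v) (r + i) = 0" using v'(2) aD(5)[OF p] by auto
  then show ?thesis unfolding qtriv_def using triv_minus[OF E aD(3) p v'(1) v] by simp
qed

lemma quot_local_triv:
  assumes E: "vector_bundle M E" and S: "subbundle M E S" and a: "adapted_triv M E S U k r \<Phi>"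
  shows "local_triv (quot_bundle M E S) U (k - r) (qtriv r \<Phi>)"
proof (rule local_trivI)
  note aD = adapted_trivD[OF a] and q = qtriv_pr[OF E S a]
  show "open U" by (rule aD(4))
  fix p assume p: "p \<in> U"
  let ?Q = "quot_bundle M E S"
  show "bij_betw (qtriv r \<Phi> p) (fib ?Q p) (topspace (Euclidean_space (k - r)))"
  proof (rule bij_betw_EuclideanI)
    show "qtriv r \<Phi> p u i = 0" if "u \<in> fib ?Q p" "k - r \<le> i" for u i
      using that local_triv_ge[OF aD(3) p, of _ "r + i"] by (auto simp: quot_fib q[OF p])
    show "a1 = a2" if a12: "a1 \<in> fib ?Q p" "a2 \<in> fib ?Q p" "\<And>i. i < k - r \<Longrightarrow> qtriv r \<Phi> p a1 i = qtriv r \<Phi> p a2 i" for a1 a2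
    proof -
      obtain u v where u: "u \<in> fib E p" "a1 = pr E S p u" and v: "v \<in> fib E p" "a2 = pr E S p v"
        using a12(1,2) by (auto simp: quot_fib)
      have "\<Phi> p (vminus E p u v) i = 0" if i: "i \<ge> r" for i
      proof (cases "i < k")
        case True
        then have "\<Phi> p u (r + (i - r)) = \<Phi> p v (r + (i - r))"
          using a12(3)[of "i - r"] i q[OF p u(1)] q[OF p v(1)] u(2) v(2) by simp
        then show ?thesis using i by (simp add: triv_minus[OF E aD(3) p u(1) v(1)])
      next
        case False
        then show ?thesis by (intro local_triv_ge[OF aD(3) p]) (simp_all add: fibs E u v)
      qed
      then have "vminus E p u v \<in> S p" using aD(5)[OF p] by (simp add: fibs E u v)
      then show ?thesis unfolding u(2) v(2) by (rule pr_eqI[OF E S u(1) v(1)])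
    qed
    fix x :: "nat \<Rightarrow> real" assume x: "\<And>i. k - r \<le> i \<Longrightarrow> x i = 0"
    define y where "y i = (if i < r then 0 else x (i - r))" for i
    have ge: "y i = 0" if "k \<le> i" for i using x[of "i - r"] that aD(2) by (simp add: y_def)
    note vy = vec_of[OF aD(3) p ge]
    show "\<exists>u\<in>fib ?Q p. \<forall>i<k - r. qtriv r \<Phi> p u i = x i"
      by (rule bexI[of _ "pr E S p (vec_of E \<Phi> p y)"]) (simp_all add: pr_fib vy q[OF p vy(1)], simp add: y_def)
  qed
  show "qtriv r \<Phi> p (vadd ?Q p a1 a2) i = qtriv r \<Phi> p a1 i + qtriv r \<Phi> p a2 i"
    if "a1 \<in> fib ?Q p" "a2 \<in> fib ?Q p" for a1 a2 i
    using that by (auto simp: quot_fib quot_add[OF E S] q[OF p] fibs E local_trivD(3)[OF aD(3) p])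
  show "qtriv r \<Phi> p (vscale ?Q p c a1) i = c * qtriv r \<Phi> p a1 i"
    if "a1 \<in> fib ?Q p" for a1 c i
    using that by (auto simp: quot_fib quot_scale[OF E S] q[OF p] fibs E local_trivD(4)[OF aD(3) p])
qed

lemma quot_vector_bundle:
  assumes E: "vector_bundle M E" and S: "subbundle M E S"
  shows "vector_bundle M (quot_bundle M E S)"
proof (rule vector_bundleI)
  let ?Q = "quot_bundle M E S"
  show "vzero ?Q p \<in> fib ?Q p" for p by (simp add: quot_zero pr_fib fibs E)
  show "vadd ?Q p (vzero ?Q p) a = a" if "a \<in> fib ?Q p" for p a
    using that by (auto simp: quot_fib quot_zero quot_add[OF E S] fibs E vector_bundleD(2)[OF E])
  show "vadd ?Q p a b \<in> fib ?Q p" if ab: "a \<in> fib ?Q p" "b \<in> fib ?Q p" for p a b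
  proof -
    obtain u v where u: "u \<in> fib E p" "a = pr E S p u" and v: "v \<in> fib E p" "b = pr E S p v"
      using ab by (auto simp: quot_fib)
    show ?thesis unfolding u(2) v(2) quot_add[OF E S u(1) v(1)] by (intro pr_fib fibs E u v)
  qed
  show "vscale ?Q p c a \<in> fib ?Q p" if a: "a \<in> fib ?Q p" for p c a
  proof -
    obtain u where u: "u \<in> fib E p" "a = pr E S p u" using a by (auto simp: quot_fib)
    show ?thesis unfolding u(2) quot_scale[OF E S u(1)] by (intro pr_fib fibs E u)
  qed
  show "local_triv ?Q U k \<Phi>" if "(U, k, \<Phi>) \<in> trivs ?Q" for U k \<Phi>
    using that quot_local_triv[OF E S] by (auto simp: quot_trivs)
  show "\<exists>U k \<Phi>. (U, k, \<Phi>) \<in> trivs ?Q \<and> p \<in> U" for p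
    by (rule subbundleE[OF S, of p]) (auto simp: quot_trivs)
  fix U m \<Theta> V n \<Xi>
  assume "(U, m, \<Theta>) \<in> trivs ?Q" "(V, n, \<Xi>) \<in> trivs ?Q"
  then obtain k r \<Phi> k' r' \<Psi> where a: "adapted_triv M E S U k r \<Phi>" and a': "adapted_triv M E S V k' r' \<Psi>"
    and m: "m = k - r" "n = k' - r'" "\<Theta> = qtriv r \<Phi>" "\<Xi> = qtriv r' \<Psi>"
    unfolding quot_trivs by blast
  note aD = adapted_trivD[OF a] and aD' = adapted_trivD[OF a']
  show "smooth_transition M ?Q U m \<Theta> V n \<Xi>"
    unfolding smooth_transition_def
  proof (intro allI impI)
    fix j i assume j: "j < m" and i: "i < n"
    have jk: "r + j < k" using j m(1) by simp
    have o: "open (V \<inter> U)" using aD(4) aD'(4) by auto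
    \<comment> \<open>The transition matrix of the quotient is the lower right block of a transition
      matrix of \<open>E\<close> between adapted trivialisations.\<close>
    have "smooth_fun M (V \<inter> U) (\<lambda>p. \<Psi> p (frame E \<Phi> (r + j) p) (r' + i))"
      by (rule lsmooth_triv[OF E aD'(1) aD(4) frame_lsmooth[OF E aD(1) jk]])
    then have "smooth_fun M (V \<inter> U) (\<lambda>p. \<Xi> p (frame ?Q \<Theta> j p) i)"
    proof (rule smooth_fun_cong[OF o])
      fix p assume "p \<in> V \<inter> U"
      then have p: "p \<in> U" "p \<in> V" by simp_all
      note fr = frame_props[OF aD(3) p(1) jk]
      have "frame ?Q \<Theta> j p = pr E S p (frame E \<Phi> (r + j) p)" unfolding m(3)
        by (rule frame_eqI[OF quot_local_triv[OF E S a] p(1)])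
          (simp_all add: j[unfolded m(1)] pr_fib fr qtriv_pr[OF E S a p(1) fr(1)])
      then show "\<Psi> p (frame E \<Phi> (r + j) p) (r' + i) = \<Xi> p (frame ?Q \<Theta> j p) i"
        by (simp add: m(4) qtriv_pr[OF E S a' p(2) fr(1)])
    qed
    then show "smooth_fun M (U \<inter> V) (\<lambda>p. \<Xi> p (frame ?Q \<Theta> j p) i)" by (simp add: Int_commute)
  qed
qed

lemma pr_linear_on:
  assumes E: "vector_bundle M E" and S: "subbundle M E S"
  shows "linear_on E (quot_bundle M E S) p (pr E S p)"
  by (rule linear_onI) (simp_all add: pr_fib quot_add[OF E S] quot_scale[OF E S])

lemma pr_bundle_map:
  assumes E: "vector_bundle M E" and S: "subbundle M E S"
  shows "bundle_map M E (quot_bundle M E S) (pr E S)"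
proof (rule bundle_mapI[OF E quot_vector_bundle[OF E S] pr_linear_on[OF E S]])
  fix s assume s: "s \<in> sections M E"
  show "sapp (pr E S) s \<in> sections M (quot_bundle M E S)"
    unfolding sections_iff
  proof (rule lsmoothI)
    show "sapp (pr E S) s p \<in> fib (quot_bundle M E S) p" for p by (simp add: sapp_def pr_fib sec_fib[OF s])
    fix U m \<Theta> i assume "(U, m, \<Theta>) \<in> trivs (quot_bundle M E S)"
    then obtain k r \<Phi> where a: "adapted_triv M E S U k r \<Phi>" and m: "\<Theta> = qtriv r \<Phi>"
      unfolding quot_trivs by blast
    note aD = adapted_trivD[OF a]
    have "smooth_fun M U (\<lambda>p. \<Phi> p (s p) (r + i))"
      using lsmooth_triv[OF E aD(1) open_UNIV s[unfolded sections_iff], of "r + i"] by simp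
    then show "smooth_fun M (U \<inter> UNIV) (\<lambda>p. \<Theta> p (sapp (pr E S) s p) i)"
      using smooth_fun_cong[OF aD(4), of "\<lambda>p. \<Phi> p (s p) (r + i)" "\<lambda>p. \<Theta> p (sapp (pr E S) s p) i"]
      by (simp add: m sapp_def qtriv_pr[OF E S a _ sec_fib[OF s]])
  qed
qed

end


subsection \<open>Direct sums\<close>

definition striv :: "nat \<Rightarrow> ('m \<Rightarrow> 'e \<Rightarrow> nat \<Rightarrow> real) \<Rightarrow> ('m \<Rightarrow> 'f \<Rightarrow> nat \<Rightarrow> real) \<Rightarrow> 'm \<Rightarrow> 'e \<times> 'f \<Rightarrow> nat \<Rightarrow> real" where
  "striv k \<Phi> \<Psi> = (\<lambda>p (u, w) i. if i < k then \<Phi> p u i else \<Psi> p w (i - k))"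

lemma sum_bundle_simps [simp]:
  "fib (sum_bundle E F) p = fib E p \<times> fib F p"
  "vzero (sum_bundle E F) p = (vzero E p, vzero F p)"
  "vadd (sum_bundle E F) p x y = (vadd E p (fst x) (fst y), vadd F p (snd x) (snd y))"
  "vscale (sum_bundle E F) p c x = (vscale E p c (fst x), vscale F p c (snd x))"
  "vminus (sum_bundle E F) p x y = (vminus E p (fst x) (fst y), vminus F p (snd x) (snd y))"
  by (auto simp: sum_bundle_def vminus_def split: prod.splits)

lemma sum_trivs: "(W, n, \<Theta>) \<in> trivs (sum_bundle E F) \<longleftrightarrow>
    (\<exists>U k \<Phi> V l \<Psi>. W = U \<inter> V \<and> n = k + l \<and> \<Theta> = striv k \<Phi> \<Psi> \<and> (U, k, \<Phi>) \<in> trivs E \<and> (V, l, \<Psi>) \<in> trivs F)"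
  by (auto simp: sum_bundle_def striv_def)

lemma striv_simp: "striv k \<Phi> \<Psi> p x i = (if i < k then \<Phi> p (fst x) i else \<Psi> p (snd x) (i - k))"
  by (cases x) (simp add: striv_def)

context smooth_mfd
begin

lemma sum_local_triv:
  assumes "local_triv E U k \<Phi>" "local_triv F V l \<Psi>"
  shows "local_triv (sum_bundle E F) (U \<inter> V) (k + l) (striv k \<Phi> \<Psi>)"
proof (rule local_trivI)
  show "open (U \<inter> V)" by (intro open_Int local_trivD(1)[OF assms(1)] local_trivD(1)[OF assms(2)])
  fix p assume "p \<in> U \<inter> V"
  then have p: "p \<in> U" "p \<in> V" by auto
  show "bij_betw (striv k \<Phi> \<Psi> p) (fib (sum_bundle E F) p) (topspace (Euclidean_space (k + l)))"
  proof (rule bij_betw_EuclideanI)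
    show "striv k \<Phi> \<Psi> p u i = 0" if "u \<in> fib (sum_bundle E F) p" "k + l \<le> i" for u i
      using that local_triv_ge[OF assms(2) p(2), of "snd u" "i - k"] by (auto simp: striv_simp)
    show "u = v" if uv: "u \<in> fib (sum_bundle E F) p" "v \<in> fib (sum_bundle E F) p"
      "\<And>i. i < k + l \<Longrightarrow> striv k \<Phi> \<Psi> p u i = striv k \<Phi> \<Psi> p v i" for u v
    proof (rule prod_eqI)
      show "fst u = fst v"
      proof (rule local_triv_inj[OF assms(1) p(1)])
        show "\<Phi> p (fst u) i = \<Phi> p (fst v) i" if "i < k" for i
          using uv(3)[of i] that by (simp add: striv_simp)
      qed (use uv in auto)
      show "snd u = snd v"
      proof (rule local_triv_inj[OF assms(2) p(2)])
        show "\<Psi> p (snd u) i = \<Psi> p (snd v) i" if "i < l" for i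
          using uv(3)[of "k + i"] that by (simp add: striv_simp)
      qed (use uv in auto)
    qed
    fix x :: "nat \<Rightarrow> real" assume x: "\<And>i. k + l \<le> i \<Longrightarrow> x i = 0"
    define y where "y i = (if i < k then x i else 0)" for i
    define z where "z i = x (k + i)" for i
    have y0: "\<And>i. k \<le> i \<Longrightarrow> y i = 0" by (simp add: y_def)
    have z0: "\<And>i. l \<le> i \<Longrightarrow> z i = 0" by (simp add: z_def x)
    note vy = vec_of[OF assms(1) p(1) y0] and vz = vec_of[OF assms(2) p(2) z0]
    show "\<exists>u\<in>fib (sum_bundle E F) p. \<forall>i<k + l. striv k \<Phi> \<Psi> p u i = x i"
      by (rule bexI[of _ "(vec_of E \<Phi> p y, vec_of F \<Psi> p z)"])
        (simp_all add: striv_simp vy vz, simp add: y_def z_def)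
  qed
  show "striv k \<Phi> \<Psi> p (vadd (sum_bundle E F) p u v) i = striv k \<Phi> \<Psi> p u i + striv k \<Phi> \<Psi> p v i"
    if "u \<in> fib (sum_bundle E F) p" "v \<in> fib (sum_bundle E F) p" for u v i
    using that by (auto simp: striv_simp local_trivD(3)[OF assms(1) p(1)] local_trivD(3)[OF assms(2) p(2)])
  show "striv k \<Phi> \<Psi> p (vscale (sum_bundle E F) p c u) i = c * striv k \<Phi> \<Psi> p u i"
    if "u \<in> fib (sum_bundle E F) p" for u c i
    using that by (auto simp: striv_simp local_trivD(4)[OF assms(1) p(1)] local_trivD(4)[OF assms(2) p(2)])
qed

lemma sum_frame:
  assumes E: "vector_bundle M E" and F: "vector_bundle M F"
    and t: "local_triv E U k \<Phi>" "local_triv F V l \<Psi>" and p: "p \<in> U" "p \<in> V" and j: "j < k + l"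
  shows "frame (sum_bundle E F) (striv k \<Phi> \<Psi>) j p =
    (if j < k then (frame E \<Phi> j p, vzero F p) else (vzero E p, frame F \<Psi> (j - k) p))"
proof (rule frame_eqI[OF sum_local_triv[OF t] _ j])
  show "p \<in> U \<inter> V" using p by simp
  show "(if j < k then (frame E \<Phi> j p, vzero F p) else (vzero E p, frame F \<Psi> (j - k) p)) \<in> fib (sum_bundle E F) p"
    using j by (auto simp: fibs E F frame_props(1)[OF t(1) p(1)] frame_props(1)[OF t(2) p(2)])
  show "striv k \<Phi> \<Psi> p (if j < k then (frame E \<Phi> j p, vzero F p) else (vzero E p, frame F \<Psi> (j - k) p)) i =
    (if i = j then 1 else 0)" for i
  proof (cases "j < k")
    case True
    then show ?thesis by (auto simp: striv_simp frame_props(2)[OF t(1) p(1)] triv_zero[OF F t(2) p(2)])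
  next
    case False
    then have "j - k < l" using j by simp
    from frame_props(2)[OF t(2) p(2) this] False show ?thesis
      by (auto simp: striv_simp triv_zero[OF E t(1) p(1)])
  qed
qed

lemma sum_vector_bundle:
  assumes E: "vector_bundle M E" and F: "vector_bundle M F"
  shows "vector_bundle M (sum_bundle E F)"
proof (rule vector_bundleI)
  let ?S = "sum_bundle E F"
  show "local_triv ?S U k \<Phi>" if "(U, k, \<Phi>) \<in> trivs ?S" for U k \<Phi>
    using that sum_local_triv vector_bundleD(5)[OF E] vector_bundleD(5)[OF F] unfolding sum_trivs by metis
  show "\<exists>U k \<Phi>. (U, k, \<Phi>) \<in> trivs ?S \<and> p \<in> U" for p
  proof -
    obtain U k \<Phi> where "(U, k, \<Phi>) \<in> trivs E" "p \<in> U" using vector_bundleD(7)[OF E] by blast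
    moreover obtain V l \<Psi> where "(V, l, \<Psi>) \<in> trivs F" "p \<in> V" using vector_bundleD(7)[OF F] by blast
    ultimately have "(U \<inter> V, k + l, striv k \<Phi> \<Psi>) \<in> trivs ?S \<and> p \<in> U \<inter> V"
      unfolding sum_trivs by blast
    then show ?thesis by blast
  qed
  fix W n \<Theta> W' n' \<Theta>'
  assume "(W, n, \<Theta>) \<in> trivs ?S" "(W', n', \<Theta>') \<in> trivs ?S"
  then obtain U k \<Phi> V l \<Psi> U' k' \<Phi>' V' l' \<Psi>'
    where t: "W = U \<inter> V" "n = k + l" "\<Theta> = striv k \<Phi> \<Psi>" "(U, k, \<Phi>) \<in> trivs E" "(V, l, \<Psi>) \<in> trivs F"
      and t': "W' = U' \<inter> V'" "n' = k' + l'" "\<Theta>' = striv k' \<Phi>' \<Psi>'" "(U', k', \<Phi>') \<in> trivs E" "(V', l', \<Psi>') \<in> trivs F"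
    unfolding sum_trivs by blast
  note l = vector_bundleD(5)[OF E t(4)] vector_bundleD(5)[OF F t(5)]
  note l' = vector_bundleD(5)[OF E t'(4)] vector_bundleD(5)[OF F t'(5)]
  have o: "open (W \<inter> W')" unfolding t(1) t'(1) using local_trivD(1)[OF l(1)] local_trivD(1)[OF l(2)] local_trivD(1)[OF l'(1)] local_trivD(1)[OF l'(2)] by auto
  show "smooth_transition M ?S W n \<Theta> W' n' \<Theta>'"
    unfolding smooth_transition_def
  proof (intro allI impI)
    fix j i assume j: "j < n" and i: "i < n'"
    have fr: "frame ?S \<Theta> j p = (if j < k then (frame E \<Phi> j p, vzero F p) else (vzero E p, frame F \<Psi> (j - k) p))"
      if "p \<in> W \<inter> W'" for p
      unfolding t(3) by (rule sum_frame[OF E F l]) (use that j t(1,2) in auto)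
    have z: "\<Phi>' p (vzero E p) a = 0" "\<Psi>' p (vzero F p) a = 0" if "p \<in> W \<inter> W'" for p a
      using that t'(1) triv_zero[OF E l'(1)] triv_zero[OF F l'(2)] by auto
    have c: "smooth_fun M (W \<inter> W') (\<lambda>_. 0)" by (rule smooth_fun_const[OF o])
    \<comment> \<open>Transition matrices of a direct sum are block diagonal; in the two mixed cases
      the entry is identically 0.\<close>
    consider "j < k" "i < k'" | "j < k" "\<not> i < k'" | "\<not> j < k" "i < k'" | "\<not> j < k" "\<not> i < k'" by blast
    then show "smooth_fun M (W \<inter> W') (\<lambda>p. \<Theta>' p (frame ?S \<Theta> j p) i)"
    proof cases
      case 1
      have "smooth_fun M (W \<inter> W') (\<lambda>p. \<Phi>' p (frame E \<Phi> j p) i)"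
        by (rule smooth_fun_subset[OF smooth_trivD(2)[OF triv_smooth[OF E t(4)] t'(4) 1]]) (auto simp: t(1) t'(1))
      then show ?thesis by (rule smooth_fun_cong[OF o]) (simp add: fr 1 t'(3) striv_simp)
    next
      case 2
      show ?thesis by (rule smooth_fun_cong[OF o c]) (simp add: fr 2 t'(3) striv_simp z)
    next
      case 3
      show ?thesis by (rule smooth_fun_cong[OF o c]) (simp add: fr 3 t'(3) striv_simp z)
    next
      case 4
      have ji: "j - k < l" "i - k' < l'" using 4 j i t(2) t'(2) by auto
      have "smooth_fun M (W \<inter> W') (\<lambda>p. \<Psi>' p (frame F \<Psi> (j - k) p) (i - k'))"
        by (rule smooth_fun_subset[OF smooth_trivD(2)[OF triv_smooth[OF F t(5)] t'(5) ji]]) (auto simp: t(1) t'(1))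
      then show ?thesis by (rule smooth_fun_cong[OF o]) (simp add: fr 4 t'(3) striv_simp)
    qed
  qed
qed (auto simp: fibs E F vector_bundleD(2)[OF E] vector_bundleD(2)[OF F])

lemma sum_sections:
  assumes E: "vector_bundle M E" and F: "vector_bundle M F"
  shows "s \<in> sections M (sum_bundle E F) \<longleftrightarrow> (fst \<circ> s) \<in> sections M E \<and> (snd \<circ> s) \<in> sections M F"
proof
  assume s: "s \<in> sections M (sum_bundle E F)"
  have f: "fst (s p) \<in> fib E p \<and> snd (s p) \<in> fib F p" for p using sec_fib[OF s, of p] by auto
  have sm: "smooth_fun M (U \<inter> V) (\<lambda>p. striv k \<Phi> \<Psi> p (s p) i)"
    if "(U, k, \<Phi>) \<in> trivs E" "(V, l, \<Psi>) \<in> trivs F" "i < k + l" for U k \<Phi> V l \<Psi> i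
  proof -
    have "(U \<inter> V, k + l, striv k \<Phi> \<Psi>) \<in> trivs (sum_bundle E F)" unfolding sum_trivs using that by blast
    from lsmoothD(2)[OF s[unfolded sections_iff] this that(3)] show ?thesis by simp
  qed
  have "fst \<circ> s \<in> sections M E"
    unfolding sections_iff
  proof (rule lsmoothI)
    show "(fst \<circ> s) p \<in> fib E p" for p using f by simp
    fix U k \<Phi> i assume t: "(U, k, \<Phi>) \<in> trivs E" and i: "i < k"
    show "smooth_fun M (U \<inter> UNIV) (\<lambda>p. \<Phi> p ((fst \<circ> s) p) i)"
    proof (rule smooth_fun_local)
      fix p assume "p \<in> U \<inter> UNIV"
      obtain V l \<Psi> where V: "(V, l, \<Psi>) \<in> trivs F" "p \<in> V" using vector_bundleD(7)[OF F] by blast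
      have "smooth_fun M (U \<inter> V) (\<lambda>p. striv k \<Phi> \<Psi> p (s p) i)" by (rule sm[OF t V(1)]) (use i in simp)
      then have "smooth_fun M (U \<inter> UNIV \<inter> V) (\<lambda>p. \<Phi> p ((fst \<circ> s) p) i)" using i by (simp add: striv_simp)
      then show "\<exists>W'. open W' \<and> p \<in> W' \<and> smooth_fun M (U \<inter> UNIV \<inter> W') (\<lambda>p. \<Phi> p ((fst \<circ> s) p) i)"
        using V(2) trivs_open[OF F V(1)] by blast
    qed
  qed
  moreover have "snd \<circ> s \<in> sections M F"
    unfolding sections_iff
  proof (rule lsmoothI)
    show "(snd \<circ> s) p \<in> fib F p" for p using f by simp
    fix V l \<Psi> i assume t: "(V, l, \<Psi>) \<in> trivs F" and i: "i < l"
    show "smooth_fun M (V \<inter> UNIV) (\<lambda>p. \<Psi> p ((snd \<circ> s) p) i)"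
    proof (rule smooth_fun_local)
      fix p assume "p \<in> V \<inter> UNIV"
      obtain U k \<Phi> where U: "(U, k, \<Phi>) \<in> trivs E" "p \<in> U" using vector_bundleD(7)[OF E] by blast
      have "smooth_fun M (U \<inter> V) (\<lambda>p. striv k \<Phi> \<Psi> p (s p) (k + i))" by (rule sm[OF U(1) t]) (use i in simp)
      then have "smooth_fun M (V \<inter> UNIV \<inter> U) (\<lambda>p. \<Psi> p ((snd \<circ> s) p) i)" by (simp add: striv_simp Int_commute)
      then show "\<exists>W'. open W' \<and> p \<in> W' \<and> smooth_fun M (V \<inter> UNIV \<inter> W') (\<lambda>p. \<Psi> p ((snd \<circ> s) p) i)"
        using U(2) trivs_open[OF E U(1)] by blast
    qed
  qed
  ultimately show "(fst \<circ> s) \<in> sections M E \<and> (snd \<circ> s) \<in> sections M F" ..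
next
  assume s: "(fst \<circ> s) \<in> sections M E \<and> (snd \<circ> s) \<in> sections M F"
  then have s1: "lsmooth E UNIV (fst \<circ> s)" and s2: "lsmooth F UNIV (snd \<circ> s)" by (simp_all add: sections_iff)
  show "s \<in> sections M (sum_bundle E F)"
    unfolding sections_iff
  proof (rule lsmoothI)
    show "s p \<in> fib (sum_bundle E F) p" for p
      using lsmoothD(1)[OF s1, of p] lsmoothD(1)[OF s2, of p] by (simp add: mem_Times_iff)
    fix W n \<Theta> i assume "(W, n, \<Theta>) \<in> trivs (sum_bundle E F)" and i: "i < n"
    then obtain U k \<Phi> V l \<Psi> where t: "W = U \<inter> V" "n = k + l" "\<Theta> = striv k \<Phi> \<Psi>" "(U, k, \<Phi>) \<in> trivs E" "(V, l, \<Psi>) \<in> trivs F"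
      unfolding sum_trivs by blast
    show "smooth_fun M (W \<inter> UNIV) (\<lambda>p. \<Theta> p (s p) i)"
    proof (cases "i < k")
      case True
      have "smooth_fun M (W \<inter> UNIV) (\<lambda>p. \<Phi> p ((fst \<circ> s) p) i)"
        by (rule smooth_fun_subset[OF lsmoothD(2)[OF s1 t(4) True]]) (simp add: t(1))
      then show ?thesis using True by (simp add: t(3) striv_simp)
    next
      case False
      have "i - k < l" using False i t(2) by simp
      have "smooth_fun M (W \<inter> UNIV) (\<lambda>p. \<Psi> p ((snd \<circ> s) p) (i - k))"
        by (rule smooth_fun_subset[OF lsmoothD(2)[OF s2 t(5) \<open>i - k < l\<close>]]) (simp add: t(1))
      then show ?thesis using False by (simp add: t(3) striv_simp)
    qed
  qed
qed

subsection \<open>Endomorphism bundles\<close>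

lemma hom_bundle_simps [simp]:
  "fib (hom_bundle E) p = {T \<in> extensional (fib E p). linear_on E E p T}"
  "vzero (hom_bundle E) p = (\<lambda>v\<in>fib E p. vzero E p)"
  "vadd (hom_bundle E) p S T = (\<lambda>v\<in>fib E p. vadd E p (S v) (T v))"
  "vscale (hom_bundle E) p c T = (\<lambda>v\<in>fib E p. vscale E p c (T v))"
  by (simp_all add: hom_bundle_def)

lemma hom_minus:
  "v \<in> fib E p \<Longrightarrow> vminus (hom_bundle E) p S T v = vminus E p (S v) (T v)"
  by (simp add: vminus_def)

definition htriv :: "('m, 'e, 'z) vbundle_scheme \<Rightarrow> nat \<Rightarrow> ('m \<Rightarrow> 'e \<Rightarrow> nat \<Rightarrow> real) \<Rightarrow> 'm \<Rightarrow> ('e \<Rightarrow> 'e) \<Rightarrow> nat \<Rightarrow> real" where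
  "htriv E k \<Phi> = (\<lambda>p T m. if m < k * k then \<Phi> p (T (frame E \<Phi> (m mod k) p)) (m div k) else 0)"

lemma hom_trivs: "(U, n, \<Theta>) \<in> trivs (hom_bundle E) \<longleftrightarrow>
    (\<exists>k \<Phi>. n = k * k \<and> \<Theta> = htriv E k \<Phi> \<and> (U, k, \<Phi>) \<in> trivs E)"
  by (auto simp: hom_bundle_def htriv_def)

lemma hom_fibI:
  assumes "T \<in> extensional (fib E p)" "linear_on E E p T" shows "T \<in> fib (hom_bundle E) p"
  using assms by simp

lemma hom_fibD:
  assumes "T \<in> fib (hom_bundle E) p" shows "T \<in> extensional (fib E p)" "linear_on E E p T"
  using assms by auto

lemma linear_on_restrict:
  assumes E: "vector_bundle M E" and h: "linear_on E F p h"
  shows "linear_on E F p (restrict h (fib E p))"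
  by (rule linear_onI) (simp_all add: linear_onD[OF h] fibs E)

lemma hom_fib_restrict:
  assumes E: "vector_bundle M E" and h: "linear_on E E p h"
  shows "restrict h (fib E p) \<in> fib (hom_bundle E) p"
  by (rule hom_fibI[OF restrict_extensional linear_on_restrict[OF E h]])

lemma hom_eqI:
  assumes "S \<in> fib (hom_bundle E) p" "T \<in> fib (hom_bundle E) p" "\<And>v. v \<in> fib E p \<Longrightarrow> S v = T v"
  shows "S = T"
  by (rule extensionalityI[OF hom_fibD(1)[OF assms(1)] hom_fibD(1)[OF assms(2)] assms(3)])

lemma index_mod_div:
  fixes k m :: nat assumes "m < k * k" shows "m mod k < k" "m div k < k"
proof -
  have k: "k > 0" using assms by (cases k) auto
  then show "m mod k < k" by simp
  show "m div k < k" using assms by (simp add: less_mult_imp_div_less)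
qed

lemma index_less:
  fixes i j k :: nat assumes "i < k" "j < k" shows "i * k + j < k * k" "(i * k + j) mod k = j" "(i * k + j) div k = i"
proof -
  have "i * k + j < Suc i * k" using assms by simp
  also have "\<dots> \<le> k * k" by (rule mult_le_mono1) (use assms in simp)
  finally show "i * k + j < k * k" .
qed (use assms in simp_all)

lemma htriv_entry:
  assumes "i < k" "j < k"
  shows "htriv E k \<Phi> p T (i * k + j) = \<Phi> p (T (frame E \<Phi> j p)) i"
  using index_less[OF assms] by (simp add: htriv_def)

lemma hom_local_triv:
  assumes E: "vector_bundle M E" and t: "local_triv E U k \<Phi>"
  shows "local_triv (hom_bundle E) U (k * k) (htriv E k \<Phi>)"
proof (rule local_trivI)
  show "open U" by (rule local_trivD(1)[OF t])
  fix p assume p: "p \<in> U"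
  note tD = local_trivD(3,4)[OF t p]
  let ?H = "hom_bundle E"
  have fr: "frame E \<Phi> j p \<in> fib E p" if "j < k" for j by (rule frame_props(1)[OF t p that])
  show "bij_betw (htriv E k \<Phi> p) (fib ?H p) (topspace (Euclidean_space (k * k)))"
  proof (rule bij_betw_EuclideanI)
    show "htriv E k \<Phi> p u i = 0" if "k * k \<le> i" for u i using that by (simp add: htriv_def)
    show "S = T" if S: "S \<in> fib ?H p" and T: "T \<in> fib ?H p"
      and eq: "\<And>i. i < k * k \<Longrightarrow> htriv E k \<Phi> p S i = htriv E k \<Phi> p T i" for S T
    proof (rule hom_eqI[OF S T])
      fix v assume v: "v \<in> fib E p"
      note S' = hom_fibD(2)[OF S] and T' = hom_fibD(2)[OF T]
      show "S v = T v"
      proof (rule local_triv_inj[OF t p linear_onD(1)[OF S' v] linear_onD(1)[OF T' v]])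
        fix i assume i: "i < k"
        have "\<Phi> p (S (frame E \<Phi> j p)) i = \<Phi> p (T (frame E \<Phi> j p)) i" if j: "j < k" for j
          using eq[OF index_less(1)[OF i j]] by (simp add: htriv_entry[OF i j])
        then show "\<Phi> p (S v) i = \<Phi> p (T v) i"
          using triv_expand_map[OF E t p t p S' v] triv_expand_map[OF E t p t p T' v] by simp
      qed
    qed
    fix x :: "nat \<Rightarrow> real"
    \<comment> \<open>The matrix with the row-major entries \<open>x\<close>, applied to the
      coordinates of \<open>v\<close>: the endomorphism built from it has the prescribed
      coordinates.\<close>
    define y where "y v i = (if i < k then \<Sum>j<k. x (i * k + j) * \<Phi> p v j else 0)" for v i
    have ge: "y v i = 0" if "k \<le> i" for v i using that by (simp add: y_def)
    note vy = vec_of[OF t p ge]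
    have lin: "linear_on E E p (\<lambda>v. vec_of E \<Phi> p (y v))"
    proof (rule linear_onI)
      show "vec_of E \<Phi> p (y v) \<in> fib E p" for v by (rule vy(1))
      show "vec_of E \<Phi> p (y (vadd E p u v)) = vadd E p (vec_of E \<Phi> p (y u)) (vec_of E \<Phi> p (y v))"
        if "u \<in> fib E p" "v \<in> fib E p" for u v
        by (rule local_triv_inj[OF t p])
          (simp_all add: vy fibs E tD that, simp_all add: y_def tD that distrib_left sum.distrib)
      show "vec_of E \<Phi> p (y (vscale E p c u)) = vscale E p c (vec_of E \<Phi> p (y u))" if "u \<in> fib E p" for u c
        by (rule local_triv_inj[OF t p])
          (simp_all add: vy fibs E tD that, simp_all add: y_def tD that sum_distrib_left mult.left_commute)
    qed
    show "\<exists>T\<in>fib ?H p. \<forall>i<k * k. htriv E k \<Phi> p T i = x i"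
    proof (rule bexI[OF _ hom_fib_restrict[OF E lin]], intro allI impI)
      fix m assume m: "m < k * k"
      note md = index_mod_div[OF m]
      have "htriv E k \<Phi> p (\<lambda>v\<in>fib E p. vec_of E \<Phi> p (y v)) m = y (frame E \<Phi> (m mod k) p) (m div k)"
        using m by (simp add: htriv_def fr[OF md(1)] vy)
      also have "\<dots> = (\<Sum>j<k. if j = m mod k then x (m div k * k + j) else 0)"
      proof -
        have "x (m div k * k + j) * \<Phi> p (frame E \<Phi> (m mod k) p) j = (if j = m mod k then x (m div k * k + j) else 0)" for j
          by (simp add: frame_props(2)[OF t p md(1)])
        then show ?thesis unfolding y_def using md(2) by simp
      qed
      also have "\<dots> = x m" using md(1) by simp
      finally show "htriv E k \<Phi> p (\<lambda>v\<in>fib E p. vec_of E \<Phi> p (y v)) m = x m" .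
    qed
  qed
  show "htriv E k \<Phi> p (vadd ?H p S T) i = htriv E k \<Phi> p S i + htriv E k \<Phi> p T i"
    if S: "S \<in> fib ?H p" and T: "T \<in> fib ?H p" for S T i
    using fr[OF index_mod_div(1)]
    by (simp add: htriv_def tD linear_onD(1)[OF hom_fibD(2)[OF S]] linear_onD(1)[OF hom_fibD(2)[OF T]])
  show "htriv E k \<Phi> p (vscale ?H p c S) i = c * htriv E k \<Phi> p S i"
    if S: "S \<in> fib ?H p" for S c i
    using fr[OF index_mod_div(1)]
    by (simp add: htriv_def tD linear_onD(1)[OF hom_fibD(2)[OF S]])
qed

text \<open>The frame of Hom(E, E) consists of the matrix units; in the row-major numbering the unit
  number \<open>m\<close> sits in row \<open>m div k\<close> and column
  \<open>m mod k\<close>.\<close>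

lemma hom_frame:
  assumes E: "vector_bundle M E" and t: "local_triv E U k \<Phi>" and p: "p \<in> U" and m: "m < k * k"
  shows "frame (hom_bundle E) (htriv E k \<Phi>) m p =
    (\<lambda>v\<in>fib E p. vscale E p (\<Phi> p v (m mod k)) (frame E \<Phi> (m div k) p))"
proof (rule frame_eqI[OF hom_local_triv[OF E t] p m])
  note md = index_mod_div[OF m]
  note fr = frame_props[OF t p md(2)]
  have "linear_on E E p (\<lambda>v. vscale E p (\<Phi> p v (m mod k)) (frame E \<Phi> (m div k) p))"
    by (rule linear_onI; (rule fib_eqI[OF E, where p = p])?)
      (simp_all add: fibs crds E fr local_trivD(3,4)[OF t p] algebra_simps)
  then show "(\<lambda>v\<in>fib E p. vscale E p (\<Phi> p v (m mod k)) (frame E \<Phi> (m div k) p)) \<in> fib (hom_bundle E) p"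
    by (rule hom_fib_restrict[OF E])
  fix n assume n: "n < k * k"
  note nd = index_mod_div[OF n]
  have "n = m \<longleftrightarrow> n mod k = m mod k \<and> n div k = m div k" by (metis div_mult_mod_eq)
  then show "htriv E k \<Phi> p (\<lambda>v\<in>fib E p. vscale E p (\<Phi> p v (m mod k)) (frame E \<Phi> (m div k) p)) n =
      (if n = m then 1 else 0)"
    using n frame_props[OF t p nd(1)] fr by (simp add: htriv_def local_trivD(4)[OF t p])
qed

lemma hom_vector_bundle:
  assumes E: "vector_bundle M E"
  shows "vector_bundle M (hom_bundle E)"
proof (rule vector_bundleI)
  let ?H = "hom_bundle E"
  have z: "linear_on E E p (\<lambda>_. vzero E p)" for p
    by (rule linear_onI) (simp_all add: fibs E vector_bundleD(2)[OF E] vscale_vzero)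
  show "vzero ?H p \<in> fib ?H p" for p unfolding hom_bundle_simps(2) by (rule hom_fib_restrict[OF E z])
  show "vadd ?H p (vzero ?H p) T = T" if T: "T \<in> fib ?H p" for p T
    using hom_fibD(1)[OF T] linear_onD(1)[OF hom_fibD(2)[OF T]]
    by (auto simp: vector_bundleD(2)[OF E] extensional_def fun_eq_iff)
  show "vadd ?H p S T \<in> fib ?H p" if S: "S \<in> fib ?H p" and T: "T \<in> fib ?H p" for p S T
    unfolding hom_bundle_simps(3)
  proof (rule hom_fib_restrict[OF E], rule linear_onI)
    note S' = linear_onD[OF hom_fibD(2)[OF S]] and T' = linear_onD[OF hom_fibD(2)[OF T]]
    show "vadd E p (S u) (T u) \<in> fib E p" if "u \<in> fib E p" for u by (simp add: fibs E S' T' that)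
    show "vadd E p (S (vadd E p u v)) (T (vadd E p u v)) = vadd E p (vadd E p (S u) (T u)) (vadd E p (S v) (T v))"
      if "u \<in> fib E p" "v \<in> fib E p" for u v
      by (rule fib_eqI[OF E, where p = p]) (simp_all add: fibs crds E S' T' that)
    show "vadd E p (S (vscale E p c u)) (T (vscale E p c u)) = vscale E p c (vadd E p (S u) (T u))"
      if "u \<in> fib E p" for u c
      by (rule fib_eqI[OF E, where p = p]) (simp_all add: fibs crds E S' T' that distrib_left)
  qed
  show "vscale ?H p c S \<in> fib ?H p" if S: "S \<in> fib ?H p" for p c S
    unfolding hom_bundle_simps(4)
  proof (rule hom_fib_restrict[OF E], rule linear_onI)
    note S' = linear_onD[OF hom_fibD(2)[OF S]]
    show "vscale E p c (S u) \<in> fib E p" if "u \<in> fib E p" for u by (simp add: fibs E S' that)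
    show "vscale E p c (S (vadd E p u v)) = vadd E p (vscale E p c (S u)) (vscale E p c (S v))"
      if "u \<in> fib E p" "v \<in> fib E p" for u v
      by (rule fib_eqI[OF E, where p = p]) (simp_all add: fibs crds E S' that distrib_left)
    show "vscale E p c (S (vscale E p d u)) = vscale E p d (vscale E p c (S u))"
      if "u \<in> fib E p" for u d
      by (rule fib_eqI[OF E, where p = p]) (simp_all add: fibs crds E S' that mult.left_commute)
  qed
  show "local_triv ?H U k \<Phi>" if "(U, k, \<Phi>) \<in> trivs ?H" for U k \<Phi>
    using that hom_local_triv[OF E vector_bundleD(5)[OF E]] by (auto simp: hom_trivs)
  show "\<exists>U k \<Phi>. (U, k, \<Phi>) \<in> trivs ?H \<and> p \<in> U" for p
  proof -
    obtain U k \<Phi> where "(U, k, \<Phi>) \<in> trivs E" "p \<in> U" using vector_bundleD(7)[OF E] by blast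
    then have "(U, k * k, htriv E k \<Phi>) \<in> trivs ?H \<and> p \<in> U" unfolding hom_trivs by blast
    then show ?thesis by blast
  qed
  fix U n \<Theta> V n' \<Theta>'
  assume "(U, n, \<Theta>) \<in> trivs ?H" "(V, n', \<Theta>') \<in> trivs ?H"
  then obtain k \<Phi> l \<Psi> where t: "n = k * k" "\<Theta> = htriv E k \<Phi>" "(U, k, \<Phi>) \<in> trivs E"
    and t': "n' = l * l" "\<Theta>' = htriv E l \<Psi>" "(V, l, \<Psi>) \<in> trivs E"
    unfolding hom_trivs by blast
  note lt = vector_bundleD(5)[OF E t(3)] and lt' = vector_bundleD(5)[OF E t'(3)]
  have o: "open (U \<inter> V)" using trivs_open[OF E t(3)] trivs_open[OF E t'(3)] by auto
  show "smooth_transition M ?H U n \<Theta> V n' \<Theta>'"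
    unfolding smooth_transition_def
  proof (intro allI impI)
    fix m i assume m: "m < n" and i: "i < n'"
    note md = index_mod_div[OF m[unfolded t(1)]] and id = index_mod_div[OF i[unfolded t'(1)]]
    \<comment> \<open>A matrix unit is expressed in the other trivialisation by products of an entry
      of the transition matrix and an entry of its inverse.\<close>
    have 1: "smooth_fun M (U \<inter> V) (\<lambda>p. \<Phi> p (frame E \<Psi> (i mod l) p) (m mod k))"
      by (rule smooth_fun_subset[OF smooth_trivD(2)[OF triv_smooth[OF E t'(3)] t(3) id(1) md(1)]]) auto
    have 2: "smooth_fun M (U \<inter> V) (\<lambda>p. \<Psi> p (frame E \<Phi> (m div k) p) (i div l))"
      by (rule smooth_fun_subset[OF smooth_trivD(2)[OF triv_smooth[OF E t(3)] t'(3) md(2) id(2)]]) auto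
    show "smooth_fun M (U \<inter> V) (\<lambda>p. \<Theta>' p (frame ?H \<Theta> m p) i)"
    proof (rule smooth_fun_cong[OF o smooth_fun_mult[OF o 1 2]])
      fix p assume "p \<in> U \<inter> V"
      then have p: "p \<in> U" "p \<in> V" by auto
      show "\<Phi> p (frame E \<Psi> (i mod l) p) (m mod k) * \<Psi> p (frame E \<Phi> (m div k) p) (i div l) = \<Theta>' p (frame ?H \<Theta> m p) i"
        unfolding t(2) t'(2) hom_frame[OF E lt p(1) m[unfolded t(1)]] using i[unfolded t'(1)]
        by (simp add: htriv_def frame_props(1)[OF lt' p(2) id(1)]
            local_trivD(4)[OF lt' p(2)] frame_props(1)[OF lt p(1) md(2)])
    qed
  qed
qed

text \<open>Matrix entries arise by applying \<open>T\<close> to a frame, so a field of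
  endomorphisms is smooth iff it preserves smooth sections. Global sections suffice for the test by
  \<open>bundle_mapI\<close>.\<close>

lemma hom_sections:
  assumes E: "vector_bundle M E"
  shows "T \<in> sections M (hom_bundle E) \<longleftrightarrow>
    (\<forall>p. T p \<in> fib (hom_bundle E) p) \<and> (\<forall>s\<in>sections M E. sapp T s \<in> sections M E)"
proof
  assume T: "T \<in> sections M (hom_bundle E)"
  note lin = hom_fibD(2)[OF sec_fib[OF T]]
  have "sapp T s \<in> sections M E" if s: "s \<in> sections M E" for s
    unfolding sections_iff
  proof (rule lsmooth_local)
    fix p :: 'm
    obtain U k \<Phi> where t: "(U, k, \<Phi>) \<in> trivs E" "p \<in> U" using vector_bundleD(7)[OF E] by blast
    note lt = vector_bundleD(5)[OF E t(1)]
    have U: "open U" by (rule trivs_open[OF E t(1)])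
    have "lsmooth E U (sapp T s)"
    proof (rule lsmooth_trivI[OF E triv_smooth[OF E t(1)] U order_refl])
      show "sapp T s q \<in> fib E q" for q unfolding sapp_def by (rule linear_onD(1)[OF lin sec_fib[OF s]])
      fix i assume i: "i < k"
      have "smooth_fun M U (\<lambda>q. \<Sum>j<k. \<Phi> q (s q) j * \<Phi> q (T q (frame E \<Phi> j q)) i)"
      proof (intro smooth_fun_sum smooth_fun_mult U)
        fix j assume "j \<in> {..<k}"
        then have j: "j < k" by simp
        show "smooth_fun M U (\<lambda>p. \<Phi> p (s p) j)"
          using lsmoothD(2)[OF s[unfolded sections_iff] t(1) j] by simp
        have "(U, k * k, htriv E k \<Phi>) \<in> trivs (hom_bundle E)" unfolding hom_trivs using t(1) by blast
        from lsmoothD(2)[OF T[unfolded sections_iff] this index_less(1)[OF i j]]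
        show "smooth_fun M U (\<lambda>q. \<Phi> q (T q (frame E \<Phi> j q)) i)" by (simp add: htriv_entry[OF i j])
      qed
      then show "smooth_fun M U (\<lambda>q. \<Phi> q (sapp T s q) i)"
        by (rule smooth_fun_cong[OF U]) (simp add: sapp_def triv_expand_map[OF E lt _ lt _ lin sec_fib[OF s]])
    qed
    then show "\<exists>W'. open W' \<and> p \<in> W' \<and> lsmooth E (UNIV \<inter> W') (sapp T s)" using U t(2) by auto
  qed
  then show "(\<forall>p. T p \<in> fib (hom_bundle E) p) \<and> (\<forall>s\<in>sections M E. sapp T s \<in> sections M E)"
    using sec_fib[OF T] by blast
next
  assume T: "(\<forall>p. T p \<in> fib (hom_bundle E) p) \<and> (\<forall>s\<in>sections M E. sapp T s \<in> sections M E)"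
  then have fibT: "T p \<in> fib (hom_bundle E) p" for p by blast
  have bm: "bundle_map M E E T"
    by (rule bundle_mapI[OF E E hom_fibD(2)[OF fibT]]) (use T in blast)
  show "T \<in> sections M (hom_bundle E)"
    unfolding sections_iff
  proof (rule lsmoothI)
    show "T p \<in> fib (hom_bundle E) p" for p by (rule fibT)
    fix U n \<Theta> m assume "(U, n, \<Theta>) \<in> trivs (hom_bundle E)" and m: "m < n"
    then obtain k \<Phi> where t: "n = k * k" "\<Theta> = htriv E k \<Phi>" "(U, k, \<Phi>) \<in> trivs E"
      unfolding hom_trivs by blast
    note md = index_mod_div[OF m[unfolded t(1)]]
    have "smooth_fun M (U \<inter> U) (\<lambda>p. \<Phi> p (sapp T (frame E \<Phi> (m mod k)) p) (m div k))"
      by (rule lsmooth_triv[OF E triv_smooth[OF E t(3)] trivs_open[OF E t(3)]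
          bundle_map_lsmooth[OF E E bm trivs_open[OF E t(3)] frame_lsmooth[OF E triv_smooth[OF E t(3)] md(1)]]])
    then show "smooth_fun M (U \<inter> UNIV) (\<lambda>p. \<Theta> p (T p) m)"
      using m by (simp add: t(1,2) htriv_def sapp_def)
  qed
qed

end


subsection \<open>Images of injective bundle maps\<close>

context smooth_mfd
begin

lemma smooth_trivI:
  assumes E: "vector_bundle M E" and t: "local_triv E U k \<Phi>"
    and fr: "\<And>j. j < k \<Longrightarrow> lsmooth E U (frame E \<Phi> j)"
    and co: "\<And>W s i. open W \<Longrightarrow> lsmooth E W s \<Longrightarrow> smooth_fun M (U \<inter> W) (\<lambda>p. \<Phi> p (s p) i)"
  shows "smooth_triv M E U k \<Phi>"
proof -
  have "smooth_transition M E U k \<Phi> V l \<Psi>" "smooth_transition M E V l \<Psi> U k \<Phi>" if V: "(V, l, \<Psi>) \<in> trivs E" for V l \<Psi>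
    unfolding smooth_transition_def
  proof (safe)
    fix j i assume "j < k" "i < l"
    then show "smooth_fun M (U \<inter> V) (\<lambda>p. \<Psi> p (frame E \<Phi> j p) i)"
      using lsmoothD(2)[OF fr V] by (simp add: Int_commute)
  next
    fix j i assume "j < l" "i < k"
    then show "smooth_fun M (V \<inter> U) (\<lambda>p. \<Phi> p (frame E \<Psi> j p) i)"
      using co[OF trivs_open[OF E V] frame_lsmooth[OF E triv_smooth[OF E V]]] by (simp add: Int_commute)
  qed
  then show ?thesis unfolding smooth_triv_def using t by auto
qed

lemma smooth_triv_subset:
  assumes E: "vector_bundle M E" and t: "smooth_triv M E U k \<Phi>" and W: "open W" "W \<subseteq> U"
  shows "smooth_triv M E W k \<Phi>"
proof (rule smooth_trivI[OF E])
  note t' = smooth_trivD(1)[OF t]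
  show "local_triv E W k \<Phi>"
    by (rule local_trivI[OF W(1)]) (use W(2) local_trivD[OF t'] in auto)
  show "lsmooth E W (frame E \<Phi> j)" if "j < k" for j
    by (rule lsmooth_subset[OF frame_lsmooth[OF E t that] W(2)])
  show "smooth_fun M (W \<inter> W') (\<lambda>p. \<Phi> p (s p) i)" if "open W'" "lsmooth E W' s" for W' s i
    by (rule smooth_fun_subset[OF lsmooth_triv[OF E t that]]) (use W(2) in auto)
qed

text \<open>A Steinitz exchange with smooth coefficients: near \<open>p\<close> the section
  \<open>s\<close> replaces the frame vector number \<open>i0\<close>, and the positions
  \<open>r\<close> and \<open>i0\<close> are swapped. Frame vectors number \<open>j < r\<close> stay
  in place since \<open>r \<le> i0\<close>, which is what allows the exchange to be
  iterated.\<close>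

lemma smooth_triv_exchange:
  assumes E: "vector_bundle M E" and t: "smooth_triv M E U k \<Phi>" and p: "p \<in> U" and s: "lsmooth E U s"
    and i0: "r \<le> i0" "i0 < k" "\<Phi> p (s p) i0 \<noteq> 0"
  obtains U' \<Phi>' where "smooth_triv M E U' k \<Phi>'" "p \<in> U'" "U' \<subseteq> U"
    "\<forall>q\<in>U'. \<forall>i. \<Phi>' q (s q) i = (if i = r then 1 else 0)"
    "\<forall>q v j. q \<in> U' \<and> j < r \<and> (\<forall>i. \<Phi> q v i = (if i = j then 1 else 0)) \<longrightarrow> (\<forall>i. \<Phi>' q v i = (if i = j then 1 else 0))"
proof -
  note t' = smooth_trivD(1)[OF t]
  have oU: "open U" by (rule local_trivD(1)[OF t'])
  define x where "x q i = \<Phi> q (s q) i" for q i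
  have xs: "smooth_fun M U (\<lambda>q. x q i)" for i
    using lsmooth_triv[OF E t oU s] by (simp add: x_def)
  define U' where "U' = U \<inter> (\<lambda>q. x q i0) -` (- {0})"
  have U': "open U'" "U' \<subseteq> U" "p \<in> U'" "\<And>q. q \<in> U' \<Longrightarrow> x q i0 \<noteq> 0"
  proof -
    show "open U'" unfolding U'_def
      by (rule continuous_open_preimage[OF smooth_fun_continuous[OF oU xs] oU]) (simp add: open_Compl)
  qed (use p i0(3) in \<open>auto simp: U'_def x_def\<close>)
  \<comment> \<open>The coefficient of \<open>s\<close> in the new frame, read off from the
    coordinate \<open>i0\<close>, where \<open>s\<close> does not vanish on
    \<open>U'\<close>.\<close>
  define c where "c q v = \<Phi> q v i0 / x q i0" for q v
  define \<Phi>' where "\<Phi>' q v i = (if i = r then c q v else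
      if i = i0 then \<Phi> q v r - c q v * x q r else \<Phi> q v i - c q v * x q i)" for q v i
  have r: "r < k" using i0 by simp
  have xge: "x q i = 0" if "q \<in> U" "k \<le> i" for q i
    unfolding x_def using local_triv_ge[OF t' that(1) lsmoothD(1)[OF s that(1)] that(2)] .
  \<comment> \<open>The inverse change of coordinates; it gives injectivity as well as the old
    coordinates of the new frame.\<close>
  have bck: "\<Phi> q v i = (if i = i0 then 0 else if i = r then \<Phi>' q v i0 else \<Phi>' q v i) + \<Phi>' q v r * x q i"
    if "q \<in> U'" for q v i
    using U'(4)[OF that] by (auto simp: \<Phi>'_def c_def)
  have lt: "local_triv E U' k \<Phi>'"
  proof (rule local_trivI[OF U'(1)])
    fix q assume q: "q \<in> U'"
    then have qU: "q \<in> U" using U'(2) by blast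
    note lD = local_trivD(3,4)[OF t' qU]
    show "bij_betw (\<Phi>' q) (fib E q) (topspace (Euclidean_space k))"
    proof (rule bij_betw_EuclideanI)
      show "\<Phi>' q u i = 0" if "u \<in> fib E q" "k \<le> i" for u i
        using that local_triv_ge[OF t' qU that] xge[OF qU that(2)] i0 r by (auto simp: \<Phi>'_def)
      show "u = v" if u: "u \<in> fib E q" and v: "v \<in> fib E q" and eq: "\<And>i. i < k \<Longrightarrow> \<Phi>' q u i = \<Phi>' q v i" for u v
      proof (rule local_triv_inj[OF t' qU u v])
        fix i assume "i < k"
        then show "\<Phi> q u i = \<Phi> q v i"
          unfolding bck[OF q, of u i] bck[OF q, of v i] using eq i0(2) r by simp
      qed
      fix y :: "nat \<Rightarrow> real" assume y: "\<And>i. k \<le> i \<Longrightarrow> y i = 0"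
      define z where "z i = (if i = i0 then 0 else if i = r then y i0 else y i) + y r * x q i" for i
      have ge: "z i = 0" if "k \<le> i" for i using that y[OF that] xge[OF qU that] i0(2) r by (auto simp: z_def)
      note vz = vec_of[where x = z, OF t' qU ge]
      have "\<Phi>' q (vec_of E \<Phi> q z) i = y i" for i
        using U'(4)[OF q] by (simp add: \<Phi>'_def c_def vz) (auto simp: z_def)
      then show "\<exists>u\<in>fib E q. \<forall>i<k. \<Phi>' q u i = y i" using vz(1) by blast
    qed
    show "\<Phi>' q (vadd E q u v) i = \<Phi>' q u i + \<Phi>' q v i" if "u \<in> fib E q" "v \<in> fib E q" for u v i
      using that by (simp add: \<Phi>'_def c_def lD add_divide_distrib distrib_right)
    show "\<Phi>' q (vscale E q d u) i = d * \<Phi>' q u i" if "u \<in> fib E q" for u d i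
      using that by (simp add: \<Phi>'_def c_def lD right_diff_distrib mult.assoc)
  qed
  have "smooth_triv M E U' k \<Phi>'"
  proof (rule smooth_trivI[OF E lt])
    fix j assume j: "j < k"
    show "lsmooth E U' (frame E \<Phi>' j)"
    proof (rule lsmooth_trivI[OF E t U'(1,2)])
      show "frame E \<Phi>' j q \<in> fib E q" if "q \<in> U'" for q by (rule frame_props(1)[OF lt that j])
      fix i
      have "smooth_fun M U' (\<lambda>q. (if i = i0 then 0 else if i = r then (if i0 = j then 1 else 0) else (if i = j then 1 else 0))
          + (if r = j then 1 else 0) * x q i)"
        by (intro smooth_fun_add smooth_fun_mult smooth_fun_const smooth_fun_subset[OF xs] U')
      then show "smooth_fun M U' (\<lambda>q. \<Phi> q (frame E \<Phi>' j q) i)"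
      proof (rule smooth_fun_cong[OF U'(1)])
        fix q assume q: "q \<in> U'"
        show "(if i = i0 then 0 else if i = r then (if i0 = j then 1 else 0) else (if i = j then 1 else 0))
            + (if r = j then 1 else 0) * x q i = \<Phi> q (frame E \<Phi>' j q) i"
          unfolding bck[OF q, of "frame E \<Phi>' j q" i] frame_props(2)[OF lt q j] by simp
      qed
    qed
  next
    fix W s' i assume W: "open W" and s': "lsmooth E W s'"
    have o: "open (U' \<inter> W)" using U'(1) W by auto
    have sm: "smooth_fun M (U' \<inter> W) (\<lambda>q. \<Phi> q (s' q) i)" for i
      by (rule smooth_fun_subset[OF lsmooth_triv[OF E t W s']]) (use U'(2) in auto)
    have sx: "smooth_fun M (U' \<inter> W) (\<lambda>q. x q i)" for i
      by (rule smooth_fun_subset[OF xs]) (use U'(2) in auto)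
    have sc: "smooth_fun M (U' \<inter> W) (\<lambda>q. c q (s' q))"
      unfolding c_def by (rule smooth_fun_divide[OF o sm sx]) (use U'(4) in auto)
    show "smooth_fun M (U' \<inter> W) (\<lambda>q. \<Phi>' q (s' q) i)"
      unfolding \<Phi>'_def
      by (cases "i = r"; cases "i = i0") (simp_all add: sc smooth_fun_diff[OF o sm smooth_fun_mult[OF o sc sx]])
  qed
  moreover have "\<forall>q\<in>U'. \<forall>i. \<Phi>' q (s q) i = (if i = r then 1 else 0)"
    using U'(4) by (auto simp: \<Phi>'_def c_def x_def[symmetric])
  moreover have "\<forall>q v j. q \<in> U' \<and> j < r \<and> (\<forall>i. \<Phi> q v i = (if i = j then 1 else 0)) \<longrightarrow> (\<forall>i. \<Phi>' q v i = (if i = j then 1 else 0))"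
    using i0(1) by (auto simp: \<Phi>'_def c_def)
  ultimately show thesis using that U'(2,3) by blast
qed

text \<open>Starting from any trivialisation of \<open>E\<close>, the images of a frame of
  \<open>F\<close> are exchanged one after another into the positions 0, 1 and so on. In the result
  \<open>h\<close> is the inclusion of the first \<open>r\<close> coordinates.\<close>

lemma image_triv:
  assumes E: "vector_bundle M E" and F: "vector_bundle M F" and h: "bundle_map M F E h"
    and inj: "\<And>p. inj_on (h p) (fib F p)"
  obtains U k \<Phi> V r \<Theta> where "p \<in> U" "U \<subseteq> V" "smooth_triv M E U k \<Phi>" "(V, r, \<Theta>) \<in> trivs F" "r \<le> k"
    "\<forall>q\<in>U. \<forall>w\<in>fib F q. \<forall>i. \<Phi> q (h q w) i = (if i < r then \<Theta> q w i else 0)"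
proof -
  obtain V r \<Theta> where V: "(V, r, \<Theta>) \<in> trivs F" "p \<in> V" using vector_bundleD(7)[OF F] by blast
  note lV = vector_bundleD(5)[OF F V(1)]
  have oV: "open V" by (rule trivs_open[OF F V(1)])
  define s where "s j = sapp h (frame F \<Theta> j)" for j
  have s: "lsmooth E V (s j)" if "j < r" for j
    unfolding s_def by (rule bundle_map_lsmooth[OF F E h oV frame_lsmooth[OF F triv_smooth[OF F V(1)] that]])
  note lin = bundle_map_linear[OF h]
  have "\<exists>U k \<Phi>. p \<in> U \<and> U \<subseteq> V \<and> smooth_triv M E U k \<Phi> \<and> (\<forall>q\<in>U. \<forall>j<m. \<forall>i. \<Phi> q (s j q) i = (if i = j then 1 else 0))"
    if "m \<le> r" for m
    using that
  proof (induction m)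
    case 0
    obtain U k \<Phi> where U: "(U, k, \<Phi>) \<in> trivs E" "p \<in> U" using vector_bundleD(7)[OF E] by blast
    have "smooth_triv M E (U \<inter> V) k \<Phi>"
      by (rule smooth_triv_subset[OF E triv_smooth[OF E U(1)]]) (use trivs_open[OF E U(1)] oV in auto)
    then show ?case using U(2) V(2) by (intro exI[of _ "U \<inter> V"] exI[of _ k] exI[of _ \<Phi>]) simp
  next
    case (Suc m)
    then have m: "m < r" by simp
    obtain U k \<Phi> where U: "p \<in> U" "U \<subseteq> V" "smooth_triv M E U k \<Phi>"
      and fr: "\<forall>q\<in>U. \<forall>j<m. \<forall>i. \<Phi> q (s j q) i = (if i = j then 1 else 0)"
      using Suc.IH m by auto
    note lU = smooth_trivD(1)[OF U(3)]
    have sm: "s m p \<in> fib E p" using lsmoothD(1)[OF s[OF m] V(2)] .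
    \<comment> \<open>Otherwise the image of frame vector \<open>m\<close> would be a combination of
      the images of the earlier ones, against the injectivity of \<open>h p\<close>.\<close>
    have "\<exists>i0. m \<le> i0 \<and> i0 < k \<and> \<Phi> p (s m p) i0 \<noteq> 0"
    proof (rule ccontr)
      assume neg: "\<not> ?thesis"
      \<comment> \<open>The coordinates of the combination of the first \<open>m\<close> frame
        vectors of \<open>F\<close> whose image would be \<open>s m p\<close>.\<close>
      define y where "y j = (if j < m then \<Phi> p (s m p) j else 0)" for j
      have ge: "y j = 0" if "r \<le> j" for j using that m by (simp add: y_def)
      note vy = vec_of[where x = y, OF lV V(2) ge]
      let ?w = "vec_of F \<Theta> p y"
      have "h p ?w = s m p"
      proof (rule local_triv_inj[OF lU U(1) linear_onD(1)[OF lin vy(1)] sm])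
        fix i assume i: "i < k"
        have "\<Phi> p (h p ?w) i = (\<Sum>j<r. y j * \<Phi> p (s j p) i)"
          using triv_expand_map[OF F lV V(2) lU U(1) lin vy(1), where i = i] by (simp add: vy(2) s_def sapp_def)
        also have "\<dots> = (\<Sum>j<r. if j = i then y i else 0)"
          by (rule sum.cong[OF refl]) (use fr U(1) in \<open>auto simp: y_def\<close>)
        also have "\<dots> = y i" using ge by simp
        also have "\<dots> = \<Phi> p (s m p) i" using neg i by (auto simp: y_def not_less)
        finally show "\<Phi> p (h p ?w) i = \<Phi> p (s m p) i" .
      qed
      then have "h p ?w = h p (frame F \<Theta> m p)" by (simp add: s_def sapp_def)
      then have "?w = frame F \<Theta> m p"
        using inj vy(1) frame_props(1)[OF lV V(2) m] by (meson inj_onD)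
      then have "y m = 1" using vy(2)[where i = m] frame_props(2)[OF lV V(2) m, where i = m] by simp
      then show False by (simp add: y_def)
    qed
    then obtain i0 where i0: "m \<le> i0" "i0 < k" "\<Phi> p (s m p) i0 \<noteq> 0" by blast
    obtain U' \<Phi>' where U': "smooth_triv M E U' k \<Phi>'" "p \<in> U'" "U' \<subseteq> U"
      "\<forall>q\<in>U'. \<forall>i. \<Phi>' q (s m q) i = (if i = m then 1 else 0)"
      "\<forall>q v j. q \<in> U' \<and> j < m \<and> (\<forall>i. \<Phi> q v i = (if i = j then 1 else 0)) \<longrightarrow> (\<forall>i. \<Phi>' q v i = (if i = j then 1 else 0))"
      by (rule smooth_triv_exchange[OF E U(3,1) lsmooth_subset[OF s[OF m] U(2)] i0])
    have "\<Phi>' q (s j q) i = (if i = j then 1 else 0)" if q: "q \<in> U'" and j: "j < Suc m" for q j i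
    proof (cases "j = m")
      case True then show ?thesis using U'(4) q by simp
    next
      case False
      then have "j < m" using j by simp
      moreover have "\<forall>i. \<Phi> q (s j q) i = (if i = j then 1 else 0)" using fr q U'(3) \<open>j < m\<close> by blast
      ultimately show ?thesis using U'(5) q by blast
    qed
    then show ?case using U'(1-3) U(2) by (intro exI[of _ U'] exI[of _ k] exI[of _ \<Phi>']) auto
  qed
  from this[of r] obtain U k \<Phi> where U: "p \<in> U" "U \<subseteq> V" "smooth_triv M E U k \<Phi>"
    and fr: "\<forall>q\<in>U. \<forall>j<r. \<forall>i. \<Phi> q (s j q) i = (if i = j then 1 else 0)" by auto
  note lU = smooth_trivD(1)[OF U(3)]
  have rk: "r \<le> k"
  proof (rule ccontr)
    assume "\<not> r \<le> k"
    then have k: "k < r" by simp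
    have "\<Phi> p (s k p) k = 1" using fr U(1) k by simp
    moreover have "\<Phi> p (s k p) k = 0" by (rule local_triv_ge[OF lU U(1) lsmoothD(1)[OF s[OF k] V(2)]]) simp
    ultimately show False by simp
  qed
  have ex: "\<Phi> q (h q w) i = (if i < r then \<Theta> q w i else 0)" if q: "q \<in> U" and w: "w \<in> fib F q" for q w i
  proof -
    have qV: "q \<in> V" using q U(2) by blast
    have "\<Phi> q (h q w) i = (\<Sum>j<r. \<Theta> q w j * \<Phi> q (s j q) i)"
      using triv_expand_map[OF F lV qV lU q lin w, where i = i] by (simp add: s_def sapp_def)
    also have "\<dots> = (\<Sum>j<r. if j = i then \<Theta> q w i else 0)"
      by (rule sum.cong[OF refl]) (use fr q in auto)
    finally show ?thesis by simp
  qed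
  then show thesis using that[OF U V(1) rk] by blast
qed

text \<open>Used for \<iota>(\<sigma>) in Hom(A/\<sigma>, A/\<sigma>) and for the copy of \<sigma>
  in C \<oplus> \<sigma>. The trivialisation of \<open>image_triv\<close> is adapted to the
  image.\<close>

lemma image_subbundle:
  assumes E: "vector_bundle M E" and F: "vector_bundle M F" and h: "bundle_map M F E h"
    and inj: "\<And>p. inj_on (h p) (fib F p)"
  shows "subbundle M E (\<lambda>p. h p ` fib F p)"
  unfolding subbundle_def
proof
  fix p
  obtain U k \<Phi> V r \<Theta> where U: "p \<in> U" "U \<subseteq> V" "smooth_triv M E U k \<Phi>" and V: "(V, r, \<Theta>) \<in> trivs F" and rk: "r \<le> k"
    and ex: "\<forall>q\<in>U. \<forall>w\<in>fib F q. \<forall>i. \<Phi> q (h q w) i = (if i < r then \<Theta> q w i else 0)"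
    by (rule image_triv[OF E F h inj])
  note lU = smooth_trivD(1)[OF U(3)] and lV = vector_bundleD(5)[OF F V] and lin = bundle_map_linear[OF h]
  have "h q ` fib F q = {v \<in> fib E q. \<forall>i\<ge>r. \<Phi> q v i = 0}" if q: "q \<in> U" for q
  proof (intro equalityI subsetI)
    fix v assume "v \<in> h q ` fib F q"
    then show "v \<in> {v \<in> fib E q. \<forall>i\<ge>r. \<Phi> q v i = 0}" using ex q linear_onD(1)[OF lin] by auto
  next
    fix v assume v: "v \<in> {v \<in> fib E q. \<forall>i\<ge>r. \<Phi> q v i = 0}"
    have qV: "q \<in> V" using q U(2) by blast
    have ge: "\<Phi> q v i = 0" if "r \<le> i" for i using v that by simp
    note vy = vec_of[where x = "\<Phi> q v", OF lV qV ge]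
    have "h q (vec_of F \<Theta> q (\<Phi> q v)) = v"
      by (rule local_triv_inj[OF lU q linear_onD(1)[OF lin vy(1)]]) (use v ge ex q in \<open>simp_all add: vy\<close>)
    then show "v \<in> h q ` fib F q" using vy(1) by (metis imageI)
  qed
  then have "adapted_triv M E (\<lambda>p. h p ` fib F p) U k r \<Phi>"
    unfolding adapted_triv_def using U(3) rk by blast
  then show "\<exists>U k r \<Phi>. p \<in> U \<and> adapted_triv M E (\<lambda>p. h p ` fib F p) U k r \<Phi>" using U(1) by blast
qed

text \<open>In the trivialisation of \<open>image_triv\<close> the inverse of \<open>h\<close> just
  reads off the first \<open>r\<close> coordinates.\<close>

lemma image_inverse_sec:
  assumes E: "vector_bundle M E" and F: "vector_bundle M F" and h: "bundle_map M F E h"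
    and inj: "\<And>p. inj_on (h p) (fib F p)"
    and s: "s \<in> sections M E" "\<And>p. s p \<in> h p ` fib F p"
  shows "(\<lambda>p. inv_into (fib F p) (h p) (s p)) \<in> sections M F"
  unfolding sections_iff
proof (rule lsmooth_local)
  fix p :: 'm
  obtain U k \<Phi> V r \<Theta> where U: "p \<in> U" "U \<subseteq> V" "smooth_triv M E U k \<Phi>" and V: "(V, r, \<Theta>) \<in> trivs F" and rk: "r \<le> k"
    and ex: "\<forall>q\<in>U. \<forall>w\<in>fib F q. \<forall>i. \<Phi> q (h q w) i = (if i < r then \<Theta> q w i else 0)"
    by (rule image_triv[OF E F h inj])
  have oU: "open U" by (rule local_trivD(1)[OF smooth_trivD(1)[OF U(3)]])
  have iv: "inv_into (fib F q) (h q) (s q) \<in> fib F q" "h q (inv_into (fib F q) (h q) (s q)) = s q" for q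
    using inv_into_into[OF s(2)[of q]] f_inv_into_f[OF s(2)[of q]] by auto
  have "lsmooth F U (\<lambda>p. inv_into (fib F p) (h p) (s p))"
  proof (rule lsmooth_trivI[OF F triv_smooth[OF F V] oU U(2) iv(1)])
    fix i assume i: "i < r"
    have "smooth_fun M U (\<lambda>p. \<Phi> p (s p) i)"
      using lsmooth_triv[OF E U(3) open_UNIV s(1)[unfolded sections_iff], of i] by simp
    then show "smooth_fun M U (\<lambda>p. \<Theta> p (inv_into (fib F p) (h p) (s p)) i)"
    proof (rule smooth_fun_cong[OF oU])
      fix q assume q: "q \<in> U"
      show "\<Phi> q (s q) i = \<Theta> q (inv_into (fib F q) (h q) (s q)) i"
        using ex[rule_format, OF q iv(1)[of q], of i] i by (simp add: iv(2))
    qed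
  qed
  then show "\<exists>W'. open W' \<and> p \<in> W' \<and> lsmooth F (UNIV \<inter> W') (\<lambda>p. inv_into (fib F p) (h p) (s p))"
    using oU U(1) by auto
qed

subsection \<open>Splittings\<close>

text \<open>In an adapted trivialisation the last \<open>k - r\<close> frame vectors span a
  complement of \<open>S\<close>, which splits \<open>pr\<close> locally. A bump function makes this
  splitting global, at the price that \<open>pr\<close> after \<zeta> becomes multiplication by
  \<open>ch\<close>.\<close>

lemma local_splitting:
  assumes E: "vector_bundle M E" and S: "subbundle M E S"
  shows "\<exists>ch V \<zeta>. ch \<in> Cinf M \<and> open V \<and> p \<in> V \<and> (\<forall>q\<in>V. ch q = 1) \<and> bundle_map M (quot_bundle M E S) E \<zeta> \<and>
    (\<forall>q. \<forall>a\<in>fib (quot_bundle M E S) q. pr E S q (\<zeta> q a) = vscale (quot_bundle M E S) q (ch q) a)"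
proof -
  let ?Q = "quot_bundle M E S"
  note Q = quot_vector_bundle[OF E S]
  obtain U k r \<Phi> where p: "p \<in> U" and a: "adapted_triv M E S U k r \<Phi>" by (rule subbundleE[OF S])
  note aD = adapted_trivD[OF a] and lQ = quot_local_triv[OF E S a]
  obtain ch V K where b: "ch \<in> Cinf M" "open V" "p \<in> V" "\<forall>q\<in>V. ch q = 1" "V \<subseteq> U"
    "closed K" "K \<subseteq> U" "\<forall>q. q \<notin> K \<longrightarrow> ch q = 0" by (rule bump_ex[OF aD(4) p])
  have off: "ch q = 0" if "q \<notin> U" for q using b(7,8) that by auto
  define y where "y q a i = (if r \<le> i then qtriv r \<Phi> q a (i - r) else 0)" for q a i
  define \<zeta>0 where "\<zeta>0 q a = vec_of E \<Phi> q (y q a)" for q a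
  have yge: "y q a i = 0" if "q \<in> U" "a \<in> fib ?Q q" "k \<le> i" for q a i
    using local_triv_ge[OF lQ that(1,2), of "i - r"] that(3) aD(2) by (simp add: y_def diff_le_mono)
  have z0: "\<zeta>0 q a \<in> fib E q" "\<Phi> q (\<zeta>0 q a) i = y q a i" if "q \<in> U" "a \<in> fib ?Q q" for q a i
    using vec_of[OF aD(3) that(1) yge[OF that]] by (auto simp: \<zeta>0_def)
  have pz0: "pr E S q (\<zeta>0 q a) = a" if q: "q \<in> U" and a': "a' \<in> fib ?Q q" and aa: "a = a'" for q a a'
  proof -
    obtain v where v: "v \<in> fib E q" "a = pr E S q v" using a' aa by (auto simp: quot_fib)
    note z = z0[OF q a'[folded aa]]
    have "vminus E q (\<zeta>0 q a) v \<in> S q"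
      using aD(5)[OF q] by (simp add: fibs E z v(1) triv_minus[OF E aD(3) q z(1) v(1)])
        (simp add: y_def v(2) qtriv_pr[OF E S a q v(1)])
    then show ?thesis unfolding v(2) by (intro pr_eqI[OF E S]) (use z v in auto)
  qed
  define \<zeta> where "\<zeta> q a = (if q \<in> U then vscale E q (ch q) (\<zeta>0 q a) else vzero E q)" for q a
  have "bundle_map M ?Q E \<zeta>"
  proof (rule bundle_mapI[OF Q E])
    show "linear_on ?Q E q (\<zeta> q)" for q
    proof (cases "q \<in> U")
      case True
      note lD = local_trivD(3,4)[OF lQ True] and eD = local_trivD(3,4)[OF aD(3) True]
      have *: "vscale E q (ch q) (\<zeta>0 q x) \<in> fib E q" if "x \<in> fib ?Q q" for x by (simp add: fibs E z0[OF True that])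
      show ?thesis
      proof (rule linear_onI)
        show "\<zeta> q u \<in> fib E q" if "u \<in> fib ?Q q" for u using True *[OF that] by (simp add: \<zeta>_def)
        show "\<zeta> q (vadd ?Q q u v) = vadd E q (\<zeta> q u) (\<zeta> q v)" if u: "u \<in> fib ?Q q" and v: "v \<in> fib ?Q q" for u v
        proof -
          have uv: "vadd ?Q q u v \<in> fib ?Q q" by (simp add: fibs Q u v)
          have "vscale E q (ch q) (\<zeta>0 q (vadd ?Q q u v)) =
              vadd E q (vscale E q (ch q) (\<zeta>0 q u)) (vscale E q (ch q) (\<zeta>0 q v))"
            by (rule local_triv_inj[OF aD(3) True])
              (simp_all add: fibs E z0[OF True u] z0[OF True v] z0[OF True uv] eD, simp add: y_def lD u v distrib_left)
          then show ?thesis using True by (simp add: \<zeta>_def)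
        qed
        show "\<zeta> q (vscale ?Q q c u) = vscale E q c (\<zeta> q u)" if u: "u \<in> fib ?Q q" for u c
        proof -
          have uv: "vscale ?Q q c u \<in> fib ?Q q" by (simp add: fibs Q u)
          have "vscale E q (ch q) (\<zeta>0 q (vscale ?Q q c u)) = vscale E q c (vscale E q (ch q) (\<zeta>0 q u))"
            by (rule local_triv_inj[OF aD(3) True])
              (simp_all add: fibs E z0[OF True u] z0[OF True uv] eD, simp add: y_def lD u)
          then show ?thesis using True by (simp add: \<zeta>_def)
        qed
      qed
    next
      case False
      then show ?thesis
        by (intro linear_onI) (simp_all add: \<zeta>_def fibs E vector_bundleD(2)[OF E] vscale_vzero)
    qed
    fix s assume s: "s \<in> sections M ?Q"
    have "lsmooth E U (\<lambda>q. \<zeta>0 q (s q))"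
    proof (rule lsmooth_trivI[OF E aD(1,4) order_refl])
      show "\<zeta>0 q (s q) \<in> fib E q" if "q \<in> U" for q by (rule z0(1)[OF that sec_fib[OF s]])
      fix i assume i: "i < k"
      show "smooth_fun M U (\<lambda>q. \<Phi> q (\<zeta>0 q (s q)) i)"
      proof (cases "r \<le> i")
        case True
        have t: "(U, k - r, qtriv r \<Phi>) \<in> trivs ?Q" unfolding quot_trivs using a by blast
        have "i - r < k - r" using i True by simp
        from lsmoothD(2)[OF s[unfolded sections_iff] t this] have "smooth_fun M U (\<lambda>q. qtriv r \<Phi> q (s q) (i - r))" by simp
        then show ?thesis
          by (rule smooth_fun_cong[OF aD(4)]) (simp add: z0(2)[OF _ sec_fib[OF s]] y_def True)
      next
        case False
        show ?thesis
          by (rule smooth_fun_cong[OF aD(4) smooth_fun_const[OF aD(4), of 0]])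
            (simp add: z0(2)[OF _ sec_fib[OF s]] y_def False)
      qed
    qed
    from lsmooth_extend_by_zero[OF E aD(4) this b(1,6,7)] b(8)
    show "sapp \<zeta> s \<in> sections M E" by (simp add: sapp_def \<zeta>_def)
  qed
  moreover have "pr E S q (\<zeta> q x) = vscale ?Q q (ch q) x" if x: "x \<in> fib ?Q q" for q x
  proof (cases "q \<in> U")
    case True
    then show ?thesis
      using quot_scale[OF E S z0(1)[OF True x], of "ch q"] pz0[OF True x refl] by (simp add: \<zeta>_def)
  next
    case False
    then show ?thesis using off[OF False] vscale_zero[OF Q x] by (simp add: \<zeta>_def quot_zero)
  qed
  ultimately show ?thesis using b(1-4) by blast
qed

text \<open>Instead of a partition of unity subordinate to a locally finite cover we use a countable cover
  by the sets on which the \<open>n\<close>-th bump function is 1: there the weight \<open>\<Prod>j<m. 1 - c j\<close> of the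
  later terms vanishes, so that the sum is finite near every point.\<close>

lemma splitting_ex:
  assumes E: "vector_bundle M E" and S: "subbundle M E S"
  obtains \<xi> where "bundle_map M (quot_bundle M E S) E \<xi>"
    "\<forall>q. \<forall>a\<in>fib (quot_bundle M E S) q. pr E S q (\<xi> q a) = a"
proof -
  let ?Q = "quot_bundle M E S"
  note Q = quot_vector_bundle[OF E S]
  have "\<forall>p. \<exists>ch V \<zeta>. ch \<in> Cinf M \<and> open V \<and> p \<in> V \<and> (\<forall>q\<in>V. ch q = 1) \<and> bundle_map M ?Q E \<zeta> \<and>
    (\<forall>q. \<forall>a\<in>fib ?Q q. pr E S q (\<zeta> q a) = vscale ?Q q (ch q) a)"
    using local_splitting[OF E S] by blast
  then obtain ch V \<zeta> where loc: "\<forall>p. ch p \<in> Cinf M \<and> open (V p) \<and> p \<in> V p \<and> (\<forall>q\<in>V p. ch p q = 1) \<and>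
      bundle_map M ?Q E (\<zeta> p) \<and> (\<forall>q. \<forall>a\<in>fib ?Q q. pr E S q (\<zeta> p q a) = vscale ?Q q (ch p q) a)"
    unfolding choice_iff by (elim exE)
  \<comment> \<open>Second countability enters here: the sets on which a local splitting has cut-off
    1 have a countable subcover.\<close>
  obtain F' where F': "F' \<subseteq> range V" "countable F'" "\<Union>F' = \<Union>(range V)"
    by (rule Lindelof[of "range V"]) (use loc in auto)
  have cov: "\<Union>F' = UNIV" using F'(3) loc by auto
  obtain I where I: "countable I" "F' = V ` I" using countable_subset_image[THEN iffD1, of F' V UNIV] F' by blast
  define g where "g = from_nat_into I"
  define c where "c n = ch (g n)" for n
  have cC: "c n \<in> Cinf M" for n using loc by (simp add: c_def)
  have cov': "\<exists>n. q \<in> V (g n)" for q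
  proof -
    obtain i where "i \<in> I" "q \<in> V i" using cov I(2) by blast
    then show ?thesis using from_nat_into_surj[OF I(1)] unfolding g_def by metis
  qed
  define w where "w n q = (\<Prod>j<n. 1 - c j q)" for n q
  have wC: "w n \<in> Cinf M" for n
    unfolding w_def by (intro CinfI smooth_fun_prod smooth_fun_diff smooth_fun_const open_UNIV CinfD[OF cC])
  have w0: "w m q = 0" if "q \<in> V (g n)" "n < m" for m n q
  proof -
    have "1 - c n q = 0" using loc that(1) by (simp add: c_def)
    then show ?thesis unfolding w_def using that(2) by (intro prod_zero) auto
  qed
  \<comment> \<open>\<open>X n\<close> is the partial sum of the first \<open>n\<close> local
    splittings, the one with index \<open>m\<close> weighted by \<open>w m\<close>.\<close>
  define X where "X = rec_nat (\<lambda>q a. vzero E q) (\<lambda>n f q a. vadd E q (f q a) (vscale E q (w n q) (\<zeta> (g n) q a)))"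
  have X: "X 0 q a = vzero E q" "X (Suc n) q a = vadd E q (X n q a) (vscale E q (w n q) (\<zeta> (g n) q a))" for n q a
    by (simp_all add: X_def)
  have zl: "linear_on ?Q E q (\<zeta> (g n) q)" for n q using loc bundle_map_linear by blast
  have Xl: "linear_on ?Q E q (X n q)" for n q
  proof (induction n)
    case 0
    show ?case by (intro linear_onI) (simp_all add: X fibs E vector_bundleD(2)[OF E] vscale_vzero)
  next
    case (Suc n)
    note l1 = linear_onD[OF Suc.IH] and l2 = linear_onD[OF zl[of q n]]
    show ?case
    proof (rule linear_onI)
      show "X (Suc n) q u \<in> fib E q" if "u \<in> fib ?Q q" for u by (simp add: X fibs E l1 l2 that)
      show "X (Suc n) q (vadd ?Q q u v) = vadd E q (X (Suc n) q u) (X (Suc n) q v)"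
        if "u \<in> fib ?Q q" "v \<in> fib ?Q q" for u v
        by (rule fib_eqI[OF E, where p = q]) (simp_all add: X fibs crds E l1 l2 that distrib_left)
      show "X (Suc n) q (vscale ?Q q d u) = vscale E q d (X (Suc n) q u)" if "u \<in> fib ?Q q" for u d
        by (rule fib_eqI[OF E, where p = q]) (simp_all add: X fibs crds E l1 l2 that distrib_left)
    qed
  qed
  have Xs: "(\<lambda>q. X n q (s q)) \<in> sections M E" if s: "s \<in> sections M ?Q" for n s
  proof (induction n)
    case 0 show ?case using zero_sec[OF E] by (simp add: X)
  next
    case (Suc n)
    have "bundle_map M ?Q E (\<zeta> (g n))" using loc by blast
    from sadd_sec[OF E Suc.IH sscale_sec[OF E bundle_map_sec[OF Q E this s] wC[of n]]]
    show ?case by (simp add: X sadd_def sscale_def sapp_def)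
  qed
  \<comment> \<open>The weights telescope: \<open>w n\<close> times \<open>c n\<close> is
    \<open>w n - w (Suc n)\<close>, so the partial sum splits \<open>pr\<close> up to the factor
    \<open>1 - w n\<close>.\<close>
  have Xp: "pr E S q (X n q a) = vscale ?Q q (1 - w n q) a" if a: "a \<in> fib ?Q q" for n q a
  proof (induction n)
    case 0
    show ?case using vscale_zero[OF Q a] by (simp add: X w_def quot_zero)
  next
    case (Suc n)
    note f = linear_onD(1)[OF Xl a] linear_onD(1)[OF zl a]
    have pz: "pr E S q (\<zeta> (g n) q a) = vscale ?Q q (c n q) a" using loc a by (simp add: c_def)
    have "pr E S q (X (Suc n) q a) = vadd ?Q q (vscale ?Q q (1 - w n q) a) (vscale ?Q q (w n q) (vscale ?Q q (c n q) a))"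
      unfolding X(2) quot_add[OF E S f(1) vector_bundleD(4)[OF E f(2)], symmetric] quot_scale[OF E S f(2), symmetric] Suc.IH pz ..
    also have "\<dots> = vscale ?Q q (1 - w (Suc n) q) a"
      by (rule fib_eqI[OF Q, where p = q]) (simp_all add: fibs crds Q a w_def algebra_simps)
    finally show ?case .
  qed
  have Xst: "X (Suc (n + d)) q a = X (Suc n) q a" if q: "q \<in> V (g n)" and a: "a \<in> fib ?Q q" for n d q a
  proof (induction d)
    case (Suc d)
    have "X (Suc (n + Suc d)) q a = vadd E q (X (Suc (n + d)) q a) (vscale E q 0 (\<zeta> (g (Suc (n + d))) q a))"
      using w0[OF q, of "Suc (n + d)"] by (simp add: X(2)[of "Suc (n + d)"])
    also have "\<dots> = X (Suc (n + d)) q a"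
      by (rule fib_eqI[OF E, where p = q])
        (simp_all add: fibs crds E linear_onD(1)[OF Xl a, of "Suc (n + d)"] linear_onD(1)[OF zl a, of "Suc (n + d)"])
    finally show ?case using Suc.IH by simp
  qed simp
  define N where "N q = (LEAST n. q \<in> V (g n))" for q
  have N: "q \<in> V (g (N q))" for q unfolding N_def using LeastI_ex[OF cov'[of q]] .
  define \<xi> where "\<xi> q a = X (Suc (N q)) q a" for q a
  \<comment> \<open>Every index whose set contains \<open>q\<close> gives the same value as the
    least one. Hence on the open set \<open>V (g n)\<close> one fixed partial sum represents \<xi>,
    which makes \<xi> smooth although \<open>N\<close> jumps.\<close>
  have xi: "\<xi> q a = X (Suc n) q a" if q: "q \<in> V (g n)" and a: "a \<in> fib ?Q q" for n q a
  proof -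
    have "N q \<le> n" unfolding N_def by (rule Least_le) (rule q)
    then show ?thesis using Xst[OF N a, of "n - N q"] by (simp add: \<xi>_def)
  qed
  have "bundle_map M ?Q E \<xi>"
  proof (rule bundle_mapI[OF Q E])
    show "linear_on ?Q E q (\<xi> q)" for q unfolding \<xi>_def by (rule Xl)
    fix s assume s: "s \<in> sections M ?Q"
    show "sapp \<xi> s \<in> sections M E" unfolding sections_iff
    proof (rule lsmooth_local)
      fix p :: 'm
      have o: "open (V (g (N p)))" using loc by blast
      have "lsmooth E (V (g (N p))) (sapp \<xi> s)"
        by (rule lsmooth_cong[OF E o lsmooth_sec_subset[OF Xs[OF s, of "Suc (N p)"]]])
          (simp add: sapp_def xi[OF _ sec_fib[OF s]])
      then show "\<exists>W'. open W' \<and> p \<in> W' \<and> lsmooth E (UNIV \<inter> W') (sapp \<xi> s)" using o N[of p] by auto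
    qed
  qed
  moreover have "pr E S q (\<xi> q a) = a" if a: "a \<in> fib ?Q q" for q a
    unfolding \<xi>_def Xp[OF a] w0[OF N[of q] lessI] using vscale_one[OF Q a] by simp
  ultimately show thesis using that by blast
qed

subsection \<open>Bundle isomorphisms\<close>

lemma bundle_isoI:
  assumes E: "vector_bundle M E" and F: "vector_bundle M F" and h: "bundle_map M E F h" and g: "bundle_map M F E g"
    and gh: "\<And>p u. u \<in> fib E p \<Longrightarrow> g p (h p u) = u" and hg: "\<And>p v. v \<in> fib F p \<Longrightarrow> h p (g p v) = v"
  shows "bundle_iso M E F h" "v \<in> fib F p \<Longrightarrow> inv_into (fib E p) (h p) v = g p v"
proof -
  note hl = linear_onD(1)[OF bundle_map_linear[OF h]] and gl = linear_onD(1)[OF bundle_map_linear[OF g]]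
  have inj: "inj_on (h p) (fib E p)" for p by (rule inj_on_inverseI[where g = "g p"]) (rule gh)
  have inv: "inv_into (fib E p) (h p) v = g p v" if "v \<in> fib F p" for p v
    by (rule inv_into_f_eq[OF inj gl[OF that] hg[OF that]])
  then show "v \<in> fib F p \<Longrightarrow> inv_into (fib E p) (h p) v = g p v" .
  have "bij_betw (h p) (fib E p) (fib F p)" for p
    by (rule bij_betw_byWitness[where f' = "g p"]) (use gh hg hl gl in auto)
  moreover have "bundle_map M F E (\<lambda>p. inv_into (fib E p) (h p))"
    by (rule bundle_map_cong[OF F E g]) (simp add: inv)
  ultimately show "bundle_iso M E F h" unfolding bundle_iso_def using h by blast
qed

lemma bundle_isoE:
  assumes "bundle_iso M E F h"
  obtains g where "bundle_map M E F h" "bundle_map M F E g" "g = (\<lambda>p. inv_into (fib E p) (h p))"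
    "\<forall>p. \<forall>u\<in>fib E p. g p (h p u) = u" "\<forall>p. \<forall>v\<in>fib F p. h p (g p v) = v"
proof -
  have *: "bundle_map M E F h" "bij_betw (h p) (fib E p) (fib F p)" "bundle_map M F E (\<lambda>p. inv_into (fib E p) (h p))" for p
    using assms unfolding bundle_iso_def by auto
  show thesis
    by (rule that[OF *(1,3) refl]) (auto simp: bij_betw_inv_into_left[OF *(2)] bij_betw_inv_into_right[OF *(2)])
qed

end


section \<open>Algebroids\<close>

text \<open>Equality of the bundle parts of records with different extensions. It carries what is
  known about \<open>sum_bundle\<close> and \<open>quot_bundle\<close> over to the algebroids that
  extend them, and what is known about \<open>C\<close> to its twists.\<close>

definition same_vb :: "('m, 'e, 'y) vbundle_scheme \<Rightarrow> ('m, 'e, 'z) vbundle_scheme \<Rightarrow> bool" where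
  "same_vb E E' \<longleftrightarrow> fib E = fib E' \<and> vzero E = vzero E' \<and> vadd E = vadd E' \<and> vscale E = vscale E' \<and> trivs E = trivs E'"

lemma same_vbD:
  assumes "same_vb E E'"
  shows "fib E = fib E'" "vzero E = vzero E'" "vadd E = vadd E'" "vscale E = vscale E'" "trivs E = trivs E'"
    "vminus E = vminus E'" "sadd E = sadd E'" "sscale E = sscale E'" "sminus E = sminus E'" "frame E = frame E'"
proof -
  show *: "fib E = fib E'" "vzero E = vzero E'" "vadd E = vadd E'" "vscale E = vscale E'" "trivs E = trivs E'"
    using assms unfolding same_vb_def by auto
  show v: "vminus E = vminus E'" by (simp add: vminus_def fun_eq_iff *)
  show "sadd E = sadd E'" "sscale E = sscale E'" "frame E = frame E'"
    by (simp_all add: sadd_def sscale_def frame_def fun_eq_iff *)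
  show "sminus E = sminus E'" by (simp add: sminus_def fun_eq_iff v)
qed

lemma same_vb_transfer:
  assumes "same_vb E E'"
  shows "sections M E = sections M E'" "vector_bundle M E \<longleftrightarrow> vector_bundle M E'"
    "linear_on E F p h \<longleftrightarrow> linear_on E' F p h" "linear_on G E p h' \<longleftrightarrow> linear_on G E' p h'"
    "bundle_map M E F k \<longleftrightarrow> bundle_map M E' F k" "bundle_map M G E k' \<longleftrightarrow> bundle_map M G E' k'"
proof -
  note * = same_vbD[OF assms]
  show "sections M E = sections M E'" by (simp add: sections_def *)
  show "vector_bundle M E \<longleftrightarrow> vector_bundle M E'"
    by (simp add: vector_bundle_def local_triv_def smooth_transition_def *)
  show "linear_on E F p h \<longleftrightarrow> linear_on E' F p h" for p h by (simp add: linear_on_def *)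
  then show "bundle_map M E F k \<longleftrightarrow> bundle_map M E' F k" by (simp add: bundle_map_def *)
  show "linear_on G E p h' \<longleftrightarrow> linear_on G E' p h'" for p h' by (simp add: linear_on_def *)
  then show "bundle_map M G E k' \<longleftrightarrow> bundle_map M G E' k'" by (simp add: bundle_map_def *)
qed

lemma same_vb_transfer2:
  assumes "same_vb E E'"
  shows "subbundle M E S \<longleftrightarrow> subbundle M E' S" "hom_bundle E = hom_bundle E'" "commutator E = commutator E'"
proof -
  note * = same_vbD[OF assms]
  have l: "linear_on E E p h \<longleftrightarrow> linear_on E' E' p h" for p h by (simp add: linear_on_def *)
  have s: "smooth_triv M E U k \<Phi> \<longleftrightarrow> smooth_triv M E' U k \<Phi>" for U k \<Phi>
    by (simp add: smooth_triv_def smooth_transition_def local_triv_def *)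
  show "subbundle M E S \<longleftrightarrow> subbundle M E' S" by (simp add: subbundle_def adapted_triv_def s *)
  have f: "frame E = frame E'" by (simp add: fun_eq_iff frame_def *)
  show "hom_bundle E = hom_bundle E'" unfolding hom_bundle_def by (simp only: l f *)
  show "commutator E = commutator E'" by (simp add: commutator_def fun_eq_iff *)
qed

lemma twist_simps [simp]:
  "anchor (twist C \<eta>) = anchor C"
  "brk (twist C \<eta>) = (\<lambda>\<alpha> \<beta> p. vminus C p (vadd C p (brk C \<alpha> \<beta> p) (\<eta> p (\<alpha> p) (\<beta> p))) (\<eta> p (\<beta> p) (\<alpha> p)))"
  by (simp_all add: twist_def)

lemma same_vb_twist: "same_vb (twist C \<eta>) C"
  by (simp add: same_vb_def twist_def)

context smooth_mfd
begin

lemma almost_LieD: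
  assumes "almost_Lie_algebroid M A"
  shows "vector_bundle M A" "anchor_map M A (anchor A)"
    "\<alpha> \<in> sections M A \<Longrightarrow> \<beta> \<in> sections M A \<Longrightarrow> brk A \<alpha> \<beta> \<in> sections M A"
    "\<alpha> \<in> sections M A \<Longrightarrow> \<alpha>' \<in> sections M A \<Longrightarrow> \<beta> \<in> sections M A \<Longrightarrow>
      brk A (sadd A \<alpha> \<alpha>') \<beta> = sadd A (brk A \<alpha> \<beta>) (brk A \<alpha>' \<beta>)"
    "\<alpha> \<in> sections M A \<Longrightarrow> \<beta> \<in> sections M A \<Longrightarrow> \<beta>' \<in> sections M A \<Longrightarrow>
      brk A \<alpha> (sadd A \<beta> \<beta>') = sadd A (brk A \<alpha> \<beta>) (brk A \<alpha> \<beta>')"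
    "\<alpha> \<in> sections M A \<Longrightarrow> \<beta> \<in> sections M A \<Longrightarrow> brk A \<alpha> \<beta> = sscale A (\<lambda>_. -1) (brk A \<beta> \<alpha>)"
    "\<alpha> \<in> sections M A \<Longrightarrow> \<beta> \<in> sections M A \<Longrightarrow> f \<in> Cinf M \<Longrightarrow>
      brk A \<alpha> (sscale A f \<beta>) = sadd A (sscale A f (brk A \<alpha> \<beta>)) (sscale A (Lie A \<alpha> f) \<beta>)"
    "\<alpha> \<in> sections M A \<Longrightarrow> \<beta> \<in> sections M A \<Longrightarrow> f \<in> Cinf M \<Longrightarrow>
      Lie A (brk A \<alpha> \<beta>) f = (\<lambda>p. Lie A \<alpha> (Lie A \<beta> f) p - Lie A \<beta> (Lie A \<alpha> f) p)"
    "\<alpha> \<in> sections M A \<Longrightarrow> \<beta> \<in> sections M A \<Longrightarrow> brk A (sscale A (\<lambda>_. c) \<alpha>) \<beta> = sscale A (\<lambda>_. c) (brk A \<alpha> \<beta>)"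
    "\<alpha> \<in> sections M A \<Longrightarrow> \<beta> \<in> sections M A \<Longrightarrow> brk A \<alpha> (sscale A (\<lambda>_. c) \<beta>) = sscale A (\<lambda>_. c) (brk A \<alpha> \<beta>)"
  using assms unfolding almost_Lie_algebroid_def bilinear_sections_def by blast+

lemma anchor_mapD:
  assumes "anchor_map M E \<rho>"
  shows "u \<in> fib E p \<Longrightarrow> \<rho> p u \<in> tangent_space M p"
    "u \<in> fib E p \<Longrightarrow> v \<in> fib E p \<Longrightarrow> \<rho> p (vadd E p u v) = (\<lambda>f. \<rho> p u f + \<rho> p v f)"
    "u \<in> fib E p \<Longrightarrow> \<rho> p (vscale E p c u) = (\<lambda>f. c * \<rho> p u f)"
  using assms unfolding anchor_map_def by auto

text \<open>For each fixed \<open>f\<close> this is \<open>smooth_functional_iff\<close>; it allows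
  anchors to be verified on sections.\<close>

lemma anchor_map_iff:
  assumes E: "vector_bundle M E"
  shows "anchor_map M E \<rho> \<longleftrightarrow>
    (\<forall>p. \<forall>u\<in>fib E p. \<rho> p u \<in> tangent_space M p) \<and>
    (\<forall>p. \<forall>u\<in>fib E p. \<forall>v\<in>fib E p. \<rho> p (vadd E p u v) = (\<lambda>f. \<rho> p u f + \<rho> p v f)) \<and>
    (\<forall>p c. \<forall>u\<in>fib E p. \<rho> p (vscale E p c u) = (\<lambda>f. c * \<rho> p u f)) \<and>
    (\<forall>s\<in>sections M E. \<forall>f\<in>Cinf M. (\<lambda>p. \<rho> p (s p) f) \<in> Cinf M)"
proof -
  have "(\<forall>(U, k, \<Phi>) \<in> trivs E. \<forall>j<k. \<forall>f\<in>Cinf M. smooth_fun M U (\<lambda>p. \<rho> p (frame E \<Phi> j p) f)) \<longleftrightarrow>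
      (\<forall>s\<in>sections M E. \<forall>f\<in>Cinf M. (\<lambda>p. \<rho> p (s p) f) \<in> Cinf M)"
    if "\<forall>p. \<forall>u\<in>fib E p. \<forall>v\<in>fib E p. \<rho> p (vadd E p u v) = (\<lambda>f. \<rho> p u f + \<rho> p v f)"
      "\<forall>p c. \<forall>u\<in>fib E p. \<rho> p (vscale E p c u) = (\<lambda>f. c * \<rho> p u f)"
  proof -
    have "(\<forall>(U, k, \<Phi>) \<in> trivs E. \<forall>j<k. smooth_fun M U (\<lambda>p. \<rho> p (frame E \<Phi> j p) f)) \<longleftrightarrow>
      (\<forall>s\<in>sections M E. (\<lambda>p. \<rho> p (s p) f) \<in> Cinf M)" for f
      by (rule smooth_functional_iff[OF E, where L = "\<lambda>p u. \<rho> p u f"]) (simp_all add: that)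
    then show ?thesis by fast
  qed
  note sm = this
  show ?thesis unfolding anchor_map_def by (intro conj_cong refl) (rule sm; assumption)
qed

lemma Lie_Cinf:
  assumes A: "almost_Lie_algebroid M A" and "s \<in> sections M A" "f \<in> Cinf M"
  shows "Lie A s f \<in> Cinf M"
  using almost_LieD(2)[OF A] assms(2,3) unfolding anchor_map_iff[OF almost_LieD(1)[OF A]] Lie_def by blast

lemma tangent_vector_eq_zero:
  assumes "v \<in> tangent_space M p" "\<And>f. f \<in> Cinf M \<Longrightarrow> v f = 0" shows "v = (\<lambda>_. 0)"
proof
  fix f show "v f = 0" using assms unfolding tangent_space_def by (cases "f \<in> Cinf M") auto
qed

lemma brk_minus:
  assumes A: "almost_Lie_algebroid M A" and s: "\<alpha> \<in> sections M A" "\<alpha>' \<in> sections M A" "\<beta> \<in> sections M A"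
  shows "brk A (sminus A \<alpha> \<alpha>') \<beta> = sminus A (brk A \<alpha> \<beta>) (brk A \<alpha>' \<beta>)"
    "brk A \<beta> (sminus A \<alpha> \<alpha>') = sminus A (brk A \<beta> \<alpha>) (brk A \<beta> \<alpha>')"
proof -
  note AD = almost_LieD[OF A]
  have m: "sscale A (\<lambda>_. -1) \<alpha>' \<in> sections M A" by (intro secs AD(1) s)
  show "brk A (sminus A \<alpha> \<alpha>') \<beta> = sminus A (brk A \<alpha> \<beta>) (brk A \<alpha>' \<beta>)"
    unfolding sminus_eq AD(4)[OF s(1) m s(3)] AD(9)[OF s(2,3)] ..
  show "brk A \<beta> (sminus A \<alpha> \<alpha>') = sminus A (brk A \<beta> \<alpha>) (brk A \<beta> \<alpha>')"
    unfolding sminus_eq AD(5)[OF s(3,1) m] AD(10)[OF s(3,2)] ..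
qed

lemma brk_skew:
  assumes A: "almost_Lie_algebroid M A" and s: "\<alpha> \<in> sections M A" "\<beta> \<in> sections M A"
  shows "brk A \<alpha> \<beta> p = vscale A p (-1) (brk A \<beta> \<alpha> p)"
  using fun_cong[OF almost_LieD(6)[OF A s], of p] by (simp add: sscale_def)

text \<open>Skew symmetry moves the Leibniz rule to the first argument, where the derivative term
  changes its sign.\<close>

lemma brk_scale_left:
  assumes A: "almost_Lie_algebroid M A" and s: "\<alpha> \<in> sections M A" "\<beta> \<in> sections M A" and f: "f \<in> Cinf M"
  shows "brk A (sscale A f \<alpha>) \<beta> p = vminus A p (vscale A p (f p) (brk A \<alpha> \<beta> p)) (vscale A p (Lie A \<beta> f p) (\<alpha> p))"
proof -
  note AD = almost_LieD[OF A]
  note vb = AD(1)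
  have fa: "sscale A f \<alpha> \<in> sections M A" by (intro secs vb s f)
  note fibs' = sec_fib[OF s(1)] sec_fib[OF s(2)] sec_fib[OF AD(3)[OF s]] sec_fib[OF AD(3)[OF s(2,1)]]
  have "brk A (sscale A f \<alpha>) \<beta> p = vscale A p (-1) (brk A \<beta> (sscale A f \<alpha>) p)" by (rule brk_skew[OF A fa s(2)])
  also have "brk A \<beta> (sscale A f \<alpha>) p = vadd A p (vscale A p (f p) (brk A \<beta> \<alpha> p)) (vscale A p (Lie A \<beta> f p) (\<alpha> p))"
    unfolding AD(7)[OF s(2,1) f] by (simp add: sadd_def sscale_def)
  also have "vscale A p (-1) \<dots> = vminus A p (vscale A p (f p) (brk A \<alpha> \<beta> p)) (vscale A p (Lie A \<beta> f p) (\<alpha> p))"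
    unfolding brk_skew[OF A s, of p]
    by (rule fib_eqI[OF vb, where p = p]) (simp_all add: fibs crds vb fibs')
  finally show ?thesis .
qed

lemma almost_CartanD:
  assumes "almost_Cartan_algebroid M C \<sigma>"
  shows "almost_Lie_algebroid M C" "vector_bundle M C" "transitive_algebroid M C" "subbundle M (hom_bundle C) \<sigma>"
    "T \<in> \<sigma> p \<Longrightarrow> v \<in> fib C p \<Longrightarrow> anchor C p (T v) = (\<lambda>_. 0)"
    "vector_bundle M (hom_bundle C)" "vector_bundle M (sub_bundle M (hom_bundle C) \<sigma>)"
    "T \<in> \<sigma> p \<Longrightarrow> T \<in> extensional (fib C p)" "T \<in> \<sigma> p \<Longrightarrow> linear_on C C p T"
proof -
  show 1: "almost_Lie_algebroid M C" "transitive_algebroid M C" "subbundle M (hom_bundle C) \<sigma>"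
    "T \<in> \<sigma> p \<Longrightarrow> v \<in> fib C p \<Longrightarrow> anchor C p (T v) = (\<lambda>_. 0)"
    using assms unfolding almost_Cartan_algebroid_def by auto
  show 2: "vector_bundle M C" by (rule almost_LieD(1)[OF 1(1)])
  show 3: "vector_bundle M (hom_bundle C)" by (rule hom_vector_bundle[OF 2])
  show "vector_bundle M (sub_bundle M (hom_bundle C) \<sigma>)" by (rule sub_vector_bundle[OF 3 1(3)])
  show "T \<in> \<sigma> p \<Longrightarrow> T \<in> extensional (fib C p)" "T \<in> \<sigma> p \<Longrightarrow> linear_on C C p T"
    using sub_fib[OF 1(3), of T p] hom_fibD by auto
qed

lemma Cartan_algebroidD:
  assumes "Cartan_algebroid M C \<sigma>"
  shows "almost_Cartan_algebroid M C \<sigma>" "S \<in> \<sigma> p \<Longrightarrow> T \<in> \<sigma> p \<Longrightarrow> commutator C p S T \<in> \<sigma> p"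
  using assms unfolding Cartan_algebroid_def by auto

text \<open>\<open>sub_sections\<close> and \<open>hom_sections\<close> combined: the working
  criterion for sections of \<sigma>, free of matrix entries.\<close>

lemma sigma_sections:
  assumes C: "vector_bundle M C" and S: "subbundle M (hom_bundle C) \<sigma>"
  shows "T \<in> sections M (sub_bundle M (hom_bundle C) \<sigma>) \<longleftrightarrow> (\<forall>p. T p \<in> \<sigma> p) \<and> (\<forall>r\<in>sections M C. sapp T r \<in> sections M C)"
  unfolding sub_sections[OF hom_vector_bundle[OF C] S] hom_sections[OF C]
  using sub_fib[OF S] by blast

lemma sigma_bundle_mapD:
  assumes E: "vector_bundle M E" and C: "vector_bundle M C" and S: "subbundle M (hom_bundle C) \<sigma>"
    and h: "bundle_map M E (sub_bundle M (hom_bundle C) \<sigma>) \<eta>"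
  shows "u \<in> fib E p \<Longrightarrow> \<eta> p u \<in> \<sigma> p"
    "u \<in> fib E p \<Longrightarrow> linear_on C C p (\<eta> p u)"
    "u \<in> fib E p \<Longrightarrow> w \<in> fib C p \<Longrightarrow> \<eta> p u w \<in> fib C p"
    "u \<in> fib E p \<Longrightarrow> v \<in> fib E p \<Longrightarrow> w \<in> fib C p \<Longrightarrow> \<eta> p (vadd E p u v) w = vadd C p (\<eta> p u w) (\<eta> p v w)"
    "u \<in> fib E p \<Longrightarrow> w \<in> fib C p \<Longrightarrow> \<eta> p (vscale E p c u) w = vscale C p c (\<eta> p u w)"
    "s \<in> sections M E \<Longrightarrow> r \<in> sections M C \<Longrightarrow> (\<lambda>p. \<eta> p (s p) (r p)) \<in> sections M C"
proof -
  note l = linear_onD[OF bundle_map_linear[OF h]]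
  show m: "\<And>u. u \<in> fib E p \<Longrightarrow> \<eta> p u \<in> \<sigma> p" using l(1) by simp
  show ll: "\<And>u. u \<in> fib E p \<Longrightarrow> linear_on C C p (\<eta> p u)" by (rule hom_fibD(2)[OF sub_fib[OF S m]])
  show "u \<in> fib E p \<Longrightarrow> w \<in> fib C p \<Longrightarrow> \<eta> p u w \<in> fib C p" by (rule linear_onD(1)[OF ll])
  show "u \<in> fib E p \<Longrightarrow> v \<in> fib E p \<Longrightarrow> w \<in> fib C p \<Longrightarrow> \<eta> p (vadd E p u v) w = vadd C p (\<eta> p u w) (\<eta> p v w)"
    using l(2)[of u p v] by simp
  show "u \<in> fib E p \<Longrightarrow> w \<in> fib C p \<Longrightarrow> \<eta> p (vscale E p c u) w = vscale C p c (\<eta> p u w)"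
    using l(3)[of u p c] by simp
  assume s: "s \<in> sections M E" and r: "r \<in> sections M C"
  have "sapp \<eta> s \<in> sections M (sub_bundle M (hom_bundle C) \<sigma>)"
    by (rule bundle_map_sec[OF E sub_vector_bundle[OF hom_vector_bundle[OF C] S] h s])
  then show "(\<lambda>p. \<eta> p (s p) (r p)) \<in> sections M C"
    unfolding sigma_sections[OF C S] using r by (auto simp: sapp_def)
qed

subsection \<open>Gauge equivalence\<close>

text \<open>The isomorphism runs from \<open>C'\<close> to a twist of \<open>C\<close>, as in
  \<open>gauge_equivalent\<close>. With an explicit inverse \<open>g\<close> the equality of the
  \<sigma>-bundles splits into two inclusions, and the twisted bracket is spelt out in terms of
  \<open>C\<close>.\<close>

lemma gauge_equivalentI:
  assumes C: "almost_Cartan_algebroid M C \<sigma>" and C': "almost_Cartan_algebroid M C' \<sigma>'"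
    and eta: "bundle_map M C (sub_bundle M (hom_bundle C) \<sigma>) \<eta>"
    and psi: "bundle_map M C' C \<psi>" and g: "bundle_map M C C' g"
    and gp: "\<And>p u. u \<in> fib C' p \<Longrightarrow> g p (\<psi> p u) = u" and pg: "\<And>p v. v \<in> fib C p \<Longrightarrow> \<psi> p (g p v) = v"
    and br: "\<And>\<alpha> \<beta> p. \<alpha> \<in> sections M C' \<Longrightarrow> \<beta> \<in> sections M C' \<Longrightarrow> \<psi> p (brk C' \<alpha> \<beta> p) =
      vminus C p (vadd C p (brk C (sapp \<psi> \<alpha>) (sapp \<psi> \<beta>) p) (\<eta> p (\<psi> p (\<alpha> p)) (\<psi> p (\<beta> p)))) (\<eta> p (\<psi> p (\<beta> p)) (\<psi> p (\<alpha> p)))"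
    and an: "\<And>p v. v \<in> fib C' p \<Longrightarrow> anchor C p (\<psi> p v) = anchor C' p v"
    and s1: "\<And>p T. T \<in> \<sigma>' p \<Longrightarrow> (\<lambda>v\<in>fib C p. \<psi> p (T (g p v))) \<in> \<sigma> p"
    and s2: "\<And>p T. T \<in> \<sigma> p \<Longrightarrow> (\<lambda>v\<in>fib C' p. g p (T (\<psi> p v))) \<in> \<sigma>' p"
  shows "gauge_equivalent M C \<sigma> C' \<sigma>'"
proof -
  note CD = almost_CartanD[OF C] and CD' = almost_CartanD[OF C']
  note t = same_vb_transfer[OF same_vb_twist] same_vbD[OF same_vb_twist]
  note iso = bundle_isoI[OF CD'(2) CD(2) psi g gp pg]
  note gl = linear_onD(1)[OF bundle_map_linear[OF g]]
  have "bundle_iso M C' (twist C \<eta>) \<psi>"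
    using iso(1) unfolding bundle_iso_def by (simp add: t)
  moreover have "sapp \<psi> (brk C' \<alpha> \<beta>) = brk (twist C \<eta>) (sapp \<psi> \<alpha>) (sapp \<psi> \<beta>)"
    if "\<alpha> \<in> sections M C'" "\<beta> \<in> sections M C'" for \<alpha> \<beta>
    using br[OF that] by (simp add: fun_eq_iff sapp_def)
  moreover have "(\<lambda>T. \<lambda>v\<in>fib (twist C \<eta>) p. \<psi> p (T (inv_into (fib C' p) (\<psi> p) v))) ` \<sigma>' p = \<sigma> p" for p
  proof -
    have eq: "(\<lambda>v\<in>fib (twist C \<eta>) p. \<psi> p (T (inv_into (fib C' p) (\<psi> p) v))) = (\<lambda>v\<in>fib C p. \<psi> p (T (g p v)))" for T
      by (rule ext) (simp add: t iso(2))
    show ?thesis unfolding eq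
    proof (intro equalityI subsetI)
      fix T assume T: "T \<in> \<sigma> p"
      have "T = (\<lambda>v\<in>fib C p. \<psi> p ((\<lambda>v\<in>fib C' p. g p (T (\<psi> p v))) (g p v)))"
        by (rule extensionalityI[OF CD(8)[OF T] restrict_extensional])
          (simp add: gl pg linear_onD(1)[OF CD(9)[OF T]])
      then show "T \<in> (\<lambda>T. \<lambda>v\<in>fib C p. \<psi> p (T (g p v))) ` \<sigma>' p" using s2[OF T] by blast
    qed (use s1 in auto)
  qed
  ultimately have "Cartan_algebroid_iso M C' \<sigma>' (twist C \<eta>) \<sigma>"
    unfolding Cartan_algebroid_iso_def using an by (intro exI[of _ \<psi>]) simp
  then show ?thesis unfolding gauge_equivalent_def using eta by blast
qed

lemma gauge_equivalentE:
  assumes g: "gauge_equivalent M C \<sigma> C' \<sigma>'"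
    and C: "almost_Cartan_algebroid M C \<sigma>" and C': "almost_Cartan_algebroid M C' \<sigma>'"
  obtains \<eta> \<psi> g where "bundle_map M C (sub_bundle M (hom_bundle C) \<sigma>) \<eta>"
    "bundle_map M C' C \<psi>" "bundle_map M C C' g"
    "\<forall>p. \<forall>u\<in>fib C' p. g p (\<psi> p u) = u" "\<forall>p. \<forall>v\<in>fib C p. \<psi> p (g p v) = v"
    "\<forall>\<alpha>\<in>sections M C'. \<forall>\<beta>\<in>sections M C'. \<forall>p. \<psi> p (brk C' \<alpha> \<beta> p) =
      vminus C p (vadd C p (brk C (sapp \<psi> \<alpha>) (sapp \<psi> \<beta>) p) (\<eta> p (\<psi> p (\<alpha> p)) (\<psi> p (\<beta> p)))) (\<eta> p (\<psi> p (\<beta> p)) (\<psi> p (\<alpha> p)))"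
    "\<forall>p. \<forall>v\<in>fib C' p. anchor C p (\<psi> p v) = anchor C' p v"
    "\<forall>p. \<forall>T\<in>\<sigma>' p. (\<lambda>v\<in>fib C p. \<psi> p (T (g p v))) \<in> \<sigma> p"
    "\<forall>p. \<forall>T\<in>\<sigma> p. (\<lambda>v\<in>fib C' p. g p (T (\<psi> p v))) \<in> \<sigma>' p"
proof -
  note CD = almost_CartanD[OF C] and CD' = almost_CartanD[OF C']
  note t = same_vb_transfer[OF same_vb_twist] same_vbD[OF same_vb_twist]
  obtain \<eta> \<psi> where eta: "bundle_map M C (sub_bundle M (hom_bundle C) \<sigma>) \<eta>"
    and iso: "bundle_iso M C' (twist C \<eta>) \<psi>"
    and br: "\<forall>\<alpha>\<in>sections M C'. \<forall>\<beta>\<in>sections M C'. sapp \<psi> (brk C' \<alpha> \<beta>) = brk (twist C \<eta>) (sapp \<psi> \<alpha>) (sapp \<psi> \<beta>)"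
    and an: "\<forall>p. \<forall>v\<in>fib C' p. anchor (twist C \<eta>) p (\<psi> p v) = anchor C' p v"
    and sg: "\<forall>p. (\<lambda>T. \<lambda>v\<in>fib (twist C \<eta>) p. \<psi> p (T (inv_into (fib C' p) (\<psi> p) v))) ` \<sigma>' p = \<sigma> p"
    using g unfolding gauge_equivalent_def Cartan_algebroid_iso_def by (elim exE conjE)
  obtain g where g: "bundle_map M C' (twist C \<eta>) \<psi>" "bundle_map M (twist C \<eta>) C' g" "g = (\<lambda>p. inv_into (fib C' p) (\<psi> p))"
    "\<forall>p. \<forall>u\<in>fib C' p. g p (\<psi> p u) = u" "\<forall>p. \<forall>v\<in>fib (twist C \<eta>) p. \<psi> p (g p v) = v"
    by (rule bundle_isoE[OF iso])
  have psi: "bundle_map M C' C \<psi>" "bundle_map M C C' g" using g(1,2) by (simp_all add: t)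
  note pl = linear_onD(1)[OF bundle_map_linear[OF psi(1)]]
  have sg': "(\<lambda>T. \<lambda>v\<in>fib C p. \<psi> p (T (g p v))) ` \<sigma>' p = \<sigma> p" for p
    using sg unfolding g(3) by (simp add: t)
  have s1: "\<forall>p. \<forall>T\<in>\<sigma>' p. (\<lambda>v\<in>fib C p. \<psi> p (T (g p v))) \<in> \<sigma> p" using sg' by blast
  have s2: "(\<lambda>v\<in>fib C' p. g p (T (\<psi> p v))) \<in> \<sigma>' p" if "T \<in> \<sigma> p" for p T
  proof -
    obtain T' where T': "T' \<in> \<sigma>' p" "T = (\<lambda>v\<in>fib C p. \<psi> p (T' (g p v)))" using \<open>T \<in> \<sigma> p\<close> sg'[of p] by blast
    have "(\<lambda>v\<in>fib C' p. g p (T (\<psi> p v))) = T'"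
      by (rule extensionalityI[OF restrict_extensional CD'(8)[OF T'(1)]])
        (simp add: T'(2) pl g(4) linear_onD(1)[OF CD'(9)[OF T'(1)]])
    then show ?thesis using T'(1) by simp
  qed
  show thesis
  proof (rule that[OF eta psi g(4) _ _ _ s1])
    show "\<forall>p. \<forall>v\<in>fib C p. \<psi> p (g p v) = v" using g(5) by (simp add: t)
    show "\<forall>\<alpha>\<in>sections M C'. \<forall>\<beta>\<in>sections M C'. \<forall>p. \<psi> p (brk C' \<alpha> \<beta> p) =
      vminus C p (vadd C p (brk C (sapp \<psi> \<alpha>) (sapp \<psi> \<beta>) p) (\<eta> p (\<psi> p (\<alpha> p)) (\<psi> p (\<beta> p)))) (\<eta> p (\<psi> p (\<beta> p)) (\<psi> p (\<alpha> p)))"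
    proof (intro ballI allI)
      fix \<alpha> \<beta> p assume "\<alpha> \<in> sections M C'" "\<beta> \<in> sections M C'"
      then have "sapp \<psi> (brk C' \<alpha> \<beta>) p = brk (twist C \<eta>) (sapp \<psi> \<alpha>) (sapp \<psi> \<beta>) p" using br by simp
      then show "\<psi> p (brk C' \<alpha> \<beta> p) =
        vminus C p (vadd C p (brk C (sapp \<psi> \<alpha>) (sapp \<psi> \<beta>) p) (\<eta> p (\<psi> p (\<alpha> p)) (\<psi> p (\<beta> p)))) (\<eta> p (\<psi> p (\<beta> p)) (\<psi> p (\<alpha> p)))"
        by (simp add: sapp_def)
    qed
    show "\<forall>p. \<forall>v\<in>fib C' p. anchor C p (\<psi> p v) = anchor C' p v" using an by simp
  qed (use s2 in blast)
qed

lemma bundle_map_id: "vector_bundle M E \<Longrightarrow> bundle_map M E E (\<lambda>p u. u)"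
  by (rule bundle_mapI) (simp_all add: linear_on_id sapp_def)

lemma bundle_map_comp:
  assumes "vector_bundle M E" "vector_bundle M F" "vector_bundle M G" "bundle_map M E F h" "bundle_map M F G k"
  shows "bundle_map M E G (\<lambda>p u. k p (h p u))"
proof (rule bundle_mapI[OF assms(1,3)])
  show "linear_on E G p (\<lambda>u. k p (h p u))" for p
    by (rule linear_onI) (simp_all add: linear_onD[OF bundle_map_linear[OF assms(4)]] linear_onD[OF bundle_map_linear[OF assms(5)]])
  show "sapp (\<lambda>p u. k p (h p u)) s \<in> sections M G" if "s \<in> sections M E" for s
    using bundle_map_sec[OF assms(2,3,5) bundle_map_sec[OF assms(1,2,4) that]] by (simp add: sapp_def)
qed

subsection \<open>Isomorphisms of Cartan pairs\<close>

lemma Cartan_pairD: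
  assumes "Cartan_pair M A \<sigma>"
  shows "almost_Lie_algebroid M A" "vector_bundle M A" "transitive_algebroid M A" "subbundle M A \<sigma>"
    "v \<in> \<sigma> p \<Longrightarrow> anchor A p v = (\<lambda>_. 0)"
    "S \<in> sections M A \<Longrightarrow> (\<And>p. S p \<in> \<sigma> p) \<Longrightarrow> T \<in> sections M A \<Longrightarrow> (\<And>p. T p \<in> \<sigma> p) \<Longrightarrow> brk A S T p \<in> \<sigma> p"
    "\<alpha> \<in> sections M A \<Longrightarrow> \<beta> \<in> sections M A \<Longrightarrow> \<gamma> \<in> sections M A \<Longrightarrow> jacobiator A \<alpha> \<beta> \<gamma> p \<in> \<sigma> p"
proof -
  show 1: "almost_Lie_algebroid M A" "transitive_algebroid M A" "subbundle M A \<sigma>"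
    "v \<in> \<sigma> p \<Longrightarrow> anchor A p v = (\<lambda>_. 0)"
    using assms unfolding Cartan_pair_def by auto
  show 2: "vector_bundle M A" by (rule almost_LieD(1)[OF 1(1)])
  note ss = sub_sections[OF 2 1(3)]
  {
    assume "S \<in> sections M A" "\<And>p. S p \<in> \<sigma> p" "T \<in> sections M A" "\<And>p. T p \<in> \<sigma> p"
    then have "S \<in> sections M (sub_bundle M A \<sigma>)" "T \<in> sections M (sub_bundle M A \<sigma>)" by (simp_all add: ss)
    then have "brk A S T \<in> sections M (sub_bundle M A \<sigma>)" using assms unfolding Cartan_pair_def by blast
    then show "brk A S T p \<in> \<sigma> p" by (simp add: ss)
  }
  assume "\<alpha> \<in> sections M A" "\<beta> \<in> sections M A" "\<gamma> \<in> sections M A"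
  then have "jacobiator A \<alpha> \<beta> \<gamma> \<in> sections M (sub_bundle M A \<sigma>)"
    using assms unfolding Cartan_pair_def by blast
  then show "jacobiator A \<alpha> \<beta> \<gamma> p \<in> \<sigma> p" by (simp add: ss)
qed

lemma Cartan_pair_isoI:
  assumes A: "vector_bundle M A" and A': "vector_bundle M A'"
    and psi: "bundle_map M A A' \<psi>" and g: "bundle_map M A' A g"
    and gp: "\<And>p u. u \<in> fib A p \<Longrightarrow> g p (\<psi> p u) = u" and pg: "\<And>p v. v \<in> fib A' p \<Longrightarrow> \<psi> p (g p v) = v"
    and sub: "subbundle M A' \<sigma>'"
    and s1: "\<And>p u. u \<in> \<sigma> p \<Longrightarrow> \<psi> p u \<in> \<sigma>' p" and s2: "\<And>p v. v \<in> \<sigma>' p \<Longrightarrow> g p v \<in> \<sigma> p"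
    and an: "\<And>p v. v \<in> fib A p \<Longrightarrow> anchor A' p (\<psi> p v) = anchor A p v"
    and br: "\<And>\<alpha> \<beta> p. \<alpha> \<in> sections M A \<Longrightarrow> \<beta> \<in> sections M A \<Longrightarrow>
      vminus A' p (\<psi> p (brk A \<alpha> \<beta> p)) (brk A' (sapp \<psi> \<alpha>) (sapp \<psi> \<beta>) p) \<in> \<sigma>' p"
  shows "Cartan_pair_iso M A \<sigma> A' \<sigma>'"
proof -
  have "\<psi> p ` \<sigma> p = \<sigma>' p" for p
  proof (intro equalityI subsetI)
    fix v assume v: "v \<in> \<sigma>' p"
    then show "v \<in> \<psi> p ` \<sigma> p" using pg[OF sub_fib[OF sub v]] s2[OF v] by (metis imageI)
  qed (use s1 in auto)
  then show ?thesis
    unfolding Cartan_pair_iso_def using bundle_isoI(1)[OF A A' psi g gp pg] an br by (intro exI[of _ \<psi>]) simp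
qed

lemma Cartan_pair_isoE:
  assumes i: "Cartan_pair_iso M A \<sigma> A' \<sigma>'" and sub: "subbundle M A \<sigma>"
  obtains \<psi> g where "bundle_map M A A' \<psi>" "bundle_map M A' A g"
    "\<forall>p. \<forall>u\<in>fib A p. g p (\<psi> p u) = u" "\<forall>p. \<forall>v\<in>fib A' p. \<psi> p (g p v) = v"
    "\<forall>p. \<forall>u\<in>\<sigma> p. \<psi> p u \<in> \<sigma>' p" "\<forall>p. \<forall>v\<in>\<sigma>' p. g p v \<in> \<sigma> p"
    "\<forall>p. \<forall>v\<in>fib A p. anchor A' p (\<psi> p v) = anchor A p v"
    "\<forall>\<alpha>\<in>sections M A. \<forall>\<beta>\<in>sections M A. \<forall>p.
      vminus A' p (\<psi> p (brk A \<alpha> \<beta> p)) (brk A' (sapp \<psi> \<alpha>) (sapp \<psi> \<beta>) p) \<in> \<sigma>' p"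
proof -
  obtain \<psi> where psi: "bundle_iso M A A' \<psi>" "\<forall>p. \<psi> p ` \<sigma> p = \<sigma>' p"
    "\<forall>p. \<forall>v\<in>fib A p. anchor A' p (\<psi> p v) = anchor A p v"
    "\<forall>\<alpha>\<in>sections M A. \<forall>\<beta>\<in>sections M A. \<forall>p.
      vminus A' p (\<psi> p (brk A \<alpha> \<beta> p)) (brk A' (sapp \<psi> \<alpha>) (sapp \<psi> \<beta>) p) \<in> \<sigma>' p"
    using i unfolding Cartan_pair_iso_def by (elim exE conjE)
  obtain g where g: "bundle_map M A A' \<psi>" "bundle_map M A' A g" "g = (\<lambda>p. inv_into (fib A p) (\<psi> p))"
    "\<forall>p. \<forall>u\<in>fib A p. g p (\<psi> p u) = u" "\<forall>p. \<forall>v\<in>fib A' p. \<psi> p (g p v) = v" by (rule bundle_isoE[OF psi(1)])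
  have "g p v \<in> \<sigma> p" if "v \<in> \<sigma>' p" for p v
  proof -
    obtain u where u: "u \<in> \<sigma> p" "v = \<psi> p u" using psi(2) \<open>v \<in> \<sigma>' p\<close> by blast
    then show ?thesis using g(4) sub_fib[OF sub u(1)] by simp
  qed
  moreover have "\<forall>p. \<forall>u\<in>\<sigma> p. \<psi> p u \<in> \<sigma>' p" using psi(2) by blast
  ultimately show thesis by (intro that[OF g(1,2,4,5) _ _ psi(3,4)]) auto
qed

lemma Cartan_pair_iso_refl:
  assumes A: "Cartan_pair M A \<sigma>"
  shows "Cartan_pair_iso M A \<sigma> A \<sigma>"
proof -
  note AD = Cartan_pairD[OF A]
  show ?thesis
  proof (rule Cartan_pair_isoI[OF AD(2,2) bundle_map_id[OF AD(2)] bundle_map_id[OF AD(2)] _ _ AD(4)])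
    fix \<alpha> \<beta> p assume s: "\<alpha> \<in> sections M A" "\<beta> \<in> sections M A"
    have "vminus A p (brk A \<alpha> \<beta> p) (brk A \<alpha> \<beta> p) = vzero A p"
      by (rule fib_eqI[OF AD(2), where p = p]) (simp_all add: fibs crds AD(2) sec_fib[OF almost_LieD(3)[OF AD(1) s]])
    then show "vminus A p (brk A \<alpha> \<beta> p) (brk A (sapp (\<lambda>p u. u) \<alpha>) (sapp (\<lambda>p u. u) \<beta>) p) \<in> \<sigma> p"
      using sub_zero[OF AD(2,4)] by (simp add: sapp_def)
  qed simp_all
qed

text \<open>The bracket defect of \<psi> on the sections that \<open>g\<close> makes of \<alpha> and
  \<beta> lies in \<sigma>'; applying \<open>g\<close> turns it, up to sign, into the bracket defect
  of \<open>g\<close>.\<close>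

lemma Cartan_pair_iso_sym:
  assumes A: "Cartan_pair M A \<sigma>" and A': "Cartan_pair M A' \<sigma>'" and i: "Cartan_pair_iso M A \<sigma> A' \<sigma>'"
  shows "Cartan_pair_iso M A' \<sigma>' A \<sigma>"
proof -
  note AD = Cartan_pairD[OF A] and AD' = Cartan_pairD[OF A']
  obtain \<psi> g where psi: "bundle_map M A A' \<psi>" and g: "bundle_map M A' A g"
    and gp: "\<forall>p. \<forall>u\<in>fib A p. g p (\<psi> p u) = u" and pg: "\<forall>p. \<forall>v\<in>fib A' p. \<psi> p (g p v) = v"
    and s1: "\<forall>p. \<forall>u\<in>\<sigma> p. \<psi> p u \<in> \<sigma>' p" and s2: "\<forall>p. \<forall>v\<in>\<sigma>' p. g p v \<in> \<sigma> p"
    and an: "\<forall>p. \<forall>v\<in>fib A p. anchor A' p (\<psi> p v) = anchor A p v"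
    and br: "\<forall>\<alpha>\<in>sections M A. \<forall>\<beta>\<in>sections M A. \<forall>p.
      vminus A' p (\<psi> p (brk A \<alpha> \<beta> p)) (brk A' (sapp \<psi> \<alpha>) (sapp \<psi> \<beta>) p) \<in> \<sigma>' p"
    by (rule Cartan_pair_isoE[OF i AD(4)])
  note gl = linear_onD[OF bundle_map_linear[OF g]] and pl = linear_onD[OF bundle_map_linear[OF psi]]
  show ?thesis
  proof (rule Cartan_pair_isoI[OF AD'(2) AD(2) g psi _ _ AD(4)])
    show "anchor A p (g p v) = anchor A' p v" if "v \<in> fib A' p" for p v
      using an[rule_format, OF gl(1)[OF that]] pg that by simp
    fix \<alpha> \<beta> p assume s: "\<alpha> \<in> sections M A'" "\<beta> \<in> sections M A'"
    have gs: "sapp g \<alpha> \<in> sections M A" "sapp g \<beta> \<in> sections M A" by (intro bundle_map_sec[OF AD'(2) AD(2) g] s)+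
    have pgs: "sapp \<psi> (sapp g \<alpha>) = \<alpha>" "sapp \<psi> (sapp g \<beta>) = \<beta>"
      using pg sec_fib[OF s(1)] sec_fib[OF s(2)] by (simp_all add: sapp_def)
    note f = sec_fib[OF almost_LieD(3)[OF AD(1) gs], of p] sec_fib[OF almost_LieD(3)[OF AD'(1) s], of p]
    have "g p (vminus A' p (\<psi> p (brk A (sapp g \<alpha>) (sapp g \<beta>) p)) (brk A' \<alpha> \<beta> p)) \<in> \<sigma> p"
      using br[rule_format, OF gs, of p] s2 unfolding pgs by blast
    then have "vscale A p (-1) (vminus A p (brk A (sapp g \<alpha>) (sapp g \<beta>) p) (g p (brk A' \<alpha> \<beta> p))) \<in> \<sigma> p"
      using gp f pl(1)[OF f(1)] by (intro sub_scale[OF AD(2,4)]) (simp add: linear_on_minus[OF AD'(2) bundle_map_linear[OF g]])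
    moreover have "vscale A p (-1) (vminus A p (brk A (sapp g \<alpha>) (sapp g \<beta>) p) (g p (brk A' \<alpha> \<beta> p))) =
        vminus A p (g p (brk A' \<alpha> \<beta> p)) (brk A (sapp g \<alpha>) (sapp g \<beta>) p)"
      by (rule fib_eqI[OF AD(2), where p = p]) (simp_all add: fibs crds AD(2) f gl)
    ultimately show "vminus A p (g p (brk A' \<alpha> \<beta> p)) (brk A (sapp g \<alpha>) (sapp g \<beta>) p) \<in> \<sigma> p" by simp
  qed (use gp pg s1 s2 in auto)
qed

lemma Cartan_pair_iso_trans:
  assumes A1: "Cartan_pair M A1 \<sigma>1" and A2: "Cartan_pair M A2 \<sigma>2" and A3: "Cartan_pair M A3 \<sigma>3"
    and i: "Cartan_pair_iso M A1 \<sigma>1 A2 \<sigma>2" "Cartan_pair_iso M A2 \<sigma>2 A3 \<sigma>3"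
  shows "Cartan_pair_iso M A1 \<sigma>1 A3 \<sigma>3"
proof -
  note D1 = Cartan_pairD[OF A1] and D2 = Cartan_pairD[OF A2] and D3 = Cartan_pairD[OF A3]
  obtain \<psi> g where psi: "bundle_map M A1 A2 \<psi>" and g: "bundle_map M A2 A1 g"
    and gp: "\<forall>p. \<forall>u\<in>fib A1 p. g p (\<psi> p u) = u" and pg: "\<forall>p. \<forall>v\<in>fib A2 p. \<psi> p (g p v) = v"
    and s1: "\<forall>p. \<forall>u\<in>\<sigma>1 p. \<psi> p u \<in> \<sigma>2 p" and s2: "\<forall>p. \<forall>v\<in>\<sigma>2 p. g p v \<in> \<sigma>1 p"
    and an: "\<forall>p. \<forall>v\<in>fib A1 p. anchor A2 p (\<psi> p v) = anchor A1 p v"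
    and br: "\<forall>\<alpha>\<in>sections M A1. \<forall>\<beta>\<in>sections M A1. \<forall>p.
      vminus A2 p (\<psi> p (brk A1 \<alpha> \<beta> p)) (brk A2 (sapp \<psi> \<alpha>) (sapp \<psi> \<beta>) p) \<in> \<sigma>2 p"
    by (rule Cartan_pair_isoE[OF i(1) D1(4)])
  obtain \<psi>' g' where psi': "bundle_map M A2 A3 \<psi>'" and g': "bundle_map M A3 A2 g'"
    and gp': "\<forall>p. \<forall>u\<in>fib A2 p. g' p (\<psi>' p u) = u" and pg': "\<forall>p. \<forall>v\<in>fib A3 p. \<psi>' p (g' p v) = v"
    and s1': "\<forall>p. \<forall>u\<in>\<sigma>2 p. \<psi>' p u \<in> \<sigma>3 p" and s2': "\<forall>p. \<forall>v\<in>\<sigma>3 p. g' p v \<in> \<sigma>2 p"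
    and an': "\<forall>p. \<forall>v\<in>fib A2 p. anchor A3 p (\<psi>' p v) = anchor A2 p v"
    and br': "\<forall>\<alpha>\<in>sections M A2. \<forall>\<beta>\<in>sections M A2. \<forall>p.
      vminus A3 p (\<psi>' p (brk A2 \<alpha> \<beta> p)) (brk A3 (sapp \<psi>' \<alpha>) (sapp \<psi>' \<beta>) p) \<in> \<sigma>3 p"
    by (rule Cartan_pair_isoE[OF i(2) D2(4)])
  note gl = linear_onD[OF bundle_map_linear[OF g]] and pl = linear_onD[OF bundle_map_linear[OF psi]]
  note gl' = linear_onD[OF bundle_map_linear[OF g']] and pl' = linear_onD[OF bundle_map_linear[OF psi']]
  show ?thesis
  proof (rule Cartan_pair_isoI[OF D1(2) D3(2) bundle_map_comp[OF D1(2) D2(2) D3(2) psi psi']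
        bundle_map_comp[OF D3(2) D2(2) D1(2) g' g] _ _ D3(4)])
    fix \<alpha> \<beta> p assume s: "\<alpha> \<in> sections M A1" "\<beta> \<in> sections M A1"
    have ps: "sapp \<psi> \<alpha> \<in> sections M A2" "sapp \<psi> \<beta> \<in> sections M A2" by (intro bundle_map_sec[OF D1(2) D2(2) psi] s)+
    have pps: "sapp \<psi>' (sapp \<psi> \<alpha>) \<in> sections M A3" "sapp \<psi>' (sapp \<psi> \<beta>) \<in> sections M A3"
      by (intro bundle_map_sec[OF D2(2) D3(2) psi'] ps)+
    note f = sec_fib[OF almost_LieD(3)[OF D1(1) s], of p] sec_fib[OF almost_LieD(3)[OF D2(1) ps], of p]
      sec_fib[OF almost_LieD(3)[OF D3(1) pps], of p]
    have 1: "\<psi>' p (vminus A2 p (\<psi> p (brk A1 \<alpha> \<beta> p)) (brk A2 (sapp \<psi> \<alpha>) (sapp \<psi> \<beta>) p)) \<in> \<sigma>3 p"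
      using br s s1' by blast
    have 2: "vminus A3 p (\<psi>' p (brk A2 (sapp \<psi> \<alpha>) (sapp \<psi> \<beta>) p)) (brk A3 (sapp \<psi>' (sapp \<psi> \<alpha>)) (sapp \<psi>' (sapp \<psi> \<beta>)) p) \<in> \<sigma>3 p"
      using br' ps by blast
    have sc: "sapp (\<lambda>p u. \<psi>' p (\<psi> p u)) \<gamma> = sapp \<psi>' (sapp \<psi> \<gamma>)" for \<gamma> by (simp add: sapp_def)
    \<comment> \<open>The bracket defect of the composite is the image under \<psi>' of the first
      defect plus the second defect.\<close>
    have "vminus A3 p (\<psi>' p (\<psi> p (brk A1 \<alpha> \<beta> p))) (brk A3 (sapp \<psi>' (sapp \<psi> \<alpha>)) (sapp \<psi>' (sapp \<psi> \<beta>)) p) =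
      vadd A3 p (\<psi>' p (vminus A2 p (\<psi> p (brk A1 \<alpha> \<beta> p)) (brk A2 (sapp \<psi> \<alpha>) (sapp \<psi> \<beta>) p)))
        (vminus A3 p (\<psi>' p (brk A2 (sapp \<psi> \<alpha>) (sapp \<psi> \<beta>) p)) (brk A3 (sapp \<psi>' (sapp \<psi> \<alpha>)) (sapp \<psi>' (sapp \<psi> \<beta>)) p))"
      by (rule fib_eqI[OF D3(2), where p = p])
        (simp_all add: fibs crds D3(2) D2(2) f pl pl' linear_on_minus[OF D2(2) bundle_map_linear[OF psi']])
    then show "vminus A3 p (\<psi>' p (\<psi> p (brk A1 \<alpha> \<beta> p)))
        (brk A3 (sapp (\<lambda>p u. \<psi>' p (\<psi> p u)) \<alpha>) (sapp (\<lambda>p u. \<psi>' p (\<psi> p u)) \<beta>) p) \<in> \<sigma>3 p"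
      unfolding sc using sub_add[OF D3(2,4) 1 2] by simp
  qed (use gp pg gp' pg' s1 s2 s1' s2' an an' pl(1) pl'(1) gl(1) gl'(1) in auto)
qed

end


section \<open>Alternating bundle maps and a criterion for almost Lie algebroids\<close>

context smooth_mfd
begin

lemma alternating_bundle_mapD:
  assumes "alternating_bundle_map M E F t"
  shows "u \<in> fib E p \<Longrightarrow> linear_on E F p (t p u)"
    "u \<in> fib E p \<Longrightarrow> v \<in> fib E p \<Longrightarrow> t p v u = vscale F p (-1) (t p u v)"
    "(U, k, \<Phi>) \<in> trivs E \<Longrightarrow> (V, l, \<Psi>) \<in> trivs F \<Longrightarrow> j < k \<Longrightarrow> j' < k \<Longrightarrow> i < l \<Longrightarrow>
      smooth_fun M (U \<inter> V) (\<lambda>p. \<Psi> p (t p (frame E \<Phi> j p) (frame E \<Phi> j' p)) i)"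
proof -
  note a = assms[unfolded alternating_bundle_map_def]
  show "u \<in> fib E p \<Longrightarrow> linear_on E F p (t p u)" by (rule a[THEN conjunct1, rule_format])
  show "u \<in> fib E p \<Longrightarrow> v \<in> fib E p \<Longrightarrow> t p v u = vscale F p (-1) (t p u v)"
    by (rule a[THEN conjunct2, THEN conjunct1, rule_format])
  assume U: "(U, k, \<Phi>) \<in> trivs E" and V: "(V, l, \<Psi>) \<in> trivs F" and ji: "j < k" "j' < k" "i < l"
  have "\<forall>(U, k, \<Phi>) \<in> trivs E. \<forall>(V, l, \<Psi>) \<in> trivs F. \<forall>j<k. \<forall>j'<k. \<forall>i<l.
        smooth_fun M (U \<inter> V) (\<lambda>p. \<Psi> p (t p (frame E \<Phi> j p) (frame E \<Phi> j' p)) i)"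
    by (rule a[THEN conjunct2, THEN conjunct2])
  from bspec[OF this U] have "\<forall>(V, l, \<Psi>) \<in> trivs F. \<forall>j<k. \<forall>j'<k. \<forall>i<l.
        smooth_fun M (U \<inter> V) (\<lambda>p. \<Psi> p (t p (frame E \<Phi> j p) (frame E \<Phi> j' p)) i)" by simp
  from bspec[OF this V] show "smooth_fun M (U \<inter> V) (\<lambda>p. \<Psi> p (t p (frame E \<Phi> j p) (frame E \<Phi> j' p)) i)"
    using ji by simp
qed

lemma alternating_bundle_map_sec:
  assumes E: "vector_bundle M E" and F: "vector_bundle M F" and t: "alternating_bundle_map M E F t"
    and s: "\<alpha> \<in> sections M E" "\<beta> \<in> sections M E"
  shows "(\<lambda>p. t p (\<alpha> p) (\<beta> p)) \<in> sections M F"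
  unfolding sections_iff
proof (rule lsmoothI)
  note tD = alternating_bundle_mapD[OF t]
  show "t p (\<alpha> p) (\<beta> p) \<in> fib F p" for p by (rule linear_onD(1)[OF tD(1)[OF sec_fib[OF s(1)]] sec_fib[OF s(2)]])
  fix V l \<Psi> i assume V: "(V, l, \<Psi>) \<in> trivs F" and i: "i < l"
  note lV = vector_bundleD(5)[OF F V]
  show "smooth_fun M (V \<inter> UNIV) (\<lambda>p. \<Psi> p (t p (\<alpha> p) (\<beta> p)) i)"
  proof (rule smooth_fun_local)
    fix p assume p: "p \<in> V \<inter> UNIV"
    obtain U k \<Phi> where U: "(U, k, \<Phi>) \<in> trivs E" "p \<in> U" using vector_bundleD(7)[OF E] by blast
    note lU = vector_bundleD(5)[OF E U(1)]
    have o: "open (U \<inter> V)" using trivs_open[OF E U(1)] trivs_open[OF F V] by auto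
    have co: "smooth_fun M (U \<inter> V) (\<lambda>p. \<Phi> p (s p) j)" if "s \<in> sections M E" "j < k" for s j
      by (rule smooth_fun_subset[OF lsmoothD(2)[OF that(1)[unfolded sections_iff] U(1) that(2)]]) auto
    \<comment> \<open>\<open>alternating_bundle_map\<close> gives linearity in the second argument.
      The expansion in the first argument goes through skew symmetry, hence the factor -1.\<close>
    have "smooth_fun M (U \<inter> V) (\<lambda>p. \<Sum>j'<k. \<Phi> p (\<beta> p) j' * ((-1) * (\<Sum>j<k. \<Phi> p (\<alpha> p) j * \<Psi> p (t p (frame E \<Phi> j' p) (frame E \<Phi> j p)) i)))"
      using co[OF s(1)] co[OF s(2)] tD(3)[OF U(1) V _ _ i]
      by (intro smooth_fun_sum smooth_fun_mult smooth_fun_const o) auto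
    then have "smooth_fun M (U \<inter> V) (\<lambda>p. \<Psi> p (t p (\<alpha> p) (\<beta> p)) i)"
    proof (rule smooth_fun_cong[OF o])
      fix q assume "q \<in> U \<inter> V"
      then have q: "q \<in> U" "q \<in> V" by auto
      note f = sec_fib[OF s(1), of q] sec_fib[OF s(2), of q]
      have fr: "frame E \<Phi> j q \<in> fib E q" if "j < k" for j by (rule frame_props(1)[OF lU q(1) that])
      have "\<Psi> q (t q (\<alpha> q) (\<beta> q)) i = (\<Sum>j'<k. \<Phi> q (\<beta> q) j' * \<Psi> q (t q (\<alpha> q) (frame E \<Phi> j' q)) i)"
        by (rule triv_expand_map[OF E lU q(1) lV q(2) tD(1)[OF f(1)] f(2)])
      also have "\<dots> = (\<Sum>j'<k. \<Phi> q (\<beta> q) j' * ((-1) * (\<Sum>j<k. \<Phi> q (\<alpha> q) j * \<Psi> q (t q (frame E \<Phi> j' q) (frame E \<Phi> j q)) i)))"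
      proof (rule sum.cong[OF refl])
        fix j' assume "j' \<in> {..<k}"
        then have e: "frame E \<Phi> j' q \<in> fib E q" using fr by simp
        have "\<Psi> q (t q (\<alpha> q) (frame E \<Phi> j' q)) i = (-1) * \<Psi> q (t q (frame E \<Phi> j' q) (\<alpha> q)) i"
          unfolding tD(2)[OF e f(1)] by (rule local_trivD(4)[OF lV q(2) linear_onD(1)[OF tD(1)[OF e] f(1)]])
        also have "\<Psi> q (t q (frame E \<Phi> j' q) (\<alpha> q)) i = (\<Sum>j<k. \<Phi> q (\<alpha> q) j * \<Psi> q (t q (frame E \<Phi> j' q) (frame E \<Phi> j q)) i)"
          by (rule triv_expand_map[OF E lU q(1) lV q(2) tD(1)[OF e] f(1)])
        finally show "\<Phi> q (\<beta> q) j' * \<Psi> q (t q (\<alpha> q) (frame E \<Phi> j' q)) i =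
            \<Phi> q (\<beta> q) j' * ((-1) * (\<Sum>j<k. \<Phi> q (\<alpha> q) j * \<Psi> q (t q (frame E \<Phi> j' q) (frame E \<Phi> j q)) i))" by simp
      qed
      finally show "(\<Sum>j'<k. \<Phi> q (\<beta> q) j' * ((-1) * (\<Sum>j<k. \<Phi> q (\<alpha> q) j * \<Psi> q (t q (frame E \<Phi> j' q) (frame E \<Phi> j q)) i))) =
          \<Psi> q (t q (\<alpha> q) (\<beta> q)) i" by simp
    qed
    then have "smooth_fun M (V \<inter> UNIV \<inter> U) (\<lambda>p. \<Psi> p (t p (\<alpha> p) (\<beta> p)) i)" by (simp add: Int_commute)
    then show "\<exists>W'. open W' \<and> p \<in> W' \<and> smooth_fun M (V \<inter> UNIV \<inter> W') (\<lambda>p. \<Psi> p (t p (\<alpha> p) (\<beta> p)) i)"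
      using trivs_open[OF E U(1)] U(2) by blast
  qed
qed

text \<open>As for \<open>bundle_mapI\<close>, with both frame sections extended at once and the
  neighbourhoods intersected.\<close>

lemma alternating_bundle_mapI:
  assumes E: "vector_bundle M E" and F: "vector_bundle M F"
    and lin: "\<And>p u. u \<in> fib E p \<Longrightarrow> linear_on E F p (t p u)"
    and alt: "\<And>p u v. u \<in> fib E p \<Longrightarrow> v \<in> fib E p \<Longrightarrow> t p v u = vscale F p (-1) (t p u v)"
    and sec: "\<And>\<alpha> \<beta>. \<alpha> \<in> sections M E \<Longrightarrow> \<beta> \<in> sections M E \<Longrightarrow> (\<lambda>p. t p (\<alpha> p) (\<beta> p)) \<in> sections M F"
  shows "alternating_bundle_map M E F t"
proof -
  have "smooth_fun M (U \<inter> V) (\<lambda>p. \<Psi> p (t p (frame E \<Phi> j p) (frame E \<Phi> j' p)) i)"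
    if U: "(U, k, \<Phi>) \<in> trivs E" and V: "(V, l, \<Psi>) \<in> trivs F" and j: "j < k" "j' < k" and i: "i < l"
    for U k \<Phi> V l \<Psi> j j' i
  proof (rule smooth_fun_local)
    fix p assume p: "p \<in> U \<inter> V"
    have oU: "open U" by (rule trivs_open[OF E U])
    have pU: "p \<in> U" using p by simp
    obtain \<alpha> W where a: "\<alpha> \<in> sections M E" "open W" "p \<in> W" "W \<subseteq> U" "\<forall>q\<in>W. \<alpha> q = frame E \<Phi> j q"
      by (rule lsmooth_extend[OF E oU frame_lsmooth[OF E triv_smooth[OF E U] j(1)] pU])
    obtain \<beta> W' where b: "\<beta> \<in> sections M E" "open W'" "p \<in> W'" "W' \<subseteq> U" "\<forall>q\<in>W'. \<beta> q = frame E \<Phi> j' q"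
      by (rule lsmooth_extend[OF E oU frame_lsmooth[OF E triv_smooth[OF E U] j(2)] pU])
    have o: "open (U \<inter> V \<inter> (W \<inter> W'))" using oU trivs_open[OF F V] a(2) b(2) by auto
    have "smooth_fun M (U \<inter> V \<inter> (W \<inter> W')) (\<lambda>p. \<Psi> p (t p (\<alpha> p) (\<beta> p)) i)"
      by (rule smooth_fun_subset[OF lsmoothD(2)[OF sec[OF a(1) b(1), unfolded sections_iff] V i]]) auto
    then have "smooth_fun M (U \<inter> V \<inter> (W \<inter> W')) (\<lambda>p. \<Psi> p (t p (frame E \<Phi> j p) (frame E \<Phi> j' p)) i)"
      by (rule smooth_fun_cong[OF o]) (use a(5) b(5) in simp)
    moreover have "open (W \<inter> W')" "p \<in> W \<inter> W'" using a b by auto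
    ultimately show "\<exists>W'. open W' \<and> p \<in> W' \<and> smooth_fun M (U \<inter> V \<inter> W') (\<lambda>p. \<Psi> p (t p (frame E \<Phi> j p) (frame E \<Phi> j' p)) i)"
      by blast
  qed
  note sm = this
  show ?thesis unfolding alternating_bundle_map_def
  proof (intro conjI allI ballI)
    fix x assume xt: "x \<in> trivs E"
    obtain U k \<Phi> where x: "x = (U, k, \<Phi>)" by (cases x)
    show "case x of (U, k, \<Phi>) \<Rightarrow> \<forall>(V, l, \<Psi>) \<in> trivs F. \<forall>j<k. \<forall>j'<k. \<forall>i<l.
        smooth_fun M (U \<inter> V) (\<lambda>p. \<Psi> p (t p (frame E \<Phi> j p) (frame E \<Phi> j' p)) i)"
      unfolding x prod.case
    proof (clarify)
      fix V l \<Psi> j j' i assume "(V, l, \<Psi>) \<in> trivs F" "j < k" "j' < k" "i < l"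
      then show "smooth_fun M (U \<inter> V) (\<lambda>p. \<Psi> p (t p (frame E \<Phi> j p) (frame E \<Phi> j' p)) i)"
        by (rule sm[OF xt[unfolded x]])
    qed
  qed (rule lin alt; assumption)+
qed

text \<open>The product rule applied to 1 = 1 * 1 gives v(1) = 2 v(1).\<close>

lemma tangent_vector_const:
  assumes v: "v \<in> tangent_space M p" shows "v (\<lambda>_. c) = 0"
proof -
  have c: "(\<lambda>_. 1) \<in> Cinf M" "(\<lambda>_. c) \<in> Cinf M" by (rule Cinf_const)+
  have m: "\<forall>f\<in>Cinf M. \<forall>g\<in>Cinf M. v (\<lambda>q. f q * g q) = f p * v g + g p * v f"
    and l: "\<forall>c. \<forall>f\<in>Cinf M. v (\<lambda>q. c * f q) = c * v f"
    using v by (simp_all add: tangent_space_def)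
  have "v (\<lambda>_. 1) = 0" using bspec[OF bspec[OF m c(1)] c(1)] by simp
  then show ?thesis using bspec[OF spec[OF l, of c] c(1)] by simp
qed

text \<open>Linearity on the left follows from linearity on the right by skew symmetry. Linearity
  over constants is the Leibniz rule, because tangent vectors kill constants.\<close>

lemma almost_Lie_algebroidI:
  assumes A: "vector_bundle M A" and an: "anchor_map M A (anchor A)"
    and sec: "\<And>\<alpha> \<beta>. \<alpha> \<in> sections M A \<Longrightarrow> \<beta> \<in> sections M A \<Longrightarrow> brk A \<alpha> \<beta> \<in> sections M A"
    and add: "\<And>\<alpha> \<beta> \<beta>' p. \<alpha> \<in> sections M A \<Longrightarrow> \<beta> \<in> sections M A \<Longrightarrow> \<beta>' \<in> sections M A \<Longrightarrow>
      brk A \<alpha> (sadd A \<beta> \<beta>') p = vadd A p (brk A \<alpha> \<beta> p) (brk A \<alpha> \<beta>' p)"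
    and skew: "\<And>\<alpha> \<beta> p. \<alpha> \<in> sections M A \<Longrightarrow> \<beta> \<in> sections M A \<Longrightarrow> brk A \<alpha> \<beta> p = vscale A p (-1) (brk A \<beta> \<alpha> p)"
    and leib: "\<And>\<alpha> \<beta> f p. \<alpha> \<in> sections M A \<Longrightarrow> \<beta> \<in> sections M A \<Longrightarrow> f \<in> Cinf M \<Longrightarrow>
      brk A \<alpha> (sscale A f \<beta>) p = vadd A p (vscale A p (f p) (brk A \<alpha> \<beta> p)) (vscale A p (Lie A \<alpha> f p) (\<beta> p))"
    and hom: "\<And>\<alpha> \<beta> f p. \<alpha> \<in> sections M A \<Longrightarrow> \<beta> \<in> sections M A \<Longrightarrow> f \<in> Cinf M \<Longrightarrow>
      Lie A (brk A \<alpha> \<beta>) f p = Lie A \<alpha> (Lie A \<beta> f) p - Lie A \<beta> (Lie A \<alpha> f) p"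
  shows "almost_Lie_algebroid M A"
proof -
  have cr: "brk A \<alpha> (sscale A (\<lambda>_. c) \<beta>) p = vscale A p c (brk A \<alpha> \<beta> p)" if s: "\<alpha> \<in> sections M A" "\<beta> \<in> sections M A" for \<alpha> \<beta> c p
  proof -
    have "Lie A \<alpha> (\<lambda>_. c) p = 0" unfolding Lie_def
      by (rule tangent_vector_const[OF anchor_mapD(1)[OF an sec_fib[OF s(1)]]])
    then show ?thesis unfolding leib[OF s Cinf_const]
      by (intro fib_eqI[OF A, where p = p]) (simp_all add: fibs crds A sec_fib[OF s(2)] sec_fib[OF sec[OF s]])
  qed
  have al: "brk A (sadd A \<alpha> \<alpha>') \<beta> p = vadd A p (brk A \<alpha> \<beta> p) (brk A \<alpha>' \<beta> p)"
    if s: "\<alpha> \<in> sections M A" "\<alpha>' \<in> sections M A" "\<beta> \<in> sections M A" for \<alpha> \<alpha>' \<beta> p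
    unfolding skew[OF sadd_sec[OF A s(1,2)] s(3)] add[OF s(3,1,2)] skew[OF s(1,3)] skew[OF s(2,3)]
    by (rule fib_eqI[OF A, where p = p]) (simp_all add: fibs crds A sec_fib[OF sec[OF s(3,1)]] sec_fib[OF sec[OF s(3,2)]])
  have cl: "brk A (sscale A (\<lambda>_. c) \<alpha>) \<beta> p = vscale A p c (brk A \<alpha> \<beta> p)"
    if s: "\<alpha> \<in> sections M A" "\<beta> \<in> sections M A" for \<alpha> \<beta> c p
    unfolding skew[OF sscale_sec[OF A s(1) Cinf_const] s(2)] cr[OF s(2,1)] skew[OF s]
    by (rule fib_eqI[OF A, where p = p]) (simp_all add: fibs crds A sec_fib[OF sec[OF s(2,1)]])
  have bl: "bilinear_sections M A A A (brk A)"
    unfolding bilinear_sections_def by (auto simp: sec fun_eq_iff al add cl cr sadd_def[of A "brk A _ _"] sscale_def[of A _ "brk A _ _"])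
  have k1: "brk A \<alpha> \<beta> = sscale A (\<lambda>_. -1) (brk A \<beta> \<alpha>)" if "\<alpha> \<in> sections M A" "\<beta> \<in> sections M A" for \<alpha> \<beta>
    using skew[OF that] by (simp add: fun_eq_iff sscale_def)
  have k2: "brk A \<alpha> (sscale A f \<beta>) = sadd A (sscale A f (brk A \<alpha> \<beta>)) (sscale A (Lie A \<alpha> f) \<beta>)"
    if "\<alpha> \<in> sections M A" "\<beta> \<in> sections M A" "f \<in> Cinf M" for \<alpha> \<beta> f
    by (rule ext, subst leib[OF that]) (simp add: sadd_def sscale_def)
  have k3: "Lie A (brk A \<alpha> \<beta>) f = (\<lambda>p. Lie A \<alpha> (Lie A \<beta> f) p - Lie A \<beta> (Lie A \<alpha> f) p)"
    if "\<alpha> \<in> sections M A" "\<beta> \<in> sections M A" "f \<in> Cinf M" for \<alpha> \<beta> f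
    by (rule ext) (rule hom[OF that])
  show ?thesis
    unfolding almost_Lie_algebroid_def by (intro conjI ballI A an bl k1 k2 k3)
qed

lemma brk_zero:
  assumes A: "almost_Lie_algebroid M A" and s: "\<beta> \<in> sections M A"
  shows "brk A (vzero A) \<beta> p = vzero A p"
proof -
  note AD = almost_LieD[OF A]
  have z: "sscale A (\<lambda>_. 0) (vzero A) = vzero A" by (simp add: sscale_def vscale_vzero[OF AD(1)])
  note zs = zero_sec[OF AD(1)]
  show "brk A (vzero A) \<beta> p = vzero A p"
    using fun_cong[OF AD(9)[OF zs s, of 0], of p] unfolding z
    by (simp add: sscale_def vscale_zero[OF AD(1)] sec_fib[OF AD(3)[OF zs s]])
qed

subsection \<open>The action of the isotropy on the quotient\<close>

text \<open>For sections \<open>T\<close> of \<sigma> the class pr([T, \<alpha>]) is function-linear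
  in both arguments: the derivative term in the first is a multiple of \<open>T\<close>, which
  \<open>pr\<close> kills, and the one in the second contains \<rho>(T) = 0. It depends on
  pr(\<alpha>) only, because sections of \<sigma> are closed under the bracket. So the description
  operator in \<open>iota\<close> has a unique value to pick.\<close>

lemma iota_facts:
  assumes P: "Cartan_pair M A \<sigma>"
  defines "Q \<equiv> quot_bundle M A \<sigma>"
  shows "T \<in> sections M A \<Longrightarrow> (\<And>q. T q \<in> \<sigma> q) \<Longrightarrow> \<alpha> \<in> sections M A \<Longrightarrow>
      iota M A \<sigma> p (T p) (pr A \<sigma> p (\<alpha> p)) = pr A \<sigma> p (brk A T \<alpha> p)"
    "iota M A \<sigma> p u \<in> extensional (fib Q p)"
    "u \<in> \<sigma> p \<Longrightarrow> linear_on Q Q p (iota M A \<sigma> p u)"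
    "u \<in> \<sigma> p \<Longrightarrow> v \<in> \<sigma> p \<Longrightarrow> a \<in> fib Q p \<Longrightarrow> iota M A \<sigma> p (vadd A p u v) a = vadd Q p (iota M A \<sigma> p u a) (iota M A \<sigma> p v a)"
    "u \<in> \<sigma> p \<Longrightarrow> a \<in> fib Q p \<Longrightarrow> iota M A \<sigma> p (vscale A p c u) a = vscale Q p c (iota M A \<sigma> p u a)"
proof -
  note PD = Cartan_pairD[OF P]
  note AL = almost_LieD[OF PD(1)]
  note vb = PD(2)
  define F where "F = sub_bundle M A \<sigma>"
  have vF: "vector_bundle M F" unfolding F_def by (rule sub_vector_bundle[OF vb PD(4)])
  have Fs: "T \<in> sections M F \<longleftrightarrow> T \<in> sections M A \<and> (\<forall>p. T p \<in> \<sigma> p)" for T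
    unfolding F_def by (rule sub_sections[OF vb PD(4)])
  have Fo: "fib F = \<sigma>" "sadd F = sadd A" "sscale F = sscale A" "vadd F = vadd A" "vscale F = vscale A" by (simp_all add: F_def)
  have vQ: "vector_bundle M Q" unfolding Q_def by (rule quot_vector_bundle[OF vb PD(4)])
  have prm: "bundle_map M A Q (pr A \<sigma>)" unfolding Q_def by (rule pr_bundle_map[OF vb PD(4)])
  note prl = linear_onD[OF bundle_map_linear[OF prm]]
  have prz: "pr A \<sigma> p w = vzero Q p" if "w \<in> \<sigma> p" for p w
  proof -
    have wf: "w \<in> fib A p" by (rule sub_fib[OF PD(4) that])
    have "vminus A p w (vzero A p) = w" by (rule fib_eqI[OF vb, where p = p]) (simp_all add: fibs crds vb wf)
    then show ?thesis unfolding Q_def quot_zero using that by (intro pr_eqI[OF vb PD(4) wf]) (simp_all add: fibs vb)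
  qed
  define B where "B T \<alpha> = sapp (pr A \<sigma>) (brk A T \<alpha>)" for T \<alpha>
  have Bs: "B T \<alpha> \<in> sections M Q" if "T \<in> sections M F" "\<alpha> \<in> sections M A" for T \<alpha>
    unfolding B_def using that Fs by (intro bundle_map_sec[OF vb vQ prm] AL(3)) auto
  have B1: "module_map F Q (\<lambda>T. B T \<alpha>)" if a: "\<alpha> \<in> sections M A" for \<alpha>
  proof (rule module_mapI)
    show "B T \<alpha> \<in> sections M Q" if "T \<in> sections M F" for T by (rule Bs[OF that a])
    show "B (sadd F T T') \<alpha> = sadd Q (B T \<alpha>) (B T' \<alpha>)" if "T \<in> sections M F" "T' \<in> sections M F" for T T'
    proof -
      have T: "T \<in> sections M A" "T' \<in> sections M A" using that Fs by auto
      show ?thesis unfolding B_def Fo AL(4)[OF T a]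
        by (rule ext) (simp add: sapp_def sadd_def prl sec_fib[OF AL(3)[OF T(1) a]] sec_fib[OF AL(3)[OF T(2) a]])
    qed
    show "B (sscale F f T) \<alpha> = sscale Q f (B T \<alpha>)" if f: "f \<in> Cinf M" and T': "T \<in> sections M F" for f T
    proof
      fix p
      have T: "T \<in> sections M A" "T p \<in> \<sigma> p" using T' Fs by auto
      note ff = sec_fib[OF AL(3)[OF T(1) a], of p] sec_fib[OF T(1), of p]
      have "pr A \<sigma> p (brk A (sscale A f T) \<alpha> p) = vminus Q p (vscale Q p (f p) (pr A \<sigma> p (brk A T \<alpha> p))) (vscale Q p (Lie A \<alpha> f p) (pr A \<sigma> p (T p)))"
        unfolding brk_scale_left[OF PD(1) T(1) a f] by (simp add: linear_on_minus[OF vb bundle_map_linear[OF prm]] prl fibs vb ff)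
      also have "\<dots> = vscale Q p (f p) (pr A \<sigma> p (brk A T \<alpha> p))"
        unfolding prz[OF T(2)] by (rule fib_eqI[OF vQ, where p = p]) (simp_all add: fibs crds vQ prl(1)[OF ff(1)])
      finally show "B (sscale F f T) \<alpha> p = sscale Q f (B T \<alpha>) p" unfolding Fo by (simp add: B_def sapp_def sscale_def)
    qed
  qed
  have B2: "module_map A Q (B T)" if T': "T \<in> sections M F" for T
  proof (rule module_mapI)
    have T: "T \<in> sections M A" "\<And>p. T p \<in> \<sigma> p" using T' Fs by auto
    show "B T \<alpha> \<in> sections M Q" if "\<alpha> \<in> sections M A" for \<alpha> by (rule Bs[OF T' that])
    show "B T (sadd A \<alpha> \<beta>) = sadd Q (B T \<alpha>) (B T \<beta>)" if a: "\<alpha> \<in> sections M A" "\<beta> \<in> sections M A" for \<alpha> \<beta>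
      unfolding B_def AL(5)[OF T(1) a]
      by (rule ext) (simp add: sapp_def sadd_def prl sec_fib[OF AL(3)[OF T(1) a(1)]] sec_fib[OF AL(3)[OF T(1) a(2)]])
    show "B T (sscale A f \<alpha>) = sscale Q f (B T \<alpha>)" if f: "f \<in> Cinf M" and a: "\<alpha> \<in> sections M A" for f \<alpha>
    proof
      fix p
      note ff = sec_fib[OF AL(3)[OF T(1) a], of p] sec_fib[OF a, of p]
      have "Lie A T f p = 0" unfolding Lie_def PD(5)[OF T(2)] ..
      then have "brk A T (sscale A f \<alpha>) p = vscale A p (f p) (brk A T \<alpha> p)"
        unfolding AL(7)[OF T(1) a f] unfolding sadd_def sscale_def
        by (intro fib_eqI[OF vb, where p = p]) (simp_all add: fibs crds vb ff)
      then show "B T (sscale A f \<alpha>) p = sscale Q f (B T \<alpha>) p" by (simp add: B_def sapp_def sscale_def[of Q] prl ff)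
    qed
  qed
  define b where "b p u v = B (sec_thr F p u) (sec_thr A p v) p" for p u v
  have bt: "b p (s p) (t p) = B s t p" if "s \<in> sections M F" "t \<in> sections M A" for p s t
    unfolding b_def by (rule bilinear_tensor(1)[OF vF vb vQ]) (use B1 B2 that in auto)
  have bt2: "linear_on A Q p (b p u)" if "u \<in> \<sigma> p" for p u
    unfolding b_def by (rule bilinear_tensor(2)[OF vF vb vQ]) (use B1 B2 that Fo in auto)
  have bt3: "linear_on F Q p (\<lambda>u. b p u v)" if "v \<in> fib A p" for p v
    unfolding b_def by (rule bilinear_tensor(3)[OF vF vb vQ]) (use B1 B2 that Fo in auto)
  \<comment> \<open>Closure of the sections of \<sigma> under the bracket makes \<open>b p u\<close>
    vanish on \<sigma>, which lets it descend to the quotient.\<close>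
  have b0: "b p u v = vzero Q p" if u: "u \<in> \<sigma> p" and v: "v \<in> \<sigma> p" for p u v
  proof -
    obtain T where T: "T \<in> sections M F" "T p = u" by (rule section_through[OF vF, of u p]) (use u Fo in auto)
    obtain \<beta> where \<beta>: "\<beta> \<in> sections M F" "\<beta> p = v" by (rule section_through[OF vF, of v p]) (use v Fo in auto)
    have T': "T \<in> sections M A" "\<And>p. T p \<in> \<sigma> p" using T(1) Fs by auto
    have \<beta>': "\<beta> \<in> sections M A" "\<And>p. \<beta> p \<in> \<sigma> p" using \<beta>(1) Fs by auto
    have "b p (T p) (\<beta> p) = B T \<beta> p" by (rule bt[OF T(1) \<beta>'(1)])
    also have "\<dots> = vzero Q p" unfolding B_def sapp_def by (rule prz[OF PD(6)[OF T' \<beta>']])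
    finally show ?thesis using T(2) \<beta>(2) by simp
  qed
  have beq: "b p u v = b p u v'" if u: "u \<in> \<sigma> p" and v: "v \<in> fib A p" "v' \<in> fib A p" "pr A \<sigma> p v = pr A \<sigma> p v'" for p u v v'
  proof -
    have lin: "linear_on A Q p (b p u)" by (rule bt2[OF u])
    have "vminus A p v v' \<in> \<sigma> p" by (rule pr_eqD[OF vb PD(4) v])
    then have z: "vminus Q p (b p u v) (b p u v') = vzero Q p"
      using b0[OF u] linear_on_minus[OF vb lin v(1,2)] by simp
    note f = linear_onD(1)[OF lin v(1)] linear_onD(1)[OF lin v(2)]
    show ?thesis
      by (rule fib_eqI[OF vQ f]) (use crd_minus[OF vQ f] z crd_zero[OF vQ] in \<open>metis eq_iff_diff_eq_0\<close>)
  qed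
  have io: "iota M A \<sigma> p u (pr A \<sigma> p v) = b p u v" if u: "u \<in> \<sigma> p" and v: "v \<in> fib A p" for p u v
  proof -
    obtain T where T: "T \<in> sections M F" "T p = u" by (rule section_through[OF vF, of u p]) (use u Fo in auto)
    obtain \<alpha> where a: "\<alpha> \<in> sections M A" "\<alpha> p = v" by (rule section_through[OF vb v])
    have "(THE x. \<exists>T\<in>sections M (sub_bundle M A \<sigma>). \<exists>\<alpha>\<in>sections M A.
       T p = u \<and> pr A \<sigma> p (\<alpha> p) = pr A \<sigma> p v \<and> x = pr A \<sigma> p (brk A T \<alpha> p)) = b p u v"
    proof (rule the_equality)
      show "\<exists>T\<in>sections M (sub_bundle M A \<sigma>). \<exists>\<alpha>\<in>sections M A.
         T p = u \<and> pr A \<sigma> p (\<alpha> p) = pr A \<sigma> p v \<and> b p u v = pr A \<sigma> p (brk A T \<alpha> p)"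
        using T a bt[OF T(1) a(1), of p] unfolding F_def[symmetric] by (intro bexI[OF _ T(1)] bexI[OF _ a(1)]) (simp add: B_def sapp_def)
      fix x assume "\<exists>T\<in>sections M (sub_bundle M A \<sigma>). \<exists>\<alpha>\<in>sections M A.
         T p = u \<and> pr A \<sigma> p (\<alpha> p) = pr A \<sigma> p v \<and> x = pr A \<sigma> p (brk A T \<alpha> p)"
      then obtain T' \<alpha>' where T': "T' \<in> sections M F" "T' p = u" and a': "\<alpha>' \<in> sections M A" "pr A \<sigma> p (\<alpha>' p) = pr A \<sigma> p v"
        and x: "x = pr A \<sigma> p (brk A T' \<alpha>' p)" unfolding F_def[symmetric] by auto
      have "x = b p u (\<alpha>' p)" unfolding x using bt[OF T'(1) a'(1), of p] T'(2) by (simp add: B_def sapp_def)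
      also have "\<dots> = b p u v" by (rule beq[OF u sec_fib[OF a'(1)] v a'(2)])
      finally show "x = b p u v" .
    qed
    then show ?thesis unfolding iota_def using pr_fib[OF v] by simp
  qed
  {
    assume T: "T \<in> sections M A" "\<And>q. T q \<in> \<sigma> q" and a: "\<alpha> \<in> sections M A"
    have "T \<in> sections M F" using T Fs by auto
    from bt[OF this a, of p] io[OF T(2) sec_fib[OF a], of p]
    show "iota M A \<sigma> p (T p) (pr A \<sigma> p (\<alpha> p)) = pr A \<sigma> p (brk A T \<alpha> p)" by (simp add: B_def sapp_def)
  }
  show "iota M A \<sigma> p u \<in> extensional (fib Q p)" unfolding iota_def Q_def by simp
  note qa = quot_add[OF vb PD(4), folded Q_def] and qs = quot_scale[OF vb PD(4), folded Q_def]
  show "linear_on Q Q p (iota M A \<sigma> p u)" if u: "u \<in> \<sigma> p" for u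
  proof (rule linear_onI)
    note bl = linear_onD[OF bt2[OF u]]
    show "iota M A \<sigma> p u a \<in> fib Q p" if "a \<in> fib Q p" for a
      using that bl(1) io[OF u] unfolding Q_def quot_fib by auto
    show "iota M A \<sigma> p u (vadd Q p a a') = vadd Q p (iota M A \<sigma> p u a) (iota M A \<sigma> p u a')"
      if a: "a \<in> fib Q p" "a' \<in> fib Q p" for a a'
    proof -
      obtain v v' where v: "v \<in> fib A p" "a = pr A \<sigma> p v" "v' \<in> fib A p" "a' = pr A \<sigma> p v'"
        using a unfolding Q_def quot_fib by auto
      have "vadd A p v v' \<in> fib A p" by (intro fibs vb v)
      then show ?thesis unfolding v(2,4) qa[OF v(1,3)] by (simp add: io[OF u] v(1,3) bl)
    qed
    show "iota M A \<sigma> p u (vscale Q p c a) = vscale Q p c (iota M A \<sigma> p u a)" if a: "a \<in> fib Q p" for c a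
    proof -
      obtain v where v: "v \<in> fib A p" "a = pr A \<sigma> p v" using a unfolding Q_def quot_fib by auto
      have "vscale A p c v \<in> fib A p" by (intro fibs vb v)
      then show ?thesis unfolding v(2) qs[OF v(1)] by (simp add: io[OF u] v(1) bl)
    qed
  qed
  show "iota M A \<sigma> p (vadd A p u v) a = vadd Q p (iota M A \<sigma> p u a) (iota M A \<sigma> p v a)"
    if u: "u \<in> \<sigma> p" "v \<in> \<sigma> p" and a: "a \<in> fib Q p"
  proof -
    obtain w where w: "w \<in> fib A p" "a = pr A \<sigma> p w" using a unfolding Q_def quot_fib by auto
    show ?thesis unfolding w(2) io[OF u(1) w(1)] io[OF u(2) w(1)] io[OF sub_add[OF vb PD(4) u] w(1)]
      using linear_onD(2)[OF bt3[OF w(1)], of u v] u Fo by simp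
  qed
  show "iota M A \<sigma> p (vscale A p c u) a = vscale Q p c (iota M A \<sigma> p u a)" if u: "u \<in> \<sigma> p" and a: "a \<in> fib Q p"
  proof -
    obtain w where w: "w \<in> fib A p" "a = pr A \<sigma> p w" using a unfolding Q_def quot_fib by auto
    show ?thesis unfolding w(2) io[OF u w(1)] io[OF sub_scale[OF vb PD(4) u] w(1)]
      using linear_onD(3)[OF bt3[OF w(1)], of u c] u Fo by simp
  qed
qed

section \<open>Inclusions and projections of a direct sum\<close>

lemma bundle_map_inr:
  assumes E: "vector_bundle M E" and F: "vector_bundle M F"
  shows "bundle_map M F (sum_bundle E F) (\<lambda>p w. (vzero E p, w))"
proof (rule bundle_mapI[OF F sum_vector_bundle[OF E F]])
  show "linear_on F (sum_bundle E F) p (\<lambda>w. (vzero E p, w))" for p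
    by (rule linear_onI) (simp_all add: fibs E vector_bundleD(2)[OF E] vscale_vzero)
  show "sapp (\<lambda>p w. (vzero E p, w)) s \<in> sections M (sum_bundle E F)" if "s \<in> sections M F" for s
    using zero_sec[OF E] that by (simp add: sum_sections[OF E F] sapp_def comp_def)
qed

lemma bundle_map_inl:
  assumes E: "vector_bundle M E" and F: "vector_bundle M F"
  shows "bundle_map M E (sum_bundle E F) (\<lambda>p u. (u, vzero F p))"
proof (rule bundle_mapI[OF E sum_vector_bundle[OF E F]])
  show "linear_on E (sum_bundle E F) p (\<lambda>u. (u, vzero F p))" for p
    by (rule linear_onI) (simp_all add: fibs F vector_bundleD(2)[OF F] vscale_vzero)
  show "sapp (\<lambda>p u. (u, vzero F p)) s \<in> sections M (sum_bundle E F)" if "s \<in> sections M E" for s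
    using zero_sec[OF F] that by (simp add: sum_sections[OF E F] sapp_def comp_def)
qed

lemma bundle_map_fst:
  assumes E: "vector_bundle M E" and F: "vector_bundle M F"
  shows "bundle_map M (sum_bundle E F) E (\<lambda>p x. fst x)"
proof (rule bundle_mapI[OF sum_vector_bundle[OF E F] E])
  show "linear_on (sum_bundle E F) E p (\<lambda>x. fst x)" for p by (rule linear_onI) auto
  show "sapp (\<lambda>p x. fst x) s \<in> sections M E" if "s \<in> sections M (sum_bundle E F)" for s
    using that by (simp add: sum_sections[OF E F] sapp_def comp_def)
qed

lemma bundle_map_snd:
  assumes E: "vector_bundle M E" and F: "vector_bundle M F"
  shows "bundle_map M (sum_bundle E F) F (\<lambda>p x. snd x)"
proof (rule bundle_mapI[OF sum_vector_bundle[OF E F] F])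
  show "linear_on (sum_bundle E F) F p (\<lambda>x. snd x)" for p by (rule linear_onI) auto
  show "sapp (\<lambda>p x. snd x) s \<in> sections M F" if "s \<in> sections M (sum_bundle E F)" for s
    using that by (simp add: sum_sections[OF E F] sapp_def comp_def)
qed

end


section \<open>From Cartan algebroids to Cartan pairs\<close>

locale cartan_data = smooth_mfd M for M :: "'m::{t2_space, second_countable_topology} manifold" +
  fixes C :: "('m, 'c) algebroid" and \<sigma> t D
  assumes C: "Cartan_algebroid M C \<sigma>" and t: "Cartan_torsion M C \<sigma> t" and D: "Cartan_connection M C \<sigma> D"
begin

abbreviation "H \<equiv> hom_bundle C"
abbreviation "Sg \<equiv> sub_bundle M (hom_bundle C) \<sigma>"
abbreviation "P \<equiv> pair_of M C \<sigma> t D"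

lemmas acC = Cartan_algebroidD(1)[OF C]
lemmas CD = almost_CartanD[OF acC]
lemmas AL = almost_LieD[OF CD(1)]
lemmas vC = CD(2)
lemmas Sg_sections = sigma_sections[OF CD(2) CD(4)]
lemmas sigma_hom = sub_fib[OF CD(4)]
lemmas sigma_lin = linear_onD[OF CD(9)]

lemma torsion_alt: "alternating_bundle_map M C Sg t"
  using t unfolding Cartan_torsion_def by blast

lemma torsion_mem: "u \<in> fib C p \<Longrightarrow> v \<in> fib C p \<Longrightarrow> t p u v \<in> \<sigma> p"
  using linear_onD(1)[OF alternating_bundle_mapD(1)[OF torsion_alt]] by simp

lemma torsion_in: "u \<in> fib C p \<Longrightarrow> v \<in> fib C p \<Longrightarrow> w \<in> fib C p \<Longrightarrow> t p u v w \<in> fib C p"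
  by (rule sigma_lin(1)[OF torsion_mem])

lemma torsion_add: "u \<in> fib C p \<Longrightarrow> v \<in> fib C p \<Longrightarrow> v' \<in> fib C p \<Longrightarrow> w \<in> fib C p \<Longrightarrow>
    t p u (vadd C p v v') w = vadd C p (t p u v w) (t p u v' w)"
  using linear_onD(2)[OF alternating_bundle_mapD(1)[OF torsion_alt], of u p v v'] by simp

lemma torsion_scale: "u \<in> fib C p \<Longrightarrow> v \<in> fib C p \<Longrightarrow> w \<in> fib C p \<Longrightarrow>
    t p u (vscale C p c v) w = vscale C p c (t p u v w)"
  using linear_onD(3)[OF alternating_bundle_mapD(1)[OF torsion_alt], of u p v c] by simp

lemma torsion_skew: "u \<in> fib C p \<Longrightarrow> v \<in> fib C p \<Longrightarrow> w \<in> fib C p \<Longrightarrow> t p v u w = vscale C p (-1) (t p u v w)"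
  using alternating_bundle_mapD(2)[OF torsion_alt, of u p v] by simp

lemma torsion_sec: "\<alpha> \<in> sections M C \<Longrightarrow> \<beta> \<in> sections M C \<Longrightarrow> (\<lambda>p. t p (\<alpha> p) (\<beta> p)) \<in> sections M Sg"
  by (rule alternating_bundle_map_sec[OF vC CD(7) torsion_alt])

lemma torsion_jacobi:
  assumes "\<alpha> \<in> sections M C" "\<beta> \<in> sections M C" "\<gamma> \<in> sections M C"
  shows "vadd C p (vadd C p (brk C (brk C \<alpha> \<beta>) \<gamma> p) (brk C (brk C \<beta> \<gamma>) \<alpha> p)) (brk C (brk C \<gamma> \<alpha>) \<beta> p) =
    vadd C p (vadd C p (t p (\<alpha> p) (\<beta> p) (\<gamma> p)) (t p (\<beta> p) (\<gamma> p) (\<alpha> p))) (t p (\<gamma> p) (\<alpha> p) (\<beta> p))"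
proof -
  have "jacobiator C \<alpha> \<beta> \<gamma> = (\<lambda>p. vadd C p (vadd C p (t p (\<alpha> p) (\<beta> p) (\<gamma> p)) (t p (\<beta> p) (\<gamma> p) (\<alpha> p))) (t p (\<gamma> p) (\<alpha> p) (\<beta> p)))"
    using t assms unfolding Cartan_torsion_def by blast
  from fun_cong[OF this, of p] show ?thesis by (simp add: jacobiator_def sadd_def)
qed

lemma conn_bilinear: "bilinear_sections M C Sg Sg D"
  using D unfolding Cartan_connection_def by (elim conjE)

lemma conn_sec: "\<alpha> \<in> sections M C \<Longrightarrow> T \<in> sections M Sg \<Longrightarrow> D \<alpha> T \<in> sections M Sg"
  using conn_bilinear unfolding bilinear_sections_def by blast

lemma conn_add:
  "\<alpha> \<in> sections M C \<Longrightarrow> \<alpha>' \<in> sections M C \<Longrightarrow> T \<in> sections M Sg \<Longrightarrow> D (sadd C \<alpha> \<alpha>') T = sadd H (D \<alpha> T) (D \<alpha>' T)"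
  "\<alpha> \<in> sections M C \<Longrightarrow> T \<in> sections M Sg \<Longrightarrow> T' \<in> sections M Sg \<Longrightarrow> D \<alpha> (sadd H T T') = sadd H (D \<alpha> T) (D \<alpha> T')"
  using conn_bilinear unfolding bilinear_sections_def sub_bundle_simps by blast+

lemma conn_scale:
  assumes "\<alpha> \<in> sections M C" "T \<in> sections M Sg" "f \<in> Cinf M"
  shows "D (sscale C f \<alpha>) T = sscale H f (D \<alpha> T)"
    "D \<alpha> (sscale H f T) = sadd H (sscale H f (D \<alpha> T)) (sscale H (Lie C \<alpha> f) T)"
proof -
  have "\<forall>\<alpha>\<in>sections M C. \<forall>T\<in>sections M Sg. \<forall>f\<in>Cinf M.
        D (sscale C f \<alpha>) T = sscale H f (D \<alpha> T) \<and>
        D \<alpha> (sscale H f T) = sadd H (sscale H f (D \<alpha> T)) (sscale H (Lie C \<alpha> f) T)"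
    using D unfolding Cartan_connection_def sub_bundle_simps by (elim conjE)
  then show "D (sscale C f \<alpha>) T = sscale H f (D \<alpha> T)"
    "D \<alpha> (sscale H f T) = sadd H (sscale H f (D \<alpha> T)) (sscale H (Lie C \<alpha> f) T)"
    using assms by blast+
qed

lemma conn_brk:
  assumes "\<alpha> \<in> sections M C" "\<beta> \<in> sections M C" "T \<in> sections M Sg"
  shows "vminus C p (vminus C p (T p (brk C \<alpha> \<beta> p)) (brk C (sapp T \<alpha>) \<beta> p)) (brk C \<alpha> (sapp T \<beta>) p) =
    vminus C p (D \<beta> T p (\<alpha> p)) (D \<alpha> T p (\<beta> p))"
proof -
  have "\<forall>\<alpha>\<in>sections M C. \<forall>\<beta>\<in>sections M C. \<forall>T\<in>sections M Sg.
        sminus C (sminus C (sapp T (brk C \<alpha> \<beta>)) (brk C (sapp T \<alpha>) \<beta>)) (brk C \<alpha> (sapp T \<beta>)) =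
        sminus C (sapp (D \<beta> T) \<alpha>) (sapp (D \<alpha> T) \<beta>)"
    using D unfolding Cartan_connection_def by (elim conjE)
  then have "sminus C (sminus C (sapp T (brk C \<alpha> \<beta>)) (brk C (sapp T \<alpha>) \<beta>)) (brk C \<alpha> (sapp T \<beta>)) =
        sminus C (sapp (D \<beta> T) \<alpha>) (sapp (D \<alpha> T) \<beta>)" using assms by blast
  from fun_cong[OF this, of p] show ?thesis by (simp add: sminus_def sapp_def)
qed

lemma same_vb_pair: "same_vb P (sum_bundle C Sg)"
  by (simp add: same_vb_def pair_of_def Let_def vbundle.defs algebroid.defs)

lemma pair_simps [simp]:
  "fib P p = fib C p \<times> \<sigma> p"
  "vzero P p = (vzero C p, vzero H p)"
  "vadd P p x y = (vadd C p (fst x) (fst y), vadd H p (snd x) (snd y))"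
  "vscale P p c x = (vscale C p c (fst x), vscale H p c (snd x))"
  "vminus P p x y = (vminus C p (fst x) (fst y), vminus H p (snd x) (snd y))"
  "anchor P p x = anchor C p (fst x)"
  using same_vbD[OF same_vb_pair]
  by (simp_all del: hom_bundle_simps)
    (cases x, simp add: pair_of_def Let_def vbundle.defs algebroid.defs)

lemma pair_brk: "brk P a b p =
   (vminus C p (vadd C p (brk C (fst \<circ> a) (fst \<circ> b) p) (snd (a p) (fst (b p)))) (snd (b p) (fst (a p))),
    vadd H p (vminus H p (vadd H p (vscale H p (-1) (t p (fst (a p)) (fst (b p)))) (D (fst \<circ> a) (snd \<circ> b) p))
      (D (fst \<circ> b) (snd \<circ> a) p)) (commutator C p (snd (a p)) (snd (b p))))"
  by (simp add: pair_of_def Let_def vbundle.defs algebroid.defs del: hom_bundle_simps)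

lemma pair_brk_fst:
  "fst (brk P a b p) = vminus C p (vadd C p (brk C (fst \<circ> a) (fst \<circ> b) p) (snd (a p) (fst (b p)))) (snd (b p) (fst (a p)))"
  by (simp add: pair_brk)

lemma pair_brk_snd:
  "w \<in> fib C p \<Longrightarrow> snd (brk P a b p) w =
    vadd C p (vminus C p (vadd C p (vscale C p (-1) (t p (fst (a p)) (fst (b p)) w)) (D (fst \<circ> a) (snd \<circ> b) p w))
      (D (fst \<circ> b) (snd \<circ> a) p w)) (vminus C p (snd (a p) (snd (b p) w)) (snd (b p) (snd (a p) w)))"
  by (simp add: pair_brk hom_minus commutator_def)

lemma vP: "vector_bundle M P"
  using sum_vector_bundle[OF vC CD(7)] same_vb_transfer(2)[OF same_vb_pair] by blast

lemma pair_sections: "a \<in> sections M P \<longleftrightarrow> fst \<circ> a \<in> sections M C \<and> snd \<circ> a \<in> sections M Sg"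
  unfolding same_vb_transfer(1)[OF same_vb_pair] by (rule sum_sections[OF vC CD(7)])

lemma pair_comp:
  "fst \<circ> sadd P a b = sadd C (fst \<circ> a) (fst \<circ> b)" "snd \<circ> sadd P a b = sadd H (snd \<circ> a) (snd \<circ> b)"
  "fst \<circ> sscale P f a = sscale C f (fst \<circ> a)" "snd \<circ> sscale P f a = sscale H f (snd \<circ> a)"
  by (simp_all add: fun_eq_iff sadd_def sscale_def del: hom_bundle_simps)

lemma pair_sec:
  assumes "a \<in> sections M P"
  shows "fst \<circ> a \<in> sections M C" "snd \<circ> a \<in> sections M Sg" "fst (a p) \<in> fib C p" "snd (a p) \<in> \<sigma> p"
  using assms sec_fib[OF assms, of p] Sg_sections[of "snd \<circ> a"] unfolding pair_sections by auto

lemma sapp_sec: "T \<in> sections M Sg \<Longrightarrow> r \<in> sections M C \<Longrightarrow> sapp T r \<in> sections M C"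
  using Sg_sections by blast

lemma Sg_mem: "T \<in> sections M Sg \<Longrightarrow> T p \<in> \<sigma> p"
  using Sg_sections by blast

lemma conn_mem: "\<alpha> \<in> sections M C \<Longrightarrow> T \<in> sections M Sg \<Longrightarrow> D \<alpha> T p \<in> \<sigma> p"
  by (rule Sg_mem[OF conn_sec])

lemma pair_brk_fst_sec:
  "fst \<circ> brk P a b = sminus C (sadd C (brk C (fst \<circ> a) (fst \<circ> b)) (sapp (snd \<circ> a) (fst \<circ> b))) (sapp (snd \<circ> b) (fst \<circ> a))"
  by (simp add: fun_eq_iff pair_brk_fst sminus_def sadd_def sapp_def)

lemma pair_brk_sec:
  assumes a: "a \<in> sections M P" and b: "b \<in> sections M P"
  shows "brk P a b \<in> sections M P"
  unfolding pair_sections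
proof
  note a' = pair_sec[OF a] and b' = pair_sec[OF b]
  show "fst \<circ> brk P a b \<in> sections M C" unfolding pair_brk_fst_sec
    by (intro secs vC AL(3) sapp_sec a' b')
  have com: "(\<lambda>p. commutator C p (snd (a p)) (snd (b p))) \<in> sections M Sg"
    unfolding Sg_sections
  proof (intro conjI allI ballI)
    show "commutator C p (snd (a p)) (snd (b p)) \<in> \<sigma> p" for p
      by (rule Cartan_algebroidD(2)[OF C a'(4) b'(4)])
    fix r assume r: "r \<in> sections M C"
    have "sminus C (sapp (snd \<circ> a) (sapp (snd \<circ> b) r)) (sapp (snd \<circ> b) (sapp (snd \<circ> a) r)) \<in> sections M C"
      by (intro secs vC sapp_sec a' b' r)
    then show "sapp (\<lambda>p. commutator C p (snd (a p)) (snd (b p))) r \<in> sections M C"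
      by (simp add: sapp_def sminus_def commutator_def sec_fib[OF r])
  qed
  have "sadd Sg (sminus Sg (sadd Sg (sscale Sg (\<lambda>_. -1) (\<lambda>p. t p ((fst \<circ> a) p) ((fst \<circ> b) p))) (D (fst \<circ> a) (snd \<circ> b)))
      (D (fst \<circ> b) (snd \<circ> a))) (\<lambda>p. commutator C p (snd (a p)) (snd (b p))) \<in> sections M Sg"
    by (intro secs CD(7) torsion_sec conn_sec com a' b')
  moreover have "sadd Sg (sminus Sg (sadd Sg (sscale Sg (\<lambda>_. -1) (\<lambda>p. t p ((fst \<circ> a) p) ((fst \<circ> b) p))) (D (fst \<circ> a) (snd \<circ> b)))
      (D (fst \<circ> b) (snd \<circ> a))) (\<lambda>p. commutator C p (snd (a p)) (snd (b p))) = snd \<circ> brk P a b"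
    by (simp add: fun_eq_iff pair_brk sadd_def sscale_def sminus_def del: hom_bundle_simps)
  ultimately show "snd \<circ> brk P a b \<in> sections M Sg" by simp
qed

text \<open>Elements of \<sigma> are extensional functions, so second components may be compared on
  vectors of the fibre. Every bracket identity thereby becomes a family of equations in the fibres
  of \<open>C\<close>.\<close>

lemma pair_eqI:
  assumes "x \<in> fib P p" "y \<in> fib P p" "fst x = fst y" "\<And>w. w \<in> fib C p \<Longrightarrow> snd x w = snd y w"
  shows "x = y"
proof (rule prod_eqI[OF assms(3)])
  show "snd x = snd y"
    by (rule hom_eqI[of _ C p]) (use assms sigma_hom in \<open>auto simp del: hom_bundle_simps\<close>)
qed

lemma pair_anchor_map: "anchor_map M P (anchor P)"
  unfolding anchor_map_iff[OF vP]
proof (intro conjI allI ballI)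
  fix p x assume x: "x \<in> fib P p"
  then have x1: "fst x \<in> fib C p" by auto
  show "anchor P p x \<in> tangent_space M p" using anchor_mapD(1)[OF AL(2) x1] by simp
  show "anchor P p (vscale P p c x) = (\<lambda>f. c * anchor P p x f)" for c using anchor_mapD(3)[OF AL(2) x1] by simp
  fix y assume y: "y \<in> fib P p"
  then have y1: "fst y \<in> fib C p" by auto
  show "anchor P p (vadd P p x y) = (\<lambda>f. anchor P p x f + anchor P p y f)"
    using anchor_mapD(2)[OF AL(2) x1 y1] by simp
next
  fix s f assume s: "s \<in> sections M P" and f: "f \<in> Cinf M"
  show "(\<lambda>p. anchor P p (s p) f) \<in> Cinf M"
    using Lie_Cinf[OF CD(1) pair_sec(1)[OF s] f] by (simp add: Lie_def)
qed

lemma anchor_minus: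
  assumes "u \<in> fib C p" "v \<in> fib C p"
  shows "anchor C p (vminus C p u v) = (\<lambda>f. anchor C p u f - anchor C p v f)"
  unfolding vminus_def using assms
  by (simp add: anchor_mapD[OF AL(2)] fibs vC)

text \<open>Derivatives of a scalar enter only through the bracket of \<open>C\<close> and the
  connection, which obey the same Leibniz rule; all other terms are fibrewise linear. The anchor
  respects brackets because it kills the images of the endomorphisms in \<sigma>.\<close>

lemma pair_almost_Lie: "almost_Lie_algebroid M P"
proof (rule almost_Lie_algebroidI[OF vP pair_anchor_map pair_brk_sec])
  fix a b b' p assume a: "a \<in> sections M P" and b: "b \<in> sections M P" and b': "b' \<in> sections M P"
  note a1 = pair_sec[OF a] and b1 = pair_sec[OF b] and b1' = pair_sec[OF b']
  note f = sec_fib[OF AL(3)[OF a1(1) b1(1)]] sec_fib[OF AL(3)[OF a1(1) b1'(1)]]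
  note m = conn_mem[OF a1(1) b1(2)] conn_mem[OF a1(1) b1'(2)] conn_mem[OF b1(1) a1(2)] conn_mem[OF b1'(1) a1(2)]
  show "brk P a (sadd P b b') p = vadd P p (brk P a b p) (brk P a b' p)"
  proof (rule pair_eqI[of _ p])
    show "brk P a (sadd P b b') p \<in> fib P p" by (rule sec_fib[OF pair_brk_sec[OF a sadd_sec[OF vP b b']]])
    show "vadd P p (brk P a b p) (brk P a b' p) \<in> fib P p"
      by (rule vector_bundleD(3)[OF vP sec_fib[OF pair_brk_sec[OF a b]] sec_fib[OF pair_brk_sec[OF a b']]])
    have e: "fst (sadd P b b' p) = vadd C p (fst (b p)) (fst (b' p))"
      "\<And>w. w \<in> fib C p \<Longrightarrow> snd (sadd P b b' p) w = vadd C p (snd (b p) w) (snd (b' p) w)"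
      by (simp_all add: sadd_def)
    show "fst (brk P a (sadd P b b') p) = fst (vadd P p (brk P a b p) (brk P a b' p))"
      unfolding pair_brk_fst pair_comp AL(5)[OF a1(1) b1(1) b1'(1)] e(1) e(2)[OF a1(3)]
      by (rule fib_eqI[OF vC, where p = p])
        (simp_all add: pair_brk_fst sadd_def[of C] fibs crds vC a1 b1 b1' f sigma_lin[OF a1(4)] sigma_lin[OF b1(4)] sigma_lin[OF b1'(4)])
    fix w assume w: "w \<in> fib C p"
    note g = sigma_lin(1)[OF m(1) w] sigma_lin(1)[OF m(2) w] sigma_lin(1)[OF m(3) w] sigma_lin(1)[OF m(4) w]
      sigma_lin(1)[OF a1(4)] sigma_lin(1)[OF b1(4)] sigma_lin(1)[OF b1'(4)]
    show "snd (brk P a (sadd P b b') p) w = snd (vadd P p (brk P a b p) (brk P a b' p)) w"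
      unfolding pair_brk_snd[OF w] pair_comp conn_add(1)[OF b1(1) b1'(1) a1(2)] conn_add(2)[OF a1(1) b1(2) b1'(2)] e(1)
        e(2)[OF w] e(2)[OF g(5)[OF w]]
      by (rule fib_eqI[OF vC, where p = p])
        (simp_all add: pair_brk_snd sadd_def[of H] fibs crds vC a1 b1 b1' f g w torsion_in torsion_add sigma_lin(2)[OF a1(4)])
  qed
next
  fix a b p assume a: "a \<in> sections M P" and b: "b \<in> sections M P"
  note a1 = pair_sec[OF a] and b1 = pair_sec[OF b]
  note f = sec_fib[OF AL(3)[OF a1(1) b1(1)]] sec_fib[OF AL(3)[OF b1(1) a1(1)]]
  note m = conn_mem[OF a1(1) b1(2)] conn_mem[OF b1(1) a1(2)]
  show "brk P a b p = vscale P p (-1) (brk P b a p)"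
  proof (rule pair_eqI[of _ p])
    show "brk P a b p \<in> fib P p" by (rule sec_fib[OF pair_brk_sec[OF a b]])
    show "vscale P p (-1) (brk P b a p) \<in> fib P p"
      by (rule vector_bundleD(4)[OF vP sec_fib[OF pair_brk_sec[OF b a]]])
    show "fst (brk P a b p) = fst (vscale P p (-1) (brk P b a p))"
      unfolding pair_brk_fst brk_skew[OF CD(1) a1(1) b1(1)]
      by (rule fib_eqI[OF vC, where p = p])
        (simp_all add: pair_brk_fst fibs crds vC a1 b1 f sigma_lin[OF a1(4)] sigma_lin[OF b1(4)])
    fix w assume w: "w \<in> fib C p"
    note g = sigma_lin(1)[OF m(1) w] sigma_lin(1)[OF m(2) w] sigma_lin(1)[OF a1(4)] sigma_lin(1)[OF b1(4)]
    show "snd (brk P a b p) w = snd (vscale P p (-1) (brk P b a p)) w"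
      unfolding pair_brk_snd[OF w] torsion_skew[OF b1(3) a1(3) w]
      by (rule fib_eqI[OF vC, where p = p])
        (simp_all add: pair_brk_snd fibs crds vC a1 b1 f g w torsion_in)
  qed
  fix h assume h: "h \<in> Cinf M"
  have Lie_eq: "Lie P x h = Lie C (fst \<circ> x) h" for x h by (simp add: Lie_def)
  show "brk P a (sscale P h b) p = vadd P p (vscale P p (h p) (brk P a b p)) (vscale P p (Lie P a h p) (b p))"
  proof (rule pair_eqI[of _ p])
    show "brk P a (sscale P h b) p \<in> fib P p" by (rule sec_fib[OF pair_brk_sec[OF a sscale_sec[OF vP b h]]])
    show "vadd P p (vscale P p (h p) (brk P a b p)) (vscale P p (Lie P a h p) (b p)) \<in> fib P p"
      by (intro vector_bundleD[OF vP] sec_fib[OF pair_brk_sec[OF a b]] sec_fib[OF b])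
    have e: "fst (sscale P h b p) = vscale C p (h p) (fst (b p))"
      "\<And>w. w \<in> fib C p \<Longrightarrow> snd (sscale P h b p) w = vscale C p (h p) (snd (b p) w)"
      by (simp_all add: sscale_def)
    show "fst (brk P a (sscale P h b) p) = fst (vadd P p (vscale P p (h p) (brk P a b p)) (vscale P p (Lie P a h p) (b p)))"
      unfolding pair_brk_fst pair_comp AL(7)[OF a1(1) b1(1) h] e(1) e(2)[OF a1(3)]
      by (rule fib_eqI[OF vC, where p = p])
        (simp_all add: pair_brk_fst sadd_def[of C] sscale_def[of C] Lie_eq fibs crds vC a1 b1 f sigma_lin[OF a1(4)] sigma_lin[OF b1(4)] algebra_simps)
    fix w assume w: "w \<in> fib C p"
    note g = sigma_lin(1)[OF m(1) w] sigma_lin(1)[OF m(2) w] sigma_lin(1)[OF a1(4)] sigma_lin(1)[OF b1(4)]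
    show "snd (brk P a (sscale P h b) p) w = snd (vadd P p (vscale P p (h p) (brk P a b p)) (vscale P p (Lie P a h p) (b p))) w"
      unfolding pair_brk_snd[OF w] pair_comp conn_scale(1)[OF b1(1) a1(2) h] conn_scale(2)[OF a1(1) b1(2) h] e(1)
        e(2)[OF w] e(2)[OF g(3)[OF w]]
      by (rule fib_eqI[OF vC, where p = p])
        (simp_all add: pair_brk_snd sadd_def[of H] sscale_def[of H] Lie_eq fibs crds vC a1 b1 f g w torsion_in torsion_scale sigma_lin(3)[OF a1(4)] algebra_simps)
  qed
  have "Lie C (fst \<circ> brk P a b) h p = Lie C (brk C (fst \<circ> a) (fst \<circ> b)) h p"
    by (simp add: Lie_def pair_brk_fst anchor_minus anchor_mapD[OF AL(2)] fibs vC f a1 b1 sigma_lin(1)[OF a1(4)] sigma_lin(1)[OF b1(4)]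
        CD(5)[OF a1(4) b1(3)] CD(5)[OF b1(4) a1(3)])
  then show "Lie P (brk P a b) h p = Lie P a (Lie P b h) p - Lie P b (Lie P a h) p"
    unfolding Lie_eq AL(8)[OF a1(1) b1(1) h] .
qed

lemma pair_subbundle: "subbundle M P (pair_sub C \<sigma>)"
proof -
  have "subbundle M (sum_bundle C Sg) (\<lambda>p. (\<lambda>w. (vzero C p, w)) ` fib Sg p)"
    by (rule image_subbundle[OF sum_vector_bundle[OF vC CD(7)] CD(7) bundle_map_inr[OF vC CD(7)]]) (simp add: inj_on_def)
  moreover have "(\<lambda>p. (\<lambda>w. (vzero C p, w)) ` fib Sg p) = pair_sub C \<sigma>"
    by (auto simp: fun_eq_iff pair_sub_def)
  ultimately show ?thesis using same_vb_transfer2(1)[OF same_vb_pair] by simp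
qed

text \<open>The C-component of the cyclic sum is sorted by the number of endomorphisms involved.
  Without any, the Jacobiator of \<open>C\<close> cancels the terms -t by axiom (2). With one,
  brackets and connection terms cancel by axiom (3), once for each of \<open>S\<close>,
  \<open>T\<close>, \<open>U\<close>. With two, the commutators cancel against the compositions
  produced by the first components.\<close>

lemma pair_jacobi:
  assumes a: "a \<in> sections M P" and b: "b \<in> sections M P" and c: "c \<in> sections M P"
  shows "fst (jacobiator P a b c p) = vzero C p"
proof -
  note a1 = pair_sec[OF a] and b1 = pair_sec[OF b] and c1 = pair_sec[OF c]
  define \<alpha> S \<beta> T \<gamma> U where d: "\<alpha> = fst \<circ> a" "S = snd \<circ> a" "\<beta> = fst \<circ> b" "T = snd \<circ> b" "\<gamma> = fst \<circ> c" "U = snd \<circ> c"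
  note s = a1(1,2)[folded d] b1(1,2)[folded d] c1(1,2)[folded d]
  \<comment> \<open>Both components of the inner bracket contribute: the first through the bracket
    of \<open>C\<close> and under \<open>snd (z p)\<close>, the second through its action on
    \<open>fst (z p)\<close>.\<close>
  have step: "fst (brk P (brk P x y) z p) =
      vminus C p (vadd C p (vminus C p (vadd C p (brk C (brk C (fst \<circ> x) (fst \<circ> y)) (fst \<circ> z) p)
        (brk C (sapp (snd \<circ> x) (fst \<circ> y)) (fst \<circ> z) p)) (brk C (sapp (snd \<circ> y) (fst \<circ> x)) (fst \<circ> z) p))
        (vadd C p (vminus C p (vadd C p (vscale C p (-1) (t p (fst (x p)) (fst (y p)) (fst (z p)))) (D (fst \<circ> x) (snd \<circ> y) p (fst (z p))))
          (D (fst \<circ> y) (snd \<circ> x) p (fst (z p)))) (vminus C p (snd (x p) (snd (y p) (fst (z p)))) (snd (y p) (snd (x p) (fst (z p)))))))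
        (vminus C p (vadd C p (snd (z p) (brk C (fst \<circ> x) (fst \<circ> y) p)) (snd (z p) (snd (x p) (fst (y p)))))
          (snd (z p) (snd (y p) (fst (x p)))))"
    if x: "x \<in> sections M P" and y: "y \<in> sections M P" and z: "z \<in> sections M P" for x y z
  proof -
    note x1 = pair_sec[OF x] and y1 = pair_sec[OF y] and z1 = pair_sec[OF z]
    have q: "sapp (snd \<circ> x) (fst \<circ> y) \<in> sections M C" "sapp (snd \<circ> y) (fst \<circ> x) \<in> sections M C"
      "brk C (fst \<circ> x) (fst \<circ> y) \<in> sections M C" by (intro sapp_sec AL(3) x1 y1)+
    have q': "sadd C (brk C (fst \<circ> x) (fst \<circ> y)) (sapp (snd \<circ> x) (fst \<circ> y)) \<in> sections M C" by (intro secs vC q)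
    have e: "brk C (sminus C (sadd C (brk C (fst \<circ> x) (fst \<circ> y)) (sapp (snd \<circ> x) (fst \<circ> y))) (sapp (snd \<circ> y) (fst \<circ> x))) (fst \<circ> z) p =
        vminus C p (vadd C p (brk C (brk C (fst \<circ> x) (fst \<circ> y)) (fst \<circ> z) p) (brk C (sapp (snd \<circ> x) (fst \<circ> y)) (fst \<circ> z) p))
          (brk C (sapp (snd \<circ> y) (fst \<circ> x)) (fst \<circ> z) p)"
      unfolding brk_minus(1)[OF CD(1) q' q(2) z1(1)] AL(4)[OF q(3,1) z1(1)] unfolding sminus_def sadd_def ..
    note zl = sigma_lin[OF z1(4)] linear_on_minus[OF vC CD(9)[OF z1(4)]]
    show ?thesis
      unfolding pair_brk_fst[of "brk P x y"] pair_brk_fst_sec e pair_brk_snd[OF z1(3)] pair_brk_fst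
      by (simp add: zl fibs vC sec_fib[OF q(3)] sigma_lin(1)[OF x1(4)] sigma_lin(1)[OF y1(4)] x1 y1)
  qed
  have ss: "sapp S \<beta> \<in> sections M C" "sapp S \<gamma> \<in> sections M C" "sapp T \<alpha> \<in> sections M C" "sapp T \<gamma> \<in> sections M C"
    "sapp U \<alpha> \<in> sections M C" "sapp U \<beta> \<in> sections M C" by (intro sapp_sec s)+
  have bs: "brk C \<alpha> \<beta> \<in> sections M C" "brk C \<beta> \<gamma> \<in> sections M C" "brk C \<gamma> \<alpha> \<in> sections M C"
    by (intro AL(3) s)+
  note pt = sec_fib[OF s(1), of p] sec_fib[OF s(3), of p] sec_fib[OF s(5), of p]
  note sg = Sg_mem[OF s(2), of p] Sg_mem[OF s(4), of p] Sg_mem[OF s(6), of p]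
  note cm = conn_mem[OF s(1) s(4), of p] conn_mem[OF s(3) s(2), of p] conn_mem[OF s(3) s(6), of p] conn_mem[OF s(5) s(4), of p]
    conn_mem[OF s(5) s(2), of p] conn_mem[OF s(1) s(6), of p]
  note mem = pt sigma_lin(1)[OF sg(1)] sigma_lin(1)[OF sg(2)] sigma_lin(1)[OF sg(3)]
    sigma_lin(1)[OF cm(1)] sigma_lin(1)[OF cm(2)] sigma_lin(1)[OF cm(3)] sigma_lin(1)[OF cm(4)] sigma_lin(1)[OF cm(5)] sigma_lin(1)[OF cm(6)]
    sec_fib[OF bs(1), of p] sec_fib[OF bs(2), of p] sec_fib[OF bs(3), of p]
    sec_fib[OF AL(3)[OF bs(1) s(5)], of p] sec_fib[OF AL(3)[OF bs(2) s(1)], of p] sec_fib[OF AL(3)[OF bs(3) s(3)], of p]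
    sec_fib[OF AL(3)[OF ss(1) s(5)], of p] sec_fib[OF AL(3)[OF ss(2) s(3)], of p]
    sec_fib[OF AL(3)[OF ss(3) s(5)], of p] sec_fib[OF AL(3)[OF ss(4) s(1)], of p]
    sec_fib[OF AL(3)[OF ss(5) s(3)], of p] sec_fib[OF AL(3)[OF ss(6) s(1)], of p]
    sec_fib[OF AL(3)[OF s(3) ss(2)], of p] sec_fib[OF AL(3)[OF s(5) ss(3)], of p] sec_fib[OF AL(3)[OF s(1) ss(6)], of p]
    torsion_in
  have pts: "fst (a p) = \<alpha> p" "fst (b p) = \<beta> p" "fst (c p) = \<gamma> p" "snd (a p) = S p" "snd (b p) = T p" "snd (c p) = U p"
    by (simp_all add: d)
  note sk = brk_skew[OF CD(1) ss(2) s(3), of p] brk_skew[OF CD(1) ss(3) s(5), of p] brk_skew[OF CD(1) ss(6) s(1), of p]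
  \<comment> \<open>Axiom (3) has these brackets with the endomorphism in the second argument; they
    are put into that order so that the rest is linear arithmetic.\<close>
  have sk2: "crd C p (brk C (sapp S \<gamma>) \<beta> p) i = - crd C p (brk C \<beta> (sapp S \<gamma>) p) i"
    "crd C p (brk C (sapp T \<alpha>) \<gamma> p) i = - crd C p (brk C \<gamma> (sapp T \<alpha>) p) i"
    "crd C p (brk C (sapp U \<beta>) \<alpha> p) i = - crd C p (brk C \<alpha> (sapp U \<beta>) p) i" for i
    unfolding sk by (simp_all add: crds vC mem)
  have J: "crd C p (brk C (brk C \<alpha> \<beta>) \<gamma> p) i + crd C p (brk C (brk C \<beta> \<gamma>) \<alpha> p) i + crd C p (brk C (brk C \<gamma> \<alpha>) \<beta> p) i =
    crd C p (t p (\<alpha> p) (\<beta> p) (\<gamma> p)) i + crd C p (t p (\<beta> p) (\<gamma> p) (\<alpha> p)) i + crd C p (t p (\<gamma> p) (\<alpha> p) (\<beta> p)) i" for i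
    using arg_cong[OF torsion_jacobi[OF s(1,3,5), of p], of "\<lambda>v. crd C p v i"] by (simp add: crds fibs vC mem)
  have K: "crd C p (S p (brk C \<beta> \<gamma> p)) i - crd C p (brk C (sapp S \<beta>) \<gamma> p) i - crd C p (brk C \<beta> (sapp S \<gamma>) p) i =
      crd C p (D \<gamma> S p (\<beta> p)) i - crd C p (D \<beta> S p (\<gamma> p)) i"
    "crd C p (T p (brk C \<gamma> \<alpha> p)) i - crd C p (brk C (sapp T \<gamma>) \<alpha> p) i - crd C p (brk C \<gamma> (sapp T \<alpha>) p) i =
      crd C p (D \<alpha> T p (\<gamma> p)) i - crd C p (D \<gamma> T p (\<alpha> p)) i"
    "crd C p (U p (brk C \<alpha> \<beta> p)) i - crd C p (brk C (sapp U \<alpha>) \<beta> p) i - crd C p (brk C \<alpha> (sapp U \<beta>) p) i =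
      crd C p (D \<beta> U p (\<alpha> p)) i - crd C p (D \<alpha> U p (\<beta> p)) i" for i
    using arg_cong[OF conn_brk[OF s(3,5,2), of p], of "\<lambda>v. crd C p v i"]
      arg_cong[OF conn_brk[OF s(5,1,4), of p], of "\<lambda>v. crd C p v i"]
      arg_cong[OF conn_brk[OF s(1,3,6), of p], of "\<lambda>v. crd C p v i"] by (simp_all add: crds fibs vC mem)
  have "fst (jacobiator P a b c p) = vadd C p (vadd C p (fst (brk P (brk P a b) c p)) (fst (brk P (brk P b c) a p))) (fst (brk P (brk P c a) b p))"
    by (simp add: jacobiator_def sadd_def)
  also have "\<dots> = vzero C p"
    unfolding step[OF a b c] step[OF b c a] step[OF c a b] d[symmetric] pts
  proof (rule fib_eqI[OF vC, where p = p], goal_cases)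
    \<comment> \<open>In coordinates the claim is a linear combination of \<open>J\<close>,
      \<open>K\<close> and \<open>sk2\<close>; the terms with two endomorphisms cancel by
      themselves.\<close>
    case (3 i)
    show ?case
      using J[of i] K[of i] sk2[of i] by (simp add: crds fibs vC mem)
  qed (simp_all add: fibs vC mem)
  finally show ?thesis .
qed

lemma pair_Cartan: "Cartan_pair M P (pair_sub C \<sigma>)"
  unfolding Cartan_pair_def
proof (intro conjI)
  note vS = pair_subbundle
  note ss = sub_sections[OF vP vS]
  show "almost_Lie_algebroid M P" by (rule pair_almost_Lie)
  show "subbundle M P (pair_sub C \<sigma>)" by (rule vS)
  show "transitive_algebroid M P"
    unfolding transitive_algebroid_def
  proof
    fix p
    have "anchor P p ` fib P p = anchor C p ` fib C p"
    proof (intro equalityI subsetI)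
      fix v assume "v \<in> anchor C p ` fib C p"
      then obtain u where u: "u \<in> fib C p" "v = anchor C p u" by blast
      have "(u, vzero H p) \<in> fib P p" using u sub_zero[OF CD(6,4)] by (simp del: hom_bundle_simps)
      moreover have "v = anchor P p (u, vzero H p)" using u by simp
      ultimately show "v \<in> anchor P p ` fib P p" by blast
    qed auto
    then show "anchor P p ` fib P p = tangent_space M p"
      using CD(3) unfolding transitive_algebroid_def by simp
  qed
  show "\<forall>p. \<forall>v\<in>pair_sub C \<sigma> p. anchor P p v = (\<lambda>_. 0)"
  proof (intro allI ballI)
    fix p v assume v: "v \<in> pair_sub C \<sigma> p"
    have "anchor C p (vscale C p 0 (vzero C p)) = (\<lambda>f. 0 * anchor C p (vzero C p) f)"
      by (rule anchor_mapD(3)[OF AL(2)]) (simp add: fibs vC)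
    then show "anchor P p v = (\<lambda>_. 0)" using v by (auto simp: pair_sub_def vscale_vzero vC)
  qed
  show "\<forall>S\<in>sections M (sub_bundle M P (pair_sub C \<sigma>)). \<forall>T\<in>sections M (sub_bundle M P (pair_sub C \<sigma>)).
        brk P S T \<in> sections M (sub_bundle M P (pair_sub C \<sigma>))"
  proof (intro ballI)
    fix a b assume "a \<in> sections M (sub_bundle M P (pair_sub C \<sigma>))" "b \<in> sections M (sub_bundle M P (pair_sub C \<sigma>))"
    then have a: "a \<in> sections M P" "\<And>p. a p \<in> pair_sub C \<sigma> p" and b: "b \<in> sections M P" "\<And>p. b p \<in> pair_sub C \<sigma> p"
      by (auto simp: ss)
    note a1 = pair_sec[OF a(1)] and b1 = pair_sec[OF b(1)]
    have z': "fst (a p) = vzero C p" "fst (b p) = vzero C p" for p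
      using a(2)[of p] b(2)[of p] by (auto simp: pair_sub_def)
    have z: "fst \<circ> a = vzero C" "fst \<circ> b = vzero C" by (simp_all add: fun_eq_iff z')
    have "brk P a b p \<in> pair_sub C \<sigma> p" for p
    proof -
      note lz = linear_on_zero[OF vC vC CD(9)]
      have "fst (brk P a b p) = vzero C p"
        unfolding pair_brk_fst z z' brk_zero[OF CD(1) zero_sec[OF vC]] lz[OF a1(4)] lz[OF b1(4)]
        by (rule fib_eqI[OF vC, where p = p]) (simp_all add: fibs crds vC)
      moreover have "snd (brk P a b p) \<in> \<sigma> p" by (rule pair_sec(4)[OF pair_brk_sec[OF a(1) b(1)]])
      ultimately show ?thesis by (simp add: pair_sub_def mem_Times_iff)
    qed
    then show "brk P a b \<in> sections M (sub_bundle M P (pair_sub C \<sigma>))"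
      unfolding ss using pair_brk_sec[OF a(1) b(1)] by blast
  qed
  show "\<forall>\<alpha>\<in>sections M P. \<forall>\<beta>\<in>sections M P. \<forall>\<gamma>\<in>sections M P. jacobiator P \<alpha> \<beta> \<gamma> \<in> sections M (sub_bundle M P (pair_sub C \<sigma>))"
  proof (intro ballI)
    fix a b c assume abc: "a \<in> sections M P" "b \<in> sections M P" "c \<in> sections M P"
    have js: "jacobiator P a b c \<in> sections M P" unfolding jacobiator_def by (intro secs vP pair_brk_sec abc)
    have "jacobiator P a b c p \<in> pair_sub C \<sigma> p" for p
      using pair_jacobi[OF abc] pair_sec(4)[OF js] by (simp add: pair_sub_def mem_Times_iff)
    then show "jacobiator P a b c \<in> sections M (sub_bundle M P (pair_sub C \<sigma>))" unfolding ss using js by blast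
  qed
qed

lemma pair_pr_fst:
  assumes x: "x \<in> fib P p" and y: "y \<in> fib P p" and e: "pr P (pair_sub C \<sigma>) p x = pr P (pair_sub C \<sigma>) p y"
  shows "fst x = fst y"
proof -
  have "vminus P p x y \<in> pair_sub C \<sigma> p" by (rule pr_eqD[OF vP pair_subbundle x y e])
  then have z: "vminus C p (fst x) (fst y) = vzero C p" by (simp add: pair_sub_def)
  have f: "fst x \<in> fib C p" "fst y \<in> fib C p" using x y by auto
  show ?thesis
    by (rule fib_eqI[OF vC f]) (use crd_minus[OF vC f] z crd_zero[OF vC] in \<open>metis eq_iff_diff_eq_0\<close>)
qed

lemma sec_pair:
  assumes "\<alpha> \<in> sections M C" "T \<in> sections M Sg" shows "(\<lambda>p. (\<alpha> p, T p)) \<in> sections M P"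
  using assms by (simp add: pair_sections comp_def)

text \<open>The class of (v, 0) is sent by \<iota>(0, S) to the class of an element with first
  component S(v), and first components are determined modulo the copy of \<sigma>. Hence \<iota>(0,
  S) determines \<open>S\<close>.\<close>

lemma pair_standard: "standard_Cartan_pair M P (pair_sub C \<sigma>)"
  unfolding standard_Cartan_pair_def
proof (intro conjI allI pair_Cartan inj_onI)
  fix p x y assume x: "x \<in> pair_sub C \<sigma> p" and y: "y \<in> pair_sub C \<sigma> p"
    and e: "iota M P (pair_sub C \<sigma>) p x = iota M P (pair_sub C \<sigma>) p y"
  obtain S T where S: "x = (vzero C p, S)" "S \<in> \<sigma> p" and T: "y = (vzero C p, T)" "T \<in> \<sigma> p"
    using x y by (auto simp: pair_sub_def)
  obtain s where s: "s \<in> sections M Sg" "s p = S" by (rule section_through[OF CD(7), of S p]) (use S(2) in simp)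
  obtain r where r: "r \<in> sections M Sg" "r p = T" by (rule section_through[OF CD(7), of T p]) (use T(2) in simp)
  have key: "iota M P (pair_sub C \<sigma>) p (vzero C p, q p) (pr P (pair_sub C \<sigma>) p (v, vzero H p)) =
      pr P (pair_sub C \<sigma>) p (brk P (\<lambda>p. (vzero C p, q p)) (\<lambda>p. (\<alpha> p, vzero H p)) p)"
    "fst (brk P (\<lambda>p. (vzero C p, q p)) (\<lambda>p. (\<alpha> p, vzero H p)) p) = q p v"
    "brk P (\<lambda>p. (vzero C p, q p)) (\<lambda>p. (\<alpha> p, vzero H p)) p \<in> fib P p"
    if q: "q \<in> sections M Sg" and a: "\<alpha> \<in> sections M C" "\<alpha> p = v" for q \<alpha> v
  proof -
    have q1: "(\<lambda>p. (vzero C p, q p)) \<in> sections M P" using sec_pair[OF zero_sec[OF vC] q] .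
    have a1: "(\<lambda>p. (\<alpha> p, vzero H p)) \<in> sections M P" using sec_pair[OF a(1) zero_sec[OF CD(7)]] by (simp del: hom_bundle_simps)
    show "iota M P (pair_sub C \<sigma>) p (vzero C p, q p) (pr P (pair_sub C \<sigma>) p (v, vzero H p)) =
      pr P (pair_sub C \<sigma>) p (brk P (\<lambda>p. (vzero C p, q p)) (\<lambda>p. (\<alpha> p, vzero H p)) p)"
      using iota_facts(1)[OF pair_Cartan q1 _ a1, of p] a(2) Sg_mem[OF q] by (simp add: pair_sub_def del: hom_bundle_simps)
    show "brk P (\<lambda>p. (vzero C p, q p)) (\<lambda>p. (\<alpha> p, vzero H p)) p \<in> fib P p" by (rule sec_fib[OF pair_brk_sec[OF q1 a1]])
    have v: "v \<in> fib C p" using sec_fib[OF a(1), of p] a(2) by simp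
    have cf: "fst \<circ> (\<lambda>p. (vzero C p, q p)) = vzero C" "fst \<circ> (\<lambda>p. (\<alpha> p, vzero H p)) = \<alpha>" by (auto simp: fun_eq_iff)
    have vz: "vzero H p (vzero C p) = vzero C p" by (simp add: fibs vC)
    show "fst (brk P (\<lambda>p. (vzero C p, q p)) (\<lambda>p. (\<alpha> p, vzero H p)) p) = q p v"
      unfolding pair_brk_fst cf fst_conv snd_conv a(2) brk_zero[OF CD(1) a(1)] vz
      by (rule fib_eqI[OF vC, where p = p]) (simp_all add: fibs crds vC sigma_lin(1)[OF Sg_mem[OF q] v])
  qed
  have "S = T"
  proof (rule hom_eqI[OF sigma_hom[OF S(2)] sigma_hom[OF T(2)]])
    fix v assume v: "v \<in> fib C p"
    obtain \<alpha> where a: "\<alpha> \<in> sections M C" "\<alpha> p = v" by (rule section_through[OF vC v])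
    note ks = key[OF s(1) a] and kr = key[OF r(1) a]
    have "pr P (pair_sub C \<sigma>) p (brk P (\<lambda>p. (vzero C p, s p)) (\<lambda>p. (\<alpha> p, vzero H p)) p) =
        pr P (pair_sub C \<sigma>) p (brk P (\<lambda>p. (vzero C p, r p)) (\<lambda>p. (\<alpha> p, vzero H p)) p)"
      using e ks(1) kr(1) s(2) r(2) S(1) T(1) by simp
    from pair_pr_fst[OF ks(3) kr(3) this] show "S v = T v" using ks(2) kr(2) s(2) r(2) by simp
  qed
  then show "x = y" using S T by simp
qed

end


section \<open>Congruence modulo the copy of \<sigma>\<close>

context cartan_data
begin

text \<open>Together with \<open>pair_sub_minusD\<close>: congruence modulo the copy of \<sigma> is
  equality of first components. As \<open>t\<close> and \<open>D\<close> enter only the second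
  component of the bracket, they drop out of every comparison of brackets in
  \<open>Cartan_pair_iso\<close>.\<close>

lemma pair_sub_minusI:
  assumes "x \<in> fib P p" "y \<in> fib P p" "fst x = fst y"
  shows "vminus P p x y \<in> pair_sub C \<sigma> p"
proof -
  have f: "fst y \<in> fib C p" using assms by auto
  have "vminus C p (fst y) (fst y) = vzero C p"
    by (rule fib_eqI[OF vC, where p = p]) (simp_all add: fibs crds vC f)
  moreover have "snd (vminus P p x y) \<in> \<sigma> p"
    using vminus_in[OF vP assms(1,2)] by (simp add: mem_Times_iff)
  ultimately show ?thesis using assms(3) by (simp add: pair_sub_def mem_Times_iff)
qed

lemma pair_sub_minusD:
  assumes x: "x \<in> fib P p" and y: "y \<in> fib P p" and e: "vminus P p x y \<in> pair_sub C \<sigma> p"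
  shows "fst x = fst y"
  by (rule pair_pr_fst[OF x y pr_eqI[OF vP pair_subbundle x y e]])

lemma pair_sub_iff: "x \<in> pair_sub C \<sigma> p \<longleftrightarrow> x \<in> fib P p \<and> fst x = vzero C p"
  by (auto simp: pair_sub_def fibs vC)

lemma pair_inl: "bundle_map M C P (\<lambda>p u. (u, vzero H p))"
  using same_vb_transfer(6)[OF same_vb_pair, THEN iffD2, OF bundle_map_inl[OF vC CD(7)]]
  by (simp del: hom_bundle_simps)

lemma pair_fst: "bundle_map M P C (\<lambda>p x. fst x)"
  by (rule same_vb_transfer(5)[OF same_vb_pair, THEN iffD2, OF bundle_map_fst[OF vC CD(7)]])

lemma pair_snd: "bundle_map M P Sg (\<lambda>p x. snd x)"
  by (rule same_vb_transfer(5)[OF same_vb_pair, THEN iffD2, OF bundle_map_snd[OF vC CD(7)]])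

end

section \<open>Gauge equivalence and isomorphism of pairs\<close>

context smooth_mfd
begin

text \<open>The isomorphism is conjugation by \<psi> on the \<sigma>-part with \<eta> added off the
  diagonal. Letting the second component act on \<psi>(\<beta>) produces exactly the \<eta>-terms of
  the twisted bracket, so the first components of the brackets match. It runs from the pair of
  \<open>C2\<close> to that of \<open>C1\<close>, the direction of \<psi>.\<close>

lemma gauge_imp_pair_iso:
  assumes X: "Cartan_algebroid M C1 \<sigma>1" "Cartan_torsion M C1 \<sigma>1 t1" "Cartan_connection M C1 \<sigma>1 D1"
    and Y: "Cartan_algebroid M C2 \<sigma>2" "Cartan_torsion M C2 \<sigma>2 t2" "Cartan_connection M C2 \<sigma>2 D2"
    and ge: "gauge_equivalent M C1 \<sigma>1 C2 \<sigma>2"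
  shows "Cartan_pair_iso M (pair_of M C2 \<sigma>2 t2 D2) (pair_sub C2 \<sigma>2) (pair_of M C1 \<sigma>1 t1 D1) (pair_sub C1 \<sigma>1)"
proof -
  interpret X: cartan_data M C1 \<sigma>1 t1 D1 by unfold_locales (fact X)+
  interpret Y: cartan_data M C2 \<sigma>2 t2 D2 by unfold_locales (fact Y)+
  obtain \<eta> \<psi> g where eta: "bundle_map M C1 (sub_bundle M (hom_bundle C1) \<sigma>1) \<eta>"
    and psi: "bundle_map M C2 C1 \<psi>" and g: "bundle_map M C1 C2 g"
    and gp: "\<forall>p. \<forall>u\<in>fib C2 p. g p (\<psi> p u) = u" and pg: "\<forall>p. \<forall>v\<in>fib C1 p. \<psi> p (g p v) = v"
    and br: "\<forall>\<alpha>\<in>sections M C2. \<forall>\<beta>\<in>sections M C2. \<forall>p. \<psi> p (brk C2 \<alpha> \<beta> p) =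
      vminus C1 p (vadd C1 p (brk C1 (sapp \<psi> \<alpha>) (sapp \<psi> \<beta>) p) (\<eta> p (\<psi> p (\<alpha> p)) (\<psi> p (\<beta> p)))) (\<eta> p (\<psi> p (\<beta> p)) (\<psi> p (\<alpha> p)))"
    and an: "\<forall>p. \<forall>v\<in>fib C2 p. anchor C1 p (\<psi> p v) = anchor C2 p v"
    and s1: "\<forall>p. \<forall>T\<in>\<sigma>2 p. (\<lambda>v\<in>fib C1 p. \<psi> p (T (g p v))) \<in> \<sigma>1 p"
    and s2: "\<forall>p. \<forall>T\<in>\<sigma>1 p. (\<lambda>v\<in>fib C2 p. g p (T (\<psi> p v))) \<in> \<sigma>2 p"
    by (rule gauge_equivalentE[OF ge X.acC Y.acC])
  note gp' = gp[rule_format] and pg' = pg[rule_format]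
  note pl = linear_onD[OF bundle_map_linear[OF psi]] and gl = linear_onD[OF bundle_map_linear[OF g]]
  note pm = linear_on_minus[OF Y.vC bundle_map_linear[OF psi]] and gm = linear_on_minus[OF X.vC bundle_map_linear[OF g]]
  note eD = sigma_bundle_mapD[OF X.vC X.vC X.CD(4) eta]
  define \<Psi> where "\<Psi> p x = (\<psi> p (fst x), \<lambda>v\<in>fib C1 p. vadd C1 p (\<eta> p (\<psi> p (fst x)) v) (\<psi> p (snd x (g p v))))" for p x
  \<comment> \<open>The inverse of \<Psi>: the contribution of \<eta> is subtracted before
    conjugating back.\<close>
  define G where "G p y = (g p (fst y), \<lambda>w\<in>fib C2 p. g p (vminus C1 p (snd y (\<psi> p w)) (\<eta> p (fst y) (\<psi> p w))))" for p y
  \<comment> \<open>The endomorphism part is the value of \<eta>, which lies in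
    \<open>\<sigma>1\<close>, plus a conjugate of an element of \<open>\<sigma>2\<close>, which lies
    in \<open>\<sigma>1\<close> by \<open>s1\<close>.\<close>
  have Pf: "\<Psi> p x \<in> fib X.P p" if x: "x \<in> fib Y.P p" for p x
  proof -
    have x': "fst x \<in> fib C2 p" "snd x \<in> \<sigma>2 p" using x by auto
    have "(\<lambda>v\<in>fib C1 p. \<psi> p (snd x (g p v))) \<in> \<sigma>1 p" using s1 x'(2) by blast
    from sub_add[OF X.CD(6,4) eD(1)[OF pl(1)[OF x'(1)]] this]
    have "(\<lambda>v\<in>fib C1 p. vadd C1 p (\<eta> p (\<psi> p (fst x)) v) ((\<lambda>v\<in>fib C1 p. \<psi> p (snd x (g p v))) v)) \<in> \<sigma>1 p" by simp
    moreover have "(\<lambda>v\<in>fib C1 p. vadd C1 p (\<eta> p (\<psi> p (fst x)) v) ((\<lambda>v\<in>fib C1 p. \<psi> p (snd x (g p v))) v)) = snd (\<Psi> p x)"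
      unfolding \<Psi>_def by (rule ext) simp
    ultimately have "snd (\<Psi> p x) \<in> \<sigma>1 p" by simp
    then show ?thesis using pl(1)[OF x'(1)] by (simp add: mem_Times_iff) (simp add: \<Psi>_def)
  qed
  have Gf: "G p y \<in> fib Y.P p" if y: "y \<in> fib X.P p" for p y
  proof -
    have y': "fst y \<in> fib C1 p" "snd y \<in> \<sigma>1 p" using y by auto
    have "vminus X.H p (snd y) (\<eta> p (fst y)) \<in> \<sigma>1 p" by (rule sub_minus[OF X.CD(6,4) y'(2) eD(1)[OF y'(1)]])
    then have "(\<lambda>w\<in>fib C2 p. g p (vminus X.H p (snd y) (\<eta> p (fst y)) (\<psi> p w))) \<in> \<sigma>2 p" using s2 by blast
    moreover have "(\<lambda>w\<in>fib C2 p. g p (vminus X.H p (snd y) (\<eta> p (fst y)) (\<psi> p w))) = snd (G p y)"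
      unfolding G_def by (rule ext) (simp add: hom_minus pl)
    ultimately have "snd (G p y) \<in> \<sigma>2 p" by simp
    then show ?thesis using gl(1)[OF y'(1)] by (simp add: mem_Times_iff) (simp add: G_def)
  qed
  have Pm: "bundle_map M Y.P X.P \<Psi>"
  proof (rule bundle_mapI[OF Y.vP X.vP])
    fix p show "linear_on Y.P X.P p (\<Psi> p)"
    proof (rule linear_onI[OF Pf])
      fix x assume x: "x \<in> fib Y.P p"
      then have x': "fst x \<in> fib C2 p" "snd x \<in> \<sigma>2 p" by auto
      note xl = Y.sigma_lin[OF x'(2)]
      show "\<Psi> p (vscale Y.P p c x) = vscale X.P p c (\<Psi> p x)" for c
      proof (rule X.pair_eqI[of _ p])
        show "\<Psi> p (vscale Y.P p c x) \<in> fib X.P p" by (rule Pf[OF vector_bundleD(4)[OF Y.vP x]])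
        show "vscale X.P p c (\<Psi> p x) \<in> fib X.P p" by (rule vector_bundleD(4)[OF X.vP Pf[OF x]])
        show "fst (\<Psi> p (vscale Y.P p c x)) = fst (vscale X.P p c (\<Psi> p x))" by (simp add: \<Psi>_def pl x')
        fix w assume w: "w \<in> fib C1 p"
        show "snd (\<Psi> p (vscale Y.P p c x)) w = snd (vscale X.P p c (\<Psi> p x)) w"
          by (rule fib_eqI[OF X.vC, where p = p])
            (simp_all add: \<Psi>_def w x' pl gl xl eD fibs crds X.vC Y.vC algebra_simps)
      qed
      fix y assume y: "y \<in> fib Y.P p"
      then have y': "fst y \<in> fib C2 p" "snd y \<in> \<sigma>2 p" by auto
      note yl = Y.sigma_lin[OF y'(2)]
      show "\<Psi> p (vadd Y.P p x y) = vadd X.P p (\<Psi> p x) (\<Psi> p y)"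
      proof (rule X.pair_eqI[of _ p])
        show "\<Psi> p (vadd Y.P p x y) \<in> fib X.P p" by (rule Pf[OF vector_bundleD(3)[OF Y.vP x y]])
        show "vadd X.P p (\<Psi> p x) (\<Psi> p y) \<in> fib X.P p" by (rule vector_bundleD(3)[OF X.vP Pf[OF x] Pf[OF y]])
        show "fst (\<Psi> p (vadd Y.P p x y)) = fst (vadd X.P p (\<Psi> p x) (\<Psi> p y))" by (simp add: \<Psi>_def pl x' y')
        fix w assume w: "w \<in> fib C1 p"
        show "snd (\<Psi> p (vadd Y.P p x y)) w = snd (vadd X.P p (\<Psi> p x) (\<Psi> p y)) w"
          by (rule fib_eqI[OF X.vC, where p = p])
            (simp_all add: \<Psi>_def w x' y' pl gl xl yl eD fibs crds X.vC Y.vC)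
      qed
    qed
    fix s assume s: "s \<in> sections M Y.P"
    note s' = Y.pair_sec[OF s]
    show "sapp \<Psi> s \<in> sections M X.P"
      unfolding X.pair_sections X.Sg_sections
    proof (intro conjI allI ballI)
      have "fst \<circ> sapp \<Psi> s = sapp \<psi> (fst \<circ> s)" by (simp add: fun_eq_iff sapp_def \<Psi>_def)
      then show "fst \<circ> sapp \<Psi> s \<in> sections M C1" using bundle_map_sec[OF Y.vC X.vC psi s'(1)] by simp
      show "(snd \<circ> sapp \<Psi> s) p \<in> \<sigma>1 p" for p using Pf[OF sec_fib[OF s, of p]] by (simp add: sapp_def mem_Times_iff)
      fix r assume r: "r \<in> sections M C1"
      have "sadd C1 (\<lambda>p. \<eta> p (sapp \<psi> (fst \<circ> s) p) (r p)) (sapp \<psi> (sapp (snd \<circ> s) (sapp g r))) \<in> sections M C1"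
        by (intro sadd_sec X.vC eD(6) bundle_map_sec[OF Y.vC X.vC psi] bundle_map_sec[OF X.vC Y.vC g] Y.sapp_sec s' r)
      then show "sapp (snd \<circ> sapp \<Psi> s) r \<in> sections M C1"
        by (simp add: sapp_def sadd_def \<Psi>_def sec_fib[OF r])
    qed
  qed
  have Gm: "bundle_map M X.P Y.P G"
  proof (rule bundle_mapI[OF X.vP Y.vP])
    fix p show "linear_on X.P Y.P p (G p)"
    proof (rule linear_onI[OF Gf])
      fix x assume x: "x \<in> fib X.P p"
      then have x': "fst x \<in> fib C1 p" "snd x \<in> \<sigma>1 p" by auto
      note xl = X.sigma_lin[OF x'(2)]
      show "G p (vscale X.P p c x) = vscale Y.P p c (G p x)" for c
      proof (rule Y.pair_eqI[of _ p])
        show "G p (vscale X.P p c x) \<in> fib Y.P p" by (rule Gf[OF vector_bundleD(4)[OF X.vP x]])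
        show "vscale Y.P p c (G p x) \<in> fib Y.P p" by (rule vector_bundleD(4)[OF Y.vP Gf[OF x]])
        show "fst (G p (vscale X.P p c x)) = fst (vscale Y.P p c (G p x))" by (simp add: G_def gl x')
        fix w assume w: "w \<in> fib C2 p"
        show "snd (G p (vscale X.P p c x)) w = snd (vscale Y.P p c (G p x)) w"
          by (rule fib_eqI[OF Y.vC, where p = p])
            (simp_all add: G_def w x' pl gl gm xl eD fibs crds X.vC Y.vC algebra_simps)
      qed
      fix y assume y: "y \<in> fib X.P p"
      then have y': "fst y \<in> fib C1 p" "snd y \<in> \<sigma>1 p" by auto
      note yl = X.sigma_lin[OF y'(2)]
      show "G p (vadd X.P p x y) = vadd Y.P p (G p x) (G p y)"
      proof (rule Y.pair_eqI[of _ p])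
        show "G p (vadd X.P p x y) \<in> fib Y.P p" by (rule Gf[OF vector_bundleD(3)[OF X.vP x y]])
        show "vadd Y.P p (G p x) (G p y) \<in> fib Y.P p" by (rule vector_bundleD(3)[OF Y.vP Gf[OF x] Gf[OF y]])
        show "fst (G p (vadd X.P p x y)) = fst (vadd Y.P p (G p x) (G p y))" by (simp add: G_def gl x' y')
        fix w assume w: "w \<in> fib C2 p"
        show "snd (G p (vadd X.P p x y)) w = snd (vadd Y.P p (G p x) (G p y)) w"
          by (rule fib_eqI[OF Y.vC, where p = p])
            (simp_all add: G_def w x' y' pl gl gm xl yl eD fibs crds X.vC Y.vC)
      qed
    qed
    fix s assume s: "s \<in> sections M X.P"
    note s' = X.pair_sec[OF s]
    show "sapp G s \<in> sections M Y.P"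
      unfolding Y.pair_sections Y.Sg_sections
    proof (intro conjI allI ballI)
      have "fst \<circ> sapp G s = sapp g (fst \<circ> s)" by (simp add: fun_eq_iff sapp_def G_def)
      then show "fst \<circ> sapp G s \<in> sections M C2" using bundle_map_sec[OF X.vC Y.vC g s'(1)] by simp
      show "(snd \<circ> sapp G s) p \<in> \<sigma>2 p" for p using Gf[OF sec_fib[OF s, of p]] by (simp add: sapp_def mem_Times_iff)
      fix r assume r: "r \<in> sections M C2"
      have "sapp g (sminus C1 (sapp (snd \<circ> s) (sapp \<psi> r)) (\<lambda>p. \<eta> p ((fst \<circ> s) p) (sapp \<psi> r p))) \<in> sections M C2"
        by (intro sminus_sec X.vC eD(6) bundle_map_sec[OF Y.vC X.vC psi] bundle_map_sec[OF X.vC Y.vC g] X.sapp_sec s' r)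
      then show "sapp (snd \<circ> sapp G s) r \<in> sections M C2"
        by (simp add: sapp_def sminus_def G_def sec_fib[OF r])
    qed
  qed
  show ?thesis
  proof (rule Cartan_pair_isoI[OF Y.vP X.vP Pm Gm _ _ X.pair_subbundle])
    show "G p (\<Psi> p x) = x" if x: "x \<in> fib Y.P p" for p x
    proof (rule Y.pair_eqI[OF Gf[OF Pf[OF x]] x])
      have x': "fst x \<in> fib C2 p" "snd x \<in> \<sigma>2 p" using x by auto
      show "fst (G p (\<Psi> p x)) = fst x" by (simp add: G_def \<Psi>_def gp' x')
      fix w assume w: "w \<in> fib C2 p"
      note xl = Y.sigma_lin[OF x'(2)]
      have "vminus C1 p (vadd C1 p (\<eta> p (\<psi> p (fst x)) (\<psi> p w)) (\<psi> p (snd x w))) (\<eta> p (\<psi> p (fst x)) (\<psi> p w)) = \<psi> p (snd x w)"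
        by (rule fib_eqI[OF X.vC, where p = p]) (simp_all add: fibs crds X.vC w x' pl xl eD)
      then show "snd (G p (\<Psi> p x)) w = snd x w" by (simp add: G_def \<Psi>_def w pl gp' x' xl)
    qed
    show "\<Psi> p (G p x) = x" if x: "x \<in> fib X.P p" for p x
    proof (rule X.pair_eqI[OF Pf[OF Gf[OF x]] x])
      have x': "fst x \<in> fib C1 p" "snd x \<in> \<sigma>1 p" using x by auto
      show "fst (\<Psi> p (G p x)) = fst x" by (simp add: G_def \<Psi>_def pg' x')
      fix w assume w: "w \<in> fib C1 p"
      note xl = X.sigma_lin[OF x'(2)]
      show "snd (\<Psi> p (G p x)) w = snd x w"
        by (rule fib_eqI[OF X.vC, where p = p]) (simp_all add: G_def \<Psi>_def fibs crds X.vC w x' pg' gl xl eD)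
    qed
    have z: "\<psi> p (vzero C2 p) = vzero C1 p" "g p (vzero C1 p) = vzero C2 p" for p
      by (rule linear_on_zero[OF Y.vC X.vC bundle_map_linear[OF psi]], rule linear_on_zero[OF X.vC Y.vC bundle_map_linear[OF g]])
    show "\<Psi> p x \<in> pair_sub C1 \<sigma>1 p" if "x \<in> pair_sub C2 \<sigma>2 p" for p x
      using that Pf[of x p] z(1)[of p] unfolding X.pair_sub_iff Y.pair_sub_iff by (simp add: \<Psi>_def)
    show "G p x \<in> pair_sub C2 \<sigma>2 p" if "x \<in> pair_sub C1 \<sigma>1 p" for p x
      using that Gf[of x p] z(2)[of p] unfolding X.pair_sub_iff Y.pair_sub_iff by (simp add: G_def)
    show "anchor X.P p (\<Psi> p x) = anchor Y.P p x" if "x \<in> fib Y.P p" for p x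
      using that an by (auto simp: \<Psi>_def)
    fix a b p assume a: "a \<in> sections M Y.P" and b: "b \<in> sections M Y.P"
    note a' = Y.pair_sec[OF a] and b' = Y.pair_sec[OF b]
    note al = Y.sigma_lin[OF a'(4)] and bl = Y.sigma_lin[OF b'(4)]
    have Pab: "sapp \<Psi> a \<in> sections M X.P" "sapp \<Psi> b \<in> sections M X.P" by (intro bundle_map_sec[OF Y.vP X.vP Pm] a b)+
    have fc: "fst \<circ> sapp \<Psi> a = sapp \<psi> (fst \<circ> a)" "fst \<circ> sapp \<Psi> b = sapp \<psi> (fst \<circ> b)"
      by (simp_all add: fun_eq_iff sapp_def \<Psi>_def)
    have ps: "sapp \<psi> (fst \<circ> a) \<in> sections M C1" "sapp \<psi> (fst \<circ> b) \<in> sections M C1"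
      by (intro bundle_map_sec[OF Y.vC X.vC psi] a' b')+
    note f = sec_fib[OF Y.AL(3)[OF a'(1) b'(1)], of p] sec_fib[OF X.AL(3)[OF ps], of p]
    have "fst (\<Psi> p (brk Y.P a b p)) = \<psi> p (fst (brk Y.P a b p))" by (simp add: \<Psi>_def)
    also have "\<dots> = vminus C1 p (vadd C1 p (\<psi> p (brk C2 (fst \<circ> a) (fst \<circ> b) p)) (\<psi> p (snd (a p) (fst (b p))))) (\<psi> p (snd (b p) (fst (a p))))"
      unfolding Y.pair_brk_fst by (simp add: pl pm fibs Y.vC f a' b' al bl)
    also have "\<dots> = fst (brk X.P (sapp \<Psi> a) (sapp \<Psi> b) p)"
      unfolding br[rule_format, OF a'(1) b'(1), of p] X.pair_brk_fst fc
      by (rule fib_eqI[OF X.vC, where p = p])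
        (simp_all add: sapp_def[of \<Psi>] \<Psi>_def fibs crds X.vC f a' b' al bl pl gl gp' eD)
    finally show "vminus X.P p (\<Psi> p (brk Y.P a b p)) (brk X.P (sapp \<Psi> a) (sapp \<Psi> b) p) \<in> pair_sub C1 \<sigma>1 p"
      by (intro X.pair_sub_minusI Pf sec_fib[OF Y.pair_brk_sec[OF a b]] sec_fib[OF X.pair_brk_sec[OF Pab]])
  qed
qed

text \<open>The \<sigma>-block of the isomorphism is not free: comparing the brackets of (0, T) and
  (w, 0) forces it to be conjugation by the diagonal part \<psi>. Comparing the brackets of
  (\<alpha>, 0) and (\<beta>, 0) then yields the twisted bracket.\<close>

lemma pair_iso_imp_gauge:
  assumes X: "Cartan_algebroid M C1 \<sigma>1" "Cartan_torsion M C1 \<sigma>1 t1" "Cartan_connection M C1 \<sigma>1 D1"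
    and Y: "Cartan_algebroid M C2 \<sigma>2" "Cartan_torsion M C2 \<sigma>2 t2" "Cartan_connection M C2 \<sigma>2 D2"
    and iso: "Cartan_pair_iso M (pair_of M C1 \<sigma>1 t1 D1) (pair_sub C1 \<sigma>1) (pair_of M C2 \<sigma>2 t2 D2) (pair_sub C2 \<sigma>2)"
  shows "gauge_equivalent M C2 \<sigma>2 C1 \<sigma>1"
proof -
  interpret X: cartan_data M C1 \<sigma>1 t1 D1 by unfold_locales (fact X)+
  interpret Y: cartan_data M C2 \<sigma>2 t2 D2 by unfold_locales (fact Y)+
  obtain \<Psi> G where Pm: "bundle_map M X.P Y.P \<Psi>" and Gm: "bundle_map M Y.P X.P G"
    and GP: "\<forall>p. \<forall>u\<in>fib X.P p. G p (\<Psi> p u) = u" and PG: "\<forall>p. \<forall>v\<in>fib Y.P p. \<Psi> p (G p v) = v"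
    and s1: "\<forall>p. \<forall>u\<in>pair_sub C1 \<sigma>1 p. \<Psi> p u \<in> pair_sub C2 \<sigma>2 p" and s2: "\<forall>p. \<forall>v\<in>pair_sub C2 \<sigma>2 p. G p v \<in> pair_sub C1 \<sigma>1 p"
    and an: "\<forall>p. \<forall>v\<in>fib X.P p. anchor Y.P p (\<Psi> p v) = anchor X.P p v"
    and br: "\<forall>\<alpha>\<in>sections M X.P. \<forall>\<beta>\<in>sections M X.P. \<forall>p.
      vminus Y.P p (\<Psi> p (brk X.P \<alpha> \<beta> p)) (brk Y.P (sapp \<Psi> \<alpha>) (sapp \<Psi> \<beta>) p) \<in> pair_sub C2 \<sigma>2 p"
    by (rule Cartan_pair_isoE[OF iso X.pair_subbundle])
  note Pl = linear_onD[OF bundle_map_linear[OF Pm]] and Gl = linear_onD[OF bundle_map_linear[OF Gm]]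
  define \<psi> where "\<psi> p u = fst (\<Psi> p (u, vzero X.H p))" for p u
  define g where "g p v = fst (G p (v, vzero Y.H p))" for p v
  \<comment> \<open>The off-diagonal block starts at \<open>C1\<close>, whereas a twist of
    \<open>C2\<close> needs a map that starts at \<open>C2\<close>; precomposition with
    \<open>g\<close> provides it.\<close>
  define \<eta> where "\<eta> p w = snd (\<Psi> p (g p w, vzero X.H p))" for p w
  have psi: "bundle_map M C1 C2 \<psi>" unfolding \<psi>_def
    by (rule bundle_map_comp[OF X.vC Y.vP Y.vC bundle_map_comp[OF X.vC X.vP Y.vP X.pair_inl Pm] Y.pair_fst])
  have g: "bundle_map M C2 C1 g" unfolding g_def
    by (rule bundle_map_comp[OF Y.vC X.vP X.vC bundle_map_comp[OF Y.vC Y.vP X.vP Y.pair_inl Gm] X.pair_fst])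
  have eta: "bundle_map M C2 Y.Sg \<eta>" unfolding \<eta>_def
    by (rule bundle_map_comp[OF Y.vC Y.vP Y.CD(7) bundle_map_comp[OF Y.vC X.vC Y.vP g
          bundle_map_comp[OF X.vC X.vP Y.vP X.pair_inl Pm]] Y.pair_snd])
  note pl = linear_onD[OF bundle_map_linear[OF psi]] and gl = linear_onD[OF bundle_map_linear[OF g]]
  have zX: "vzero X.H p \<in> \<sigma>1 p" for p by (rule sub_zero[OF X.CD(6,4)])
  have zY: "vzero Y.H p \<in> \<sigma>2 p" for p by (rule sub_zero[OF Y.CD(6,4)])
  have inX: "(u, vzero X.H p) \<in> fib X.P p" if "u \<in> fib C1 p" for p u using that zX by (simp del: hom_bundle_simps)
  have inY: "(u, vzero Y.H p) \<in> fib Y.P p" if "u \<in> fib C2 p" for p u using that zY by (simp del: hom_bundle_simps)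
  \<comment> \<open>Elements (0, S) go to the copy of \<sigma>, so the second component of
    \<open>x\<close> has no influence on the first component of its image.\<close>
  have fP: "fst (\<Psi> p x) = \<psi> p (fst x)" if x: "x \<in> fib X.P p" for p x
  proof -
    have x': "fst x \<in> fib C1 p" "snd x \<in> \<sigma>1 p" using x by auto
    have o: "(vzero C1 p, snd x) \<in> pair_sub C1 \<sigma>1 p" using x'(2) by (simp add: pair_sub_def)
    then have o': "(vzero C1 p, snd x) \<in> fib X.P p" by (simp add: X.pair_sub_iff)
    have "vadd X.P p (fst x, vzero X.H p) (vzero C1 p, snd x) = x"
    proof (rule X.pair_eqI[OF vector_bundleD(3)[OF X.vP inX[OF x'(1)] o'] x])
      show "fst (vadd X.P p (fst x, vzero X.H p) (vzero C1 p, snd x)) = fst x"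
        by (rule fib_eqI[OF X.vC, where p = p]) (simp_all add: fibs crds X.vC x')
      show "snd (vadd X.P p (fst x, vzero X.H p) (vzero C1 p, snd x)) w = snd x w" if w: "w \<in> fib C1 p" for w
        by (rule fib_eqI[OF X.vC, where p = p]) (simp_all add: fibs crds X.vC w X.sigma_lin(1)[OF x'(2) w])
    qed
    then have "\<Psi> p x = vadd Y.P p (\<Psi> p (fst x, vzero X.H p)) (\<Psi> p (vzero C1 p, snd x))"
      using Pl(2)[OF inX[OF x'(1)] o'] by simp
    then have "fst (\<Psi> p x) = vadd C2 p (\<psi> p (fst x)) (fst (\<Psi> p (vzero C1 p, snd x)))" by (simp add: \<psi>_def del: hom_bundle_simps)
    moreover have "fst (\<Psi> p (vzero C1 p, snd x)) = vzero C2 p" using s1 o by (simp add: Y.pair_sub_iff)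
    moreover have "vadd C2 p (\<psi> p (fst x)) (vzero C2 p) = \<psi> p (fst x)"
      by (rule fib_eqI[OF Y.vC, where p = p]) (simp_all add: fibs crds Y.vC pl x')
    ultimately show ?thesis by simp
  qed
  have fG: "fst (G p x) = g p (fst x)" if x: "x \<in> fib Y.P p" for p x
  proof -
    have x': "fst x \<in> fib C2 p" "snd x \<in> \<sigma>2 p" using x by auto
    have o: "(vzero C2 p, snd x) \<in> pair_sub C2 \<sigma>2 p" using x'(2) by (simp add: pair_sub_def)
    then have o': "(vzero C2 p, snd x) \<in> fib Y.P p" by (simp add: Y.pair_sub_iff)
    have "vadd Y.P p (fst x, vzero Y.H p) (vzero C2 p, snd x) = x"
    proof (rule Y.pair_eqI[OF vector_bundleD(3)[OF Y.vP inY[OF x'(1)] o'] x])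
      show "fst (vadd Y.P p (fst x, vzero Y.H p) (vzero C2 p, snd x)) = fst x"
        by (rule fib_eqI[OF Y.vC, where p = p]) (simp_all add: fibs crds Y.vC x')
      show "snd (vadd Y.P p (fst x, vzero Y.H p) (vzero C2 p, snd x)) w = snd x w" if w: "w \<in> fib C2 p" for w
        by (rule fib_eqI[OF Y.vC, where p = p]) (simp_all add: fibs crds Y.vC w Y.sigma_lin(1)[OF x'(2) w])
    qed
    then have "G p x = vadd X.P p (G p (fst x, vzero Y.H p)) (G p (vzero C2 p, snd x))"
      using Gl(2)[OF inY[OF x'(1)] o'] by simp
    then have "fst (G p x) = vadd C1 p (g p (fst x)) (fst (G p (vzero C2 p, snd x)))" by (simp add: g_def del: hom_bundle_simps)
    moreover have "fst (G p (vzero C2 p, snd x)) = vzero C1 p" using s2 o by (simp add: X.pair_sub_iff)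
    moreover have "vadd C1 p (g p (fst x)) (vzero C1 p) = g p (fst x)"
      by (rule fib_eqI[OF X.vC, where p = p]) (simp_all add: fibs crds X.vC gl x')
    ultimately show ?thesis by simp
  qed
  have gp: "g p (\<psi> p u) = u" if u: "u \<in> fib C1 p" for p u
    using fG[OF Pl(1)[OF inX[OF u]]] GP inX[OF u] fP[OF inX[OF u]] by (simp del: hom_bundle_simps)
  have pg: "\<psi> p (g p v) = v" if v: "v \<in> fib C2 p" for p v
    using fP[OF Gl(1)[OF inY[OF v]]] PG inY[OF v] fG[OF inY[OF v]] by (simp del: hom_bundle_simps)
  \<comment> \<open>Compatibility of brackets modulo the copy of \<sigma>, turned into an equation
    between first components. It is used for the \<sigma>-block and again for the twisted
    bracket.\<close>
  have brf: "\<psi> p (fst (brk X.P a b p)) = fst (brk Y.P (sapp \<Psi> a) (sapp \<Psi> b) p)"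
    if a: "a \<in> sections M X.P" and b: "b \<in> sections M X.P" for a b p
  proof -
    have Pab: "sapp \<Psi> a \<in> sections M Y.P" "sapp \<Psi> b \<in> sections M Y.P" by (intro bundle_map_sec[OF X.vP Y.vP Pm] a b)+
    note f = sec_fib[OF X.pair_brk_sec[OF a b], of p] sec_fib[OF Y.pair_brk_sec[OF Pab], of p]
    show ?thesis unfolding fP[OF f(1), symmetric]
      by (rule Y.pair_sub_minusD[OF Pl(1)[OF f(1)] f(2) br[rule_format, OF a b]])
  qed
  have secX: "(\<lambda>p. (\<alpha> p, vzero X.H p)) \<in> sections M X.P" if "\<alpha> \<in> sections M C1" for \<alpha>
    using X.sec_pair[OF that zero_sec[OF X.CD(7)]] by (simp del: hom_bundle_simps)
  have zv: "vzero X.H p v = vzero C1 p" if "v \<in> fib C1 p" for p v using that by simp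
  \<comment> \<open>Extend (0, T) and (w, 0) to sections and compare first components of brackets:
    one side gives T(w) under \<psi>, the other the \<sigma>-block applied to \<psi>(w).\<close>
  have kap: "snd (\<Psi> p (vzero C1 p, T)) (\<psi> p w) = \<psi> p (T w)" if T: "T \<in> \<sigma>1 p" and w: "w \<in> fib C1 p" for p T w
  proof -
    obtain s where s: "s \<in> sections M X.Sg" "s p = T" by (rule section_through[OF X.CD(7), of T p]) (use T in simp)
    obtain \<beta> where b: "\<beta> \<in> sections M C1" "\<beta> p = w" by (rule section_through[OF X.vC w])
    define a where "a = (\<lambda>p. (vzero C1 p, s p))"
    define b' where "b' = (\<lambda>p. (\<beta> p, vzero X.H p))"
    have as: "a \<in> sections M X.P" unfolding a_def by (rule X.sec_pair[OF zero_sec[OF X.vC] s(1)])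
    have bs: "b' \<in> sections M X.P" unfolding b'_def by (rule secX[OF b(1)])
    have Pab: "sapp \<Psi> a \<in> sections M Y.P" "sapp \<Psi> b' \<in> sections M Y.P" by (intro bundle_map_sec[OF X.vP Y.vP Pm] as bs)+
    note Pa = Y.pair_sec[OF Pab(1)] and Pb = Y.pair_sec[OF Pab(2)]
    have fa: "fst \<circ> a = vzero C1" "fst \<circ> b' = \<beta>" by (simp_all add: a_def b'_def fun_eq_iff)
    have Tw: "T w \<in> fib C1 p" by (rule X.sigma_lin(1)[OF T w])
    have 1: "fst (brk X.P a b' p) = T w"
      unfolding X.pair_brk_fst fa brk_zero[OF X.CD(1) b(1)]
      by (rule fib_eqI[OF X.vC, where p = p]) (simp_all add: a_def b'_def s(2) b(2) fibs crds X.vC Tw)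
    have fz: "fst \<circ> sapp \<Psi> a = vzero C2"
    proof
      fix q
      have "\<Psi> q (a q) \<in> pair_sub C2 \<sigma>2 q" using s1 X.Sg_mem[OF s(1)] by (simp add: a_def pair_sub_def[of C1])
      then show "(fst \<circ> sapp \<Psi> a) q = vzero C2 q" by (simp add: sapp_def Y.pair_sub_iff)
    qed
    then have fz': "fst (sapp \<Psi> a p) = vzero C2 p" by (metis comp_apply)
    have bp: "fst (sapp \<Psi> b' p) = \<psi> p w" using fP[OF sec_fib[OF bs, of p]] by (simp add: sapp_def b'_def b(2))
    have k: "snd (sapp \<Psi> a p) (\<psi> p w) \<in> fib C2 p" by (rule Y.sigma_lin(1)[OF Pa(4) pl(1)[OF w]])
    have 2: "fst (brk Y.P (sapp \<Psi> a) (sapp \<Psi> b') p) = snd (sapp \<Psi> a p) (\<psi> p w)"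
      unfolding Y.pair_brk_fst fz fz' bp brk_zero[OF Y.CD(1) Pb(1)] linear_on_zero[OF Y.vC Y.vC Y.CD(9)[OF Pb(4)]]
      by (rule fib_eqI[OF Y.vC, where p = p]) (simp_all add: fibs crds Y.vC k)
    show ?thesis using brf[OF as bs, of p] unfolding 1 2 by (simp add: sapp_def a_def s(2))
  qed
  have kmem: "snd (\<Psi> p (vzero C1 p, T)) \<in> \<sigma>2 p" if "T \<in> \<sigma>1 p" for p T
  proof -
    have "\<Psi> p (vzero C1 p, T) \<in> pair_sub C2 \<sigma>2 p" using s1 that by (simp add: pair_sub_def[of C1])
    then show ?thesis by (auto simp: pair_sub_def)
  qed
  show ?thesis
  proof (rule gauge_equivalentI[OF Y.acC X.acC eta psi g gp pg])
    show "anchor C2 p (\<psi> p v) = anchor C1 p v" if "v \<in> fib C1 p" for p v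
      using an inX[OF that] by (simp add: \<psi>_def del: hom_bundle_simps)
    show "(\<lambda>v\<in>fib C2 p. \<psi> p (T (g p v))) \<in> \<sigma>2 p" if T: "T \<in> \<sigma>1 p" for p T
    proof -
      have "(\<lambda>v\<in>fib C2 p. \<psi> p (T (g p v))) = snd (\<Psi> p (vzero C1 p, T))"
        by (rule extensionalityI[OF restrict_extensional Y.CD(8)[OF kmem[OF T]]])
          (simp add: kap[OF T gl(1), symmetric] pg)
      then show ?thesis using kmem[OF T] by simp
    qed
    show "(\<lambda>v\<in>fib C1 p. g p (T (\<psi> p v))) \<in> \<sigma>1 p" if T: "T \<in> \<sigma>2 p" for p T
    proof -
      have o: "(vzero C2 p, T) \<in> pair_sub C2 \<sigma>2 p" using T by (simp add: pair_sub_def)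
      \<comment> \<open>The preimage of (0, T) is some (0, T'), and \<open>kap\<close> for T'
        exhibits T' as the conjugate of \<open>T\<close>.\<close>
      have "G p (vzero C2 p, T) \<in> pair_sub C1 \<sigma>1 p" using s2 o by blast
      then obtain T' where T': "G p (vzero C2 p, T) = (vzero C1 p, T')" "T' \<in> \<sigma>1 p" by (auto simp: pair_sub_def)
      have "\<Psi> p (vzero C1 p, T') = (vzero C2 p, T)" using PG o T'(1) unfolding Y.pair_sub_iff by metis
      then have "T (\<psi> p w) = \<psi> p (T' w)" if "w \<in> fib C1 p" for w using kap[OF T'(2) that] by simp
      then have "(\<lambda>v\<in>fib C1 p. g p (T (\<psi> p v))) = T'"
        by (intro extensionalityI[OF restrict_extensional X.CD(8)[OF T'(2)]])
          (simp add: gp X.sigma_lin(1)[OF T'(2)])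
      then show ?thesis using T'(2) by simp
    qed
    fix \<alpha> \<beta> p assume a: "\<alpha> \<in> sections M C1" and b: "\<beta> \<in> sections M C1"
    note as = secX[OF a] and bs = secX[OF b]
    have fc: "fst \<circ> (\<lambda>p. (\<alpha> p, vzero X.H p)) = \<alpha>" "fst \<circ> (\<lambda>p. (\<beta> p, vzero X.H p)) = \<beta>" by (auto simp: fun_eq_iff)
    have fs: "fst \<circ> sapp \<Psi> (\<lambda>p. (\<gamma> p, vzero X.H p)) = sapp \<psi> \<gamma>" for \<gamma>
      by (simp add: fun_eq_iff sapp_def \<psi>_def)
    have sn: "snd (sapp \<Psi> (\<lambda>p. (\<gamma> p, vzero X.H p)) p) = \<eta> p (\<psi> p (\<gamma> p))" if "\<gamma> \<in> sections M C1" for \<gamma>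
      by (simp add: sapp_def \<eta>_def gp[OF sec_fib[OF that]])
    have fn: "fst (sapp \<Psi> (\<lambda>p. (\<gamma> p, vzero X.H p)) p) = \<psi> p (\<gamma> p)" for \<gamma> by (simp add: sapp_def \<psi>_def)
    have ab: "brk C1 \<alpha> \<beta> p \<in> fib C1 p" by (rule sec_fib[OF X.AL(3)[OF a b]])
    have 1: "fst (brk X.P (\<lambda>p. (\<alpha> p, vzero X.H p)) (\<lambda>p. (\<beta> p, vzero X.H p)) p) = brk C1 \<alpha> \<beta> p"
      unfolding X.pair_brk_fst fc fst_conv snd_conv zv[OF sec_fib[OF a]] zv[OF sec_fib[OF b]]
      by (rule fib_eqI[OF X.vC, where p = p]) (simp_all add: fibs crds X.vC ab)
    show "\<psi> p (brk C1 \<alpha> \<beta> p) = vminus C2 p (vadd C2 p (brk C2 (sapp \<psi> \<alpha>) (sapp \<psi> \<beta>) p) (\<eta> p (\<psi> p (\<alpha> p)) (\<psi> p (\<beta> p))))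
        (\<eta> p (\<psi> p (\<beta> p)) (\<psi> p (\<alpha> p)))"
      using brf[OF as bs, of p] unfolding 1 Y.pair_brk_fst fs sn[OF a] sn[OF b] fn .
  qed
qed

end


section \<open>From Cartan pairs to Cartan algebroids\<close>

lemma sapp_at: "sapp h s p = h p (s p)"
  by (simp add: sapp_def)

lemma sadd_at: "sadd E s r p = vadd E p (s p) (r p)"
  by (simp add: sadd_def)

locale pair_data = smooth_mfd M for M :: "'m::{t2_space, second_countable_topology} manifold" +
  fixes A :: "('m, 'a) algebroid" and \<sigma> \<xi>
  assumes S: "standard_Cartan_pair M A \<sigma>" and xi: "splitting M A \<sigma> \<xi>"
begin

abbreviation "Q \<equiv> quot_bundle M A \<sigma>"
abbreviation "F \<equiv> sub_bundle M A \<sigma>"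
abbreviation "B \<equiv> algebroid_of M A \<sigma> \<xi>"
abbreviation "\<tau> \<equiv> algebroid_sub M A \<sigma>"
abbreviation "io \<equiv> iota M A \<sigma>"
abbreviation "prj \<equiv> pr A \<sigma>"

lemma pair: "Cartan_pair M A \<sigma>" using S unfolding standard_Cartan_pair_def by blast

lemma io_inj: "inj_on (io p) (\<sigma> p)" using S unfolding standard_Cartan_pair_def by blast

lemmas PD = Cartan_pairD[OF pair]
lemmas AL = almost_LieD[OF PD(1)]
lemmas vA = PD(2)
lemmas vQ = quot_vector_bundle[OF PD(2) PD(4)]
lemmas vF = sub_vector_bundle[OF PD(2) PD(4)]
lemmas F_sections = sub_sections[OF PD(2) PD(4)]
lemmas prm = pr_bundle_map[OF PD(2) PD(4)]
lemmas prl = linear_onD[OF bundle_map_linear[OF pr_bundle_map[OF PD(2) PD(4)]]]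
lemmas prmin = linear_on_minus[OF PD(2) bundle_map_linear[OF pr_bundle_map[OF PD(2) PD(4)]]]
lemmas iofacts = iota_facts[OF pair]
lemmas iol = linear_onD[OF iota_facts(3)[OF pair]]
lemmas sub = subs[OF PD(2) PD(4)]
lemmas sfib = sub_fib[OF PD(4)]

lemma xim: "bundle_map M Q A \<xi>" and pr_xi: "a \<in> fib Q p \<Longrightarrow> prj p (\<xi> p a) = a"
  using xi unfolding splitting_def by auto

lemmas xil = linear_onD[OF bundle_map_linear[OF xim]]

lemma pr_zero: "u \<in> \<sigma> p \<Longrightarrow> prj p u = vzero Q p"
proof -
  assume u: "u \<in> \<sigma> p"
  have "vminus A p u (vzero A p) = u"
    by (rule fib_eqI[OF vA, where p = p]) (simp_all add: fibs crds vA sfib[OF u])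
  then show ?thesis unfolding quot_zero using u sfib[OF u] by (intro pr_eqI[OF vA PD(4)]) (simp_all add: fibs vA)
qed

lemma same_vb_B: "same_vb B Q"
  by (simp add: same_vb_def algebroid_of_def vbundle.defs algebroid.defs)

lemma B_simps [simp]:
  "fib B = fib Q" "vzero B = vzero Q" "vadd B = vadd Q" "vscale B = vscale Q" "vminus B = vminus Q"
  "sadd B = sadd Q" "sscale B = sscale Q" "sminus B = sminus Q"
  "sections M B = sections M Q" "hom_bundle B = hom_bundle Q" "commutator B = commutator Q"
  "anchor B p a = anchor A p (\<xi> p a)"
  using same_vbD[OF same_vb_B] same_vb_transfer(1)[OF same_vb_B] same_vb_transfer2(2,3)[OF same_vb_B]
  by (simp_all add: algebroid_of_def vbundle.defs algebroid.defs)

lemma B_brk: "brk B a b p = prj p (brk A (sapp \<xi> a) (sapp \<xi> b) p)"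
  by (simp add: algebroid_of_def vbundle.defs algebroid.defs sapp_def)

lemma vB: "vector_bundle M B"
  using vQ same_vb_transfer(2)[OF same_vb_B] by blast

text \<open>The projection onto \<sigma> along the image of \<xi>, in other words the connection
  form of the splitting.\<close>

definition om :: "'m \<Rightarrow> 'a \<Rightarrow> 'a" where
  "om p v = vminus A p v (\<xi> p (prj p v))"

lemma om_mem: "v \<in> fib A p \<Longrightarrow> om p v \<in> \<sigma> p"
  unfolding om_def by (rule pr_eqD[OF vA PD(4)]) (simp_all add: xil prl pr_xi)

lemma om_in: "v \<in> fib A p \<Longrightarrow> om p v \<in> fib A p"
  by (rule sfib[OF om_mem])

lemma om_linear:
  "u \<in> fib A p \<Longrightarrow> v \<in> fib A p \<Longrightarrow> om p (vadd A p u v) = vadd A p (om p u) (om p v)"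
  "u \<in> fib A p \<Longrightarrow> om p (vscale A p c u) = vscale A p c (om p u)"
  unfolding om_def
  by (rule fib_eqI[OF vA, where p = p]; simp add: prl xil fibs crds vA algebra_simps)+

lemma om_id: "u \<in> \<sigma> p \<Longrightarrow> om p u = u"
proof -
  assume u: "u \<in> \<sigma> p"
  have "\<xi> p (vzero Q p) = vzero A p" by (rule linear_on_zero[OF vQ vA bundle_map_linear[OF xim]])
  then show ?thesis unfolding om_def pr_zero[OF u]
    by (intro fib_eqI[OF vA, where p = p]) (simp_all add: fibs crds vA sfib[OF u])
qed

lemma om_xi: "a \<in> fib Q p \<Longrightarrow> om p (\<xi> p a) = vzero A p"
  unfolding om_def by (rule fib_eqI[OF vA, where p = p]) (simp_all add: pr_xi xil fibs crds vA)

lemma om_map: "bundle_map M A F om"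
proof (rule bundle_mapI[OF vA vF])
  show "linear_on A F p (om p)" for p by (rule linear_onI) (simp_all add: om_mem om_linear)
  fix s assume s: "s \<in> sections M A"
  have "sapp om s = sminus A s (sapp \<xi> (sapp prj s))" by (simp add: sapp_def om_def sminus_def)
  also have "\<dots> \<in> sections M A" by (intro sminus_sec vA s bundle_map_sec[OF vQ vA xim] bundle_map_sec[OF vA vQ prm])
  finally show "sapp om s \<in> sections M F" unfolding F_sections using om_mem[OF sec_fib[OF s]] by (simp add: sapp_def)
qed

lemma xi_sec: "a \<in> sections M Q \<Longrightarrow> sapp \<xi> a \<in> sections M A"
  by (rule bundle_map_sec[OF vQ vA xim])

lemma pr_sec: "s \<in> sections M A \<Longrightarrow> sapp prj s \<in> sections M Q"
  by (rule bundle_map_sec[OF vA vQ prm])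

lemma om_sec: "s \<in> sections M A \<Longrightarrow> sapp om s \<in> sections M F"
  by (rule bundle_map_sec[OF vA vF om_map])

lemma F_sec: "s \<in> sections M F \<Longrightarrow> s \<in> sections M A" "s \<in> sections M F \<Longrightarrow> s p \<in> \<sigma> p"
  using F_sections by auto

lemma xi_pr_sec: "s \<in> sections M A \<Longrightarrow> sapp \<xi> (sapp prj s) = sminus A s (sapp om s)"
proof
  fix p assume s: "s \<in> sections M A"
  note f = sec_fib[OF s, of p]
  show "sapp \<xi> (sapp prj s) p = sminus A s (sapp om s) p"
    unfolding sapp_def sminus_def om_def
    by (rule fib_eqI[OF vA, where p = p]) (simp_all add: fibs crds vA f xil prl)
qed

lemma B_brk_sec: "a \<in> sections M Q \<Longrightarrow> b \<in> sections M Q \<Longrightarrow> brk B a b \<in> sections M Q"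
  using pr_sec[OF AL(3)[OF xi_sec xi_sec]] by (simp add: sapp_def B_brk[abs_def])

lemma brk_B_eq: "brk B a b = sapp prj (brk A (sapp \<xi> a) (sapp \<xi> b))"
  by (simp add: fun_eq_iff B_brk sapp_def)

lemma io_pr: "T \<in> sections M F \<Longrightarrow> \<alpha> \<in> sections M A \<Longrightarrow> io p (T p) (prj p (\<alpha> p)) = prj p (brk A T \<alpha> p)"
  by (rule iofacts(1)) (auto simp: F_sec)

text \<open>\<xi>(pr(s)) differs from \<open>s\<close> by its \<sigma>-component, and bracketing
  with that component acts on the quotient as \<iota>. The formula turns iterated brackets of
  \<open>B\<close> into brackets of \<open>A\<close>, whose Jacobiator is known to lie in
  \<sigma>.\<close>

lemma brk_B_pr:
  assumes s: "s \<in> sections M A" and b: "b \<in> sections M Q"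
  shows "brk B (sapp prj s) b p = vminus Q p (prj p (brk A s (sapp \<xi> b) p)) (io p (om p (s p)) (b p))"
proof -
  note xb = xi_sec[OF b] and os = om_sec[OF s]
  note f = sec_fib[OF AL(3)[OF s xb], of p] sec_fib[OF AL(3)[OF F_sec(1)[OF os] xb], of p]
  have "io p (om p (s p)) (b p) = prj p (brk A (sapp om s) (sapp \<xi> b) p)"
    using io_pr[OF os xb, of p] by (simp add: sapp_def[of om s] sapp_at[of \<xi> b p] pr_xi[OF sec_fib[OF b]])
  then show ?thesis
    unfolding B_brk xi_pr_sec[OF s] brk_minus(1)[OF PD(1) s F_sec(1)[OF os] xb]
    by (simp add: sminus_def[of A "brk A _ _"] prmin f)
qed

lemma B_skew:
  assumes a: "a \<in> sections M Q" and b: "b \<in> sections M Q"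
  shows "brk B a b p = vscale Q p (-1) (brk B b a p)"
  unfolding B_brk brk_skew[OF PD(1) xi_sec[OF a] xi_sec[OF b]]
  by (rule prl(3)[OF sec_fib[OF AL(3)[OF xi_sec[OF b] xi_sec[OF a]]]])

text \<open>\<open>v\<close> and \<xi>(pr(v)) differ by an element of \<sigma>, which the anchor
  kills.\<close>

lemma anchor_om: "v \<in> fib A p \<Longrightarrow> anchor A p (\<xi> p (prj p v)) = anchor A p v"
proof -
  assume v: "v \<in> fib A p"
  have x: "\<xi> p (prj p v) \<in> fib A p" by (rule xil(1)[OF prl(1)[OF v]])
  have "v = vadd A p (\<xi> p (prj p v)) (om p v)"
    unfolding om_def by (rule fib_eqI[OF vA, where p = p]) (simp_all add: fibs crds vA v x)
  then have "anchor A p v = (\<lambda>f. anchor A p (\<xi> p (prj p v)) f + anchor A p (om p v) f)"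
    using anchor_mapD(2)[OF AL(2) x om_in[OF v]] by simp
  then show ?thesis using PD(5)[OF om_mem[OF v]] by simp
qed

lemma B_almost_Lie: "almost_Lie_algebroid M B"
proof (rule almost_Lie_algebroidI[OF vB])
  have LB: "Lie B a f = Lie A (sapp \<xi> a) f" for a f by (simp add: Lie_def sapp_def)
  show "anchor_map M B (anchor B)"
    unfolding anchor_map_iff[OF vB]
  proof (intro conjI allI ballI)
    fix p a assume a: "a \<in> fib B p"
    then have x: "\<xi> p a \<in> fib A p" by (simp add: xil)
    show "anchor B p a \<in> tangent_space M p" using anchor_mapD(1)[OF AL(2) x] by simp
    show "anchor B p (vscale B p c a) = (\<lambda>f. c * anchor B p a f)" for c
      using a anchor_mapD(3)[OF AL(2) x] by (simp add: xil)
    fix b assume b: "b \<in> fib B p"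
    then have y: "\<xi> p b \<in> fib A p" by (simp add: xil)
    show "anchor B p (vadd B p a b) = (\<lambda>f. anchor B p a f + anchor B p b f)"
      using a b anchor_mapD(2)[OF AL(2) x y] by (simp add: xil)
  next
    fix s f assume "s \<in> sections M B" "f \<in> Cinf M"
    then show "(\<lambda>p. anchor B p (s p) f) \<in> Cinf M"
      using Lie_Cinf[OF PD(1) xi_sec] by (simp add: Lie_def sapp_def)
  qed
  fix a b p assume a: "a \<in> sections M B" and b: "b \<in> sections M B"
  then have a': "a \<in> sections M Q" and b': "b \<in> sections M Q" by simp_all
  note xa = xi_sec[OF a'] and xb = xi_sec[OF b']
  note f = sec_fib[OF AL(3)[OF xa xb], of p]
  show "brk B a b \<in> sections M B" using B_brk_sec[OF a' b'] by simp
  show "brk B a b p = vscale B p (-1) (brk B b a p)" using B_skew[OF a' b'] by simp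
  {
    fix c assume "c \<in> sections M B"
    then have c': "c \<in> sections M Q" by simp
    have e: "sapp \<xi> (sadd Q b c) = sadd A (sapp \<xi> b) (sapp \<xi> c)"
      by (simp add: fun_eq_iff sapp_def sadd_def xil sec_fib[OF b'] sec_fib[OF c'])
    show "brk B a (sadd B b c) p = vadd B p (brk B a b p) (brk B a c p)"
      unfolding B_brk B_simps e AL(5)[OF xa xb xi_sec[OF c']]
      by (simp add: sadd_def[of A "brk A _ _"] prl f sec_fib[OF AL(3)[OF xa xi_sec[OF c']]])
  }
  fix h assume h: "h \<in> Cinf M"
  have e: "sapp \<xi> (sscale Q h b) = sscale A h (sapp \<xi> b)"
    by (simp add: fun_eq_iff sapp_def sscale_def xil sec_fib[OF b'])
  show "brk B a (sscale B h b) p = vadd B p (vscale B p (h p) (brk B a b p)) (vscale B p (Lie B a h p) (b p))"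
    unfolding B_brk B_simps e AL(7)[OF xa xb h] LB
    unfolding sadd_def sscale_def
    by (simp add: prl f fibs vA sec_fib[OF xb]) (simp add: sapp_def pr_xi sec_fib[OF b'])
  have "Lie B (brk B a b) h p = Lie A (brk A (sapp \<xi> a) (sapp \<xi> b)) h p"
    by (simp add: Lie_def B_brk anchor_om f)
  then show "Lie B (brk B a b) h p = Lie B a (Lie B b h) p - Lie B b (Lie B a h) p"
    unfolding LB AL(8)[OF xa xb h] .
qed

section \<open>The image of \<sigma> among the endomorphisms of the quotient\<close>

lemma io_hom: "u \<in> \<sigma> p \<Longrightarrow> io p u \<in> fib (hom_bundle Q) p"
  by (rule hom_fibI[OF iofacts(2,3)])

lemma io_map: "bundle_map M F (hom_bundle Q) io"
proof (rule bundle_mapI[OF vF hom_vector_bundle[OF vQ]])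
  note vH = hom_vector_bundle[OF vQ]
  show "linear_on F (hom_bundle Q) p (io p)" for p
  proof (rule linear_onI)
    show "io p u \<in> fib (hom_bundle Q) p" if "u \<in> fib F p" for u using io_hom that by (simp del: hom_bundle_simps)
    show "io p (vadd F p u v) = vadd (hom_bundle Q) p (io p u) (io p v)" if "u \<in> fib F p" "v \<in> fib F p" for u v
    proof -
      have uv: "u \<in> \<sigma> p" "v \<in> \<sigma> p" using that by auto
      show ?thesis
        by (rule hom_eqI[of _ Q p])
          (use io_hom[OF uv(1)] io_hom[OF uv(2)] io_hom[OF sub(2)[OF uv]] vector_bundleD(3)[OF vH, of "io p u" p "io p v"] iofacts(4)[OF uv] in \<open>simp_all add: mem_Collect_eq\<close>)
    qed
    show "io p (vscale F p c u) = vscale (hom_bundle Q) p c (io p u)" if "u \<in> fib F p" for u c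
    proof -
      have u: "u \<in> \<sigma> p" using that by auto
      have m: "io p (vscale A p c u) \<in> fib (hom_bundle Q) p" "vscale (hom_bundle Q) p c (io p u) \<in> fib (hom_bundle Q) p"
        using io_hom[OF u] io_hom[OF sub(3)[OF u]] vector_bundleD(4)[OF vH] by blast+
      show ?thesis unfolding sub_bundle_simps
        by (rule hom_eqI[OF m]) (simp add: iofacts(5) u)
    qed
  qed
  fix T assume T: "T \<in> sections M F"
  show "sapp io T \<in> sections M (hom_bundle Q)"
    unfolding hom_sections[OF vQ]
  proof (intro conjI allI ballI)
    show "sapp io T p \<in> fib (hom_bundle Q) p" for p unfolding sapp_def by (rule io_hom[OF F_sec(2)[OF T]])
    fix a assume a: "a \<in> sections M Q"
    \<comment> \<open>Lifting \<open>a\<close> by \<xi> expresses the action of \<iota> on sections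
      as the class of a bracket of sections, which is smooth.\<close>
    have "sapp (sapp io T) a = sapp prj (brk A T (sapp \<xi> a))"
    proof
      fix p show "sapp (sapp io T) a p = sapp prj (brk A T (sapp \<xi> a)) p"
        using io_pr[OF T xi_sec[OF a], of p] by (simp add: sapp_def[of io T] sapp_at[of \<xi> a p] sapp_def[of "\<lambda>p. io p (T p)"] sapp_def[of prj] pr_xi[OF sec_fib[OF a]])
    qed
    then show "sapp (sapp io T) a \<in> sections M Q" using pr_sec[OF AL(3)[OF F_sec(1)[OF T] xi_sec[OF a]]] by simp
  qed
qed

lemma tau_def': "\<tau> = (\<lambda>p. io p ` fib F p)"
  by (simp add: fun_eq_iff algebroid_sub_def)

text \<open>Standardness enters here as fibrewise injectivity of \<iota>.\<close>

lemma tau_subbundle: "subbundle M (hom_bundle Q) \<tau>"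
  unfolding tau_def' by (rule image_subbundle[OF hom_vector_bundle[OF vQ] vF io_map]) (simp add: io_inj)

abbreviation "G \<equiv> sub_bundle M (hom_bundle Q) \<tau>"

lemmas vG = sub_vector_bundle[OF hom_vector_bundle[OF vQ] tau_subbundle]
lemmas G_sections = sub_sections[OF hom_vector_bundle[OF vQ] tau_subbundle]

definition ii :: "'m \<Rightarrow> ('a set \<Rightarrow> 'a set) \<Rightarrow> 'a" where
  "ii p R = inv_into (\<sigma> p) (io p) R"

lemma ii_props: "R \<in> \<tau> p \<Longrightarrow> ii p R \<in> \<sigma> p" "R \<in> \<tau> p \<Longrightarrow> io p (ii p R) = R" "u \<in> \<sigma> p \<Longrightarrow> ii p (io p u) = u"
  unfolding ii_def algebroid_sub_def by (auto simp: inv_into_into f_inv_into_f inv_into_f_f[OF io_inj])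

lemma io_tau: "u \<in> \<sigma> p \<Longrightarrow> io p u \<in> \<tau> p"
  unfolding algebroid_sub_def by blast

lemma io_sec: "T \<in> sections M F \<Longrightarrow> sapp io T \<in> sections M G"
  unfolding G_sections using bundle_map_sec[OF vF hom_vector_bundle[OF vQ] io_map] io_tau[OF F_sec(2)] by (simp add: sapp_def)

lemma ii_sec: "R \<in> sections M G \<Longrightarrow> sapp ii R \<in> sections M F"
proof -
  assume R: "R \<in> sections M G"
  have "(\<lambda>p. inv_into (fib F p) (io p) (R p)) \<in> sections M F"
    by (rule image_inverse_sec[OF hom_vector_bundle[OF vQ] vF io_map])
      (use R[unfolded G_sections] io_inj in \<open>auto simp: tau_def' simp del: hom_bundle_simps\<close>)
  then show ?thesis by (simp add: sapp_def ii_def)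
qed

lemma G_sec: "R \<in> sections M G \<Longrightarrow> R p \<in> \<tau> p"
  using G_sections by blast

lemma io_ii_sec: "R \<in> sections M G \<Longrightarrow> sapp io (sapp ii R) = R"
  by (simp add: fun_eq_iff sapp_def ii_props G_sec)

lemma io_linear:
  "u \<in> \<sigma> p \<Longrightarrow> v \<in> \<sigma> p \<Longrightarrow> io p (vadd A p u v) = vadd (hom_bundle Q) p (io p u) (io p v)"
  "u \<in> \<sigma> p \<Longrightarrow> io p (vscale A p c u) = vscale (hom_bundle Q) p c (io p u)"
  using linear_onD(2,3)[OF bundle_map_linear[OF io_map], of _ p] by (simp_all del: hom_bundle_simps)

lemma ii_linear:
  assumes R: "R \<in> \<tau> p"
  shows "R' \<in> \<tau> p \<Longrightarrow> ii p (vadd (hom_bundle Q) p R R') = vadd A p (ii p R) (ii p R')"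
    "ii p (vscale (hom_bundle Q) p c R) = vscale A p c (ii p R)"
proof -
  note r = ii_props(1,2)[OF R]
  show "ii p (vscale (hom_bundle Q) p c R) = vscale A p c (ii p R)"
    using ii_props(3)[OF sub(3)[OF r(1)], of c] io_linear(2)[OF r(1), of c] r(2) by metis
  assume R': "R' \<in> \<tau> p"
  note r' = ii_props(1,2)[OF R']
  show "ii p (vadd (hom_bundle Q) p R R') = vadd A p (ii p R) (ii p R')"
    using ii_props(3)[OF sub(2)[OF r(1) r'(1)]] io_linear(1)[OF r(1) r'(1)] r(2) r'(2) by metis
qed

lemma B_almost_Cartan: "almost_Cartan_algebroid M B \<tau>"
  unfolding almost_Cartan_algebroid_def
proof (intro conjI allI ballI)
  show "almost_Lie_algebroid M B" by (rule B_almost_Lie)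
  show "subbundle M (hom_bundle B) \<tau>" using tau_subbundle by simp
  show "transitive_algebroid M B"
    unfolding transitive_algebroid_def
  proof
    fix p
    have "anchor B p ` fib B p = anchor A p ` fib A p"
    proof (intro equalityI subsetI)
      fix v assume "v \<in> anchor B p ` fib B p"
      then show "v \<in> anchor A p ` fib A p" using xil(1) by auto
    next
      fix v assume "v \<in> anchor A p ` fib A p"
      then obtain u where u: "u \<in> fib A p" "v = anchor A p u" by blast
      then have "v = anchor B p (prj p u)" "prj p u \<in> fib B p" by (simp_all add: anchor_om prl)
      then show "v \<in> anchor B p ` fib B p" by blast
    qed
    then show "anchor B p ` fib B p = tangent_space M p" using PD(3) unfolding transitive_algebroid_def by simp
  qed
  fix p R a assume R: "R \<in> \<tau> p" and a: "a \<in> fib B p"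
  then have a': "a \<in> fib Q p" by simp
  \<comment> \<open>R(a) is the class of a bracket [s, \<alpha>] with \<open>s\<close> in \<sigma>.
    Its anchor is the commutator of \<rho>(s) = 0 with \<rho>(\<alpha>), hence zero.\<close>
  obtain s where s: "s \<in> sections M F" "s p = ii p R" by (rule section_through[OF vF, of "ii p R" p]) (use ii_props(1)[OF R] in simp)
  obtain \<alpha> where al: "\<alpha> \<in> sections M A" "\<alpha> p = \<xi> p a" by (rule section_through[OF vA xil(1)[OF a']])
  note f = sec_fib[OF AL(3)[OF F_sec(1)[OF s(1)] al(1)], of p]
  have "R a = prj p (brk A s \<alpha> p)" using io_pr[OF s(1) al(1), of p] s(2) al(2) ii_props(2)[OF R] pr_xi[OF a'] by simp
  then have "anchor B p (R a) = anchor A p (brk A s \<alpha> p)" by (simp add: anchor_om f)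
  also have "\<dots> = (\<lambda>_. 0)"
  proof (rule tangent_vector_eq_zero[OF anchor_mapD(1)[OF AL(2) f]])
    fix h assume h: "h \<in> Cinf M"
    have "Lie A s g = (\<lambda>_. 0)" for g by (simp add: fun_eq_iff Lie_def PD(5)[OF F_sec(2)[OF s(1)]])
    moreover have "Lie A \<alpha> (\<lambda>_. 0) p = 0"
      unfolding Lie_def by (rule tangent_vector_const[OF anchor_mapD(1)[OF AL(2) sec_fib[OF al(1)]]])
    ultimately have "Lie A (brk A s \<alpha>) h p = 0" unfolding AL(8)[OF F_sec(1)[OF s(1)] al(1) h] by simp
    then show "anchor A p (brk A s \<alpha> p) h = 0" by (simp add: Lie_def)
  qed
  finally show "anchor B p (R a) = (\<lambda>_. 0)" .
qed

text \<open>\<iota> is a representation, because the Jacobiator of \<open>s\<close>,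
  \<open>r\<close> and a lift \<alpha> vanishes in the quotient. This is what makes \<tau> closed
  under commutators.\<close>

lemma io_brk:
  assumes s: "s \<in> sections M F" and r: "r \<in> sections M F"
  shows "commutator Q p (io p (s p)) (io p (r p)) = io p (brk A s r p)"
proof -
  note s' = F_sec[OF s] and r' = F_sec[OF r]
  have br: "brk A s r p \<in> \<sigma> p" for p by (rule PD(6)[OF s' r'])
  have brs: "brk A s r \<in> sections M F" unfolding F_sections using AL(3)[OF s'(1) r'(1)] br by blast
  show ?thesis
  proof (rule extensionalityI[of _ "fib Q p"])
    show "commutator Q p (io p (s p)) (io p (r p)) \<in> extensional (fib Q p)" by (simp add: commutator_def)
    show "io p (brk A s r p) \<in> extensional (fib Q p)" by (rule iofacts(2))
    fix a assume a: "a \<in> fib Q p"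
    obtain \<alpha> where al: "\<alpha> \<in> sections M A" "\<alpha> p = \<xi> p a" by (rule section_through[OF vA xil(1)[OF a]])
    have pa: "prj p (\<alpha> p) = a" using al(2) pr_xi[OF a] by simp
    have ra: "brk A r \<alpha> \<in> sections M A" "brk A s \<alpha> \<in> sections M A" "brk A \<alpha> s \<in> sections M A"
      using AL(3)[OF r'(1) al(1)] AL(3)[OF s'(1) al(1)] AL(3)[OF al(1) s'(1)] .
    have 1: "io p (s p) (io p (r p) a) = prj p (brk A s (brk A r \<alpha>) p)"
      using io_pr[OF r al(1), of p] io_pr[OF s ra(1), of p] pa by simp
    have 2: "io p (r p) (io p (s p) a) = prj p (brk A r (brk A s \<alpha>) p)"
      using io_pr[OF s al(1), of p] io_pr[OF r ra(2), of p] pa by simp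
    have 3: "io p (brk A s r p) a = prj p (brk A (brk A s r) \<alpha> p)" using io_pr[OF brs al(1), of p] pa by simp
    note f = sec_fib[OF AL(3)[OF s'(1) ra(1)], of p] sec_fib[OF AL(3)[OF r'(1) ra(2)], of p]
      sec_fib[OF AL(3)[OF AL(3)[OF s'(1) r'(1)] al(1)], of p]
    have as: "brk A \<alpha> s = sscale A (\<lambda>_. -1) (brk A s \<alpha>)" by (rule AL(6)[OF al(1) s'(1)])
    \<comment> \<open>Two sign changes bring the third cyclic term of the Jacobiator into the form
      [r, [s, \<alpha>]].\<close>
    have "brk A (brk A \<alpha> s) r p = vscale A p (-1) (brk A r (sscale A (\<lambda>_. -1) (brk A s \<alpha>)) p)"
      unfolding as by (rule brk_skew[OF PD(1)]) (use ra(3)[unfolded as] r'(1) in auto)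
    also have "\<dots> = brk A r (brk A s \<alpha>) p"
      unfolding AL(10)[OF r'(1) ra(2)] unfolding sscale_def
      by (rule fib_eqI[OF vA, where p = p]) (simp_all add: fibs crds vA f)
    finally have sw: "brk A (brk A \<alpha> s) r p = brk A r (brk A s \<alpha>) p" .
    have "jacobiator A s r \<alpha> p \<in> \<sigma> p" by (rule PD(7)[OF s'(1) r'(1) al(1)])
    moreover have "jacobiator A s r \<alpha> p = vadd A p (vadd A p (brk A (brk A s r) \<alpha> p) (vscale A p (-1) (brk A s (brk A r \<alpha>) p))) (brk A r (brk A s \<alpha>) p)"
      unfolding jacobiator_def brk_skew[OF PD(1) ra(1) s'(1), symmetric] sw[symmetric] by (simp add: sadd_def)
    ultimately have "vadd Q p (vadd Q p (prj p (brk A (brk A s r) \<alpha> p)) (vscale Q p (-1) (prj p (brk A s (brk A r \<alpha>) p)))) (prj p (brk A r (brk A s \<alpha>) p)) = vzero Q p"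
      using pr_zero[of "jacobiator A s r \<alpha> p" p] by (simp add: prl fibs vA f)
    from arg_cong[OF this, of "\<lambda>v. crd Q p v _"]
    have "crd Q p (prj p (brk A (brk A s r) \<alpha> p)) i - crd Q p (prj p (brk A s (brk A r \<alpha>) p)) i + crd Q p (prj p (brk A r (brk A s \<alpha>) p)) i = 0" for i
      by (simp add: fibs crds vQ prl f)
    then have "vminus Q p (prj p (brk A s (brk A r \<alpha>) p)) (prj p (brk A r (brk A s \<alpha>) p)) = prj p (brk A (brk A s r) \<alpha> p)"
      by (intro fib_eqI[OF vQ, where p = p]) (simp_all add: fibs crds vQ prl f, smt (verit))
    then show "commutator Q p (io p (s p)) (io p (r p)) a = io p (brk A s r p) a"
      using a by (simp add: commutator_def 1 2 3)
  qed
qed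

lemma B_commutator:
  assumes R: "R \<in> \<tau> p" "R' \<in> \<tau> p" shows "commutator B p R R' \<in> \<tau> p"
proof -
  obtain s where s: "s \<in> sections M F" "s p = ii p R" by (rule section_through[OF vF, of "ii p R" p]) (use ii_props(1)[OF R(1)] in simp)
  obtain r where r: "r \<in> sections M F" "r p = ii p R'" by (rule section_through[OF vF, of "ii p R'" p]) (use ii_props(1)[OF R(2)] in simp)
  have "brk A s r p \<in> \<sigma> p" by (rule PD(6)[OF F_sec[OF s(1)] F_sec[OF r(1)]])
  then show ?thesis using io_brk[OF s(1) r(1), of p] io_tau by (simp add: s(2) r(2) ii_props(2) R)
qed

text \<open>The derivative term of the Leibniz rule is a multiple of \<xi>(b), which
  \<open>om\<close> kills; so the \<sigma>-component of the bracket of two lifts is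
  function-linear.\<close>

lemma om_brk_module:
  assumes a: "a \<in> sections M Q"
  shows "module_map Q F (\<lambda>b. sapp om (brk A (sapp \<xi> a) (sapp \<xi> b)))"
    "module_map Q F (\<lambda>b. sapp om (brk A (sapp \<xi> b) (sapp \<xi> a)))"
proof -
  note xa = xi_sec[OF a]
  have e: "sapp \<xi> (sadd Q b c) = sadd A (sapp \<xi> b) (sapp \<xi> c)" if "b \<in> sections M Q" "c \<in> sections M Q" for b c
    using that by (simp add: fun_eq_iff sapp_def sadd_def xil sec_fib)
  have e2: "sapp \<xi> (sscale Q h b) = sscale A h (sapp \<xi> b)" if "b \<in> sections M Q" for h b
    using that by (simp add: fun_eq_iff sapp_def sscale_def xil sec_fib)
  have z: "om p (sapp \<xi> b p) = vzero A p" if "b \<in> sections M Q" for b p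
    using om_xi[OF sec_fib[OF that]] by (simp add: sapp_def)
  show "module_map Q F (\<lambda>b. sapp om (brk A (sapp \<xi> a) (sapp \<xi> b)))"
  proof (rule module_mapI)
    fix b assume b: "b \<in> sections M Q"
    note xb = xi_sec[OF b]
    note f = sec_fib[OF AL(3)[OF xa xb]] sec_fib[OF xb]
    show "sapp om (brk A (sapp \<xi> a) (sapp \<xi> b)) \<in> sections M F" by (rule om_sec[OF AL(3)[OF xa xb]])
    show "sapp om (brk A (sapp \<xi> a) (sapp \<xi> (sscale Q h b))) = sscale F h (sapp om (brk A (sapp \<xi> a) (sapp \<xi> b)))"
      if h: "h \<in> Cinf M" for h
    proof
      fix p
      have "om p (brk A (sapp \<xi> a) (sapp \<xi> (sscale Q h b)) p) = vadd A p (vscale A p (h p) (om p (brk A (sapp \<xi> a) (sapp \<xi> b) p))) (vscale A p (Lie A (sapp \<xi> a) h p) (om p (sapp \<xi> b p)))"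
        unfolding e2[OF b] AL(7)[OF xa xb h] unfolding sadd_def sscale_def by (simp add: om_linear fibs vA f)
      also have "\<dots> = vscale A p (h p) (om p (brk A (sapp \<xi> a) (sapp \<xi> b) p))"
        unfolding z[OF b] by (rule fib_eqI[OF vA, where p = p]) (simp_all add: fibs crds vA om_in[OF f(1)])
      finally show "sapp om (brk A (sapp \<xi> a) (sapp \<xi> (sscale Q h b))) p = sscale F h (sapp om (brk A (sapp \<xi> a) (sapp \<xi> b))) p"
        unfolding sub_bundle_simps by (simp add: sapp_def[of om] sscale_def[of A])
    qed
    fix c assume c: "c \<in> sections M Q"
    note xc = xi_sec[OF c]
    show "sapp om (brk A (sapp \<xi> a) (sapp \<xi> (sadd Q b c))) = sadd F (sapp om (brk A (sapp \<xi> a) (sapp \<xi> b))) (sapp om (brk A (sapp \<xi> a) (sapp \<xi> c)))"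
      unfolding e[OF b c] AL(5)[OF xa xb xc] sub_bundle_simps
      by (simp add: fun_eq_iff sapp_at[of om] sadd_at om_linear f sec_fib[OF AL(3)[OF xa xc]])
  qed
  show "module_map Q F (\<lambda>b. sapp om (brk A (sapp \<xi> b) (sapp \<xi> a)))"
  proof (rule module_mapI)
    fix b assume b: "b \<in> sections M Q"
    note xb = xi_sec[OF b]
    note f = sec_fib[OF AL(3)[OF xb xa]] sec_fib[OF xb]
    show "sapp om (brk A (sapp \<xi> b) (sapp \<xi> a)) \<in> sections M F" by (rule om_sec[OF AL(3)[OF xb xa]])
    show "sapp om (brk A (sapp \<xi> (sscale Q h b)) (sapp \<xi> a)) = sscale F h (sapp om (brk A (sapp \<xi> b) (sapp \<xi> a)))"
      if h: "h \<in> Cinf M" for h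
    proof
      fix p
      have "om p (brk A (sapp \<xi> (sscale Q h b)) (sapp \<xi> a) p) = vminus A p (vscale A p (h p) (om p (brk A (sapp \<xi> b) (sapp \<xi> a) p))) (vscale A p (Lie A (sapp \<xi> a) h p) (om p (sapp \<xi> b p)))"
        unfolding e2[OF b] brk_scale_left[OF PD(1) xb xa h] vminus_def by (simp add: om_linear fibs vA f)
      also have "\<dots> = vscale A p (h p) (om p (brk A (sapp \<xi> b) (sapp \<xi> a) p))"
        unfolding z[OF b] by (rule fib_eqI[OF vA, where p = p]) (simp_all add: fibs crds vA om_in[OF f(1)])
      finally show "sapp om (brk A (sapp \<xi> (sscale Q h b)) (sapp \<xi> a)) p = sscale F h (sapp om (brk A (sapp \<xi> b) (sapp \<xi> a))) p"
        unfolding sub_bundle_simps by (simp add: sapp_def[of om] sscale_def[of A])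
    qed
    fix c assume c: "c \<in> sections M Q"
    note xc = xi_sec[OF c]
    show "sapp om (brk A (sapp \<xi> (sadd Q b c)) (sapp \<xi> a)) = sadd F (sapp om (brk A (sapp \<xi> b) (sapp \<xi> a))) (sapp om (brk A (sapp \<xi> c) (sapp \<xi> a)))"
      unfolding e[OF b c] AL(4)[OF xb xc xa] sub_bundle_simps
      by (simp add: fun_eq_iff sapp_at[of om] sadd_at om_linear f sec_fib[OF AL(3)[OF xc xa]])
  qed
qed

end


section \<open>Torsion and connection on the quotient\<close>

context pair_data
begin

text \<open>The curvature of the splitting, that is the \<sigma>-component of [\<xi>(a), \<xi>(b)].
  By \<open>cur_sec\<close> the value does not depend on the sections chosen through
  \<open>u\<close> and \<open>v\<close>.\<close>

definition cur :: "'m \<Rightarrow> 'a set \<Rightarrow> 'a set \<Rightarrow> 'a" where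
  "cur p u v = sapp om (brk A (sapp \<xi> (sec_thr Q p u)) (sapp \<xi> (sec_thr Q p v))) p"

text \<open>The sign is that of the term -t in the bracket on C \<oplus> \<sigma>.\<close>

definition tor :: "'m \<Rightarrow> 'a set \<Rightarrow> 'a set \<Rightarrow> 'a set \<Rightarrow> 'a set" where
  "tor p u v = io p (vscale A p (-1) (cur p u v))"

lemma cur_sec: "a \<in> sections M Q \<Longrightarrow> b \<in> sections M Q \<Longrightarrow> cur p (a p) (b p) = om p (brk A (sapp \<xi> a) (sapp \<xi> b) p)"
  unfolding cur_def
  by (subst bilinear_tensor(1)[OF vQ vQ vF, where B = "\<lambda>a b. sapp om (brk A (sapp \<xi> a) (sapp \<xi> b))"])
    (simp_all add: om_brk_module sapp_at)

lemma cur_linear: "u \<in> fib Q p \<Longrightarrow> linear_on Q F p (cur p u)"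
  unfolding cur_def
  by (rule bilinear_tensor(2)[OF vQ vQ vF, where B = "\<lambda>a b. sapp om (brk A (sapp \<xi> a) (sapp \<xi> b))"])
    (simp_all add: om_brk_module)

lemma cur_skew:
  assumes u: "u \<in> fib Q p" and v: "v \<in> fib Q p" shows "cur p v u = vscale A p (-1) (cur p u v)"
proof -
  obtain a where a: "a \<in> sections M Q" "a p = u" by (rule section_through[OF vQ u])
  obtain b where b: "b \<in> sections M Q" "b p = v" by (rule section_through[OF vQ v])
  show ?thesis
    using cur_sec[OF a(1) b(1), of p] cur_sec[OF b(1) a(1), of p] brk_skew[OF PD(1) xi_sec[OF b(1)] xi_sec[OF a(1)], of p]
      om_linear(2)[OF sec_fib[OF AL(3)[OF xi_sec[OF a(1)] xi_sec[OF b(1)]]], of p "-1"] a(2) b(2) by simp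
qed

lemma cur_mem: "u \<in> fib Q p \<Longrightarrow> v \<in> fib Q p \<Longrightarrow> cur p u v \<in> \<sigma> p"
  using linear_onD(1)[OF cur_linear] by auto

lemma jac_pr:
  assumes "a \<in> sections M A" "b \<in> sections M A" "c \<in> sections M A"
  shows "crd Q p (prj p (brk A (brk A a b) c p)) i + crd Q p (prj p (brk A (brk A b c) a p)) i
    + crd Q p (prj p (brk A (brk A c a) b p)) i = 0"
proof -
  note f = sec_fib[OF AL(3)[OF AL(3)[OF assms(1,2)] assms(3)], of p] sec_fib[OF AL(3)[OF AL(3)[OF assms(2,3)] assms(1)], of p]
    sec_fib[OF AL(3)[OF AL(3)[OF assms(3,1)] assms(2)], of p]
  have "prj p (jacobiator A a b c p) = vzero Q p" by (rule pr_zero[OF PD(7)[OF assms]])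
  then have "crd Q p (prj p (jacobiator A a b c p)) i = 0" by (simp add: crds vQ)
  then show ?thesis unfolding jacobiator_def sadd_at by (simp add: prl fibs vA f crds vQ)
qed

text \<open>By \<open>brk_B_pr\<close> each double bracket of \<open>B\<close> is the class of a
  double bracket of \<open>A\<close> minus the curvature acting through \<iota>. The three classes
  add up to zero by \<open>jac_pr\<close>, and the three curvature terms that remain are the
  torsion.\<close>

lemma B_torsion: "Cartan_torsion M B \<tau> tor"
proof -
  have lin: "linear_on Q G p (tor p u)" if u: "u \<in> fib Q p" for p u
  proof (rule linear_onI)
    note l = linear_onD[OF cur_linear[OF u]]
    fix v assume v: "v \<in> fib Q p"
    show "tor p u v \<in> fib G p" unfolding tor_def using io_tau[OF sub(3)[OF cur_mem[OF u v]]] by simp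
    show "tor p u (vscale Q p c v) = vscale G p c (tor p u v)" for c
    proof -
      have "vscale A p (-1) (vscale A p c (cur p u v)) = vscale A p c (vscale A p (-1) (cur p u v))"
        by (rule fib_eqI[OF vA, where p = p]) (simp_all add: fibs crds vA sfib[OF cur_mem[OF u v]])
      then show ?thesis
        unfolding tor_def using l(3)[OF v, of c] io_linear(2)[OF sub(3)[OF cur_mem[OF u v]], of c "-1"] by (simp del: hom_bundle_simps)
    qed
    fix w assume w: "w \<in> fib Q p"
    note m = cur_mem[OF u v] cur_mem[OF u w]
    have "vscale A p (-1) (vadd A p (cur p u v) (cur p u w)) = vadd A p (vscale A p (-1) (cur p u v)) (vscale A p (-1) (cur p u w))"
      by (rule fib_eqI[OF vA, where p = p]) (simp_all add: fibs crds vA sfib[OF m(1)] sfib[OF m(2)])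
    then show "tor p u (vadd Q p v w) = vadd G p (tor p u v) (tor p u w)"
      unfolding tor_def using l(2)[OF v w] io_linear(1)[OF sub(3)[OF m(1)] sub(3)[OF m(2)], of "-1" "-1"] by (simp del: hom_bundle_simps)
  qed
  have alt: "tor p v u = vscale G p (-1) (tor p u v)" if "u \<in> fib Q p" "v \<in> fib Q p" for p u v
    unfolding tor_def cur_skew[OF that] using io_linear(2)[OF sub(3)[OF cur_mem[OF that]], of "-1" "-1"] by (simp del: hom_bundle_simps)
  have tsec: "(\<lambda>p. tor p (a p) (b p)) = sapp io (sscale F (\<lambda>_. -1) (sapp om (brk A (sapp \<xi> a) (sapp \<xi> b))))"
    if "a \<in> sections M Q" "b \<in> sections M Q" for a b
    by (simp add: fun_eq_iff tor_def cur_sec[OF that] sscale_def sapp_at)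
  have "alternating_bundle_map M B G tor"
  proof (rule alternating_bundle_mapI[OF vB vG])
    show "linear_on B G p (tor p u)" if "u \<in> fib B p" for p u using lin[of u p] that by (simp add: linear_on_def)
    show "tor p v u = vscale G p (-1) (tor p u v)" if "u \<in> fib B p" "v \<in> fib B p" for p u v using alt[of u p v] that by simp
    fix a b assume "a \<in> sections M B" "b \<in> sections M B"
    then have ab: "a \<in> sections M Q" "b \<in> sections M Q" by simp_all
    show "(\<lambda>p. tor p (a p) (b p)) \<in> sections M G" unfolding tsec[OF ab]
      by (rule io_sec[OF sscale_sec[OF vF om_sec[OF AL(3)[OF xi_sec[OF ab(1)] xi_sec[OF ab(2)]]] Cinf_const]])
  qed
  moreover have "jacobiator B a b c = (\<lambda>p. vadd B p (vadd B p (tor p (a p) (b p) (c p)) (tor p (b p) (c p) (a p))) (tor p (c p) (a p) (b p)))"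
    if abc: "a \<in> sections M Q" "b \<in> sections M Q" "c \<in> sections M Q" for a b c
  proof
    fix p
    note x = xi_sec[OF abc(1)] xi_sec[OF abc(2)] xi_sec[OF abc(3)]
    note f = sec_fib[OF abc(1), of p] sec_fib[OF abc(2), of p] sec_fib[OF abc(3), of p]
    have 1: "brk B (brk B u v) w p = vminus Q p (prj p (brk A (brk A (sapp \<xi> u) (sapp \<xi> v)) (sapp \<xi> w) p)) (io p (cur p (u p) (v p)) (w p))"
      if "u \<in> sections M Q" "v \<in> sections M Q" "w \<in> sections M Q" for u v w
      unfolding brk_B_eq[of u v] cur_sec[OF that(1,2)] by (rule brk_B_pr[OF AL(3)[OF xi_sec[OF that(1)] xi_sec[OF that(2)]] that(3)])
    have 2: "tor p u v w = vscale Q p (-1) (io p (cur p u v) w)" if "u \<in> fib Q p" "v \<in> fib Q p" "w \<in> fib Q p" for u v w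
      unfolding tor_def by (rule iofacts(5)[OF cur_mem[OF that(1,2)] that(3)])
    have 3: "io p (cur p u v) w \<in> fib Q p" if "u \<in> fib Q p" "v \<in> fib Q p" "w \<in> fib Q p" for u v w
      by (rule iol(1)[OF cur_mem[OF that(1,2)] that(3)])
    have 4: "prj p (brk A (brk A u v) w p) \<in> fib Q p" if "u \<in> sections M A" "v \<in> sections M A" "w \<in> sections M A" for u v w
      by (rule prl(1)[OF sec_fib[OF AL(3)[OF AL(3)[OF that(1,2)] that(3)]]])
    show "jacobiator B a b c p = vadd B p (vadd B p (tor p (a p) (b p) (c p)) (tor p (b p) (c p) (a p))) (tor p (c p) (a p) (b p))"
      unfolding jacobiator_def sadd_at B_simps 1[OF abc] 1[OF abc(2,3,1)] 1[OF abc(3,1,2)] 2[OF f] 2[OF f(2,3,1)] 2[OF f(3,1,2)]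
    proof (rule fib_eqI[OF vQ, where p = p])
      fix i
      show "crd Q p (vadd Q p (vadd Q p
          (vminus Q p (prj p (brk A (brk A (sapp \<xi> a) (sapp \<xi> b)) (sapp \<xi> c) p)) (io p (cur p (a p) (b p)) (c p)))
          (vminus Q p (prj p (brk A (brk A (sapp \<xi> b) (sapp \<xi> c)) (sapp \<xi> a) p)) (io p (cur p (b p) (c p)) (a p))))
          (vminus Q p (prj p (brk A (brk A (sapp \<xi> c) (sapp \<xi> a)) (sapp \<xi> b) p)) (io p (cur p (c p) (a p)) (b p)))) i =
        crd Q p (vadd Q p (vadd Q p (vscale Q p (-1) (io p (cur p (a p) (b p)) (c p))) (vscale Q p (-1) (io p (cur p (b p) (c p)) (a p))))
          (vscale Q p (-1) (io p (cur p (c p) (a p)) (b p)))) i"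
        using jac_pr[OF x, of p i] by (simp add: crds fibs vQ 3[OF f] 3[OF f(2,3,1)] 3[OF f(3,1,2)] 4[OF x] 4[OF x(2,3,1)] 4[OF x(3,1,2)])
    qed (simp_all add: fibs vQ 3[OF f] 3[OF f(2,3,1)] 3[OF f(3,1,2)] 4[OF x] 4[OF x(2,3,1)] 4[OF x(3,1,2)])
  qed
  ultimately show ?thesis unfolding Cartan_torsion_def by simp
qed

text \<open>The \<sigma>-component of [\<xi>(a), T], where \<iota>(T) = R: the value that the
  bracket on C \<oplus> \<sigma> prescribes for (a, 0) and (0, R).\<close>

definition conn :: "('m \<Rightarrow> 'a set) \<Rightarrow> ('m \<Rightarrow> 'a set \<Rightarrow> 'a set) \<Rightarrow> 'm \<Rightarrow> 'a set \<Rightarrow> 'a set" where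
  "conn a R = sapp io (sapp om (brk A (sapp \<xi> a) (sapp ii R)))"

lemma xi_op:
  "a \<in> sections M Q \<Longrightarrow> b \<in> sections M Q \<Longrightarrow> sapp \<xi> (sadd Q a b) = sadd A (sapp \<xi> a) (sapp \<xi> b)"
  "a \<in> sections M Q \<Longrightarrow> sapp \<xi> (sscale Q f a) = sscale A f (sapp \<xi> a)"
  by (simp_all add: fun_eq_iff sapp_def sadd_def sscale_def xil sec_fib)

lemma om_op:
  "a \<in> sections M A \<Longrightarrow> b \<in> sections M A \<Longrightarrow> sapp om (sadd A a b) = sadd A (sapp om a) (sapp om b)"
  "a \<in> sections M A \<Longrightarrow> sapp om (sscale A f a) = sscale A f (sapp om a)"
  by (simp_all add: fun_eq_iff sapp_def sadd_def sscale_def om_linear sec_fib)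

lemma io_op:
  "T \<in> sections M F \<Longrightarrow> S \<in> sections M F \<Longrightarrow> sapp io (sadd A T S) = sadd (hom_bundle Q) (sapp io T) (sapp io S)"
  "T \<in> sections M F \<Longrightarrow> sapp io (sscale A f T) = sscale (hom_bundle Q) f (sapp io T)"
  by (simp_all add: fun_eq_iff sapp_def[of io] sadd_def sscale_def io_linear F_sec del: hom_bundle_simps)

lemma ii_op:
  "R \<in> sections M G \<Longrightarrow> R' \<in> sections M G \<Longrightarrow> sapp ii (sadd (hom_bundle Q) R R') = sadd A (sapp ii R) (sapp ii R')"
  "R \<in> sections M G \<Longrightarrow> sapp ii (sscale (hom_bundle Q) f R) = sscale A f (sapp ii R)"
  by (simp_all add: fun_eq_iff sapp_def[of ii] sadd_def sscale_def ii_linear G_sec del: hom_bundle_simps)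

lemma conn_base:
  assumes "a \<in> sections M Q" "R \<in> sections M G"
  shows "sapp \<xi> a \<in> sections M A" "sapp ii R \<in> sections M A" "brk A (sapp \<xi> a) (sapp ii R) \<in> sections M A"
    "sapp om (brk A (sapp \<xi> a) (sapp ii R)) \<in> sections M F" "conn a R \<in> sections M G"
proof -
  show 1: "sapp \<xi> a \<in> sections M A" "sapp ii R \<in> sections M A" using xi_sec F_sec(1) ii_sec assms by blast+
  show 2: "brk A (sapp \<xi> a) (sapp ii R) \<in> sections M A" by (rule AL(3)[OF 1])
  show 3: "sapp om (brk A (sapp \<xi> a) (sapp ii R)) \<in> sections M F" by (rule om_sec[OF 2])
  show "conn a R \<in> sections M G" unfolding conn_def by (rule io_sec[OF 3])
qed

lemma om_ii: "R \<in> sections M G \<Longrightarrow> sapp om (sapp ii R) = sapp ii R"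
  by (simp add: fun_eq_iff sapp_def om_id ii_props G_sec)

lemma ii_Lie: "R \<in> sections M G \<Longrightarrow> Lie A (sapp ii R) f = (\<lambda>_. 0)"
  by (simp add: fun_eq_iff Lie_def sapp_def PD(5) ii_props G_sec)

text \<open>In the first argument the derivative term contains the anchor of an element of \<sigma>,
  which is zero. In the second it is a multiple of an element of \<sigma>, on which
  \<open>om\<close> is the identity.\<close>

lemma conn_scale:
  assumes a: "a \<in> sections M Q" and R: "R \<in> sections M G" and f: "f \<in> Cinf M"
  shows "conn (sscale Q f a) R = sscale (hom_bundle Q) f (conn a R)"
    "conn a (sscale (hom_bundle Q) f R) =
      sadd (hom_bundle Q) (sscale (hom_bundle Q) f (conn a R)) (sscale (hom_bundle Q) (Lie B a f) R)"
proof -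
  note c = conn_base[OF a R]
  have L: "Lie B a f = Lie A (sapp \<xi> a) f" by (simp add: Lie_def sapp_def)
  have Lf: "Lie A (sapp \<xi> a) f \<in> Cinf M" by (rule Lie_Cinf[OF PD(1) c(1) f])
  have "brk A (sscale A f (sapp \<xi> a)) (sapp ii R) = sscale A f (brk A (sapp \<xi> a) (sapp ii R))"
  proof
    fix p
    show "brk A (sscale A f (sapp \<xi> a)) (sapp ii R) p = sscale A f (brk A (sapp \<xi> a) (sapp ii R)) p"
      unfolding brk_scale_left[OF PD(1) c(1,2) f] ii_Lie[OF R] unfolding sscale_def
      by (rule fib_eqI[OF vA, where p = p]) (simp_all add: fibs crds vA sec_fib[OF c(1)] sec_fib[OF c(3)])
  qed
  then show "conn (sscale Q f a) R = sscale (hom_bundle Q) f (conn a R)"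
    unfolding conn_def xi_op(2)[OF a] by (simp add: om_op(2) c io_op(2) del: hom_bundle_simps)
  have m: "sscale A f (brk A (sapp \<xi> a) (sapp ii R)) \<in> sections M A" "sscale A (Lie A (sapp \<xi> a) f) (sapp ii R) \<in> sections M A"
    by (intro sscale_sec vA f c Lf)+
  have m': "sscale A f (sapp om (brk A (sapp \<xi> a) (sapp ii R))) \<in> sections M F" "sscale A (Lie A (sapp \<xi> a) f) (sapp ii R) \<in> sections M F"
    using sscale_sec[OF vF c(4) f] sscale_sec[OF vF ii_sec[OF R] Lf] by simp_all
  show "conn a (sscale (hom_bundle Q) f R) =
      sadd (hom_bundle Q) (sscale (hom_bundle Q) f (conn a R)) (sscale (hom_bundle Q) (Lie B a f) R)"
    unfolding conn_def ii_op(2)[OF R] AL(7)[OF c(1,2) f] om_op(1)[OF m] om_op(2)[OF c(3)] om_op(2)[OF c(2)] om_ii[OF R]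
      io_op(1)[OF m'] io_op(2)[OF c(4)] io_op(2)[OF ii_sec[OF R]] io_ii_sec[OF R] L ..
qed

lemma conn_add:
  assumes a: "a \<in> sections M Q" and R: "R \<in> sections M G"
  shows "b \<in> sections M Q \<Longrightarrow> conn (sadd Q a b) R = sadd (hom_bundle Q) (conn a R) (conn b R)"
    "R' \<in> sections M G \<Longrightarrow> conn a (sadd (hom_bundle Q) R R') = sadd (hom_bundle Q) (conn a R) (conn a R')"
proof -
  note c = conn_base[OF a R]
  show "conn (sadd Q a b) R = sadd (hom_bundle Q) (conn a R) (conn b R)" if b: "b \<in> sections M Q"
  proof -
    note d = conn_base[OF b R]
    show ?thesis unfolding conn_def xi_op(1)[OF a b] AL(4)[OF c(1) d(1) c(2)] om_op(1)[OF c(3) d(3)] io_op(1)[OF c(4) d(4)] ..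
  qed
  show "conn a (sadd (hom_bundle Q) R R') = sadd (hom_bundle Q) (conn a R) (conn a R')" if R': "R' \<in> sections M G"
  proof -
    note d = conn_base[OF a R']
    show ?thesis unfolding conn_def ii_op(1)[OF R R'] AL(5)[OF c(1,2) d(2)] om_op(1)[OF c(3) d(3)] io_op(1)[OF c(4) d(4)] ..
  qed
qed

text \<open>Each bracket of \<open>B\<close> on the left is expressed by brackets of
  \<open>A\<close>. The double brackets form the Jacobiator of \<xi>(a), \<xi>(b) and
  \<open>T\<close>, which vanishes in the quotient; the two corrections by \<open>om\<close> from
  \<open>brk_B_pr\<close> are the connection terms on the right.\<close>

lemma conn_identity:
  assumes a: "a \<in> sections M Q" and b: "b \<in> sections M Q" and R: "R \<in> sections M G"
  shows "sminus Q (sminus Q (sapp R (brk B a b)) (brk B (sapp R a) b)) (brk B a (sapp R b)) =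
    sminus Q (sapp (conn b R) a) (sapp (conn a R) b)"
proof
  fix p
  define T where "T = sapp ii R"
  note xa = xi_sec[OF a] and xb = xi_sec[OF b]
  have TF: "T \<in> sections M F" unfolding T_def by (rule ii_sec[OF R])
  note T = F_sec(1)[OF TF]
  define X Y Z where "X = brk A (sapp \<xi> a) (sapp \<xi> b)" and "Y = brk A T (sapp \<xi> a)" and "Z = brk A T (sapp \<xi> b)"
  have XYZ: "X \<in> sections M A" "Y \<in> sections M A" "Z \<in> sections M A" unfolding X_def Y_def Z_def by (intro AL(3) T xa xb)+
  have RT: "R q = io q (T q)" for q unfolding T_def sapp_def using ii_props(2)[OF G_sec[OF R]] by simp
  have Rs: "sapp R c = sapp prj (brk A T (sapp \<xi> c))" if "c \<in> sections M Q" for c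
    using io_pr[OF TF xi_sec[OF that]] by (simp add: fun_eq_iff sapp_at RT pr_xi[OF sec_fib[OF that]])
  have R1: "sapp R (brk B a b) p = prj p (brk A T X p)"
    using io_pr[OF TF XYZ(1), of p] by (simp add: sapp_at RT B_brk X_def)
  \<comment> \<open>\<open>conn\<close> brackets with \<xi>(c) on the left, whereas \<open>Y\<close>
    and \<open>Z\<close> have \<open>T\<close> there; hence the factor -1.\<close>
  have cn: "conn c R p d = vscale Q p (-1) (io p (om p (brk A T (sapp \<xi> c) p)) d)" if c: "c \<in> sections M Q" and d: "d \<in> fib Q p" for c d
  proof -
    note f = sec_fib[OF AL(3)[OF T xi_sec[OF c]], of p]
    have "om p (brk A (sapp \<xi> c) T p) = vscale A p (-1) (om p (brk A T (sapp \<xi> c) p))"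
      unfolding brk_skew[OF PD(1) xi_sec[OF c] T] by (rule om_linear(2)[OF f])
    then show ?thesis unfolding conn_def sapp_at[of io] sapp_at[of om] T_def[symmetric] using iofacts(5)[OF om_mem[OF f] d, of "-1"] by simp
  qed
  have Rsec: "sapp R b \<in> sections M Q" unfolding Rs[OF b] by (rule pr_sec[OF AL(3)[OF T xb]])
  have R2: "brk B (sapp R a) b p = vminus Q p (prj p (brk A Y (sapp \<xi> b) p)) (io p (om p (Y p)) (b p))"
    unfolding Rs[OF a] Y_def[symmetric] by (rule brk_B_pr[OF XYZ(2) b])
  \<comment> \<open>\<open>brk_B_pr\<close> expects the projected section in the first argument, so
    the bracket is reversed before it is applied.\<close>
  have R3: "brk B a (sapp R b) p = vscale Q p (-1) (vminus Q p (prj p (brk A Z (sapp \<xi> a) p)) (io p (om p (Z p)) (a p)))"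
    unfolding B_skew[OF a Rsec] unfolding Rs[OF b] Z_def[symmetric] brk_B_pr[OF XYZ(3) a] ..
  note f = sec_fib[OF a, of p] sec_fib[OF b, of p]
  note g = prl(1)[OF sec_fib[OF AL(3)[OF T XYZ(1)]], of p] prl(1)[OF sec_fib[OF AL(3)[OF XYZ(2) xb]], of p]
    prl(1)[OF sec_fib[OF AL(3)[OF XYZ(3) xa]], of p]
    iol(1)[OF om_mem[OF sec_fib[OF XYZ(2)]] f(2)] iol(1)[OF om_mem[OF sec_fib[OF XYZ(3)]] f(1)]
  have s1: "prj p (brk A X T p) = vscale Q p (-1) (prj p (brk A T X p))"
    unfolding brk_skew[OF PD(1) XYZ(1) T] by (rule prl(3)[OF sec_fib[OF AL(3)[OF T XYZ(1)]]])
  have z: "brk A (sapp \<xi> b) T = sscale A (\<lambda>_. -1) Z" unfolding Z_def by (rule AL(6)[OF xb T])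
  have s2: "prj p (brk A (brk A (sapp \<xi> b) T) (sapp \<xi> a) p) = vscale Q p (-1) (prj p (brk A Z (sapp \<xi> a) p))"
    unfolding z AL(9)[OF XYZ(3) xa] unfolding sscale_def by (rule prl(3)[OF sec_fib[OF AL(3)[OF XYZ(3) xa]]])
  have J: "- crd Q p (prj p (brk A T X p)) i - crd Q p (prj p (brk A Z (sapp \<xi> a) p)) i + crd Q p (prj p (brk A Y (sapp \<xi> b) p)) i = 0" for i
    using jac_pr[OF xa xb T, of p i] unfolding X_def[symmetric] Y_def[symmetric] s1 s2 by (simp add: crds vQ g)
  show "sminus Q (sminus Q (sapp R (brk B a b)) (brk B (sapp R a) b)) (brk B a (sapp R b)) p =
    sminus Q (sapp (conn b R) a) (sapp (conn a R) b) p"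
    unfolding sminus_def R1 R2 R3 sapp_at[of "conn _ _"] cn[OF a f(2)] cn[OF b f(1)] Y_def[symmetric] Z_def[symmetric]
  proof (rule fib_eqI[OF vQ, where p = p])
    fix i
    show "crd Q p (vminus Q p (vminus Q p (prj p (brk A T X p)) (vminus Q p (prj p (brk A Y (sapp \<xi> b) p)) (io p (om p (Y p)) (b p))))
        (vscale Q p (-1) (vminus Q p (prj p (brk A Z (sapp \<xi> a) p)) (io p (om p (Z p)) (a p))))) i =
      crd Q p (vminus Q p (vscale Q p (-1) (io p (om p (Z p)) (a p))) (vscale Q p (-1) (io p (om p (Y p)) (b p)))) i"
      using J[of i] by (simp add: crds fibs vQ g)
  qed (simp_all add: fibs vQ g)
qed

lemma B_connection: "Cartan_connection M B \<tau> conn"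
proof -
  have k: "sscale (hom_bundle Q) (\<lambda>_. c) (conn a R) = conn a (sscale (hom_bundle Q) (\<lambda>_. c) R)"
    if a: "a \<in> sections M Q" and R: "R \<in> sections M G" for a R c
  proof -
    note b = conn_base[OF a R]
    show ?thesis unfolding conn_def ii_op(2)[OF R] AL(10)[OF b(1,2)] om_op(2)[OF b(3)] io_op(2)[OF b(4)] ..
  qed
  have "bilinear_sections M B G G conn"
    unfolding bilinear_sections_def B_simps sub_bundle_simps
    by (intro conjI ballI allI conn_base(5) conn_add conn_scale(1) Cinf_const k[symmetric])
  moreover have "conn (sscale B f a) R = sscale G f (conn a R) \<and>
      conn a (sscale G f R) = sadd G (sscale G f (conn a R)) (sscale G (Lie B a f) R)"
    if "a \<in> sections M B" "R \<in> sections M G" "f \<in> Cinf M" for a R f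
    using conn_scale[of a R f] that unfolding B_simps sub_bundle_simps by blast
  ultimately show ?thesis
    unfolding Cartan_connection_def B_simps using conn_identity by (intro conjI ballI) simp_all
qed

lemma B_Cartan: "Cartan_algebroid M B \<tau>"
  unfolding Cartan_algebroid_def using B_almost_Cartan B_commutator B_torsion B_connection by blast

text \<open>The right-hand side is the first component of the bracket on A/\<sigma> \<oplus>
  \<sigma>, evaluated on the components of \<alpha> and \<beta>. \<open>brk_B_pr\<close> treats the
  first argument; the \<sigma>-component of the second is moved to the front by skew
  symmetry.\<close>

lemma pr_brk:
  assumes a: "\<alpha> \<in> sections M A" and b: "\<beta> \<in> sections M A"
  shows "prj p (brk A \<alpha> \<beta> p) = vminus Q p (vadd Q p (brk B (sapp prj \<alpha>) (sapp prj \<beta>) p) (io p (om p (\<alpha> p)) (prj p (\<beta> p))))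
    (io p (om p (\<beta> p)) (prj p (\<alpha> p)))"
proof -
  note ob = om_sec[OF b]
  note ob' = F_sec(1)[OF ob]
  note f = sec_fib[OF AL(3)[OF a b], of p] sec_fib[OF AL(3)[OF a ob'], of p] sec_fib[OF AL(3)[OF ob' a], of p]
  have 1: "prj p (brk A \<alpha> (sapp om \<beta>) p) = vscale Q p (-1) (io p (om p (\<beta> p)) (prj p (\<alpha> p)))"
    unfolding brk_skew[OF PD(1) a ob'] using prl(3)[OF f(3), of "-1"] io_pr[OF ob a, of p] by (simp add: sapp_at[of om])
  note g = prl(1)[OF f(1)] iol(1)[OF om_mem[OF sec_fib[OF a]] prl(1)[OF sec_fib[OF b]], of p]
    iol(1)[OF om_mem[OF sec_fib[OF b]] prl(1)[OF sec_fib[OF a]], of p]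
  show ?thesis
    unfolding brk_B_pr[OF a pr_sec[OF b]] xi_pr_sec[OF b] brk_minus(2)[OF PD(1) b ob' a] sapp_at[of prj \<beta>]
    unfolding sminus_def prmin[OF f(1,2)] 1
    by (rule fib_eqI[OF vQ, where p = p]) (simp_all add: fibs crds vQ g)
qed

text \<open>The isomorphism has the components \<open>prj\<close> and \<iota> after
  \<open>om\<close>. It works for every \<open>t\<close> and \<open>D\<close>, since only first
  components of brackets are compared and these agree by \<open>pr_brk\<close>.\<close>

lemma pair_of_algebroid_iso:
  assumes "Cartan_torsion M B \<tau> t" "Cartan_connection M B \<tau> D"
  shows "Cartan_pair_iso M A \<sigma> (pair_of M B \<tau> t D) (pair_sub B \<tau>)"
proof -
  interpret X: cartan_data M B \<tau> t D by unfold_locales (fact B_Cartan assms)+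
  have XH: "X.H = hom_bundle Q" by simp
  define \<Psi> where "\<Psi> p v = (prj p v, io p (om p v))" for p v
  define g where "g p x = vadd A p (\<xi> p (fst x)) (ii p (snd x))" for p x
  have ii_f: "ii p R \<in> fib A p" if "R \<in> \<tau> p" for p R by (rule sfib[OF ii_props(1)[OF that]])
  have Psec: "x \<in> sections M X.P \<longleftrightarrow> fst \<circ> x \<in> sections M Q \<and> snd \<circ> x \<in> sections M G" for x
    using X.pair_sections[of x] unfolding B_simps .
  have \<Psi>s: "sapp \<Psi> s \<in> sections M X.P" "fst \<circ> sapp \<Psi> s = sapp prj s" "snd \<circ> sapp \<Psi> s = sapp io (sapp om s)" if s: "s \<in> sections M A" for s
  proof -
    show e: "fst \<circ> sapp \<Psi> s = sapp prj s" "snd \<circ> sapp \<Psi> s = sapp io (sapp om s)" by (simp_all add: fun_eq_iff \<Psi>_def sapp_def)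
    show "sapp \<Psi> s \<in> sections M X.P" unfolding Psec e by (intro conjI pr_sec io_sec om_sec s)
  qed
  show ?thesis
  proof (rule Cartan_pair_isoI[OF vA X.vP, where \<psi> = \<Psi> and g = g])
    show "bundle_map M A X.P \<Psi>"
    proof (rule bundle_mapI[OF vA X.vP])
      show "linear_on A X.P p (\<Psi> p)" for p
        by (rule linear_onI) (simp_all add: \<Psi>_def prl io_tau om_mem om_linear io_linear XH del: hom_bundle_simps)
      show "sapp \<Psi> s \<in> sections M X.P" if "s \<in> sections M A" for s by (rule \<Psi>s(1)[OF that])
    qed
    show "bundle_map M X.P A g"
    proof (rule bundle_mapI[OF X.vP vA])
      show "linear_on X.P A p (g p)" for p
      proof (rule linear_onI)
        fix x assume "x \<in> fib X.P p"
        then have x: "fst x \<in> fib Q p" "snd x \<in> \<tau> p" by auto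
        note fx = xil(1)[OF x(1)] ii_f[OF x(2)]
        show "g p x \<in> fib A p" unfolding g_def by (simp add: fibs vA fx)
        show "g p (vscale X.P p c x) = vscale A p c (g p x)" for c
          unfolding g_def X.pair_simps fst_conv snd_conv B_simps xil(3)[OF x(1)] ii_linear(2)[OF x(2)]
          by (rule fib_eqI[OF vA, where p = p]) (simp_all add: fibs crds vA fx algebra_simps)
        fix y assume "y \<in> fib X.P p"
        then have y: "fst y \<in> fib Q p" "snd y \<in> \<tau> p" by auto
        note fy = xil(1)[OF y(1)] ii_f[OF y(2)]
        show "g p (vadd X.P p x y) = vadd A p (g p x) (g p y)"
          unfolding g_def X.pair_simps fst_conv snd_conv B_simps xil(2)[OF x(1) y(1)] ii_linear(1)[OF x(2) y(2)]
          by (rule fib_eqI[OF vA, where p = p]) (simp_all add: fibs crds vA fx fy)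
      qed
      fix s assume "s \<in> sections M X.P"
      then have s: "fst \<circ> s \<in> sections M Q" "snd \<circ> s \<in> sections M G" unfolding Psec by auto
      have "sapp g s = sadd A (sapp \<xi> (fst \<circ> s)) (sapp ii (snd \<circ> s))" by (simp add: fun_eq_iff g_def sapp_def sadd_def)
      also have "\<dots> \<in> sections M A" by (intro sadd_sec vA xi_sec F_sec(1)[OF ii_sec] s)
      finally show "sapp g s \<in> sections M A" .
    qed
    show "g p (\<Psi> p u) = u" if u: "u \<in> fib A p" for p u
      unfolding g_def \<Psi>_def fst_conv snd_conv ii_props(3)[OF om_mem[OF u]] unfolding om_def
      by (rule fib_eqI[OF vA, where p = p]) (simp_all add: fibs crds vA u xil prl)
    show "\<Psi> p (g p x) = x" if "x \<in> fib X.P p" for p x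
    proof -
      have x: "fst x \<in> fib Q p" "snd x \<in> \<tau> p" using that by auto
      note fx = xil(1)[OF x(1)] ii_f[OF x(2)]
      have "prj p (g p x) = fst x" unfolding g_def prl(2)[OF fx] pr_xi[OF x(1)] pr_zero[OF ii_props(1)[OF x(2)]]
        by (rule fib_eqI[OF vQ, where p = p]) (simp_all add: fibs crds vQ x)
      moreover have "om p (g p x) = ii p (snd x)"
        unfolding g_def om_linear(1)[OF fx] om_xi[OF x(1)] om_id[OF ii_props(1)[OF x(2)]]
        by (rule fib_eqI[OF vA, where p = p]) (simp_all add: fibs crds vA fx)
      ultimately show ?thesis unfolding \<Psi>_def by (simp add: ii_props(2)[OF x(2)])
    qed
    show "subbundle M X.P (pair_sub B \<tau>)" by (rule X.pair_subbundle)
    show "\<Psi> p u \<in> pair_sub B \<tau> p" if "u \<in> \<sigma> p" for p u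
      unfolding \<Psi>_def pair_sub_def using pr_zero[OF that] om_id[OF that] io_tau[OF that] by simp
    show "g p x \<in> \<sigma> p" if "x \<in> pair_sub B \<tau> p" for p x
    proof -
      have x: "fst x = vzero Q p" "snd x \<in> \<tau> p" using that unfolding pair_sub_def by auto
      have z: "\<xi> p (vzero Q p) = vzero A p" by (rule linear_on_zero[OF vQ vA bundle_map_linear[OF xim]])
      have "g p x = ii p (snd x)" unfolding g_def x(1) z
        by (rule fib_eqI[OF vA, where p = p]) (simp_all add: fibs crds vA ii_f[OF x(2)])
      then show ?thesis using ii_props(1)[OF x(2)] by simp
    qed
    show "anchor X.P p (\<Psi> p v) = anchor A p v" if "v \<in> fib A p" for p v by (simp add: \<Psi>_def anchor_om that)
    fix \<alpha> \<beta> p assume a: "\<alpha> \<in> sections M A" and b: "\<beta> \<in> sections M A"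
    show "vminus X.P p (\<Psi> p (brk A \<alpha> \<beta> p)) (brk X.P (sapp \<Psi> \<alpha>) (sapp \<Psi> \<beta>) p) \<in> pair_sub B \<tau> p"
    proof (rule X.pair_sub_minusI)
      note f = sec_fib[OF AL(3)[OF a b], of p]
      show "\<Psi> p (brk A \<alpha> \<beta> p) \<in> fib X.P p" by (simp add: \<Psi>_def prl f io_tau om_mem)
      show "brk X.P (sapp \<Psi> \<alpha>) (sapp \<Psi> \<beta>) p \<in> fib X.P p"
        by (rule sec_fib[OF X.pair_brk_sec[OF \<Psi>s(1)[OF a] \<Psi>s(1)[OF b]]])
      show "fst (\<Psi> p (brk A \<alpha> \<beta> p)) = fst (brk X.P (sapp \<Psi> \<alpha>) (sapp \<Psi> \<beta>) p)"
        unfolding X.pair_brk_fst \<Psi>s(2)[OF a] \<Psi>s(2)[OF b] B_simps by (simp add: \<Psi>_def sapp_at[of _ \<alpha>] sapp_at[of _ \<beta>] pr_brk[OF a b] del: sapp_at)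
    qed
  qed
qed

end


section \<open>The correspondence on classes\<close>

context smooth_mfd
begin

lemma standard_pair: "standard_Cartan_pair M A \<sigma> \<Longrightarrow> Cartan_pair M A \<sigma>"
  unfolding standard_Cartan_pair_def by blast

lemma splitting_exists:
  assumes "Cartan_pair M A \<sigma>" shows "\<exists>\<xi>. splitting M A \<sigma> \<xi>"
proof (rule splitting_ex[OF Cartan_pairD(2,4)[OF assms]])
  fix \<xi> assume "bundle_map M (quot_bundle M A \<sigma>) A \<xi>" "\<forall>q. \<forall>a\<in>fib (quot_bundle M A \<sigma>) q. pr A \<sigma> q (\<xi> q a) = a"
  then have "splitting M A \<sigma> \<xi>" unfolding splitting_def by (rule conjI)
  then show ?thesis by (rule exI[where x = \<xi>])
qed

lemma algebroid_of_Cartan: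
  "standard_Cartan_pair M A \<sigma> \<Longrightarrow> splitting M A \<sigma> \<xi> \<Longrightarrow> Cartan_algebroid M (algebroid_of M A \<sigma> \<xi>) (algebroid_sub M A \<sigma>)"
  by (rule pair_data.B_Cartan, unfold_locales)

lemma pair_of_standard:
  "Cartan_algebroid M C \<sigma> \<Longrightarrow> Cartan_torsion M C \<sigma> t \<Longrightarrow> Cartan_connection M C \<sigma> D \<Longrightarrow>
    standard_Cartan_pair M (pair_of M C \<sigma> t D) (pair_sub C \<sigma>)"
  by (rule cartan_data.pair_standard, unfold_locales)

lemma pair_of_algebroid_of:
  "standard_Cartan_pair M A \<sigma> \<Longrightarrow> splitting M A \<sigma> \<xi> \<Longrightarrow>
    Cartan_torsion M (algebroid_of M A \<sigma> \<xi>) (algebroid_sub M A \<sigma>) t \<Longrightarrow>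
    Cartan_connection M (algebroid_of M A \<sigma> \<xi>) (algebroid_sub M A \<sigma>) D \<Longrightarrow>
    Cartan_pair_iso M A \<sigma> (pair_of M (algebroid_of M A \<sigma> \<xi>) (algebroid_sub M A \<sigma>) t D)
      (pair_sub (algebroid_of M A \<sigma> \<xi>) (algebroid_sub M A \<sigma>))"
  by (rule pair_data.pair_of_algebroid_iso, unfold_locales)

lemma Cartan_choices:
  assumes "Cartan_algebroid M C \<sigma>" obtains t D where "Cartan_torsion M C \<sigma> t" "Cartan_connection M C \<sigma> D"
  using assms unfolding Cartan_algebroid_def by (elim conjE exE)

text \<open>\<open>gauge_imp_pair_iso\<close> and \<open>pair_iso_imp_gauge\<close> both exchange
  the order of the two objects, which the symmetry of isomorphism of pairs repairs.\<close>

lemma gauge_iff_pair_iso: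
  assumes X: "Cartan_algebroid M C1 \<sigma>1" "Cartan_torsion M C1 \<sigma>1 t1" "Cartan_connection M C1 \<sigma>1 D1"
    and Y: "Cartan_algebroid M C2 \<sigma>2" "Cartan_torsion M C2 \<sigma>2 t2" "Cartan_connection M C2 \<sigma>2 D2"
  shows "gauge_equivalent M C1 \<sigma>1 C2 \<sigma>2 \<longleftrightarrow>
    Cartan_pair_iso M (pair_of M C1 \<sigma>1 t1 D1) (pair_sub C1 \<sigma>1) (pair_of M C2 \<sigma>2 t2 D2) (pair_sub C2 \<sigma>2)"
  using gauge_imp_pair_iso[OF X Y] pair_iso_imp_gauge[OF Y X]
    Cartan_pair_iso_sym[OF standard_pair[OF pair_of_standard[OF X]] standard_pair[OF pair_of_standard[OF Y]]]
    Cartan_pair_iso_sym[OF standard_pair[OF pair_of_standard[OF Y]] standard_pair[OF pair_of_standard[OF X]]]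
  by blast

text \<open>Transported from isomorphism of pairs after choosing \<open>t\<close> and
  \<open>D\<close>, as are symmetry and transitivity below. This avoids inverting and composing
  twists.\<close>

lemma gauge_equivalent_refl:
  assumes "Cartan_algebroid M C \<sigma>" shows "gauge_equivalent M C \<sigma> C \<sigma>"
proof -
  obtain t D where c: "Cartan_torsion M C \<sigma> t" "Cartan_connection M C \<sigma> D" by (rule Cartan_choices[OF assms])
  show ?thesis unfolding gauge_iff_pair_iso[OF assms c assms c]
    by (rule Cartan_pair_iso_refl[OF standard_pair[OF pair_of_standard[OF assms c]]])
qed

lemma gauge_equivalent_sym:
  assumes C: "Cartan_algebroid M C \<sigma>" and C': "Cartan_algebroid M C' \<sigma>'" and ge: "gauge_equivalent M C \<sigma> C' \<sigma>'"
  shows "gauge_equivalent M C' \<sigma>' C \<sigma>"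
proof -
  obtain t D where c: "Cartan_torsion M C \<sigma> t" "Cartan_connection M C \<sigma> D" by (rule Cartan_choices[OF C])
  obtain t' D' where c': "Cartan_torsion M C' \<sigma>' t'" "Cartan_connection M C' \<sigma>' D'" by (rule Cartan_choices[OF C'])
  show ?thesis by (rule pair_iso_imp_gauge[OF C c C' c' ge[unfolded gauge_iff_pair_iso[OF C c C' c']]])
qed

lemma gauge_equivalent_trans:
  assumes C1: "Cartan_algebroid M C1 \<sigma>1" and C2: "Cartan_algebroid M C2 \<sigma>2" and C3: "Cartan_algebroid M C3 \<sigma>3"
    and ge: "gauge_equivalent M C1 \<sigma>1 C2 \<sigma>2" "gauge_equivalent M C2 \<sigma>2 C3 \<sigma>3"
  shows "gauge_equivalent M C1 \<sigma>1 C3 \<sigma>3"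
proof -
  obtain t1 D1 where c1: "Cartan_torsion M C1 \<sigma>1 t1" "Cartan_connection M C1 \<sigma>1 D1" by (rule Cartan_choices[OF C1])
  obtain t2 D2 where c2: "Cartan_torsion M C2 \<sigma>2 t2" "Cartan_connection M C2 \<sigma>2 D2" by (rule Cartan_choices[OF C2])
  obtain t3 D3 where c3: "Cartan_torsion M C3 \<sigma>3 t3" "Cartan_connection M C3 \<sigma>3 D3" by (rule Cartan_choices[OF C3])
  show ?thesis unfolding gauge_iff_pair_iso[OF C1 c1 C3 c3]
    by (rule Cartan_pair_iso_trans[OF standard_pair[OF pair_of_standard[OF C1 c1]] standard_pair[OF pair_of_standard[OF C2 c2]]
      standard_pair[OF pair_of_standard[OF C3 c3]] ge(1)[unfolded gauge_iff_pair_iso[OF C1 c1 C2 c2]] ge(2)[unfolded gauge_iff_pair_iso[OF C2 c2 C3 c3]]])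
qed

text \<open>Each pair is isomorphic to the pair of its quotient algebroid for some choice of
  \<open>t\<close> and \<open>D\<close>, so \<open>gauge_iff_pair_iso\<close> can be applied to the
  quotient algebroids.\<close>

lemma pair_iso_iff_gauge:
  assumes A: "standard_Cartan_pair M A1 \<sigma>1" "splitting M A1 \<sigma>1 \<xi>1" and B: "standard_Cartan_pair M A2 \<sigma>2" "splitting M A2 \<sigma>2 \<xi>2"
  shows "Cartan_pair_iso M A1 \<sigma>1 A2 \<sigma>2 \<longleftrightarrow>
    gauge_equivalent M (algebroid_of M A1 \<sigma>1 \<xi>1) (algebroid_sub M A1 \<sigma>1) (algebroid_of M A2 \<sigma>2 \<xi>2) (algebroid_sub M A2 \<sigma>2)"
proof -
  note C1 = algebroid_of_Cartan[OF A] and C2 = algebroid_of_Cartan[OF B]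
  obtain t1 D1 where 1: "Cartan_torsion M (algebroid_of M A1 \<sigma>1 \<xi>1) (algebroid_sub M A1 \<sigma>1) t1"
    "Cartan_connection M (algebroid_of M A1 \<sigma>1 \<xi>1) (algebroid_sub M A1 \<sigma>1) D1" by (rule Cartan_choices[OF C1])
  obtain t2 D2 where 2: "Cartan_torsion M (algebroid_of M A2 \<sigma>2 \<xi>2) (algebroid_sub M A2 \<sigma>2) t2"
    "Cartan_connection M (algebroid_of M A2 \<sigma>2 \<xi>2) (algebroid_sub M A2 \<sigma>2) D2" by (rule Cartan_choices[OF C2])
  note a = standard_pair[OF A(1)] standard_pair[OF B(1)]
    standard_pair[OF pair_of_standard[OF C1 1]] standard_pair[OF pair_of_standard[OF C2 2]]
  note i1 = pair_of_algebroid_of[OF A 1] and i2 = pair_of_algebroid_of[OF B 2]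
  show ?thesis
    unfolding gauge_iff_pair_iso[OF C1 1 C2 2]
  proof
    assume i: "Cartan_pair_iso M A1 \<sigma>1 A2 \<sigma>2"
    show "Cartan_pair_iso M (pair_of M (algebroid_of M A1 \<sigma>1 \<xi>1) (algebroid_sub M A1 \<sigma>1) t1 D1)
        (pair_sub (algebroid_of M A1 \<sigma>1 \<xi>1) (algebroid_sub M A1 \<sigma>1))
        (pair_of M (algebroid_of M A2 \<sigma>2 \<xi>2) (algebroid_sub M A2 \<sigma>2) t2 D2)
        (pair_sub (algebroid_of M A2 \<sigma>2 \<xi>2) (algebroid_sub M A2 \<sigma>2))"
      by (rule Cartan_pair_iso_trans[OF a(3,1,4) Cartan_pair_iso_sym[OF a(1,3) i1] Cartan_pair_iso_trans[OF a(1,2,4) i i2]])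
  next
    assume i: "Cartan_pair_iso M (pair_of M (algebroid_of M A1 \<sigma>1 \<xi>1) (algebroid_sub M A1 \<sigma>1) t1 D1)
        (pair_sub (algebroid_of M A1 \<sigma>1 \<xi>1) (algebroid_sub M A1 \<sigma>1))
        (pair_of M (algebroid_of M A2 \<sigma>2 \<xi>2) (algebroid_sub M A2 \<sigma>2) t2 D2)
        (pair_sub (algebroid_of M A2 \<sigma>2 \<xi>2) (algebroid_sub M A2 \<sigma>2))"
    show "Cartan_pair_iso M A1 \<sigma>1 A2 \<sigma>2"
      by (rule Cartan_pair_iso_trans[OF a(1,3,2) i1 Cartan_pair_iso_trans[OF a(3,4,2) i Cartan_pair_iso_sym[OF a(2,4) i2]]])
  qed
qed

text \<open>Through \<open>gauge_iff_pair_iso\<close> the claim becomes an isomorphism between the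
  pair of \<open>C\<close> and the pair of its quotient algebroid, which is the other round trip
  applied to that pair.\<close>

lemma algebroid_of_pair_of:
  assumes X: "Cartan_algebroid M C \<sigma>" "Cartan_torsion M C \<sigma> t" "Cartan_connection M C \<sigma> D"
    and x: "splitting M (pair_of M C \<sigma> t D) (pair_sub C \<sigma>) \<xi>"
  shows "gauge_equivalent M C \<sigma> (algebroid_of M (pair_of M C \<sigma> t D) (pair_sub C \<sigma>) \<xi>)
    (algebroid_sub M (pair_of M C \<sigma> t D) (pair_sub C \<sigma>))"
proof -
  note P = pair_of_standard[OF X]
  note B = algebroid_of_Cartan[OF P x]
  obtain t' D' where c: "Cartan_torsion M (algebroid_of M (pair_of M C \<sigma> t D) (pair_sub C \<sigma>) \<xi>) (algebroid_sub M (pair_of M C \<sigma> t D) (pair_sub C \<sigma>)) t'"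
    "Cartan_connection M (algebroid_of M (pair_of M C \<sigma> t D) (pair_sub C \<sigma>) \<xi>) (algebroid_sub M (pair_of M C \<sigma> t D) (pair_sub C \<sigma>)) D'"
    by (rule Cartan_choices[OF B])
  show ?thesis unfolding gauge_iff_pair_iso[OF X B c] by (rule pair_of_algebroid_of[OF P x c])
qed

end

text \<open>The constructions change the type of the fibres, from \<open>'c\<close> to
  \<open>'c \<times> ('c \<Rightarrow> 'c)\<close> and from \<open>'a\<close> to
  \<open>'a set\<close>. The relations are therefore compared across types, and the bijection of
  classes is expressed by clauses on representatives.\<close>

theorem theorem1p51:
  fixes M :: "'m::{t2_space, second_countable_topology} manifold"
  assumes "smooth_manifold M"
  shows
    \<comment> \<open>gauge equivalence of Cartan algebroids is an equivalence relation\<close>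
    "(\<forall>(C :: ('m, 'c1) algebroid) \<sigma>. Cartan_algebroid M C \<sigma> \<longrightarrow> gauge_equivalent M C \<sigma> C \<sigma>) \<and>
     (\<forall>(C1 :: ('m, 'c1) algebroid) \<sigma>1 (C2 :: ('m, 'c2) algebroid) \<sigma>2.
        Cartan_algebroid M C1 \<sigma>1 \<and> Cartan_algebroid M C2 \<sigma>2 \<and>
        gauge_equivalent M C1 \<sigma>1 C2 \<sigma>2 \<longrightarrow> gauge_equivalent M C2 \<sigma>2 C1 \<sigma>1) \<and>
     (\<forall>(C1 :: ('m, 'c1) algebroid) \<sigma>1 (C2 :: ('m, 'c2) algebroid) \<sigma>2
       (C3 :: ('m, 'c3) algebroid) \<sigma>3.
        Cartan_algebroid M C1 \<sigma>1 \<and> Cartan_algebroid M C2 \<sigma>2 \<and> Cartan_algebroid M C3 \<sigma>3 \<and>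
        gauge_equivalent M C1 \<sigma>1 C2 \<sigma>2 \<and> gauge_equivalent M C2 \<sigma>2 C3 \<sigma>3 \<longrightarrow>
        gauge_equivalent M C1 \<sigma>1 C3 \<sigma>3) \<and>
     \<comment> \<open>isomorphism of (standard) Cartan pairs is an equivalence relation\<close>
     (\<forall>(A :: ('m, 'a1) algebroid) \<sigma>. standard_Cartan_pair M A \<sigma> \<longrightarrow> Cartan_pair_iso M A \<sigma> A \<sigma>) \<and>
     (\<forall>(A1 :: ('m, 'a1) algebroid) \<sigma>1 (A2 :: ('m, 'a2) algebroid) \<sigma>2.
        standard_Cartan_pair M A1 \<sigma>1 \<and> standard_Cartan_pair M A2 \<sigma>2 \<and>
        Cartan_pair_iso M A1 \<sigma>1 A2 \<sigma>2 \<longrightarrow> Cartan_pair_iso M A2 \<sigma>2 A1 \<sigma>1) \<and>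
     (\<forall>(A1 :: ('m, 'a1) algebroid) \<sigma>1 (A2 :: ('m, 'a2) algebroid) \<sigma>2
       (A3 :: ('m, 'a3) algebroid) \<sigma>3.
        standard_Cartan_pair M A1 \<sigma>1 \<and> standard_Cartan_pair M A2 \<sigma>2 \<and>
        standard_Cartan_pair M A3 \<sigma>3 \<and>
        Cartan_pair_iso M A1 \<sigma>1 A2 \<sigma>2 \<and> Cartan_pair_iso M A2 \<sigma>2 A3 \<sigma>3 \<longrightarrow>
        Cartan_pair_iso M A1 \<sigma>1 A3 \<sigma>3) \<and>
     \<comment> \<open>choices exist, and each choice gives an object of the other kind\<close>
     (\<forall>(C :: ('m, 'c1) algebroid) \<sigma>. Cartan_algebroid M C \<sigma> \<longrightarrow>
        (\<exists>t. Cartan_torsion M C \<sigma> t) \<and> (\<exists>D. Cartan_connection M C \<sigma> D) \<and>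
        (\<forall>t D. Cartan_torsion M C \<sigma> t \<and> Cartan_connection M C \<sigma> D \<longrightarrow>
           standard_Cartan_pair M (pair_of M C \<sigma> t D) (pair_sub C \<sigma>))) \<and>
     (\<forall>(A :: ('m, 'a1) algebroid) \<sigma>. standard_Cartan_pair M A \<sigma> \<longrightarrow>
        (\<exists>\<xi>. splitting M A \<sigma> \<xi>) \<and>
        (\<forall>\<xi>. splitting M A \<sigma> \<xi> \<longrightarrow>
           Cartan_algebroid M (algebroid_of M A \<sigma> \<xi>) (algebroid_sub M A \<sigma>))) \<and>
     \<comment> \<open>both constructions are well defined and injective on classes, whatever the choices\<close>
     (\<forall>(C1 :: ('m, 'c1) algebroid) \<sigma>1 t1 D1 (C2 :: ('m, 'c2) algebroid) \<sigma>2 t2 D2.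
        Cartan_algebroid M C1 \<sigma>1 \<and> Cartan_torsion M C1 \<sigma>1 t1 \<and> Cartan_connection M C1 \<sigma>1 D1 \<and>
        Cartan_algebroid M C2 \<sigma>2 \<and> Cartan_torsion M C2 \<sigma>2 t2 \<and> Cartan_connection M C2 \<sigma>2 D2 \<longrightarrow>
        (gauge_equivalent M C1 \<sigma>1 C2 \<sigma>2 \<longleftrightarrow>
         Cartan_pair_iso M (pair_of M C1 \<sigma>1 t1 D1) (pair_sub C1 \<sigma>1)
           (pair_of M C2 \<sigma>2 t2 D2) (pair_sub C2 \<sigma>2))) \<and>
     (\<forall>(A1 :: ('m, 'a1) algebroid) \<sigma>1 \<xi>1 (A2 :: ('m, 'a2) algebroid) \<sigma>2 \<xi>2.
        standard_Cartan_pair M A1 \<sigma>1 \<and> splitting M A1 \<sigma>1 \<xi>1 \<and>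
        standard_Cartan_pair M A2 \<sigma>2 \<and> splitting M A2 \<sigma>2 \<xi>2 \<longrightarrow>
        (Cartan_pair_iso M A1 \<sigma>1 A2 \<sigma>2 \<longleftrightarrow>
         gauge_equivalent M (algebroid_of M A1 \<sigma>1 \<xi>1) (algebroid_sub M A1 \<sigma>1)
           (algebroid_of M A2 \<sigma>2 \<xi>2) (algebroid_sub M A2 \<sigma>2))) \<and>
     \<comment> \<open>the two constructions are mutually inverse on classes\<close>
     (\<forall>(C :: ('m, 'c1) algebroid) \<sigma> t D \<xi>.
        Cartan_algebroid M C \<sigma> \<and> Cartan_torsion M C \<sigma> t \<and> Cartan_connection M C \<sigma> D \<and>
        splitting M (pair_of M C \<sigma> t D) (pair_sub C \<sigma>) \<xi> \<longrightarrow>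
        gauge_equivalent M C \<sigma> (algebroid_of M (pair_of M C \<sigma> t D) (pair_sub C \<sigma>) \<xi>)
          (algebroid_sub M (pair_of M C \<sigma> t D) (pair_sub C \<sigma>))) \<and>
     (\<forall>(A :: ('m, 'a1) algebroid) \<sigma> \<xi> t D.
        standard_Cartan_pair M A \<sigma> \<and> splitting M A \<sigma> \<xi> \<and>
        Cartan_torsion M (algebroid_of M A \<sigma> \<xi>) (algebroid_sub M A \<sigma>) t \<and>
        Cartan_connection M (algebroid_of M A \<sigma> \<xi>) (algebroid_sub M A \<sigma>) D \<longrightarrow>
        Cartan_pair_iso M A \<sigma> (pair_of M (algebroid_of M A \<sigma> \<xi>) (algebroid_sub M A \<sigma>) t D)
          (pair_sub (algebroid_of M A \<sigma> \<xi>) (algebroid_sub M A \<sigma>)))"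
proof -
  interpret smooth_mfd M by unfold_locales (rule assms)
  show ?thesis
    apply (intro conjI allI impI; (elim conjE)?)
    subgoal by (rule gauge_equivalent_refl)
    subgoal by (rule gauge_equivalent_sym)
    \<comment> \<open>The middle object of transitivity does not occur in the conclusion and has to
      be named.\<close>
    subgoal for C1 \<sigma>1 C2 \<sigma>2 C3 \<sigma>3 by (rule gauge_equivalent_trans[where ?C2.0 = C2])
    subgoal by (rule Cartan_pair_iso_refl[OF standard_pair], assumption)
    subgoal by (rule Cartan_pair_iso_sym[OF standard_pair standard_pair], assumption)
    subgoal for A1 \<sigma>1 A2 \<sigma>2 A3 \<sigma>3 by (rule Cartan_pair_iso_trans[where ?A2.0 = A2, OF standard_pair standard_pair standard_pair], assumption)
    subgoal by (blast elim: Cartan_choices)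
    subgoal by (blast elim: Cartan_choices)
    subgoal by (rule pair_of_standard)
    subgoal by (rule splitting_exists[OF standard_pair])
    subgoal by (rule algebroid_of_Cartan)
    subgoal by (rule gauge_iff_pair_iso)
    subgoal by (rule pair_iso_iff_gauge)
    subgoal by (rule algebroid_of_pair_of)
    subgoal by (rule pair_of_algebroid_of)
    done
qed

end
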